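(* Let $k\in\mathbb{Z}$, and let $M_1$ and $M_2$ be graded supermanifolds equipped with $k$-shifted $S_\infty$-structures specified by master Hamiltonians $H_1\in C^\infty(T^*M_1[1-k])$ and $H_2\in C^\infty(T^*M_2[1-k])$ of weight $2-k$. Let $\Phi$ be a shifted $S_\infty$-thick morphism from $M_1$ to $M_2$. Then the pullback $\Phi^*$ is a well-defined formal $Q$-morphism $$\Phi^*\colon \mathbf{C^{\infty}}(M_2)[1-k]\to\mathbf{C^{\infty}}(M_1)[1-k]$$ of graded infinite-dimensional supermanifolds (equipped with the homological vector fields $Q_{H_2}$ and $Q_{H_1}$, respectively), and thus specifies an $L_\infty$-morphism of the shifted bracket structures.
   Context: Gradings. "Graded" means $\mathbb{Z}_2\times\mathbb{Z}$-graded: the $\mathbb{Z}_2$-grading is called parity, denoted by a tilde, and alone determines all signs; the independent $\mathbb{Z}$-grading is called weight, denoted $\mathbf{w}$, and never contributes signs. A graded supermanifold is a supermanifold with local coordinates assigned weights in $\mathbb{Z}$ in addition to parities, respected by changes of coordinates. Summation over repeated indices is understood. Spaces of functions. $\mathbf{C^{\infty}}(M)$ is the space of functions on $M$ regarded as an infinite-dimensional supermanifold whose points are even functions. $\mathbf{C^{\infty}}(M)[s]$ is the graded supermanifold whose points are the even functions on $M$ of weight $s$ (points may depend on auxiliary parameters). Shifted cotangent bundle. If $x^a$ are local coordinates on $M$ of weights $w^a$ with conjugate momenta $p_a$, then $T^*M[s]$ is the cotangent bundle with weights $\mathbf{w}^{[s]}(x^a)=w^a$, $\mathbf{w}^{[s]}(p_a)=-w^a+s$.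 Functions on it are regarded as formal in the fiber directions. $k$-shifted $S_\infty$-structures. A $k$-shifted $S_\infty$-structure on $M$ is a sequence of symmetric (in the super sense) multilinear operations $\{-,\ldots,-\}$ on $C^\infty(M)$ (one with $n$ arguments for each $n=0,1,2,\ldots$), all odd, the $n$-th of weight $2-n+k(n-1)$, satisfying for all $n\geq 0$ $$\sum_{r+s=n}\ \sum_{(r,s)\text{-shuffles }\sigma}(-1)^{\alpha}\{\{a_{\sigma(1)},\ldots,a_{\sigma(r)}\},a_{\sigma(r+1)},\ldots,a_{\sigma(r+s)}\}=0$$ ($(-1)^\alpha$ is the Koszul sign), and the Leibniz rule $\{a_1,\ldots,a_{n-1},bc\}=\{a_1,\ldots,a_{n-1},b\}c+(-1)^{(\tilde a_1+\cdots+\tilde a_{n-1}+1)\tilde b}\,b\{a_1,\ldots,a_{n-1},c\}$ for $n\geq1$. It is specified by a master Hamiltonian: an odd function $H\in C^\infty(T^*M[1-k])$ of weight $2-k$ with $(H,H)=0$ for the canonical Poisson bracket, via $\{f_1,\ldots,f_n\}_H=(\ldots(H,f_1),\ldots,f_n)|_M$. The corresponding Hamilton–Jacobi homological vector field, of weight $+1$ on $\mathbf{C^{\infty}}(M)[1-k]$, is $$Q_H=\int_M Dx\;H\Bigl(x,\frac{\partial f}{\partial x}\Bigr)\frac{\delta}{\delta f(x)},$$ i.e. the odd vector field whose value at a point $f$ is the function $H(x,\partial f/\partial x)$; it encodes the brackets above. Thick morphisms. Let $x^a$ be local coordinates on $M_1$ with conjugate momenta $p_a$, and $y^i$ local coordinates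 on $M_2$ (of parity $\tilde\imath$ and weight $w^i$) with conjugate momenta $q_i$. A thick morphism $\Phi$ from $M_1$ to $M_2$ is a formal canonical relation between $T^*M_1$ and $T^*M_2$ given locally by $p_a=\partial S/\partial x^a$, $y^i=(-1)^{\tilde\imath}\partial S/\partial q_i$, together with its even generating function (part of the structure), a formal power series $S(x,q)=S^0(x)+\varphi^i(x)q_i+\tfrac12S^{ij}(x)q_jq_i+\cdots$. Here $S^0$ is a function on $M_1$, $y^i=\varphi^i(x)$ defines a map $\varphi\colon M_1\to M_2$, and under coordinate changes $S'(x',q')=S(x,q)-y^iq_i+y^{i'}q_{i'}$, where $x=x(x')$, $y^i=(-1)^{\tilde\imath}\partial S/\partial q_i(x,q)$, $y^{i'}=y^{i'}(y)$, $q_i=\frac{\partial y^{i'}}{\partial y^i}(y)q_{i'}$. It is $s$-shifted if $S$ has weight $s$ with respect to the weights $\mathbf{w}(x^a)=w^a$, $\mathbf{w}^{[s]}(q_i)=-w^i+s$. Pullback. $\Phi^*$ sends $g(y)$ to $f(x)=g(y)+S(x,q)-y^iq_i$, where $y^i,q_i$ are determined from $y^i=(-1)^{\tilde\imath}\frac{\partial S}{\partial q_i}(x,q)$ and $q_i=\frac{\partial g}{\partial y^i}(y)$, solved by iteration; thus $f$ is a formal power series in the derivatives of $g$ at $y=\varphi(x)$, beginning $f(x)=S^0(x)+g(\varphi(x))+\tfrac12S^{ij}(x)\,\partial_jg(\varphi(x))\,\partial_ig(\varphi(x))+\cdots$. A "formal map" is one given by such a series. Shifted $S_\infty$-thick morphism.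 Given $k$-shifted $S_\infty$-structures on $M_1,M_2$ with master Hamiltonians $H_1,H_2$, an $s$-shifted thick morphism with $s=1-k$ is a shifted $S_\infty$-thick morphism if its generating function satisfies the Hamilton–Jacobi equation $$H_1\Bigl(x,\frac{\partial S}{\partial x}\Bigr)=H_2\Bigl((-1)^{\tilde\imath}\frac{\partial S}{\partial q_i},q\Bigr).$$ $Q$-morphism. A formal $Q$-morphism is a formal map of (graded) supermanifolds that intertwines the given homological vector fields, i.e. here $Q_{H_2}$ and $Q_{H_1}$ are $\Phi^*$-related. By definition, an $L_\infty$-morphism of (shifted, possibly curved) $L_\infty$-structures is such a formal $Q$-morphism of the corresponding graded supermanifolds with homological vector fields of weight $+1$. *)

theory Defs
  imports "HOL-Analysis.Analysis"
begin

section \<open>Formal power series in graded-commuting variables\<close>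

datatype coord = Ev nat | Od nat

definition codd :: "coord \<Rightarrow> bool" where
  "codd a = (case a of Ev _ \<Rightarrow> False | Od _ \<Rightarrow> True)"

text \<open>
  Local functions are power series, with smooth functions of the even coordinates as coefficients,
  in the following variables: \<open>Xi j\<close> is the odd coordinate \<open>Od j\<close>; \<open>Mom a\<close> is the momentum
  conjugate to the coordinate \<open>a\<close> and has its parity; \<open>Par b n\<close> are the auxiliary parameters on
  which points of a space of functions may depend, odd for \<open>b = True\<close>.
\<close>

datatype var = Xi nat | Mom coord | Par bool nat

definition vodd :: "var \<Rightarrow> bool" where
  "vodd v = (case v of Xi _ \<Rightarrow> True | Mom a \<Rightarrow> codd a | Par b _ \<Rightarrow> b)"

definition is_mom :: "var \<Rightarrow> bool" where
  "is_mom v \<longleftrightarrow> (\<exists>a. v = Mom a)"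

definition is_par :: "var \<Rightarrow> bool" where
  "is_par v \<longleftrightarrow> (\<exists>b n. v = Par b n)"

instance coord :: countable
  by countable_datatype

instance var :: countable
  by countable_datatype

text \<open>An arbitrary linear order, which fixes the order of the factors in a monomial.\<close>

instantiation var :: linorder
begin

definition less_eq_var :: "var \<Rightarrow> var \<Rightarrow> bool" where
  "(u :: var) \<le> v \<longleftrightarrow> to_nat u \<le> to_nat v"

definition less_var :: "var \<Rightarrow> var \<Rightarrow> bool" where
  "(u :: var) < v \<longleftrightarrow> to_nat u < to_nat v"

instance
  by standard (auto simp: less_eq_var_def less_var_def)

end

text \<open>
  A monomial is a multiset of variables in which odd variables have multiplicity at most 1; it
  stands for the product of its elements in increasing order.
\<close>

definition mono_ok :: "var multiset \<Rightarrow> bool" where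
  "mono_ok m \<longleftrightarrow> (\<forall>v. vodd v \<longrightarrow> count m v \<le> 1)"

text \<open>The number of transpositions of odd variables needed to sort the product of \<open>a\<close> and \<open>b\<close>.\<close>

definition inversions :: "var multiset \<Rightarrow> var multiset \<Rightarrow> nat" where
  "inversions a b = (\<Sum>u\<in>#a. \<Sum>v\<in>#b. if vodd u \<and> vodd v \<and> v < u then 1 else 0)"

definition ksign :: "var multiset \<Rightarrow> var multiset \<Rightarrow> real" where
  "ksign a b = (-1) ^ inversions a b"

typedef gs = "{f :: var multiset \<Rightarrow> real. \<forall>m. \<not> mono_ok m \<longrightarrow> f m = 0}"
  morphisms coeff Abs_gs
  by (rule exI[of _ "\<lambda>_. 0"]) simp

lemma coeff_not_ok: "\<not> mono_ok m \<Longrightarrow> coeff f m = 0"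
  using coeff[of f] by auto

lemma gs_eqI: "(\<And>m. mono_ok m \<Longrightarrow> coeff f m = coeff g m) \<Longrightarrow> f = g"
  by (metis coeff_inject coeff_not_ok ext)

text \<open>The truncation to admissible monomials keeps the definitions below total.\<close>

definition gs_of :: "(var multiset \<Rightarrow> real) \<Rightarrow> gs" where
  "gs_of f = Abs_gs (\<lambda>m. if mono_ok m then f m else 0)"

lemma coeff_gs_of [simp]: "coeff (gs_of f) m = (if mono_ok m then f m else 0)"
  unfolding gs_of_def by (subst Abs_gs_inverse) auto

lemma mono_ok_empty [simp]: "mono_ok {#}"
  by (simp add: mono_ok_def)

lemma mono_ok_addD: "mono_ok (a + b) \<Longrightarrow> mono_ok a" "mono_ok (a + b) \<Longrightarrow> mono_ok b"
  unfolding mono_ok_def by (metis add_leD1 count_union, metis add_leD2 count_union)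

lemma inversions_add_left: "inversions (a + b) c = inversions a c + inversions b c"
  by (simp add: inversions_def)

lemma inversions_add_right: "inversions a (b + c) = inversions a b + inversions a c"
  by (simp add: inversions_def sum_mset.distrib)

lemma inversions_empty [simp]: "inversions {#} a = 0" "inversions a {#} = 0"
  by (simp_all add: inversions_def)

definition msplits :: "var multiset \<Rightarrow> (var multiset \<times> var multiset) set" where
  "msplits m = {(a, b). a + b = m}"

lemma finite_msplits [simp]: "finite (msplits m)"
proof (rule finite_subset)
  let ?B = "mset ` {xs. set xs \<subseteq> set_mset m \<and> length xs \<le> size m}"
  have "a \<in> ?B" if "a \<subseteq># m" for a
  proof -
    obtain xs where xs: "mset xs = a"
      using ex_mset by blast
    then have "set xs = set_mset a" "length xs = size a"
      by (metis set_mset_mset, metis size_mset)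
    then have "set xs \<subseteq> set_mset m" "length xs \<le> size m"
      using set_mset_mono[OF that] size_mset_mono[OF that] by simp_all
    then show ?thesis
      using xs by blast
  qed
  then show "msplits m \<subseteq> ?B \<times> ?B"
    by (auto simp: msplits_def)
  show "finite (?B \<times> ?B)"
    by (intro finite_cartesian_product finite_imageI finite_lists_length_le) auto
qed

instantiation gs :: real_algebra_1
begin

definition "0 = gs_of (\<lambda>_. 0)"
definition "1 = gs_of (\<lambda>m. if m = {#} then 1 else 0)"
definition "f + g = gs_of (\<lambda>m. coeff f m + coeff g m)"
definition "f - g = gs_of (\<lambda>m. coeff f m - coeff g m)"
definition "- f = gs_of (\<lambda>m. - coeff f m)"
definition "r *\<^sub>R f = gs_of (\<lambda>m. r * coeff f m)"
definition "f * g = gs_of (\<lambda>m. \<Sum>(a, b)\<in>msplits m. ksign a b * coeff f a * coeff g b)"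

lemma coeff_arith [simp]:
  "coeff 0 m = 0"
  "coeff 1 m = (if m = {#} then 1 else 0)"
  "coeff (f + g) m = coeff f m + coeff g m"
  "coeff (f - g) m = coeff f m - coeff g m"
  "coeff (- f) m = - coeff f m"
  "coeff (r *\<^sub>R f) m = r * coeff f m"
  unfolding zero_gs_def one_gs_def plus_gs_def minus_gs_def uminus_gs_def scaleR_gs_def coeff_gs_of
  by (simp_all add: coeff_not_ok)

lemma coeff_mult:
  "mono_ok m \<Longrightarrow>
    coeff (f * g) m = (\<Sum>(a, b)\<in>msplits m. ksign a b * coeff f a * coeff g b)"
  by (simp add: times_gs_def)

lemma gs_mult_assoc: "(f * g) * h = f * (g * (h :: gs))"
proof (rule gs_eqI)
  fix m assume ok: "mono_ok m"
  let ?L = "\<lambda>((a, c), (b, d)). ksign a c * ksign b d * coeff f b * coeff g d * coeff h c"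
  let ?R = "\<lambda>((a, c), (b, d)). ksign a c * ksign b d * coeff f a * coeff g b * coeff h d"
  have ok1: "mono_ok (fst p)" "mono_ok (snd p)" if "p \<in> msplits m" for p
    using that ok by (auto simp: msplits_def dest: mono_ok_addD)
  have "coeff ((f * g) * h) m =
      (\<Sum>p\<in>msplits m. ksign (fst p) (snd p) * coeff (f * g) (fst p) * coeff h (snd p))"
    by (simp add: coeff_mult[OF ok] case_prod_unfold)
  also have "\<dots> = (\<Sum>p\<in>msplits m. \<Sum>q\<in>msplits (fst p). ?L (p, q))"
    by (intro sum.cong refl)
      (simp add: coeff_mult[OF ok1(1)] sum_distrib_left sum_distrib_right case_prod_unfold mult_ac)
  also have "\<dots> = (\<Sum>z\<in>Sigma (msplits m) (\<lambda>p. msplits (fst p)). ?L z)"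
    by (subst sum.Sigma) (auto simp: case_prod_unfold)
  also have "\<dots> = (\<Sum>z\<in>Sigma (msplits m) (\<lambda>p. msplits (snd p)).
      (\<lambda>((a, c), (b, d)). ksign a c * ksign b d * coeff f a * coeff g b * coeff h d) z)"
    by (rule sum.reindex_bij_witness[where
          i = "\<lambda>((a, c), (b, d)). ((a + b, d), (a, b))" and
          j = "\<lambda>((a, c), (b, d)). ((b, d + c), (d, c))"])
      (auto simp: msplits_def ksign_def inversions_add_left inversions_add_right power_add add.assoc)
  also have "\<dots> = (\<Sum>p\<in>msplits m. \<Sum>q\<in>msplits (snd p). ?R (p, q))"
    by (subst sum.Sigma) (auto simp: case_prod_unfold)
  also have "\<dots> =
      (\<Sum>p\<in>msplits m. ksign (fst p) (snd p) * coeff f (fst p) * coeff (g * h) (snd p))"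
    by (intro sum.cong refl)
      (simp add: coeff_mult[OF ok1(2)] sum_distrib_left case_prod_unfold mult_ac)
  also have "\<dots> = coeff (f * (g * h)) m"
    by (simp add: coeff_mult[OF ok] case_prod_unfold)
  finally show "coeff ((f * g) * h) m = coeff (f * (g * h)) m" .
qed

lemma gs_one_mult: "1 * f = (f :: gs)"
proof (rule gs_eqI)
  fix m assume ok: "mono_ok m"
  have "coeff (1 * f) m = (\<Sum>p\<in>msplits m. if p = ({#}, m) then coeff f m else 0)"
    unfolding coeff_mult[OF ok]
    by (intro sum.cong) (auto simp: msplits_def ksign_def split: if_splits)
  also have "\<dots> = coeff f m"
    by (subst sum.delta[OF finite_msplits]) (simp add: msplits_def)
  finally show "coeff (1 * f) m = coeff f m" .
qed

lemma gs_mult_one: "f * 1 = (f :: gs)"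
proof (rule gs_eqI)
  fix m assume ok: "mono_ok m"
  have "coeff (f * 1) m = (\<Sum>p\<in>msplits m. if p = (m, {#}) then coeff f m else 0)"
    unfolding coeff_mult[OF ok]
    by (intro sum.cong) (auto simp: msplits_def ksign_def split: if_splits)
  also have "\<dots> = coeff f m"
    by (subst sum.delta[OF finite_msplits]) (simp add: msplits_def)
  finally show "coeff (f * 1) m = coeff f m" .
qed

instance
proof
  fix f g h :: gs and r s :: real
  show "f * g * h = f * (g * h)" by (rule gs_mult_assoc)
  show "1 * f = f" by (rule gs_one_mult)
  show "f * 1 = f" by (rule gs_mult_one)
  show "(f + g) * h = f * h + g * h"
    by (rule gs_eqI) (simp add: coeff_mult case_prod_unfold distrib_left distrib_right sum.distrib)
  show "f * (g + h) = f * g + f * h"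
    by (rule gs_eqI) (simp add: coeff_mult case_prod_unfold distrib_left sum.distrib)
  show "r *\<^sub>R f * g = r *\<^sub>R (f * g)"
    by (rule gs_eqI) (simp add: coeff_mult case_prod_unfold sum_distrib_left mult_ac)
  show "f * r *\<^sub>R g = r *\<^sub>R (f * g)"
    by (rule gs_eqI) (simp add: coeff_mult case_prod_unfold sum_distrib_left mult_ac)
  show "(0 :: gs) \<noteq> 1"
  proof
    assume "(0 :: gs) = 1"
    then have "coeff 0 {#} = coeff 1 {#}" by (rule arg_cong)
    then show False by simp
  qed
  show "f + g + h = f + (g + h)" by (rule gs_eqI) simp
  show "f + g = g + f" by (rule gs_eqI) simp
  show "0 + f = f" by (rule gs_eqI) simp
  show "- f + f = 0" by (rule gs_eqI) simp
  show "f - g = f + - g" by (rule gs_eqI) simp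
  show "r *\<^sub>R (f + g) = r *\<^sub>R f + r *\<^sub>R g" by (rule gs_eqI) (simp add: distrib_left)
  show "(r + s) *\<^sub>R f = r *\<^sub>R f + s *\<^sub>R f" by (rule gs_eqI) (simp add: distrib_right)
  show "r *\<^sub>R s *\<^sub>R f = (r * s) *\<^sub>R f" by (rule gs_eqI) simp
  show "1 *\<^sub>R f = f" by (rule gs_eqI) simp
qed

end


definition gs_var :: "var \<Rightarrow> gs" where
  "gs_var v = gs_of (\<lambda>m. if m = {#v#} then 1 else 0)"

definition body :: "gs \<Rightarrow> real" where
  "body f = coeff f {#}"

definition soul :: "gs \<Rightarrow> gs" where
  "soul f = f - of_real (body f)"

text \<open>Left partial derivative.\<close>

definition vderiv :: "var \<Rightarrow> gs \<Rightarrow> gs" where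
  "vderiv v f = gs_of (\<lambda>m. ksign {#v#} m * real (count m v + 1) * coeff f (add_mset v m))"

definition gs_vars :: "var set \<Rightarrow> gs \<Rightarrow> bool" where
  "gs_vars V f \<longleftrightarrow> (\<forall>m. coeff f m \<noteq> 0 \<longrightarrow> set_mset m \<subseteq> V)"

definition gs_parity :: "bool \<Rightarrow> gs \<Rightarrow> bool" where
  "gs_parity b f \<longleftrightarrow> (\<forall>m. coeff f m \<noteq> 0 \<longrightarrow> odd (size (filter_mset vodd m)) = b)"

definition psign :: "coord \<Rightarrow> gs" where
  "psign a = (if codd a then - 1 else 1)"


section \<open>Calculus on superdomains\<close>

text \<open>
  \<open>\<real>\<^sup>p\<close> is the library's \<^term>\<open>Euclidean_space p\<close>, whose points are sequences vanishing from
  index \<open>p\<close> on. A local expression is a map \<^typ>\<open>(nat \<Rightarrow> real) \<Rightarrow> gs\<close>; only its values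
  on the relevant open set matter.
\<close>

type_synonym pt = "nat \<Rightarrow> real"

definition rpd :: "nat \<Rightarrow> (pt \<Rightarrow> real) \<Rightarrow> pt \<Rightarrow> real" where
  "rpd i h x = deriv (\<lambda>t. h (x(i := t))) (x i)"

definition smooth_on :: "nat \<Rightarrow> pt set \<Rightarrow> (pt \<Rightarrow> real) \<Rightarrow> bool" where
  "smooth_on p U h \<longleftrightarrow> (\<forall>l\<in>lists {..<p}.
     continuous_map (subtopology (Euclidean_space p) U) euclideanreal (foldr rpd l h) \<and>
     (\<forall>i<p. \<forall>x\<in>U. (\<lambda>t. foldr rpd l h (x(i := t))) differentiable (at (x i))))"

definition superfun :: "nat \<Rightarrow> pt set \<Rightarrow> var set \<Rightarrow> (pt \<Rightarrow> gs) \<Rightarrow> bool" where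
  "superfun p U V g \<longleftrightarrow>
     (\<forall>x\<in>U. gs_vars V (g x)) \<and> (\<forall>m. smooth_on p U (\<lambda>x. coeff (g x) m))"

text \<open>Left derivatives with respect to coordinates and momenta.\<close>

definition dcoord :: "coord \<Rightarrow> (pt \<Rightarrow> gs) \<Rightarrow> pt \<Rightarrow> gs" where
  "dcoord a g x = (case a of
       Ev i \<Rightarrow> gs_of (\<lambda>m. rpd i (\<lambda>y. coeff (g y) m) x)
     | Od j \<Rightarrow> vderiv (Xi j) (g x))"

definition dmom :: "coord \<Rightarrow> (pt \<Rightarrow> gs) \<Rightarrow> pt \<Rightarrow> gs" where
  "dmom a g x = vderiv (Mom a) (g x)"

text \<open>The weight is the eigenvalue of the Euler field \<open>\<Sum>\<^sub>a w\<^sup>a x\<^sup>a \<partial>/\<partial>x\<^sup>a\<close>, extended to all variables.\<close>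

definition has_weight ::
  "nat \<Rightarrow> pt set \<Rightarrow> (coord \<Rightarrow> int) \<Rightarrow> (var \<Rightarrow> int) \<Rightarrow> int \<Rightarrow> (pt \<Rightarrow> gs) \<Rightarrow> bool" where
  "has_weight p U w W s g \<longleftrightarrow> (\<forall>x\<in>U. \<forall>m.
     (\<Sum>i<p. of_int (w (Ev i)) * x i * rpd i (\<lambda>y. coeff (g y) m) x)
       + of_int (\<Sum>v\<in>#m. W v) * coeff (g x) m
     = of_int s * coeff (g x) m)"

definition vweight ::
  "(coord \<Rightarrow> int) \<Rightarrow> (coord \<Rightarrow> int) \<Rightarrow> (bool \<Rightarrow> nat \<Rightarrow> int) \<Rightarrow> var \<Rightarrow> int" where
  "vweight w \<mu> \<omega> v = (case v of Xi j \<Rightarrow> w (Od j) | Mom a \<Rightarrow> \<mu> a | Par b n \<Rightarrow> \<omega> b n)"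

text \<open>
  Evaluation of a local expression \<open>g\<close> at series \<open>X\<close> for the coordinates and \<open>P\<close> for the momenta,
  leaving parameters alone. In the even coordinates it is the Taylor expansion at the body of \<open>X\<close>:
  the term for \<open>l = [i\<^sub>1, \<dots>, i\<^sub>n]\<close> and a monomial \<open>m\<close> is
  \<open>1/n! \<partial>\<^sub>i\<^sub>1 \<dots> \<partial>\<^sub>i\<^sub>n g\<^sub>m soul(X\<^sup>i\<^sup>1) \<dots> soul(X\<^sup>i\<^sup>n) (X, P)\<^sup>m\<close>.
\<close>

definition bodypt :: "nat \<Rightarrow> (coord \<Rightarrow> gs) \<Rightarrow> pt" where
  "bodypt p X = (\<lambda>i. if i < p then body (X (Ev i)) else 0)"

definition subst_var :: "(coord \<Rightarrow> gs) \<Rightarrow> (coord \<Rightarrow> gs) \<Rightarrow> var \<Rightarrow> gs" where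
  "subst_var X P v = (case v of Xi j \<Rightarrow> X (Od j) | Mom a \<Rightarrow> P a | Par b n \<Rightarrow> gs_var (Par b n))"

definition sf_eval_term ::
  "nat \<Rightarrow> (pt \<Rightarrow> gs) \<Rightarrow> (coord \<Rightarrow> gs) \<Rightarrow> (coord \<Rightarrow> gs) \<Rightarrow> nat list \<Rightarrow> var multiset \<Rightarrow> gs" where
  "sf_eval_term p g X P l m =
     (foldr rpd l (\<lambda>y. coeff (g y) m) (bodypt p X) / fact (length l)) *\<^sub>R
       (prod_list (map (\<lambda>i. soul (X (Ev i))) l)
        * prod_list (map (subst_var X P) (sorted_list_of_multiset m)))"

text \<open>
  The contribution of the part of \<open>g\<close> of degree \<open>n\<close> in the momenta. These sums are coefficientwise
  finite whenever \<open>g\<close> involves finitely many coordinates and momenta and the odd \<open>X\<close> have no constant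
  term. The sum over \<open>n\<close> is coefficientwise finite too if the series \<open>P\<close> have no constant term; for
  other \<open>P\<close>, its convergence (\<open>sf_eval_sums\<close>) is a condition.
\<close>

definition sf_eval_deg ::
  "nat \<Rightarrow> (pt \<Rightarrow> gs) \<Rightarrow> (coord \<Rightarrow> gs) \<Rightarrow> (coord \<Rightarrow> gs) \<Rightarrow> nat \<Rightarrow> gs" where
  "sf_eval_deg p g X P n = gs_of (\<lambda>k.
     \<Sum>\<^sub>\<infinity>(l, m)\<in>lists {..<p} \<times> {m. size (filter_mset is_mom m) = n}.
       coeff (sf_eval_term p g X P l m) k)"

definition sf_eval_sums ::
  "nat \<Rightarrow> (pt \<Rightarrow> gs) \<Rightarrow> (coord \<Rightarrow> gs) \<Rightarrow> (coord \<Rightarrow> gs) \<Rightarrow> gs \<Rightarrow> bool" where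
  "sf_eval_sums p g X P f \<longleftrightarrow> (\<forall>k. (\<lambda>n. coeff (sf_eval_deg p g X P n) k) sums coeff f k)"

definition sf_eval ::
  "nat \<Rightarrow> (pt \<Rightarrow> gs) \<Rightarrow> (coord \<Rightarrow> gs) \<Rightarrow> (coord \<Rightarrow> gs) \<Rightarrow> gs" where
  "sf_eval p g X P = gs_of (\<lambda>k. \<Sum>n. coeff (sf_eval_deg p g X P n) k)"

definition mom_var :: "coord \<Rightarrow> gs" where
  "mom_var a = gs_var (Mom a)"

definition coord_pt :: "pt \<Rightarrow> coord \<Rightarrow> gs" where
  "coord_pt x a = (case a of Ev i \<Rightarrow> of_real (x i) | Od j \<Rightarrow> gs_var (Xi j))"


section \<open>Graded supermanifolds\<close>

text \<open>
  A supermanifold of dimension \<open>edim|odim\<close> is given by an atlas. \<open>transition M c d a\<close> is the coordinate \<open>a\<close>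
  of the chart \<open>d\<close> as a function of the coordinates of the chart \<open>c\<close>, defined on \<open>overlap M c d\<close>.
\<close>

record ('m, 'c) atlas =
  carrier_top :: "'m topology"
  edim :: nat
  odim :: nat
  charts :: "'c set"
  cdom :: "'c \<Rightarrow> 'm set"
  cmap :: "'c \<Rightarrow> 'm \<Rightarrow> pt"
  cweight :: "'c \<Rightarrow> coord \<Rightarrow> int"
  transition :: "'c \<Rightarrow> 'c \<Rightarrow> coord \<Rightarrow> pt \<Rightarrow> gs"

definition coords :: "('m, 'c) atlas \<Rightarrow> coord set" where
  "coords M = Ev ` {..<edim M} \<union> Od ` {..<odim M}"

definition xi_vars :: "('m, 'c) atlas \<Rightarrow> var set" where
  "xi_vars M = Xi ` {..<odim M}"

definition mom_vars :: "('m, 'c) atlas \<Rightarrow> var set" where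
  "mom_vars M = Mom ` coords M"

definition image_of :: "('m, 'c) atlas \<Rightarrow> 'c \<Rightarrow> pt set" where
  "image_of M c = cmap M c ` cdom M c"

definition overlap :: "('m, 'c) atlas \<Rightarrow> 'c \<Rightarrow> 'c \<Rightarrow> pt set" where
  "overlap M c d = cmap M c ` (cdom M c \<inter> cdom M d)"

definition change :: "('m, 'c) atlas \<Rightarrow> 'c \<Rightarrow> 'c \<Rightarrow> pt \<Rightarrow> coord \<Rightarrow> gs" where
  "change M c d x a = transition M c d a x"

definition graded_supermanifold :: "('m, 'c) atlas \<Rightarrow> bool" where
  "graded_supermanifold M \<longleftrightarrow>
     Hausdorff_space (carrier_top M) \<and> second_countable (carrier_top M) \<and>
     topspace (carrier_top M) = (\<Union>c\<in>charts M. cdom M c) \<and>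
     (\<forall>c\<in>charts M. openin (carrier_top M) (cdom M c) \<and>
        openin (Euclidean_space (edim M)) (image_of M c) \<and>
        homeomorphic_map (subtopology (carrier_top M) (cdom M c))
          (subtopology (Euclidean_space (edim M)) (image_of M c)) (cmap M c)) \<and>
     (\<forall>c\<in>charts M. \<forall>d\<in>charts M. \<forall>a\<in>coords M.
        superfun (edim M) (overlap M c d) (xi_vars M) (transition M c d a) \<and>
        (\<forall>x\<in>overlap M c d. gs_parity (codd a) (transition M c d a x)) \<and>
        has_weight (edim M) (overlap M c d) (cweight M c)
          (vweight (cweight M c) (\<lambda>_. 0) (\<lambda>_ _. 0)) (cweight M d a) (transition M c d a)) \<and>
     (\<forall>c\<in>charts M. \<forall>d\<in>charts M. \<forall>z\<in>cdom M c \<inter> cdom M d. \<forall>i<edim M.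
        body (transition M c d (Ev i) (cmap M c z)) = cmap M d z i) \<and>
     (\<forall>c\<in>charts M. \<forall>a\<in>coords M. \<forall>x\<in>image_of M c. transition M c c a x = coord_pt x a) \<and>
     (\<forall>c\<in>charts M. \<forall>d\<in>charts M. \<forall>e\<in>charts M. \<forall>a\<in>coords M.
        \<forall>z\<in>cdom M c \<inter> cdom M d \<inter> cdom M e.
        transition M c e a (cmap M c z)
          = sf_eval (edim M) (transition M d e a) (change M c d (cmap M c z)) mom_var)"

text \<open>
  Functions on \<open>M\<close> of given parity and weight, depending on parameters of weights \<open>\<omega>\<close>, as families
  of local expressions. The normalisation to 0 off the domains makes the family unique.
\<close>

definition global_functions ::
  "('m, 'c) atlas \<Rightarrow> (bool \<Rightarrow> nat \<Rightarrow> int) \<Rightarrow> bool \<Rightarrow> int \<Rightarrow> ('c \<Rightarrow> pt \<Rightarrow> gs) set" where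
  "global_functions M \<omega> b s = {F.
     (\<forall>c x. c \<notin> charts M \<or> x \<notin> image_of M c \<longrightarrow> F c x = 0) \<and>
     (\<forall>c\<in>charts M.
        superfun (edim M) (image_of M c) (xi_vars M \<union> Collect is_par) (F c) \<and>
        (\<forall>x\<in>image_of M c. gs_parity b (F c x)) \<and>
        has_weight (edim M) (image_of M c) (cweight M c)
          (vweight (cweight M c) (\<lambda>_. 0) \<omega>) s (F c)) \<and>
     (\<forall>c\<in>charts M. \<forall>d\<in>charts M. \<forall>x\<in>overlap M c d.
        F c x = sf_eval (edim M) (F d) (change M c d x) mom_var)}"

text \<open>
  Formal maps between spaces of functions are evaluated on points of the formal neighbourhood of 0
  in \<open>\<^bold>C\<^sup>\<infinity>(M)[s]\<close>, that is, on points whose parameter-free part vanishes. An arbitrary point \<open>g\<close> is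
  covered through \<open>t g\<close>, where \<open>t\<close> is an even parameter of weight 0 not occurring in \<open>g\<close>: the
  coefficient of \<open>t\<^sup>n\<close> in the value at \<open>t g\<close> is the term of degree \<open>n\<close> in \<open>g\<close>.
\<close>

definition formal_points ::
  "('m, 'c) atlas \<Rightarrow> (bool \<Rightarrow> nat \<Rightarrow> int) \<Rightarrow> int \<Rightarrow> ('c \<Rightarrow> pt \<Rightarrow> gs) set" where
  "formal_points M \<omega> s = {G \<in> global_functions M \<omega> False s.
     \<forall>c x m. coeff (G c x) m \<noteq> 0 \<longrightarrow> (\<exists>v\<in>#m. is_par v)}"


section \<open>Shifted S-infinity structures\<close>

text \<open>
  A function on \<open>T\<^sup>*M[r]\<close>, formal in the fibre directions. In the chart change
  \<open>p\<^sub>a = \<partial>x\<^sup>a\<^sup>'/\<partial>x\<^sup>a p\<^sub>a\<^sub>'\<close>.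
\<close>

definition change_mom :: "('m, 'c) atlas \<Rightarrow> 'c \<Rightarrow> 'c \<Rightarrow> pt \<Rightarrow> coord \<Rightarrow> gs" where
  "change_mom M c d x a = (\<Sum>b\<in>coords M. dcoord a (transition M c d b) x * mom_var b)"

definition cotangent_functions ::
  "('m, 'c) atlas \<Rightarrow> int \<Rightarrow> bool \<Rightarrow> int \<Rightarrow> ('c \<Rightarrow> pt \<Rightarrow> gs) set" where
  "cotangent_functions M r b s = {H.
     (\<forall>c\<in>charts M.
        superfun (edim M) (image_of M c) (xi_vars M \<union> mom_vars M) (H c) \<and>
        (\<forall>x\<in>image_of M c. gs_parity b (H c x)) \<and>
        has_weight (edim M) (image_of M c) (cweight M c)
          (vweight (cweight M c) (\<lambda>a. r - cweight M c a) (\<lambda>_ _. 0)) s (H c)) \<and>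
     (\<forall>c\<in>charts M. \<forall>d\<in>charts M. \<forall>x\<in>overlap M c d.
        sf_eval (edim M) (H c) (coord_pt x) (change_mom M c d x)
          = sf_eval (edim M) (H d) (change M c d x) mom_var)}"

text \<open>The canonical Poisson bracket of \<open>F\<close>, of parity \<open>b\<close>, and \<open>G\<close>, with \<open>(p\<^sub>a, x\<^sup>a) = 1\<close>.\<close>

definition poisson :: "coord set \<Rightarrow> bool \<Rightarrow> (pt \<Rightarrow> gs) \<Rightarrow> (pt \<Rightarrow> gs) \<Rightarrow> pt \<Rightarrow> gs" where
  "poisson A b F G x = (\<Sum>a\<in>A.
     (if b then 1 else psign a) * dmom a F x * dcoord a G x
     - (if b then psign a else 1) * dcoord a F x * dmom a G x)"

definition master_hamiltonian :: "int \<Rightarrow> ('m, 'c) atlas \<Rightarrow> ('c \<Rightarrow> pt \<Rightarrow> gs) \<Rightarrow> bool" where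
  "master_hamiltonian k M H \<longleftrightarrow>
     H \<in> cotangent_functions M (1 - k) True (2 - k) \<and>
     (\<forall>c\<in>charts M. \<forall>x\<in>image_of M c. poisson (coords M) True (H c) (H c) x = 0)"

text \<open>
  The brackets \<open>{f\<^sub>1, \<dots>, f\<^sub>n}\<^sub>H = (\<dots>(H, f\<^sub>1), \<dots>, f\<^sub>n)|\<^sub>M\<close>; each argument carries its parity. Symmetry,
  the Leibniz rule, the Jacobi identities, parity and weights follow from the conditions on \<open>H\<close>.
\<close>

definition derived_bracket ::
  "('m, 'c) atlas \<Rightarrow> ('c \<Rightarrow> pt \<Rightarrow> gs) \<Rightarrow> (bool \<times> ('c \<Rightarrow> pt \<Rightarrow> gs)) list \<Rightarrow> 'c \<Rightarrow> pt \<Rightarrow> gs" where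
  "derived_bracket M H fs c x = (if c \<in> charts M \<and> x \<in> image_of M c
     then sf_eval (edim M)
       (snd (foldl (\<lambda>(b, F) (b', f). (b \<noteq> b', poisson (coords M) b F (f c))) (True, H c) fs))
       (coord_pt x) (\<lambda>_. 0)
     else 0)"

definition specifies_S_infinity ::
  "int \<Rightarrow> ('m, 'c) atlas \<Rightarrow> ('c \<Rightarrow> pt \<Rightarrow> gs) \<Rightarrow>
     ((bool \<times> ('c \<Rightarrow> pt \<Rightarrow> gs)) list \<Rightarrow> 'c \<Rightarrow> pt \<Rightarrow> gs) \<Rightarrow> bool" where
  "specifies_S_infinity k M H br \<longleftrightarrow> master_hamiltonian k M H \<and> br = derived_bracket M H"

text \<open>The Hamilton-Jacobi vector field, given by its value at a point.\<close>

definition HJ_field ::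
  "('m, 'c) atlas \<Rightarrow> ('c \<Rightarrow> pt \<Rightarrow> gs) \<Rightarrow> ('c \<Rightarrow> pt \<Rightarrow> gs) \<Rightarrow> 'c \<Rightarrow> pt \<Rightarrow> gs" where
  "HJ_field M H F c x = (if c \<in> charts M \<and> x \<in> image_of M c
     then sf_eval (edim M) (H c) (coord_pt x) (\<lambda>a. dcoord a (F c) x) else 0)"

definition HJ_converges ::
  "('m, 'c) atlas \<Rightarrow> ('c \<Rightarrow> pt \<Rightarrow> gs) \<Rightarrow> ('c \<Rightarrow> pt \<Rightarrow> gs) \<Rightarrow> bool" where
  "HJ_converges M H F \<longleftrightarrow> (\<forall>c\<in>charts M. \<forall>x\<in>image_of M c.
     sf_eval_sums (edim M) (H c) (coord_pt x) (\<lambda>a. dcoord a (F c) x) (HJ_field M H F c x))"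


section \<open>Thick morphisms\<close>

text \<open>
  \<open>gen \<Phi> c d\<close> is the generating function \<open>S(x, q)\<close> in the chart \<open>c\<close> of the source and the chart \<open>d\<close>
  of the target, with \<open>q\<^sub>i\<close> the variable \<open>Mom i\<close>; \<open>tmap \<Phi>\<close> is the underlying map of points.
\<close>

record ('m, 'c, 'n, 'd) thick =
  tmap :: "'m \<Rightarrow> 'n"
  gen :: "'c \<Rightarrow> 'd \<Rightarrow> pt \<Rightarrow> gs"

definition tdom ::
  "('m, 'c) atlas \<Rightarrow> ('n, 'd) atlas \<Rightarrow> ('m \<Rightarrow> 'n) \<Rightarrow> 'c \<Rightarrow> 'd \<Rightarrow> 'm set" where
  "tdom M1 M2 h c d = {z \<in> cdom M1 c. h z \<in> cdom M2 d}"

text \<open>\<open>y\<^sup>i = (-1)\<^sup>i \<partial>S/\<partial>q\<^sub>i\<close> at \<open>(X, Q)\<close>; for \<open>X = x\<close>, \<open>Q = 0\<close> this is \<open>\<phi>\<^sup>i(x)\<close>.\<close>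

definition thick_y ::
  "('m, 'c) atlas \<Rightarrow> (pt \<Rightarrow> gs) \<Rightarrow> (coord \<Rightarrow> gs) \<Rightarrow> (coord \<Rightarrow> gs) \<Rightarrow> coord \<Rightarrow> gs" where
  "thick_y M1 S X Q i = psign i * sf_eval (edim M1) (dmom i S) X Q"

definition thick_phi ::
  "('m, 'c) atlas \<Rightarrow> ('m, 'c, 'n, 'd) thick \<Rightarrow> 'c \<Rightarrow> 'd \<Rightarrow> pt \<Rightarrow> coord \<Rightarrow> gs" where
  "thick_phi M1 \<Phi> c d x i = thick_y M1 (gen \<Phi> c d) (coord_pt x) (\<lambda>_. 0) i"

definition thick_morphism ::
  "int \<Rightarrow> ('m, 'c) atlas \<Rightarrow> ('n, 'd) atlas \<Rightarrow> ('m, 'c, 'n, 'd) thick \<Rightarrow> bool" where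
  "thick_morphism s M1 M2 \<Phi> \<longleftrightarrow>
     continuous_map (carrier_top M1) (carrier_top M2) (tmap \<Phi>) \<and>
     (\<forall>c\<in>charts M1. \<forall>d\<in>charts M2.
        let D = tdom M1 M2 (tmap \<Phi>) c d; U = cmap M1 c ` D; S = gen \<Phi> c d in
          superfun (edim M1) U (xi_vars M1 \<union> mom_vars M2) S \<and>
          (\<forall>x\<in>U. gs_parity False (S x)) \<and>
          has_weight (edim M1) U (cweight M1 c)
            (vweight (cweight M1 c) (\<lambda>i. s - cweight M2 d i) (\<lambda>_ _. 0)) s S \<and>
          (\<forall>z\<in>D. \<forall>i<edim M2.
             body (thick_phi M1 \<Phi> c d (cmap M1 c z) (Ev i)) = cmap M2 d (tmap \<Phi> z) i)) \<and>
     (\<forall>c\<in>charts M1. \<forall>c'\<in>charts M1. \<forall>d\<in>charts M2. \<forall>d'\<in>charts M2.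
        \<forall>z\<in>tdom M1 M2 (tmap \<Phi>) c d \<inter> tdom M1 M2 (tmap \<Phi>) c' d'.
        let x' = cmap M1 c' z; X = change M1 c' c x'; S = gen \<Phi> c d in
          \<exists>Y Q.
            (\<forall>i\<in>coords M2. Y i = thick_y M1 S X Q i) \<and>
            (\<forall>i\<in>coords M2. Q i =
               (\<Sum>j\<in>coords M2. sf_eval (edim M2) (dcoord i (transition M2 d d' j)) Y mom_var * mom_var j)) \<and>
            gen \<Phi> c' d' x' = sf_eval (edim M1) S X Q - (\<Sum>i\<in>coords M2. Y i * Q i)
              + (\<Sum>j\<in>coords M2. sf_eval (edim M2) (transition M2 d d' j) Y mom_var * mom_var j))"

text \<open>\<open>f\<close> is the value at \<open>x\<close> of the pullback of the local function \<open>g\<close>.\<close>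

definition pullback_value ::
  "('m, 'c) atlas \<Rightarrow> ('n, 'd) atlas \<Rightarrow> (pt \<Rightarrow> gs) \<Rightarrow> (pt \<Rightarrow> gs) \<Rightarrow> pt \<Rightarrow> gs \<Rightarrow> bool" where
  "pullback_value M1 M2 S g x f \<longleftrightarrow> (\<exists>Y Q.
     (\<forall>i\<in>coords M2. Y i = thick_y M1 S (coord_pt x) Q i) \<and>
     (\<forall>i\<in>coords M2. Q i = sf_eval (edim M2) (dcoord i g) Y mom_var) \<and>
     f = sf_eval (edim M2) g Y mom_var + sf_eval (edim M1) S (coord_pt x) Q
         - (\<Sum>i\<in>coords M2. Y i * Q i))"

definition is_pullback ::
  "('m, 'c) atlas \<Rightarrow> ('n, 'd) atlas \<Rightarrow> ('m, 'c, 'n, 'd) thick \<Rightarrow>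
     ('d \<Rightarrow> pt \<Rightarrow> gs) \<Rightarrow> ('c \<Rightarrow> pt \<Rightarrow> gs) \<Rightarrow> bool" where
  "is_pullback M1 M2 \<Phi> G F \<longleftrightarrow>
     (\<forall>c x. c \<notin> charts M1 \<or> x \<notin> image_of M1 c \<longrightarrow> F c x = 0) \<and>
     (\<forall>c\<in>charts M1. \<forall>d\<in>charts M2. \<forall>x\<in>cmap M1 c ` tdom M1 M2 (tmap \<Phi>) c d.
        pullback_value M1 M2 (gen \<Phi> c d) (G d) x (F c x))"

definition pullback ::
  "('m, 'c) atlas \<Rightarrow> ('n, 'd) atlas \<Rightarrow> ('m, 'c, 'n, 'd) thick \<Rightarrow>
     ('d \<Rightarrow> pt \<Rightarrow> gs) \<Rightarrow> ('c \<Rightarrow> pt \<Rightarrow> gs)" where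
  "pullback M1 M2 \<Phi> G = (THE F. is_pullback M1 M2 \<Phi> G F)"

text \<open>The Hamilton-Jacobi equation includes the convergence of its left-hand side: \<open>\<partial>S/\<partial>x\<close> contains
  the term \<open>\<partial>S\<^sup>0/\<partial>x\<close>, which is not formally small. For \<open>H\<^sub>1\<close> polynomial in the momenta or \<open>S\<^sup>0\<close>
  locally constant the sum is finite.\<close>

definition S_infinity_thick_morphism ::
  "int \<Rightarrow> ('m, 'c) atlas \<Rightarrow> ('c \<Rightarrow> pt \<Rightarrow> gs) \<Rightarrow> ('n, 'd) atlas \<Rightarrow> ('d \<Rightarrow> pt \<Rightarrow> gs) \<Rightarrow>
     ('m, 'c, 'n, 'd) thick \<Rightarrow> bool" where
  "S_infinity_thick_morphism k M1 H1 M2 H2 \<Phi> \<longleftrightarrow>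
     thick_morphism (1 - k) M1 M2 \<Phi> \<and>
     (\<forall>c\<in>charts M1. \<forall>d\<in>charts M2. \<forall>x\<in>cmap M1 c ` tdom M1 M2 (tmap \<Phi>) c d.
        let S = gen \<Phi> c d in
          sf_eval_sums (edim M1) (H1 c) (coord_pt x) (\<lambda>a. dcoord a S x)
            (sf_eval (edim M2) (H2 d) (\<lambda>i. psign i * dmom i S x) mom_var))"


section \<open>Formal Q-morphisms\<close>

text \<open>
  A formal map from \<open>\<^bold>C\<^sup>\<infinity>(M2)[s]\<close> to \<open>\<^bold>C\<^sup>\<infinity>(M1)[s]\<close> over \<open>y = \<phi>(x)\<close>: its values are sums over \<open>n\<close> of
  polynomials, homogeneous of degree \<open>n\<close>, in the derivatives of the argument at \<open>\<phi>(x)\<close>. The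
  coefficients \<open>A c d n I\<close> depend neither on the argument nor on the parameters; \<open>I\<close> lists the \<open>n\<close>
  multi-indices of differentiation.
\<close>

definition formal_map ::
  "int \<Rightarrow> ('n, 'd) atlas \<Rightarrow> ('m, 'c) atlas \<Rightarrow> ('m \<Rightarrow> 'n) \<Rightarrow>
     ('c \<Rightarrow> 'd \<Rightarrow> pt \<Rightarrow> coord \<Rightarrow> gs) \<Rightarrow>
     (('d \<Rightarrow> pt \<Rightarrow> gs) \<Rightarrow> ('c \<Rightarrow> pt \<Rightarrow> gs)) \<Rightarrow> bool" where
  "formal_map s M2 M1 h \<phi> T \<longleftrightarrow>
     (\<forall>\<omega>. \<forall>G\<in>formal_points M2 \<omega> s. T G \<in> global_functions M1 \<omega> False s) \<and>
     (\<exists>J A. \<forall>c\<in>charts M1. \<forall>d\<in>charts M2.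
        let U = cmap M1 c ` tdom M1 M2 h c d in
          (\<forall>n. finite (J c d n) \<and>
             (\<forall>I\<in>J c d n. length I = n \<and> set I \<subseteq> lists (coords M2) \<and>
                superfun (edim M1) U (xi_vars M1) (A c d n I))) \<and>
          (\<forall>\<omega>. \<forall>G\<in>formal_points M2 \<omega> s. \<forall>x\<in>U. \<forall>k.
             (\<lambda>n. coeff (\<Sum>I\<in>J c d n. A c d n I x *
                prod_list (map (\<lambda>l. sf_eval (edim M2) (foldr dcoord l (G d)) (\<phi> c d x) mom_var) I)) k)
             sums coeff (T G c x) k))"

text \<open>The tangent shift \<open>G + \<epsilon> V\<close> along a vector \<open>V\<close>, with the odd parameter \<open>\<epsilon> = Par True j\<close>.\<close>

definition shift :: "nat \<Rightarrow> ('c \<Rightarrow> pt \<Rightarrow> gs) \<Rightarrow> ('c \<Rightarrow> pt \<Rightarrow> gs) \<Rightarrow> 'c \<Rightarrow> pt \<Rightarrow> gs" where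
  "shift j G V = (\<lambda>c x. G c x + gs_var (Par True j) * V c x)"

text \<open>
  A formal homological vector field of weight 1 on \<open>\<^bold>C\<^sup>\<infinity>(M)[s]\<close>: for \<open>\<epsilon>\<close> of weight -1,
  \<open>G + \<epsilon> Q(G)\<close> is again a point, and \<open>Q\<^sup>2 = 0\<close> in the form \<open>Q(G + \<epsilon> Q(G)) = Q(G)\<close>.
\<close>

definition homological_field ::
  "int \<Rightarrow> ('m, 'c) atlas \<Rightarrow> (('c \<Rightarrow> pt \<Rightarrow> gs) \<Rightarrow> ('c \<Rightarrow> pt \<Rightarrow> gs)) \<Rightarrow> bool" where
  "homological_field s M Q \<longleftrightarrow> (\<forall>\<omega>. \<forall>G\<in>formal_points M \<omega> s.
     Q G \<in> global_functions M \<omega> True (s + 1) \<and>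
     (\<forall>j. \<omega> True j = - 1 \<longrightarrow> Q (shift j G (Q G)) = Q G))"

text \<open>
  \<open>T\<close> intertwines \<open>Q\<^sub>2\<close> and \<open>Q\<^sub>1\<close>: \<open>dT\<^sub>G (Q\<^sub>2(G)) = Q\<^sub>1(T(G))\<close>, with the derivative read off from
  \<open>T(G + \<epsilon> Q\<^sub>2(G))\<close>.
\<close>

definition intertwines ::
  "int \<Rightarrow> ('n, 'd) atlas \<Rightarrow> (('d \<Rightarrow> pt \<Rightarrow> gs) \<Rightarrow> ('d \<Rightarrow> pt \<Rightarrow> gs)) \<Rightarrow>
     (('c \<Rightarrow> pt \<Rightarrow> gs) \<Rightarrow> ('c \<Rightarrow> pt \<Rightarrow> gs)) \<Rightarrow>
     (('d \<Rightarrow> pt \<Rightarrow> gs) \<Rightarrow> ('c \<Rightarrow> pt \<Rightarrow> gs)) \<Rightarrow> bool" where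
  "intertwines s M2 Q2 Q1 T \<longleftrightarrow> (\<forall>\<omega>. \<forall>G\<in>formal_points M2 \<omega> s. \<forall>j. \<omega> True j = - 1 \<longrightarrow>
     T (shift j G (Q2 G)) = shift j (T G) (Q1 (T G)))"

text \<open>
  The value at 0 of a formal map need not vanish, so the convergence of \<open>H1\<close> on the values of \<open>T\<close>
  is part of the assertion.
\<close>

definition formal_Q_morphism ::
  "int \<Rightarrow> ('n, 'd) atlas \<Rightarrow> ('d \<Rightarrow> pt \<Rightarrow> gs) \<Rightarrow> ('m, 'c) atlas \<Rightarrow> ('c \<Rightarrow> pt \<Rightarrow> gs) \<Rightarrow>
     ('m \<Rightarrow> 'n) \<Rightarrow> ('c \<Rightarrow> 'd \<Rightarrow> pt \<Rightarrow> coord \<Rightarrow> gs) \<Rightarrow>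
     (('d \<Rightarrow> pt \<Rightarrow> gs) \<Rightarrow> ('c \<Rightarrow> pt \<Rightarrow> gs)) \<Rightarrow> bool" where
  "formal_Q_morphism s M2 H2 M1 H1 h \<phi> T \<longleftrightarrow>
     homological_field s M2 (HJ_field M2 H2) \<and>
     homological_field s M1 (HJ_field M1 H1) \<and>
     formal_map s M2 M1 h \<phi> T \<and>
     (\<forall>\<omega>. \<forall>G\<in>formal_points M2 \<omega> s. HJ_converges M1 H1 (T G)) \<and>
     intertwines s M2 (HJ_field M2 H2) (HJ_field M1 H1) T"

text \<open>Between bracket structures: a formal Q-morphism for the vector fields that encode them.\<close>

definition L_infinity_morphism ::
  "int \<Rightarrow> ('n, 'd) atlas \<Rightarrow> ((bool \<times> ('d \<Rightarrow> pt \<Rightarrow> gs)) list \<Rightarrow> 'd \<Rightarrow> pt \<Rightarrow> gs) \<Rightarrow>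
     ('m, 'c) atlas \<Rightarrow> ((bool \<times> ('c \<Rightarrow> pt \<Rightarrow> gs)) list \<Rightarrow> 'c \<Rightarrow> pt \<Rightarrow> gs) \<Rightarrow>
     ('m \<Rightarrow> 'n) \<Rightarrow> ('c \<Rightarrow> 'd \<Rightarrow> pt \<Rightarrow> coord \<Rightarrow> gs) \<Rightarrow>
     (('d \<Rightarrow> pt \<Rightarrow> gs) \<Rightarrow> ('c \<Rightarrow> pt \<Rightarrow> gs)) \<Rightarrow> bool" where
  "L_infinity_morphism k M2 br2 M1 br1 h \<phi> T \<longleftrightarrow>
     (\<exists>H2 H1. specifies_S_infinity k M2 H2 br2 \<and> specifies_S_infinity k M1 H1 br1 \<and>
        formal_Q_morphism (1 - k) M2 H2 M1 H1 h \<phi> T)"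

end

theory Submission
  imports Defs
begin

text \<open>
  Evaluation of a superfunction at series is an algebra homomorphism, commutes with substitutions of the
  parameters and momenta, and obeys the chain rule; by integrating the chain rule along the straight path from
  the body of the argument it is also compatible with composition.

  The equations \<open>y = (-1)\<^sup>i \<partial>S/\<partial>q(x, q)\<close>, \<open>q = \<partial>g/\<partial>y(y)\<close> have a unique solution, because iteration contracts
  the filtration by the number of parameters. At the solution the derivatives of \<open>y\<close> and \<open>q\<close> cancel in
  \<open>f = g(y) + S(x, q) - y q\<close>, so that \<open>\<partial>f/\<partial>x = \<partial>S/\<partial>x(x, q)\<close>. Substituting \<open>q\<close> into the Hamilton-Jacobi equation
  for \<open>S\<close> therefore gives \<open>Q\<^sub>1(\<Phi>\<^sup>*g)(x) = Q\<^sub>2(g)(y)\<close>, and by the same cancellation this is the derivative of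
  \<open>\<Phi>\<^sup>*\<close> along \<open>Q\<^sub>2(g)\<close>. The transformation law says that \<open>S'\<close> is the pullback of \<open>\<Sum>\<^sub>j t\<^sub>j(y) q\<^sub>j\<close> along \<open>S\<close>,
  with \<open>t\<close> the change of coordinates on the target; together with uniqueness this makes the pullback independent
  of the charts.
\<close>

text \<open>The implicit equations are solved separately at each point \<open>x\<close>, so the
  fixed point theorem says nothing about smoothness, parity or weight of the solution. These are
  inherited from the iterates: modulo each power of the ideal the solution coincides with an
  iterate, and iterates are compositions of superfunctions.

  The smallness behind the contraction need not come from the parameters. The local theory fixes an
  arbitrary ideal of variables and is used three times: with the parameters, for the pullback
  itself; with the momenta, for the transformation law; and with one fresh even variable
  \<open>t\<close>, to show that the pullback is a formal map. There \<open>t g\<close> is pulled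
  back in place of \<open>g\<close>, and the powers of \<open>t\<close> separate the homogeneous
  parts in the jets of \<open>g\<close>.

  The argument of \<open>H1\<close> in the Hamilton-Jacobi equation need not be formally small,
  since \<open>S\<close> has a part free of momenta. Convergence is therefore carried along when the
  solution is substituted for the momenta, and it yields both the convergence on the pullback and
  the intertwining relation.\<close>

abbreviation eopen :: "nat => pt set => bool" where
 "eopen p \<equiv> openin (Euclidean_space p)"

section \<open>Koszul signs of monomials\<close>

definition nodd :: "var multiset => nat" where
 "nodd m = size (filter_mset vodd m)"

lemma nodd_simps [simp]: "nodd {#} = 0" "nodd (a + b) = nodd a + nodd b"
 "nodd (add_mset v m) = (if vodd v then Suc (nodd m) else nodd m)"
 by (simp_all add: nodd_def)

lemma gs_parity_altdef: "gs_parity b f \<longleftrightarrow> (ALL m. coeff f m ~= 0 --> odd (nodd m) = b)"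
 by (simp add: gs_parity_def nodd_def)

definition linv :: "var => var multiset => nat" where
 "linv u b = inversions {#u#} b"

definition rinv :: "var multiset => var => nat" where
 "rinv a u = inversions a {#u#}"

lemma inversions_add_mset:
 "inversions (add_mset u a) b = linv u b + inversions a b"
 "inversions a (add_mset u b) = rinv a u + inversions a b"
 using inversions_add_left[of "{#u#}" a b] inversions_add_right[of a "{#u#}" b]
 by (simp_all add: linv_def rinv_def)

lemma linv_simps [simp]: "linv u {#} = 0" "linv u (a + b) = linv u a + linv u b"
 "linv u (add_mset v b) = (if vodd u & vodd v & v < u then Suc (linv u b) else linv u b)"
 by (simp_all add: linv_def inversions_def)

lemma rinv_simps [simp]: "rinv {#} u = 0" "rinv (a + b) u = rinv a u + rinv b u"
 "rinv (add_mset v b) u = (if vodd u & vodd v & u < v then Suc (rinv b u) else rinv b u)"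
 by (simp_all add: rinv_def inversions_def)

lemma mono_ok_add_mset:
 "mono_ok (add_mset v m) \<longleftrightarrow> mono_ok m & (vodd v --> v \<notin># m)"
proof
 assume *: "mono_ok (add_mset v m)"
 have "mono_ok m" using * mono_ok_addD(2)[of "{#v#}" m] by simp
 moreover have "v \<notin># m" if "vodd v"
 proof -
  have "count (add_mset v m) v \<le> 1" using * that by (simp only: mono_ok_def)
  then have "count m v = 0" by simp
  then show ?thesis by (simp only: not_in_iff)
 qed
 ultimately show "mono_ok m & (vodd v --> v \<notin># m)" by blast
next
 assume "mono_ok m & (vodd v --> v \<notin># m)"
 then show "mono_ok (add_mset v m)" by (auto simp: mono_ok_def not_in_iff)
qed

lemma linv_rinv:
 assumes "vodd v --> v \<notin># b"
 shows "linv v b + rinv b v = (if vodd v then nodd b else 0)"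
 using assms by (induction b) (auto split: if_splits)

lemma inversions_swap:
 assumes "mono_ok (a + b)"
 shows "inversions a b + inversions b a = nodd a * nodd b"
 using assms
proof (induction a)
 case (add x a)
 then have "mono_ok (a + b)" "vodd x --> x \<notin># b"
  by (auto simp: mono_ok_add_mset)
 with add.IH linv_rinv[of x b] show ?case
  by (auto simp: inversions_add_mset split: if_splits)
qed simp

lemma ksign_add_right: "ksign a (b + c) = ksign a b * ksign a c"
 by (simp add: ksign_def inversions_add_right power_add)

definition lsign :: "var => var multiset => real" where
 "lsign u b = (-1) ^ linv u b"

definition rsign :: "var multiset => var => real" where
 "rsign a u = (-1) ^ rinv a u"

lemma ksign_single: "ksign {#u#} b = lsign u b"
 by (simp add: ksign_def lsign_def linv_def)

lemma ksign_add_mset: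
 "ksign (add_mset u a) b = lsign u b * ksign a b"
 "ksign a (add_mset u b) = rsign a u * ksign a b"
 by (simp_all add: ksign_def lsign_def rsign_def inversions_add_mset power_add)

lemma lsign_simps [simp]: "lsign u {#} = 1" "lsign u (a + b) = lsign u a * lsign u b"
 "lsign u (add_mset v b) = (if vodd u & vodd v & v < u then - lsign u b else lsign u b)"
 "lsign u a * lsign u a = 1" "lsign u a * (lsign u a * x) = x"
 by (simp_all add: lsign_def power_add flip: power_mult_distrib mult.assoc)

lemma rsign_simps [simp]: "rsign {#} u = 1" "rsign (a + b) u = rsign a u * rsign b u"
 "rsign (add_mset v b) u = (if vodd u & vodd v & u < v then - rsign b u else rsign b u)"
 "rsign a u * rsign a u = 1" "rsign a u * (rsign a u * x) = x"
 by (simp_all add: rsign_def power_add flip: power_mult_distrib mult.assoc)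

lemma ksign_empty [simp]: "ksign {#} a = 1" "ksign a {#} = 1"
 by (simp_all add: ksign_def)

lemma ksign_sq [simp]: "ksign a b * ksign a b = 1"
 by (simp add: ksign_def flip: power_mult_distrib)

lemma ksign_sq' [simp]: "ksign a b * (ksign a b * x) = x"
 by (simp flip: mult.assoc)

lemma ksign_nz [simp]: "ksign a b ~= 0"
 by (simp add: ksign_def)

lemma lsign_even [simp]: "~ vodd v ==> lsign v m = 1" "~ vodd v ==> rsign m v = 1"
 by (induction m) simp_all

lemma ksign_swap:
 assumes "mono_ok (a + b)"
 shows "ksign a b = (-1) ^ (nodd a * nodd b) * ksign b a"
 unfolding ksign_def inversions_swap[OF assms, symmetric]
 by (simp add: power_add flip: power_mult_distrib)

lemma lsign_swap:
 assumes "vodd v" "v \<notin># b"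
 shows "lsign v b = (-1) ^ nodd b * rsign b v"
 unfolding lsign_def rsign_def using linv_rinv[of v b] assms
 by (simp add: power_add flip: power_mult_distrib)
  (metis (no_types, lifting) minus_one_mult_self mult.assoc mult.right_neutral power_add)

section \<open>Homogeneous series and graded commutativity\<close>

lemma gs_parity_0 [simp]: "gs_parity b 0"
 by (simp add: gs_parity_def)

lemma gs_parity_1 [simp]: "gs_parity False 1"
 by (simp add: gs_parity_def)

lemma gs_parity_add: "gs_parity b f ==> gs_parity b g ==> gs_parity b (f + g)"
 unfolding gs_parity_def by (metis add.right_neutral coeff_arith(3))

lemma gs_parity_uminus: "gs_parity b f ==> gs_parity b (- f)"
 by (simp add: gs_parity_def)

lemma gs_parity_diff: "gs_parity b f ==> gs_parity b g ==> gs_parity b (f - g)"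
 using gs_parity_add[of b f "- g"] gs_parity_uminus[of b g] by simp

lemma gs_parity_scaleR: "gs_parity b f ==> gs_parity b (r *\<^sub>R f)"
 by (simp add: gs_parity_def)

lemma gs_parity_of_real [simp]: "gs_parity False (of_real r)"
 by (simp add: of_real_def gs_parity_scaleR)

lemma gs_parity_sum: "(!!i. i \<in> A ==> gs_parity b (f i)) ==> gs_parity b (sum f A)"
 by (induction A rule: infinite_finite_induct) (auto intro: gs_parity_add)

lemma coeff_sum [simp]: "coeff (sum f A) k = (\<Sum>i\<in>A. coeff (f i) k)"
 by (induction A rule: infinite_finite_induct) auto

lemma coeff_mult_nonzeroE:
 assumes "coeff (f * g) k ~= 0"
 obtains a b where "a + b = k" "coeff f a ~= 0" "coeff g b ~= 0"
proof -
 have ok: "mono_ok k" using assms coeff_not_ok by blast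
 have "EX p:msplits k. (case p of (a, b) => ksign a b * coeff f a * coeff g b) ~= 0"
  using assms unfolding coeff_mult[OF ok] by (meson sum.not_neutral_contains_not_neutral)
 then show ?thesis using that by (auto simp: msplits_def)
qed

lemma gs_parity_mult: "gs_parity p f ==> gs_parity q g ==> gs_parity (p ~= q) (f * g)"
 unfolding gs_parity_altdef by (auto elim!: coeff_mult_nonzeroE)

lemma gs_mult_commute:
 assumes "gs_parity p f" "gs_parity q g"
 shows "f * g = (if p & q then - (g * f) else g * f)"
proof (rule gs_eqI)
 fix k assume ok: "mono_ok k"
 let ?s = "if p & q then - 1 else 1 :: real"
 have "coeff (f * g) k = (\<Sum>(a, b)\<in>msplits k. ksign a b * coeff f a * coeff g b)"
  by (rule coeff_mult[OF ok])
 also have "... = (\<Sum>(a, b)\<in>msplits k. ?s * (ksign b a * coeff g b * coeff f a))"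
 proof (rule sum.cong[OF refl], clarify)
  fix a b assume ab: "(a, b) \<in> msplits k"
  show "ksign a b * coeff f a * coeff g b = ?s * (ksign b a * coeff g b * coeff f a)"
  proof (cases "coeff f a = 0 | coeff g b = 0")
   case False
   then have "odd (nodd a) = p" "odd (nodd b) = q"
    using assms by (auto simp: gs_parity_altdef)
   moreover have "mono_ok (a + b)" using ab ok by (simp add: msplits_def)
   ultimately show ?thesis using ksign_swap[of a b] by auto
  qed auto
 qed
 also have "... = ?s * (\<Sum>(a, b)\<in>msplits k. ksign b a * coeff g b * coeff f a)"
  by (simp add: sum_distrib_left case_prod_unfold)
 also have "(\<Sum>(a, b)\<in>msplits k. ksign b a * coeff g b * coeff f a)
   = (\<Sum>(a, b)\<in>msplits k. ksign a b * coeff g a * coeff f b)"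
  by (rule sum.reindex_bij_witness[where i = prod.swap and j = prod.swap])
   (auto simp: msplits_def add.commute)
 finally show "coeff (f * g) k = coeff (if p & q then - (g * f) else g * f) k"
  by (auto simp: coeff_mult[OF ok])
qed

lemma gs_even_commute: "gs_parity False f ==> gs_parity q g ==> f * g = g * f"
 using gs_mult_commute[of False f q g] by simp

definition gs_part :: "bool => gs => gs" where
 "gs_part b f = gs_of (%m. if odd (nodd m) = b then coeff f m else 0)"

lemma gs_parity_part [simp]: "gs_parity b (gs_part b f)"
 by (simp add: gs_parity_altdef gs_part_def)

lemma gs_part_sum: "f = gs_part False f + gs_part True f"
 by (rule gs_eqI) (auto simp: gs_part_def)

text \<open>The two homogeneous parts of \<open>g\<close> commute with \<open>f\<close> separately,
  so \<open>g\<close> itself may be of mixed parity.\<close>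

lemma gs_even_central:
 assumes "gs_parity False f"
 shows "f * g = g * f"
proof -
 have "f * (gs_part False g + gs_part True g) = (gs_part False g + gs_part True g) * f"
  using gs_even_commute[OF assms gs_parity_part] by (simp add: distrib_left distrib_right)
 then show ?thesis by (simp flip: gs_part_sum)
qed

lemma gs_odd_square: "gs_parity True f ==> f * f = 0"
 using gs_mult_commute[of True f True f] by (metis add_eq_0_iff2 scaleR_half_double scaleR_zero_right)

subsection \<open>Monomials and continuous linear maps\<close>

definition mon :: "var multiset => gs" where
 "mon m = gs_of (%k. if k = m then 1 else 0)"

lemma coeff_mon: "coeff (mon m) k = (if k = m & mono_ok m then 1 else 0)"
 by (simp add: mon_def)

lemma mon_empty: "mon {#} = 1"
 by (rule gs_eqI) (simp add: coeff_mon)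

lemma mon_single: "mon {#v#} = gs_var v"
 by (simp add: mon_def gs_var_def)

lemma mon_not_ok: "~ mono_ok m ==> mon m = 0"
 by (rule gs_eqI) (auto simp: coeff_mon)

lemma gs_parity_mon: "gs_parity (odd (nodd m)) (mon m)"
 by (simp add: gs_parity_altdef coeff_mon)

lemma mon_mult: "mon a * mon b = ksign a b *\<^sub>R mon (a + b)"
proof (rule gs_eqI)
 fix k assume ok: "mono_ok k"
 have "coeff (mon a * mon b) k
   = (\<Sum>p\<in>msplits k. if p = (a, b) then ksign a b * (if mono_ok a & mono_ok b then 1 else 0) else 0)"
  unfolding coeff_mult[OF ok] by (intro sum.cong) (auto simp: coeff_mon split: if_splits)
 also have "... = (if (a, b) \<in> msplits k then ksign a b * (if mono_ok a & mono_ok b then 1 else 0) else 0)"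
  by (simp only: sum.delta[OF finite_msplits])
 also have "... = coeff (ksign a b *\<^sub>R mon (a + b)) k"
  using ok by (auto simp: msplits_def coeff_mon dest: mono_ok_addD)
 finally show "coeff (mon a * mon b) k = coeff (ksign a b *\<^sub>R mon (a + b)) k" .
qed

text \<open>Series in infinitely many variables are handled through linear maps for which each coefficient of the
  image depends on finitely many coefficients of the argument; they are determined by their values on monomials.\<close>

abbreviation locfin :: "(gs => gs) => var multiset => bool" where
 "locfin L k \<equiv> EX K. finite K & (ALL f. (ALL m:K. coeff f m = 0) --> coeff (L f) k = 0)"

definition clin :: "(gs => gs) => bool" where
 "clin L \<longleftrightarrow> (ALL f g. L (f + g) = L f + L g) & (ALL r f. L (r *\<^sub>R f) = r *\<^sub>R L f) &
   (ALL k. locfin L k)"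

lemma clinI:
 assumes "!!f g. L (f + g) = L f + L g" "!!r f. L (r *\<^sub>R f) = r *\<^sub>R L f"
  "!!k. mono_ok k ==> locfin L k"
 shows "clin L"
 unfolding clin_def
proof (intro conjI allI)
 fix k show "locfin L k"
 proof (cases "mono_ok k")
  case False
  then show ?thesis by (intro exI[of _ "{}"]) (simp add: coeff_not_ok)
 qed (rule assms(3))
qed (simp_all add: assms)

lemma clin_add: "clin L ==> L (f + g) = L f + L g"
 and clin_scaleR: "clin L ==> L (r *\<^sub>R f) = r *\<^sub>R L f"
 by (simp_all add: clin_def)

lemma clin_cont: "clin L ==> locfin L k"
 by (simp add: clin_def)

lemma clin_0: "clin L ==> L 0 = 0"
 using clin_scaleR[of L 0 0] by simp

lemma clin_uminus: "clin L ==> L (- f) = - L f"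
 using clin_scaleR[of L "-1" f] by simp

lemma clin_diff: "clin L ==> L (f - g) = L f - L g"
 using clin_add[of L f "- g"] clin_uminus[of L g] by simp

lemma clin_sum: "clin L ==> L (sum f A) = (\<Sum>i\<in>A. L (f i))"
 by (induction A rule: infinite_finite_induct) (auto simp: clin_0 clin_add)

text \<open>The truncation of \<open>f\<close> to \<open>K\<close> is a finite sum of monomials, and
  the remainder has no coefficient in \<open>K\<close>. Every coefficient of \<open>L f\<close> thus
  depends on finitely many values of \<open>L\<close> on monomials.\<close>

lemma clin_coeff:
 assumes "clin L"
 obtains K where "finite K" "!!f. coeff (L f) k = (\<Sum>m\<in>K. coeff f m * coeff (L (mon m)) k)"
proof -
 obtain K where K: "finite K" "!!f. (ALL m:K. coeff f m = 0) ==> coeff (L f) k = 0"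
  using clin_cont[OF assms, of k] by blast
 have "coeff (L f) k = (\<Sum>m\<in>K. coeff f m * coeff (L (mon m)) k)" for f
 proof -
  let ?g = "\<Sum>m\<in>K. coeff f m *\<^sub>R mon m"
  have "coeff (f - ?g) j = 0" if "j \<in> K" for j
  proof -
   have "coeff ?g j = (\<Sum>m\<in>K. if j = m then coeff f m * (if mono_ok m then 1 else 0) else 0)"
    by (simp add: coeff_mon) (intro sum.cong, auto)
   also have "... = coeff f j"
    using that K(1) by (simp add: coeff_not_ok)
   finally show ?thesis by simp
  qed
  then have "coeff (L (f - ?g)) k = 0" using K(2) by blast
  then have "coeff (L f) k = coeff (L ?g) k" by (simp add: clin_diff[OF assms])
  then show ?thesis by (simp add: clin_sum[OF assms] clin_scaleR[OF assms])
 qed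
 then show ?thesis using that K(1) by blast
qed

lemma clin_plus:
 assumes "clin L" "clin R"
 shows "clin (%f. L f + R f)"
proof (rule clinI)
 fix k
 obtain K where "finite K" "!!f. (ALL m:K. coeff f m = 0) ==> coeff (L f) k = 0"
  using clin_cont[OF assms(1), of k] by blast
 moreover obtain K' where "finite K'" "!!f. (ALL m:K'. coeff f m = 0) ==> coeff (R f) k = 0"
  using clin_cont[OF assms(2), of k] by blast
 ultimately show "locfin (%f. L f + R f) k"
  by (intro exI[of _ "K \<union> K'"]) auto
qed (simp_all add: clin_add[OF assms(1)] clin_add[OF assms(2)]
   clin_scaleR[OF assms(1)] clin_scaleR[OF assms(2)] scaleR_add_right)

lemma clin_lincomb:
 assumes "clin L"
 shows "clin (%f. r *\<^sub>R L f)"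
proof (rule clinI)
 fix k show "locfin (%f. r *\<^sub>R L f) k"
  using clin_cont[OF assms, of k] by auto
qed (simp_all add: clin_add[OF assms] clin_scaleR[OF assms] scaleR_add_right)

lemma clin_eqI:
 assumes "clin L" "clin R" "!!m. mono_ok m ==> L (mon m) = R (mon m)"
 shows "L f = R f"
proof -
 have "clin (%f. L f + (- 1) *\<^sub>R R f)" by (intro clin_plus clin_lincomb assms)
 then have LR: "clin (%f. L f - R f)" by simp
 have z: "L (mon m) - R (mon m) = 0" for m
  using assms(3)[of m] by (cases "mono_ok m") (auto simp: mon_not_ok clin_0 assms(1,2))
 have "coeff (L f - R f) k = 0" for k
  by (rule clin_coeff[OF LR, of k]) (simp only: z coeff_arith mult_zero_right sum.neutral_const)
 then have "L f - R f = 0" by (intro gs_eqI) (simp only: coeff_arith)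
 then show ?thesis by simp
qed

lemma clin_ident: "clin (%f. f)"
 by (rule clinI) (auto intro: exI[of _ "{_}"])

lemma clin_zero: "clin (%f. 0)"
 by (rule clinI) auto

lemma clin_sums: "(!!i. i \<in> A ==> clin (L i)) ==> clin (%f. \<Sum>i\<in>A. L i f)"
 by (induction A rule: infinite_finite_induct) (auto intro: clin_zero clin_plus)

lemma clin_compose:
 assumes "clin L" "clin R"
 shows "clin (%f. L (R f))"
proof (rule clinI)
 fix k
 obtain K where K: "finite K" "!!f. (ALL m:K. coeff f m = 0) ==> coeff (L f) k = 0"
  using clin_cont[OF assms(1), of k] by blast
 have "ALL k. locfin R k"
  using clin_cont[OF assms(2)] by blast
 then obtain K' where "!!k. finite (K' k)"
   "!!k f. (ALL m:K' k. coeff f m = 0) ==> coeff (R f) k = 0"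
  by metis
 then show "locfin (%f. L (R f)) k"
  using K by (intro exI[of _ "\<Union>(K' ` K)"]) auto
qed (simp_all add: clin_add[OF assms(1)] clin_add[OF assms(2)]
   clin_scaleR[OF assms(1)] clin_scaleR[OF assms(2)])

lemma clin_mult_left: "clin (%f. a * f)"
proof (rule clinI)
 fix k assume ok: "mono_ok k"
 show "locfin (%f. a * f) k"
  by (intro exI[of _ "snd ` msplits k"])
   (auto simp: coeff_mult[OF ok] intro!: sum.neutral)
qed (simp_all add: distrib_left)

lemma clin_mult_right: "clin (%f. f * a)"
proof (rule clinI)
 fix k assume ok: "mono_ok k"
 show "locfin (%f. f * a) k"
  by (intro exI[of _ "fst ` msplits k"])
   (auto simp: coeff_mult[OF ok] intro!: sum.neutral)
qed (simp_all add: distrib_right)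

text \<open>Separate continuity suffices, because the two arguments are reduced to monomials one
  after the other.\<close>

lemma bilin_eqI:
 assumes "!!g. clin (%f. L f g)" "!!f. clin (L f)" "!!g. clin (%f. R f g)" "!!f. clin (R f)"
  and "!!a b. mono_ok a ==> mono_ok b ==> L (mon a) (mon b) = R (mon a) (mon b)"
 shows "L f g = R f g"
proof (rule clin_eqI[of "%f. L f g" "%f. R f g"])
 fix a assume a: "mono_ok a"
 show "L (mon a) g = R (mon a) g"
  by (rule clin_eqI[of "L (mon a)" "R (mon a)"]) (use assms a in auto)
qed (use assms in auto)

lemma clin_pointwise:
 assumes "!!f m. mono_ok m ==> coeff (L f) m = c m * coeff f m"
 shows "clin L"
proof (rule clinI)
 fix k assume "mono_ok k"
 then show "locfin L k"
  by (intro exI[of _ "{k}"]) (simp add: assms)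
qed (rule gs_eqI; simp add: assms algebra_simps)+

subsection \<open>Left derivatives\<close>

lemma coeff_vderiv:
 "mono_ok m ==> coeff (vderiv v f) m = lsign v m * real (count m v + 1) * coeff f (add_mset v m)"
 by (simp add: vderiv_def ksign_single)

lemma clin_vderiv: "clin (vderiv v)"
proof (rule clinI)
 fix k assume ok: "mono_ok k"
 show "locfin (%f. vderiv v f) k"
  by (intro exI[of _ "{add_mset v k}"]) (simp add: coeff_vderiv[OF ok])
qed (rule gs_eqI; simp add: coeff_vderiv algebra_simps)+

lemma gs_parity_vderiv: "gs_parity b f ==> gs_parity (b ~= vodd v) (vderiv v f)"
 unfolding gs_parity_altdef
proof (intro allI impI)
 fix m
 assume *: "ALL m. coeff f m ~= 0 --> odd (nodd m) = b" and nz: "coeff (vderiv v f) m ~= 0"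
 from nz have "mono_ok m" using coeff_not_ok by blast
 with nz have "coeff f (add_mset v m) ~= 0" by (auto simp: coeff_vderiv)
 with * have "odd (nodd (add_mset v m)) = b" by blast
 then show "odd (nodd m) = (b ~= vodd v)" by (auto split: if_splits)
qed

lemma vderiv_mon_notin: "v \<notin># m ==> vderiv v (mon m) = 0"
 by (rule gs_eqI) (auto simp: coeff_vderiv coeff_mon)

lemma vderiv_mon_add:
 "mono_ok (add_mset v m) ==>
   vderiv v (mon (add_mset v m)) = (lsign v m * real (count m v + 1)) *\<^sub>R mon m"
 by (rule gs_eqI) (auto simp: coeff_vderiv coeff_mon mono_ok_add_mset)

lemma vderiv_commute:
 "vderiv u (vderiv v f) = (if vodd u & vodd v then -1 else 1) *\<^sub>R vderiv v (vderiv u f)"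
proof (rule gs_eqI)
 fix m assume ok: "mono_ok m"
 show "coeff (vderiv u (vderiv v f)) m
   = coeff ((if vodd u & vodd v then -1 else 1) *\<^sub>R vderiv v (vderiv u f)) m"
 proof (cases "u = v")
  case True
  show ?thesis
  proof (cases "vodd v")
   case True
   have "~ mono_ok (add_mset v (add_mset v m))" using True by (auto simp: mono_ok_add_mset)
   then have "coeff f (add_mset v (add_mset v m)) = 0" by (rule coeff_not_ok)
   then have "coeff (vderiv v (vderiv v f)) m = 0"
    by (cases "mono_ok (add_mset v m)") (auto simp: coeff_vderiv ok coeff_not_ok)
   then show ?thesis using \<open>u = v\<close> by simp
  qed (use True in auto)
 next
  case False
  show ?thesis
  proof (cases "mono_ok (add_mset u (add_mset v m))")
   case True
   then have oks: "mono_ok (add_mset u m)" "mono_ok (add_mset v m)"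
    by (auto simp: mono_ok_add_mset)
   show ?thesis
    using False linorder_less_linear[of u v]
    by (cases "vodd u"; cases "vodd v")
     (auto simp: coeff_vderiv ok oks ksign_add_mset add_mset_commute)
  next
   case no: False
   have z: "coeff f (add_mset u (add_mset v m)) = 0" "coeff f (add_mset v (add_mset u m)) = 0"
    using no by (auto simp: coeff_not_ok add_mset_commute)
   then show ?thesis
    by (cases "mono_ok (add_mset u m)"; cases "mono_ok (add_mset v m)")
     (auto simp: coeff_vderiv ok coeff_not_ok)
  qed
 qed
qed

definition sgn_if :: "bool => real" where
 "sgn_if b = (if b then - 1 else 1)"

lemma sgn_if_simps [simp]: "sgn_if False = 1" "sgn_if True = - 1" "sgn_if b * sgn_if b = 1"
 "sgn_if b * (sgn_if b * x) = x"
 by (auto simp: sgn_if_def)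

text \<open>On monomials the sign is that of moving \<open>v\<close> past the odd factors of the
  left monomial. For odd \<open>v\<close> the cases are the ways in which \<open>v\<close> can occur
  in the two factors; in the last one the product itself is 0.\<close>

lemma vderiv_mult:
 assumes "gs_parity b f"
 shows "vderiv v (f * g) = vderiv v f * g + sgn_if (vodd v & b) *\<^sub>R (f * vderiv v g)"
proof -
 have mm: "vderiv v (mon x * mon y) = vderiv v (mon x) * mon y
   + sgn_if (vodd v & odd (nodd x)) *\<^sub>R (mon x * vderiv v (mon y))"
  if ok: "mono_ok x" "mono_ok y" for x y
 proof (cases "vodd v")
  case False
  have D: "vderiv v (mon z) = (if v \<in># z then real (count z v) *\<^sub>R mon (z - {#v#}) else 0)"
   if "mono_ok z" for z
  proof (cases "v \<in># z")
   case True
   then obtain z' where z': "z = add_mset v z'" by (metis insert_DiffM)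
   show ?thesis using vderiv_mon_add[of v z'] that False by (simp add: z')
  qed (simp add: vderiv_mon_notin)
  have D': "vderiv v (mon z) = (if v \<in># z then real (count z v) *\<^sub>R mon (z - {#v#}) else 0)" for z
  proof (cases "mono_ok z")
   case no: False
   have "~ mono_ok (z - {#v#})" if "v \<in># z"
    using that no False by (metis insert_DiffM mono_ok_add_mset)
   then show ?thesis using no by (simp add: mon_not_ok clin_0 clin_vderiv)
  qed (simp add: D)
  have k: "ksign (x - {#v#}) y = ksign x y" if "v \<in># x"
   using that False ksign_add_mset(1)[of v "x - {#v#}" y] by simp
  have k': "ksign x (y - {#v#}) = ksign x y" if "v \<in># y"
   using that False ksign_add_mset(2)[of x v "y - {#v#}"] by simp
  have a: "x - {#v#} + y = x + y - {#v#}" if "v \<in># x" using that by simp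
  have a': "x + (y - {#v#}) = x + y - {#v#}" if "v \<in># y" using that by simp
  show ?thesis
   by (auto simp: D' mon_mult clin_scaleR[OF clin_vderiv] False k k' a a' not_in_iff
     scaleR_add_left[symmetric] algebra_simps simp flip: scaleR_add_left)
 next
  case odd: True
  have A: "vderiv v (mon (add_mset v m)) = lsign v m *\<^sub>R mon m" if "v \<notin># m" for m
  proof (cases "mono_ok m")
   case True
   then show ?thesis using vderiv_mon_add[of v m] that by (simp add: mono_ok_add_mset not_in_iff)
  qed (simp add: mono_ok_add_mset mon_not_ok clin_0 clin_vderiv)
  consider "v \<notin># x" "v \<notin># y" | x' where "x = add_mset v x'" "v \<notin># x'" "v \<notin># y"
   | y' where "y = add_mset v y'" "v \<notin># y'" "v \<notin># x"
   | x' y' where "x = add_mset v x'" "y = add_mset v y'" "v \<notin># x'" "v \<notin># y'"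
   using ok odd by (metis insert_DiffM mono_ok_add_mset)
  then show ?thesis
  proof cases
   case 1
   then show ?thesis by (simp add: mon_mult vderiv_mon_notin clin_scaleR[OF clin_vderiv])
  next
   case 2
   then show ?thesis using A[of "x' + y"] A[of x']
    by (simp add: mon_mult clin_scaleR[OF clin_vderiv] vderiv_mon_notin ksign_add_mset ksign_add_right)
  next
   case 3
   have sw: "lsign v x = sgn_if (odd (nodd x)) * rsign x v"
    using lsign_swap[of v x] 3 odd by (auto simp: sgn_if_def)
   then show ?thesis using 3 A[of "x + y'"] A[of y'] odd
    by (simp add: mon_mult clin_scaleR[OF clin_vderiv] vderiv_mon_notin ksign_add_mset ksign_add_right mult_ac)
  next
   case 4
   have "~ mono_ok (x + y)" using 4 odd by (simp add: mono_ok_add_mset)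
   then have l: "vderiv v (mon x * mon y) = 0"
    by (simp add: mon_mult mon_not_ok clin_0 clin_vderiv)
   \<comment> \<open>Both terms of the Leibniz rule are multiples of one monomial; the sign of
     moving \<open>v\<close> past \<open>x'\<close> makes them cancel.\<close>
   have sw: "lsign v x' = sgn_if (odd (nodd x')) * rsign x' v"
    using lsign_swap[of v x'] 4 odd by (auto simp: sgn_if_def)
   have "sgn_if (~ odd (nodd x')) = - sgn_if (odd (nodd x'))" by (simp add: sgn_if_def)
   then show ?thesis unfolding l using 4 A[of x'] A[of y'] odd sw
    by (simp add: mon_mult ksign_add_mset mult_ac flip: scaleR_add_left)
  qed
 qed
 \<comment> \<open>The parity sign is applied to each monomial of \<open>f\<close> separately. This
   turns the rule into an identity of maps linear in \<open>f\<close> and in \<open>g\<close>, which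
   can be checked on monomials; for homogeneous \<open>f\<close> it reduces to the scalar in the
   statement.\<close>
 define \<tau> where "\<tau> f = gs_of (%m. sgn_if (vodd v & odd (nodd m)) * coeff f m)" for f
 have \<tau>: "clin \<tau>" by (rule clin_pointwise[where c = "%m. sgn_if (vodd v & odd (nodd m))"]) (simp add: \<tau>_def)
 have \<tau>m: "\<tau> (mon m) = sgn_if (vodd v & odd (nodd m)) *\<^sub>R mon m" for m
  by (rule gs_eqI) (auto simp: \<tau>_def coeff_mon)
 have "vderiv v (f * g) = vderiv v f * g + \<tau> f * vderiv v g"
  by (rule bilin_eqI[of "%f g. vderiv v (f * g)" "%f g. vderiv v f * g + \<tau> f * vderiv v g"])
   (auto intro!: clin_plus clin_compose[OF clin_vderiv] clin_mult_left clin_mult_right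
    clin_compose[OF clin_mult_left] clin_compose[OF clin_mult_right] clin_vderiv \<tau>
    simp: mm \<tau>m)
 moreover have "\<tau> f = sgn_if (vodd v & b) *\<^sub>R f"
  by (rule gs_eqI) (use assms in \<open>auto simp: \<tau>_def gs_parity_altdef sgn_if_def\<close>)
 ultimately show ?thesis by simp
qed

text \<open>The part of the Euler field of \<open>has_weight\<close> that acts on the variables of
  the series, as opposed to the even coordinates.\<close>

definition wscale :: "(var => real) => gs => gs" where
 "wscale W f = gs_of (%m. (\<Sum>v\<in>#m. W v) * coeff f m)"

lemma coeff_wscale [simp]: "coeff (wscale W f) m = (\<Sum>v\<in>#m. W v) * coeff f m"
 by (simp add: wscale_def coeff_not_ok)

lemma clin_wscale: "clin (wscale W)"
 by (rule clin_pointwise[where c = "%m. \<Sum>v\<in>#m. W v"]) simp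

lemma wscale_mon: "wscale W (mon m) = (\<Sum>v\<in>#m. W v) *\<^sub>R mon m"
 by (rule gs_eqI) (simp add: coeff_mon)

lemma wscale_mult: "wscale W (f * g) = wscale W f * g + f * wscale W g"
 by (rule bilin_eqI[of "%f g. wscale W (f * g)" "%f g. wscale W f * g + f * wscale W g"])
  (auto intro!: clin_plus clin_compose[OF clin_wscale] clin_mult_left clin_mult_right
   clin_compose[OF clin_mult_left] clin_compose[OF clin_mult_right] clin_wscale
   simp: wscale_mon mon_mult clin_scaleR[OF clin_wscale] algebra_simps scaleR_add_left)

lemma gs_parity_wscale: "gs_parity b f ==> gs_parity b (wscale W f)"
 by (simp add: gs_parity_def)

subsection \<open>Order of vanishing\<close>

text \<open>Membership in the \<open>n\<close>-th power of the ideal generated by the variables in \<open>W\<close>.\<close>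

definition gsord :: "(var => bool) => nat => gs => bool" where
 "gsord W n f \<longleftrightarrow> (ALL k. size (filter_mset W k) < n --> coeff f k = 0)"

lemma gsord_0 [simp]: "gsord W n 0" "gsord W 0 f"
 by (simp_all add: gsord_def)

lemma gsord_mono: "gsord W n f ==> m \<le> n ==> gsord W m f"
 by (auto simp: gsord_def)

lemma gsord_add: "gsord W n f ==> gsord W n g ==> gsord W n (f + g)"
 by (simp add: gsord_def)

lemma gsord_diff: "gsord W n f ==> gsord W n g ==> gsord W n (f - g)"
 by (simp add: gsord_def)

lemma gsord_scaleR: "gsord W n f ==> gsord W n (r *\<^sub>R f)"
 by (simp add: gsord_def)

lemma gsord_sum: "(!!i. i \<in> A ==> gsord W n (f i)) ==> gsord W n (sum f A)"
 by (induction A rule: infinite_finite_induct) (auto intro: gsord_add)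

lemma gsord_mult: "gsord W m f ==> gsord W n g ==> gsord W (m + n) (f * g)"
 unfolding gsord_def
proof (intro allI impI, rule ccontr)
 fix k
 assume *: "ALL k. size (filter_mset W k) < m --> coeff f k = 0"
  "ALL k. size (filter_mset W k) < n --> coeff g k = 0"
  "size (filter_mset W k) < m + n" "coeff (f * g) k ~= 0"
 then obtain a b where "a + b = k" "coeff f a ~= 0" "coeff g b ~= 0"
  by (blast elim: coeff_mult_nonzeroE)
 with * have "m \<le> size (filter_mset W a)" "n \<le> size (filter_mset W b)"
  by (meson not_less)+
 with \<open>a + b = k\<close> * show False by auto
qed

text \<open>The powers of the ideal have zero intersection, as a given monomial contains only
  finitely many variables of \<open>W\<close>.\<close>

lemma gsord_eqI: "(!!n. gsord W n (f - g)) ==> f = g"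
 by (rule gs_eqI) (metis gsord_def coeff_arith(4) eq_iff_diff_eq_0 lessI)

lemma gsord_UNIV_1: "gsord (%_. True) 1 f \<longleftrightarrow> coeff f {#} = 0"
 by (simp add: gsord_def)

lemma gsord_soul: "gsord (%_. True) 1 (soul f)"
 unfolding gsord_UNIV_1 by (simp add: soul_def body_def of_real_def)

subsection \<open>Substitution\<close>

definition mprod :: "(var => gs) => var multiset => gs" where
 "mprod \<sigma> m = prod_list (map \<sigma> (sorted_list_of_multiset m))"

lemma mprod_empty [simp]: "mprod \<sigma> {#} = 1"
 by (simp add: mprod_def)

lemma mprod_single [simp]: "mprod \<sigma> {#v#} = \<sigma> v"
 by (simp add: mprod_def)

lemma lsign_le: "(!!u. u \<in># b ==> v \<le> u) ==> lsign v b = 1"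
 by (induction b) (auto simp: not_less)

lemma prod_list_insort:
 assumes "!!v. gs_parity (vodd v) (\<sigma> v)" "sorted xs"
 shows "prod_list (map \<sigma> (insort v xs)) = lsign v (mset xs) *\<^sub>R (\<sigma> v * prod_list (map \<sigma> xs))"
 using assms(2)
proof (induction xs)
 case (Cons x xs)
 show ?case
 proof (cases "v \<le> x")
  case True
  then have "lsign v (mset (x # xs)) = 1"
   using Cons.prems by (intro lsign_le) auto
  then show ?thesis using True by (simp del: mset.simps)
 next
  case False
  have "\<sigma> x * \<sigma> v = (if vodd x & vodd v then - (\<sigma> v * \<sigma> x) else \<sigma> v * \<sigma> x)"
   by (rule gs_mult_commute[OF assms(1) assms(1)])
  then have "\<sigma> x * (\<sigma> v * P) = (if vodd x & vodd v then - (\<sigma> v * (\<sigma> x * P)) else \<sigma> v * (\<sigma> x * P))" for P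
   by (simp flip: mult.assoc)
  then show ?thesis using False Cons by auto
 qed
qed simp

lemma mprod_add_mset:
 assumes "!!v. gs_parity (vodd v) (\<sigma> v)"
 shows "mprod \<sigma> (add_mset v m) = lsign v m *\<^sub>R (\<sigma> v * mprod \<sigma> m)"
 using prod_list_insort[OF assms, of "sorted_list_of_multiset m" v]
 by (simp add: mprod_def)

lemma mprod_add:
 assumes "!!v. gs_parity (vodd v) (\<sigma> v)"
 shows "mprod \<sigma> a * mprod \<sigma> b = ksign a b *\<^sub>R mprod \<sigma> (a + b)"
 by (induction a)
  (simp_all add: mprod_add_mset[OF assms] ksign_add_mset mult.assoc mult_ac)

lemma mprod_not_ok:
 assumes "!!v. gs_parity (vodd v) (\<sigma> v)" "~ mono_ok m"
 shows "mprod \<sigma> m = 0"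
proof -
 obtain v where v: "vodd v" "~ count m v \<le> 1" using assms(2) by (auto simp: mono_ok_def)
 then have "v \<in># m" by (metis not_in_iff zero_le_one)
 then obtain m' where m': "m = add_mset v m'" by (metis insert_DiffM)
 have "count m' v > 0" using v(2) m' by simp
 then have "v \<in># m'" by simp
 then obtain m'' where "m = add_mset v (add_mset v m'')" using m' by (metis insert_DiffM)
 moreover have "\<sigma> v * \<sigma> v = 0" using assms(1)[of v] v(1) by (simp add: gs_odd_square)
 then have "\<sigma> v * (\<sigma> v * P) = 0" for P by (simp flip: mult.assoc)
 ultimately show ?thesis by (simp add: mprod_add_mset[OF assms(1)] mult.assoc)
qed

lemma gs_parity_mprod:
 assumes "!!v. gs_parity (vodd v) (\<sigma> v)"
 shows "gs_parity (odd (nodd m)) (mprod \<sigma> m)"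
proof (induction m)
 case (add v m)
 have "odd (nodd (add_mset v m)) = (vodd v ~= odd (nodd m))" by simp
 show ?case
  unfolding mprod_add_mset[OF assms] \<open>odd (nodd (add_mset v m)) = (vodd v ~= odd (nodd m))\<close>
  using gs_parity_scaleR[OF gs_parity_mult[OF assms[of v] add], of "lsign v m"] by simp
qed simp

lemma gs_parity_var [simp]: "gs_parity (vodd v) (gs_var v)"
 using gs_parity_mon[of "{#v#}"] by (cases "vodd v") (simp_all add: mon_single)

lemma mon_mprod: "mono_ok m ==> mon m = mprod gs_var m"
proof (induction m)
 case (add v m)
 from add have "mon (add_mset v m) = lsign v m *\<^sub>R (mon {#v#} * mon m)"
  unfolding mon_mult by (simp add: ksign_single)
 then show ?case using add by (simp add: mprod_add_mset mono_ok_add_mset mon_single)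
qed (simp add: mon_empty)

lemma coeff_gs_var: "coeff (gs_var v) k = (if k = {#v#} then 1 else 0)"
 by (simp add: gs_var_def mono_ok_add_mset[of v "{#}"])

text \<open>The second and third conditions make substitution coefficientwise finite even with
  infinitely many variables: a product of more than \<open>size k\<close> factors cannot reach the
  monomial \<open>k\<close>, and each of the finitely many submonomials of \<open>k\<close> occurs
  in the images of finitely many variables. The parity condition makes it a homomorphism.\<close>

definition good :: "(var => gs) => bool" where
 "good \<sigma> \<longleftrightarrow> (ALL v. gs_parity (vodd v) (\<sigma> v)) & (ALL v. coeff (\<sigma> v) {#} = 0) &
   (ALL k. finite {v. coeff (\<sigma> v) k ~= 0})"

lemma goodD: "good \<sigma> ==> gs_parity (vodd v) (\<sigma> v)" "good \<sigma> ==> coeff (\<sigma> v) {#} = 0"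
 "good \<sigma> ==> finite {v. coeff (\<sigma> v) k ~= 0}"
 by (simp_all add: good_def)

lemma good_var: "good gs_var"
proof -
 have "finite {v. k = {#v#}}" for k :: "var multiset"
  by (rule finite_subset[of _ "set_mset k"]) auto
 then show ?thesis by (simp add: good_def coeff_gs_var)
qed

text \<open>Without constant terms every factor uses up at least one variable of \<open>k\<close>,
  which bounds the number of factors.\<close>

lemma prod_list_supp:
 assumes "!!v. v \<in> set vs ==> coeff (\<sigma> v) {#} = 0" "coeff (prod_list (map \<sigma> vs)) k ~= 0"
 shows "length vs \<le> size k & (ALL v:set vs. EX k'. k' \<subseteq># k & coeff (\<sigma> v) k' ~= 0)"
 using assms
proof (induction vs arbitrary: k)
 case (Cons v vs)
 then obtain a b where ab: "a + b = k" "coeff (\<sigma> v) a ~= 0" "coeff (prod_list (map \<sigma> vs)) b ~= 0"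
  by (auto elim: coeff_mult_nonzeroE)
 have "a ~= {#}" using ab(2) Cons.prems(1)[of v] by auto
 then have "size a \<ge> 1" by (simp add: Suc_leI nonempty_has_size)
 moreover have "length vs \<le> size b" "ALL v:set vs. EX k'. k' \<subseteq># b & coeff (\<sigma> v) k' ~= 0"
  using Cons.IH[OF _ ab(3)] Cons.prems(1) by auto
 moreover have "a \<subseteq># k" "b \<subseteq># k" using ab(1) by auto
 ultimately show ?case using ab(1,2) by (auto intro: subset_mset.order_trans)
qed simp

lemma mprod_supp:
 assumes "!!v. coeff (\<sigma> v) {#} = 0" "coeff (mprod \<sigma> m) k ~= 0"
 shows "size m \<le> size k" "!!v. v \<in># m ==> EX k'. k' \<subseteq># k & coeff (\<sigma> v) k' ~= 0"
proof -
 have "length (sorted_list_of_multiset m) \<le> size k &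
   (ALL v:set (sorted_list_of_multiset m). EX k'. k' \<subseteq># k & coeff (\<sigma> v) k' ~= 0)"
  by (rule prod_list_supp[OF assms(1) assms(2)[unfolded mprod_def]])
 moreover have "length (sorted_list_of_multiset m) = size m"
  by (metis mset_sorted_list_of_multiset size_mset)
 ultimately show "size m \<le> size k" "!!v. v \<in># m ==> EX k'. k' \<subseteq># k & coeff (\<sigma> v) k' ~= 0"
  by simp_all
qed

lemma finite_sub_mset: "finite {k'. k' \<subseteq># (k :: var multiset)}"
 by (rule finite_subset[of _ "fst ` msplits k"])
  (auto simp: msplits_def image_iff subset_mset.le_iff_add finite_imageI[OF finite_msplits, unfolded msplits_def])

lemma finite_mset_bounded: "finite V ==> finite {m. set_mset m \<subseteq> V & size m \<le> n}"
proof (rule finite_subset)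
 assume "finite V"
 then show "finite (mset ` {xs. set xs \<subseteq> V & length xs \<le> n})"
  by (intro finite_imageI finite_lists_length_le)
 show "{m. set_mset m \<subseteq> V & size m \<le> n} \<subseteq> mset ` {xs. set xs \<subseteq> V & length xs \<le> n}"
 proof
  fix m assume m: "m \<in> {m. set_mset m \<subseteq> V & size m \<le> n}"
  obtain xs where xs: "mset xs = m" using ex_mset by blast
  then have "set xs = set_mset m" "length xs = size m" by auto
  then show "m \<in> mset ` {xs. set xs \<subseteq> V & length xs \<le> n}" using m xs by auto
 qed
qed

text \<open>The point is uniformity in the index \<open>s\<close>: it permits differentiating a
  substitution along a curve, or proving its continuity in a point, one coefficient at a time with
  one finite sum.\<close>

lemma finite_mprod_supp:
 fixes \<sigma> :: "'s => var => gs"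
 assumes "!!s v. coeff (\<sigma> s v) {#} = 0" "!!k. finite {v. EX s. coeff (\<sigma> s v) k ~= 0}"
 shows "finite {m. EX s. coeff (mprod (\<sigma> s) m) k ~= 0}"
proof (rule finite_subset)
 let ?V = "\<Union>k'\<in>{k'. k' \<subseteq># k}. {v. EX s. coeff (\<sigma> s v) k' ~= 0}"
 show "{m. EX s. coeff (mprod (\<sigma> s) m) k ~= 0} \<subseteq> {m. set_mset m \<subseteq> ?V & size m \<le> size k}"
 proof (intro subsetI CollectI conjI)
  fix m v assume "m \<in> {m. EX s. coeff (mprod (\<sigma> s) m) k ~= 0}"
  then obtain s where s: "coeff (mprod (\<sigma> s) m) k ~= 0" by blast
  show "size m \<le> size k" by (rule mprod_supp(1)[OF assms(1) s])
  assume "v \<in># m"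
  then show "v \<in> ?V" using mprod_supp(2)[OF assms(1) s, of v] by auto
 qed
 show "finite {m. set_mset m \<subseteq> ?V & size m \<le> size k}"
  using assms(2) finite_sub_mset by (intro finite_mset_bounded finite_UN_I) auto
qed

lemma good_mprod_supp: "good \<sigma> ==> finite {m. coeff (mprod \<sigma> m) k ~= 0}"
 using finite_mprod_supp[of "%_::unit. \<sigma>" k] by (simp add: good_def)

definition msub :: "(var => gs) => gs => gs" where
 "msub \<sigma> f = gs_of (%k. \<Sum>m | coeff (mprod \<sigma> m) k ~= 0. coeff f m * coeff (mprod \<sigma> m) k)"

lemma coeff_msub:
 assumes "finite B" "!!m. coeff (mprod \<sigma> m) k ~= 0 ==> coeff f m ~= 0 ==> m \<in> B" "good \<sigma>"
 shows "coeff (msub \<sigma> f) k = (\<Sum>m\<in>B. coeff f m * coeff (mprod \<sigma> m) k)"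
proof (cases "mono_ok k")
 case True
 then show ?thesis unfolding msub_def coeff_gs_of
  using assms(1,2) good_mprod_supp[OF assms(3), of k]
  by simp (intro sum.mono_neutral_cong, auto)
qed (simp add: coeff_not_ok)

lemma clin_msub: "good \<sigma> ==> clin (msub \<sigma>)"
proof (rule clinI)
 fix k assume g: "good \<sigma>" and ok: "mono_ok k"
 show "locfin (msub \<sigma>) k"
  by (intro exI[of _ "{m. coeff (mprod \<sigma> m) k ~= 0}"])
   (simp add: msub_def good_mprod_supp[OF g])
qed (rule gs_eqI; simp add: msub_def algebra_simps sum.distrib sum_distrib_left)+

lemma msub_mon:
 assumes "good \<sigma>"
 shows "msub \<sigma> (mon m) = mprod \<sigma> m"
proof (cases "mono_ok m")
 case True
 show ?thesis
  by (rule gs_eqI, subst coeff_msub[OF _ _ assms, of "{m}"])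
   (use True in \<open>auto simp: coeff_mon split: if_splits\<close>)
next
 case False
 then show ?thesis using mprod_not_ok[OF goodD(1)[OF assms]]
  by (simp add: mon_not_ok clin_0[OF clin_msub[OF assms]])
qed

lemma msub_1: "good \<sigma> ==> msub \<sigma> 1 = 1"
 using msub_mon[of \<sigma> "{#}"] by (simp add: mon_empty)

lemma msub_var: "good \<sigma> ==> msub \<sigma> (gs_var v) = \<sigma> v"
 using msub_mon[of \<sigma> "{#v#}"] by (simp add: mon_single)

lemma msub_of_real: "good \<sigma> ==> msub \<sigma> (of_real r) = of_real r"
 by (simp add: of_real_def clin_scaleR clin_msub msub_1)

lemma msub_mult:
 assumes "good \<sigma>"
 shows "msub \<sigma> (f * g) = msub \<sigma> f * msub \<sigma> g"
proof (rule bilin_eqI[of "%f g. msub \<sigma> (f * g)" "%f g. msub \<sigma> f * msub \<sigma> g"])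
 fix a b
 show "msub \<sigma> (mon a * mon b) = msub \<sigma> (mon a) * msub \<sigma> (mon b)"
  by (simp add: mon_mult clin_scaleR[OF clin_msub[OF assms]] msub_mon[OF assms]
    mprod_add[OF goodD(1)[OF assms]])
 show "clin (%f. msub \<sigma> (f * g))" for g
  by (rule clin_compose[OF clin_msub[OF assms] clin_mult_right])
 show "clin (%g. msub \<sigma> (f * g))" for f
  by (rule clin_compose[OF clin_msub[OF assms] clin_mult_left])
 show "clin (%f. msub \<sigma> f * msub \<sigma> g)" for g
  by (rule clin_compose[OF clin_mult_right clin_msub[OF assms]])
 show "clin (%g. msub \<sigma> f * msub \<sigma> g)" for f
  by (rule clin_compose[OF clin_mult_left clin_msub[OF assms]])
qed

lemma msub_prod_list: "good \<sigma> ==> msub \<sigma> (prod_list fs) = prod_list (map (msub \<sigma>) fs)"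
 by (induction fs) (simp_all add: msub_1 msub_mult)

lemma msub_mprod: "good \<sigma> ==> msub \<sigma> (mprod \<tau> m) = mprod (msub \<sigma> \<circ> \<tau>) m"
 by (simp add: mprod_def msub_prod_list)

lemma gs_parity_clin:
 assumes "clin L" "!!m. mono_ok m ==> gs_parity (odd (nodd m) ~= d) (L (mon m))" "gs_parity b f"
 shows "gs_parity (b ~= d) (L f)"
 unfolding gs_parity_altdef
proof (intro allI impI)
 fix k assume nz: "coeff (L f) k ~= 0"
 obtain K where "finite K" "!!f. coeff (L f) k = (\<Sum>m\<in>K. coeff f m * coeff (L (mon m)) k)"
  using clin_coeff[OF assms(1), of k] by blast
 with nz obtain m where m: "coeff f m ~= 0" "coeff (L (mon m)) k ~= 0"
  by (metis (no_types, lifting) mult_eq_0_iff sum.neutral)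
 then have "mono_ok m" using coeff_not_ok by blast
 with m assms(2)[of m] assms(3) show "odd (nodd k) = (b ~= d)"
  by (auto simp: gs_parity_altdef)
qed

lemma gs_parity_msub: "good \<sigma> ==> gs_parity b f ==> gs_parity b (msub \<sigma> f)"
 using gs_parity_clin[of "msub \<sigma>" False b f] gs_parity_mprod[of \<sigma>]
 by (simp add: clin_msub msub_mon goodD)

lemma coeff_msub_empty: "good \<sigma> ==> coeff (msub \<sigma> f) {#} = coeff f {#}"
proof (subst coeff_msub[of "{{#}}"])
 show "m \<in> {{#}}" if "good \<sigma>" "coeff (mprod \<sigma> m) {#} ~= 0" for m
  using mprod_supp(1)[of \<sigma> m "{#}"] that by (simp add: goodD)
qed auto

lemma good_msub:
 assumes "good \<sigma>" "good \<tau>"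
 shows "good (msub \<sigma> \<circ> \<tau>)"
 unfolding good_def
proof (intro conjI allI)
 fix k
 let ?K = "{m. coeff (mprod \<sigma> m) k ~= 0}"
 show "finite {v. coeff ((msub \<sigma> \<circ> \<tau>) v) k ~= 0}"
 proof (rule finite_subset)
  show "finite (\<Union>m\<in>?K. {v. coeff (\<tau> v) m ~= 0})"
   using good_mprod_supp[OF assms(1)] goodD(3)[OF assms(2)] by auto
  show "{v. coeff ((msub \<sigma> \<circ> \<tau>) v) k ~= 0} \<subseteq> (\<Union>m\<in>?K. {v. coeff (\<tau> v) m ~= 0})"
  proof
   fix v assume "v \<in> {v. coeff ((msub \<sigma> \<circ> \<tau>) v) k ~= 0}"
   then have "coeff (msub \<sigma> (\<tau> v)) k ~= 0" by simp
   then have "(\<Sum>m\<in>?K. coeff (\<tau> v) m * coeff (mprod \<sigma> m) k) ~= 0"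
    by (subst (asm) coeff_msub[OF good_mprod_supp _ assms(1)]) (use assms in auto)
   then obtain m where "m \<in> ?K" "coeff (\<tau> v) m * coeff (mprod \<sigma> m) k ~= 0"
    by (rule sum.not_neutral_contains_not_neutral)
   then show "v \<in> (\<Union>m\<in>?K. {v. coeff (\<tau> v) m ~= 0})"
    by auto
  qed
 qed
qed (use assms in \<open>auto simp: gs_parity_msub goodD coeff_msub_empty\<close>)

lemma msub_msub:
 assumes "good \<sigma>" "good \<tau>"
 shows "msub \<sigma> (msub \<tau> f) = msub (msub \<sigma> \<circ> \<tau>) f"
proof (rule clin_eqI[of "%f. msub \<sigma> (msub \<tau> f)"])
 fix m show "msub \<sigma> (msub \<tau> (mon m)) = msub (msub \<sigma> \<circ> \<tau>) (mon m)"
  by (simp only: msub_mon[OF assms(1)] msub_mon[OF assms(2)] msub_mon[OF good_msub[OF assms]]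
    msub_mprod[OF assms(1)])
qed (rule clin_compose[OF clin_msub[OF assms(1)] clin_msub[OF assms(2)]]
   clin_msub[OF good_msub[OF assms]])+

lemma msub_gs_var: "msub gs_var f = f"
 by (rule clin_eqI[OF clin_msub[OF good_var] clin_ident]) (metis msub_mon[OF good_var] mon_mprod)

text \<open>Composition with this projection lets an identity for series in \<open>V\<close> be
  tested on the monomials in \<open>V\<close> alone.\<close>

definition gproj :: "var set => gs => gs" where
 "gproj V f = gs_of (%m. if set_mset m \<subseteq> V then coeff f m else 0)"

lemma clin_gproj: "clin (gproj V)"
 by (rule clin_pointwise[where c = "%m. if set_mset m \<subseteq> V then 1 else 0"]) (simp add: gproj_def)

lemma gproj_id: "gs_vars V f ==> gproj V f = f"
 by (rule gs_eqI) (auto simp: gproj_def gs_vars_def)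

lemma gproj_mon: "gproj V (mon m) = (if set_mset m \<subseteq> V then mon m else 0)"
 by (rule gs_eqI) (auto simp: gproj_def coeff_mon)

lemma clin_eq_vars:
 assumes "clin L" "clin R" "gs_vars V f"
  and "!!m. mono_ok m ==> set_mset m \<subseteq> V ==> L (mon m) = R (mon m)"
 shows "L f = R f"
proof -
 have "L (gproj V f) = R (gproj V f)"
  by (rule clin_eqI[of "%f. L (gproj V f)" "%f. R (gproj V f)"])
   (use assms in \<open>auto intro: clin_compose clin_gproj simp: gproj_mon clin_0\<close>)
 then show ?thesis by (simp add: gproj_id[OF assms(3)])
qed

lemma mprod_cong: "(!!v. v \<in># m ==> \<sigma> v = \<tau> v) ==> mprod \<sigma> m = mprod \<tau> m"
 unfolding mprod_def by (metis (mono_tags, lifting) map_eq_conv set_sorted_list_of_multiset)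

lemma msub_cong:
 assumes "good \<sigma>" "good \<tau>" "gs_vars V f" "!!v. v \<in> V ==> \<sigma> v = \<tau> v"
 shows "msub \<sigma> f = msub \<tau> f"
 by (rule clin_eq_vars[OF _ _ assms(3)])
  (use assms in \<open>auto simp: clin_msub msub_mon intro!: mprod_cong\<close>)

lemma gs_vars_mult: "gs_vars V f ==> gs_vars V g ==> gs_vars V (f * g)"
 unfolding gs_vars_def by (auto elim!: coeff_mult_nonzeroE) blast+

lemma gs_vars_prod_list: "(!!f. f \<in> set fs ==> gs_vars V f) ==> gs_vars V (prod_list fs)"
 by (induction fs) (auto simp: gs_vars_mult, simp add: gs_vars_def)

lemma gs_vars_clin:
 assumes "clin L" "gs_vars V f" "!!m. mono_ok m ==> set_mset m \<subseteq> V ==> gs_vars V' (L (mon m))"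
 shows "gs_vars V' (L f)"
 unfolding gs_vars_def
proof (intro allI impI)
 fix k assume nz: "coeff (L f) k ~= 0"
 obtain K where "finite K" "!!f. coeff (L f) k = (\<Sum>m\<in>K. coeff f m * coeff (L (mon m)) k)"
  using clin_coeff[OF assms(1), of k] by blast
 with nz obtain m where m: "coeff f m ~= 0" "coeff (L (mon m)) k ~= 0"
  by (metis (no_types, lifting) mult_eq_0_iff sum.neutral)
 have "mono_ok m" using m(1) coeff_not_ok by blast
 moreover have "set_mset m \<subseteq> V" using m(1) assms(2) by (simp add: gs_vars_def)
 ultimately have "gs_vars V' (L (mon m))" by (rule assms(3))
 then show "set_mset k \<subseteq> V'" using m(2) by (simp add: gs_vars_def)
qed

lemma gs_vars_msub:
 assumes "good \<sigma>" "gs_vars V f" "!!v. v \<in> V ==> gs_vars V' (\<sigma> v)"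
 shows "gs_vars V' (msub \<sigma> f)"
proof (rule gs_vars_clin[OF clin_msub[OF assms(1)] assms(2)])
 fix m assume "set_mset m \<subseteq> V"
 then show "gs_vars V' (msub \<sigma> (mon m))"
  unfolding msub_mon[OF assms(1)] mprod_def using assms(3)
  by (intro gs_vars_prod_list) auto
qed

subsection \<open>The chain rule for substitutions\<close>

text \<open>Monomials outside \<open>K\<close> contribute nothing, so the range of summation may be
  enlarged until it agrees with that of another map.\<close>

lemma clin_coeff':
 assumes "clin L"
 obtains K where "finite K"
  "!!K' f. finite K' ==> K \<subseteq> K' ==> coeff (L f) k = (\<Sum>m\<in>K'. coeff f m * coeff (L (mon m)) k)"
proof -
 obtain K where K: "finite K" "!!f. coeff (L f) k = (\<Sum>m\<in>K. coeff f m * coeff (L (mon m)) k)"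
  using clin_coeff[OF assms, of k] by blast
 have "coeff (L (mon m)) k = 0" if "m \<notin> K" for m
  unfolding K(2)[of "mon m"] using that by (intro sum.neutral) (auto simp: coeff_mon)
 then have "coeff (L f) k = (\<Sum>m\<in>K'. coeff f m * coeff (L (mon m)) k)"
  if "finite K'" "K \<subseteq> K'" for f K'
  unfolding K(2)[of f] using that by (intro sum.mono_neutral_left) auto
 then show ?thesis using that K(1) by blast
qed

definition cder :: "(real => gs) => gs => bool" where
 "cder f e \<longleftrightarrow> (ALL k. ((%s. coeff (f s) k) has_real_derivative coeff e k) (at 0))"

lemma cder_unique: "cder f e ==> cder f e' ==> e = e'"
 unfolding cder_def by (rule gs_eqI) (meson DERIV_unique)

lemma cder_const: "cder (%s. a) 0"
 by (simp add: cder_def)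

lemma cder_add: "cder f e ==> cder g h ==> cder (%s. f s + g s) (e + h)"
 by (auto simp: cder_def intro!: derivative_eq_intros)

lemma cder_diff: "cder f e ==> cder g h ==> cder (%s. f s - g s) (e - h)"
 by (auto simp: cder_def intro!: derivative_eq_intros)

lemma cder_sum: "(!!i. i \<in> A ==> cder (f i) (e i)) ==> cder (%s. \<Sum>i\<in>A. f i s) (\<Sum>i\<in>A. e i)"
 by (auto simp: cder_def intro!: derivative_eq_intros)

lemma cder_smul:
 "(h has_real_derivative h') (at 0) ==> cder f e ==> cder (%s. h s *\<^sub>R f s) (h' *\<^sub>R f 0 + h 0 *\<^sub>R e)"
 by (auto simp: cder_def intro!: derivative_eq_intros)

lemma cder_mult:
 assumes "cder f e" "cder g h"
 shows "cder (%s. f s * g s) (e * g 0 + f 0 * h)"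
 unfolding cder_def
proof
 fix k
 show "((%s. coeff (f s * g s) k) has_real_derivative coeff (e * g 0 + f 0 * h) k) (at 0)"
 proof (cases "mono_ok k")
  case True
  have "((%s. \<Sum>p\<in>msplits k. ksign (fst p) (snd p) * coeff (f s) (fst p) * coeff (g s) (snd p))
   has_real_derivative (\<Sum>p\<in>msplits k. ksign (fst p) (snd p) * coeff e (fst p) * coeff (g 0) (snd p)
    + ksign (fst p) (snd p) * coeff (f 0) (fst p) * coeff h (snd p))) (at 0)"
   using assms by (auto simp: cder_def mult_ac intro!: derivative_eq_intros sum.cong)
  then show ?thesis by (simp add: coeff_mult[OF True] case_prod_unfold sum.distrib)
 qed (simp add: coeff_not_ok)
qed

lemma cder_cong:
 assumes "cder f e" "eventually (%s. f s = g s) (at 0)" "f 0 = g 0"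
 shows "cder g e"
proof -
 have "eventually (%s. f s = g s) (nhds 0)"
  using assms(2,3) by (simp add: eventually_nhds_conv_at)
 then have ev: "eventually (%s. coeff (f s) k = coeff (g s) k) (nhds 0)" for k
  by eventually_elim simp
 show ?thesis using assms(1) unfolding cder_def DERIV_cong_ev[OF refl ev refl] .
qed

lemma cder_parity: "cder f e ==> (!!s. gs_parity b (f s)) ==> gs_parity b e"
 unfolding gs_parity_altdef cder_def
proof (intro allI impI, rule ccontr)
 fix m
 assume *: "ALL k. ((%s. coeff (f s) k) has_real_derivative coeff e k) (at 0)"
  "!!s. ALL m. coeff (f s) m ~= 0 --> odd (nodd m) = b" "coeff e m ~= 0" "odd (nodd m) ~= b"
 then have "(%s. coeff (f s) m) = (%s. 0)" by (intro ext) metis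
 then have "((%s. 0) has_real_derivative coeff e m) (at 0)" using *(1) by metis
 then show False using *(3) DERIV_unique[OF _ DERIV_const[of 0]] by metis
qed

lemma wscale_var: "wscale W (gs_var v) = W v *\<^sub>R gs_var v"
 using wscale_mon[of W "{#v#}"] by (simp add: mon_single)

definition parw :: "(bool => nat => real) => var => real" where
 "parw c v = (case v of Par b n => c b n | _ => 0)"

lemma parw_0: "~ is_par v ==> parw c v = 0"
 by (auto simp: parw_def is_par_def split: var.splits)

text \<open>The scalars \<open>c\<close> record the action on the parameters, which substitutions
  leave fixed. They vanish for the zero derivation and for derivatives in other variables; for
  \<open>wscale\<close> they are the weights of the parameters.\<close>

locale superder =
 fixes D :: "gs => gs" and d :: bool and c :: "bool => nat => real"
 assumes clin_D: "clin D"
  and parity_D: "gs_parity b f ==> gs_parity (b ~= d) (D f)"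
  and D_mult: "gs_parity b f ==> D (f * g) = D f * g + sgn_if (d & b) *\<^sub>R (f * D g)"
  and D_par: "D (gs_var (Par b' n)) = c b' n *\<^sub>R gs_var (Par b' n)"
  and c_odd: "d ==> c b' n = 0"
begin

text \<open>\<open>R f f'\<close> says that \<open>f'\<close> is the value at 0 of \<open>d/ds + D\<close> on the curve \<open>f\<close>. Derivatives along curves
  (\<open>D = 0\<close>) and derivations (constant curves) thus share one proof of the chain rule.\<close>

definition R :: "(real => gs) => gs => bool" where
 "R f f' \<longleftrightarrow> cder f (f' - D (f 0)) & (d --> f' = D (f 0))"

lemma D_1: "D 1 = 0"
 using D_mult[of False 1 1] by simp

lemma R_const: "R (%s. a) (D a)"
 by (simp add: R_def cder_const)

lemma R_add:
 assumes "R f f'" "R g g'"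
 shows "R (%s. f s + g s) (f' + g')"
 using assms cder_add[of f "f' - D (f 0)" g "g' - D (g 0)"]
 by (auto simp: R_def clin_add[OF clin_D] algebra_simps)

lemma R_sum: "(!!i. i \<in> A ==> R (f i) (f' i)) ==> R (%s. \<Sum>i\<in>A. f i s) (\<Sum>i\<in>A. f' i)"
proof (induction A rule: infinite_finite_induct)
 case empty then show ?case using R_const[of 0] by (simp add: clin_0[OF clin_D])
next
 case infinite then show ?case using R_const[of 0] by (simp add: clin_0[OF clin_D])
next
 case (insert x F)
 then show ?case by (simp add: R_add)
qed

lemma R_smul:
 assumes "(h has_real_derivative h') (at 0)" "d --> h' = 0" "R f f'"
 shows "R (%s. h s *\<^sub>R f s) (h' *\<^sub>R f 0 + h 0 *\<^sub>R f')"
 using cder_smul[OF assms(1), of f "f' - D (f 0)"] assms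
 by (auto simp: R_def clin_scaleR[OF clin_D] algebra_simps)

lemma R_scaleR: "R f f' ==> R (%s. r *\<^sub>R f s) (r *\<^sub>R f')"
 using R_smul[of "%_. r" 0 f f'] by simp

lemma R_mult:
 assumes "R f f'" "R g g'" "gs_parity b (f 0)"
 shows "R (%s. f s * g s) (f' * g 0 + sgn_if (d & b) *\<^sub>R (f 0 * g'))"
 using assms cder_mult[of f "f' - D (f 0)" g "g' - D (g 0)"]
 unfolding R_def by (cases d) (auto simp: D_mult[OF assms(3)] algebra_simps)

lemma R_parity:
 assumes "R f f'" "!!s. gs_parity b (f s)"
 shows "gs_parity (b ~= d) f'"
proof (cases d)
 case True
 then have "f' = D (f 0)" using assms(1) unfolding R_def by blast
 then show ?thesis using parity_D[OF assms(2)] by simp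
next
 case False
 then have "gs_parity b (f' - D (f 0))" using assms cder_parity unfolding R_def by blast
 moreover have "gs_parity b (D (f 0))" using parity_D[OF assms(2)[of 0]] False by simp
 ultimately have "gs_parity b (f' - D (f 0) + D (f 0))" by (rule gs_parity_add)
 then show ?thesis using False by simp
qed

text \<open>For monomials this is an induction with the product rule \<open>R_mult\<close>;
  continuity in the series gives the rest. The summand with \<open>wscale\<close> is the action of
  \<open>D\<close> on the parameters, which the substitution does not touch.\<close>

lemma R_msub:
 assumes V: "finite V" "!!v. v \<in> V ==> ~ is_par v"
  and \<sigma>: "!!s. good (\<sigma> s)" "!!s v. v \<notin> V ==> \<sigma> s v = \<sigma> 0 v"
   "!!s b n. \<sigma> s (Par b n) = gs_var (Par b n)"
   "!!v. v \<in> V ==> R (%s. \<sigma> s v) (\<sigma>' v)"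
  and f: "!!s. gs_vars (V \<union> Collect is_par) (f s)" "cder f f'" "d --> f' = 0"
 shows "R (%s. msub (\<sigma> s) (f s)) (msub (\<sigma> 0) f'
  + ((\<Sum>v\<in>V. \<sigma>' v * msub (\<sigma> 0) (vderiv v (f 0))) + msub (\<sigma> 0) (wscale (parw c) (f 0))))"
proof -
 let ?W = "V \<union> Collect is_par"
 define \<psi> where "\<psi> g = (\<Sum>v\<in>V. \<sigma>' v * msub (\<sigma> 0) (vderiv v g)) + msub (\<sigma> 0) (wscale (parw c) g)" for g
 note cm = clin_msub[OF \<sigma>(1)]
 have c\<psi>: "clin \<psi>"
  unfolding \<psi>_def
  by (intro clin_plus clin_sums clin_compose[OF clin_mult_left clin_compose[OF cm clin_vderiv]]
    clin_compose[OF cm clin_wscale])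
 have \<sigma>'p: "gs_parity (vodd v ~= d) (\<sigma>' v)" if "v \<in> V" for v
  using R_parity[OF \<sigma>(4)[OF that] goodD(1)[OF \<sigma>(1)]] by simp
 have P: "R (%s. mprod (\<sigma> s) m) (\<psi> (mon m))" if "mono_ok m" "set_mset m \<subseteq> ?W" for m
  using that
 proof (induction m)
  case empty
  have "\<psi> 1 = 0"
   by (simp add: \<psi>_def mon_empty[symmetric] vderiv_mon_notin wscale_mon clin_0[OF cm])
  then show ?case using R_const[of 1] by (simp add: D_1 mon_empty)
 next
  case (add v m)
  from add.prems have ok: "mono_ok m" "set_mset m \<subseteq> ?W" by (auto simp: mono_ok_add_mset)
  have mv: "mon (add_mset v m) = lsign v m *\<^sub>R (gs_var v * mon m)"
   using mon_mult[of "{#v#}" m] by (simp add: mon_single ksign_single)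
  define \<delta> where "\<delta> = (if v \<in> V then \<sigma>' v else parw c v *\<^sub>R \<sigma> 0 v)"
  have \<delta>: "R (%s. \<sigma> s v) \<delta>"
  proof (cases "v \<in> V")
   case False
   with add.prems have "is_par v" by auto
   then obtain b n where v: "v = Par b n" by (auto simp: is_par_def)
   then show ?thesis using R_const[of "gs_var v"] False by (simp add: \<delta>_def \<sigma>(3) D_par parw_def)
  qed (simp add: \<delta>_def \<sigma>(4))
  define \<kappa> where "\<kappa> u = sgn_if (vodd u & vodd v)" for u
  define \<epsilon> where "\<epsilon> u = sgn_if ((vodd u ~= d) & vodd v)" for u
  have vd: "vderiv u (gs_var v * mon m)
    = (if u = v then mon m else 0) + \<kappa> u *\<^sub>R (gs_var v * vderiv u (mon m))" for u
  proof -
   have "vderiv u (gs_var v) = (if u = v then 1 else 0)"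
    using vderiv_mon_add[of v "{#}"] vderiv_mon_notin[of u "{#v#}"]
    by (auto simp: mon_single mon_empty mono_ok_add_mset)
   then show ?thesis by (simp add: vderiv_mult[OF gs_parity_var] \<kappa>_def)
  qed
  have sv: "\<sigma>' u * (\<sigma> 0 v * X) = \<epsilon> u *\<^sub>R (\<sigma> 0 v * (\<sigma>' u * X))" if "u \<in> V" for u X
  proof -
   have "\<sigma>' u * \<sigma> 0 v = \<epsilon> u *\<^sub>R (\<sigma> 0 v * \<sigma>' u)"
    using gs_mult_commute[OF \<sigma>'p[OF that] goodD(1)[OF \<sigma>(1)]] by (simp add: sgn_if_def \<epsilon>_def)
   then have "\<sigma>' u * \<sigma> 0 v * X = \<epsilon> u *\<^sub>R (\<sigma> 0 v * \<sigma>' u) * X" by simp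
   then show ?thesis by (simp add: mult.assoc)
  qed
  have sg: "\<kappa> u * \<epsilon> u = sgn_if (d & vodd v)" for u
   by (auto simp: sgn_if_def \<kappa>_def \<epsilon>_def)
  have "(\<Sum>u\<in>V. \<sigma>' u * msub (\<sigma> 0) (vderiv u (gs_var v * mon m)))
   = (\<Sum>u\<in>V. (if u = v then \<sigma>' v * mprod (\<sigma> 0) m else 0)
     + sgn_if (d & vodd v) *\<^sub>R (\<sigma> 0 v * (\<sigma>' u * msub (\<sigma> 0) (vderiv u (mon m)))))"
   by (intro sum.cong refl, subst vd)
    (simp add: clin_add[OF cm] clin_scaleR[OF cm] msub_mult[OF \<sigma>(1)] msub_var[OF \<sigma>(1)]
     msub_mon[OF \<sigma>(1)] distrib_left sv scaleR_scaleR sg clin_0[OF cm] del: sgn_if_simps)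
  also have "... = (if v \<in> V then \<sigma>' v * mprod (\<sigma> 0) m else 0)
    + sgn_if (d & vodd v) *\<^sub>R (\<sigma> 0 v * (\<Sum>u\<in>V. \<sigma>' u * msub (\<sigma> 0) (vderiv u (mon m))))"
   using V(1) by (simp add: sum.distrib scaleR_sum_right sum_distrib_left)
  finally have s1: "(\<Sum>u\<in>V. \<sigma>' u * msub (\<sigma> 0) (vderiv u (gs_var v * mon m))) = ..." .
  have "wscale (parw c) (gs_var v * mon m) = parw c v *\<^sub>R (gs_var v * mon m) + gs_var v * wscale (parw c) (mon m)"
   using wscale_mult[of "parw c" "gs_var v" "mon m"] by (simp add: wscale_var)
  then have s2: "msub (\<sigma> 0) (wscale (parw c) (gs_var v * mon m))
    = parw c v *\<^sub>R (\<sigma> 0 v * mprod (\<sigma> 0) m) + \<sigma> 0 v * msub (\<sigma> 0) (wscale (parw c) (mon m))"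
   by (simp add: clin_add[OF cm] clin_scaleR[OF cm] msub_mult[OF \<sigma>(1)] msub_var[OF \<sigma>(1)]
     msub_mon[OF \<sigma>(1)])
  \<comment> \<open>The sign costs nothing: an odd \<open>D\<close> annihilates the parameters, so
    this term is 0 whenever the sign could be -1.\<close>
  have s3: "\<sigma> 0 v * msub (\<sigma> 0) (wscale (parw c) (mon m))
    = sgn_if (d & vodd v) *\<^sub>R (\<sigma> 0 v * msub (\<sigma> 0) (wscale (parw c) (mon m)))"
  proof (cases d)
   case True
   then have "parw c u = 0" for u by (auto simp: parw_def c_odd split: var.splits)
   then have "wscale (parw c) (mon m) = 0" by (simp add: wscale_mon)
   then show ?thesis by (simp add: clin_0[OF cm])
  qed simp
  have pv: "parw c v = 0" if "v \<in> V" using that V(2) parw_0 by blast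
  have "\<psi> (gs_var v * mon m) = \<delta> * mprod (\<sigma> 0) m + sgn_if (d & vodd v) *\<^sub>R (\<sigma> 0 v * \<psi> (mon m))"
   unfolding \<psi>_def s1 s2
   by (subst s3) (auto simp: \<delta>_def pv distrib_left scaleR_add_right)
  moreover have "R (%s. lsign v m *\<^sub>R (\<sigma> s v * mprod (\<sigma> s) m))
    (lsign v m *\<^sub>R (\<delta> * mprod (\<sigma> 0) m + sgn_if (d & vodd v) *\<^sub>R (\<sigma> 0 v * \<psi> (mon m))))"
   by (intro R_scaleR R_mult \<delta> add.IH ok goodD(1)[OF \<sigma>(1)])
  ultimately show ?case
   by (simp add: mv clin_scaleR[OF c\<psi>] mprod_add_mset[OF goodD(1)[OF \<sigma>(1)]])
 qed
 \<comment> \<open>The contribution of the moving curve once the action of \<open>D\<close> on the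
   value at 0 is removed; on monomials it is an ordinary derivative.\<close>
 define L where "L g = \<psi> g - D (msub (\<sigma> 0) g)" for g
 have cL: "clin L"
 proof -
  have "clin (%g. \<psi> g + (-1) *\<^sub>R D (msub (\<sigma> 0) g))"
   by (intro clin_plus clin_lincomb clin_compose[OF clin_D cm] c\<psi>)
  then show ?thesis by (simp add: L_def[abs_def])
 qed
 have Lmon: "cder (%s. mprod (\<sigma> s) m) (L (mon m))" if "mono_ok m" "set_mset m \<subseteq> ?W" for m
  using P[OF that] by (simp add: R_def L_def msub_mon[OF \<sigma>(1)])
 have fin: "finite {m. EX s. coeff (mprod (\<sigma> s) m) k ~= 0}" for k
 proof (rule finite_mprod_supp)
  have *: "v \<in> V \<union> {v. coeff (\<sigma> 0 v) k ~= 0}" if "coeff (\<sigma> s v) k ~= 0" for s v k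
   using that \<sigma>(2)[of v s] by (cases "v \<in> V") auto
  show "finite {v. EX s. coeff (\<sigma> s v) k ~= 0}" for k
   by (rule finite_subset, rule subsetI, erule CollectE, erule exE, erule *) (use V(1) goodD(3)[OF \<sigma>(1)] in simp)
 qed (rule goodD(2)[OF \<sigma>(1)])
 have "cder (%s. msub (\<sigma> s) (f s)) (msub (\<sigma> 0) f' + L (f 0))"
  unfolding cder_def
 proof
  fix k
  obtain K where K: "finite K" "!!K' f. finite K' ==> K \<subseteq> K' ==>
    coeff (L f) k = (\<Sum>m\<in>K'. coeff f m * coeff (L (mon m)) k)"
   using clin_coeff'[OF cL, of k] by blast
  \<comment> \<open>One finite range for all \<open>s\<close>: outside it neither the substituted
    monomials nor \<open>L\<close> contribute to the coefficient at \<open>k\<close>.\<close>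
  define B where "B = K \<union> {m. EX s. coeff (mprod (\<sigma> s) m) k ~= 0}"
  have B: "finite B" "K \<subseteq> B" using K(1) fin by (auto simp: B_def)
  have e: "coeff (msub (\<sigma> s) g) k = (\<Sum>m\<in>B. coeff g m * coeff (mprod (\<sigma> s) m) k)" for s g
   by (rule coeff_msub[OF B(1) _ \<sigma>(1)]) (auto simp: B_def)
  have t: "((%s. coeff (f s) m * coeff (mprod (\<sigma> s) m) k) has_real_derivative
    coeff f' m * coeff (mprod (\<sigma> 0) m) k + coeff (f 0) m * coeff (L (mon m)) k) (at 0)" for m
  proof (cases "mono_ok m & set_mset m \<subseteq> ?W")
   case True
   then show ?thesis using f(2) Lmon[of m]
    by (auto simp: cder_def intro!: derivative_eq_intros)
  next
   case False
   then have z: "coeff (f s) m = 0" for s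
    using f(1)[of s] coeff_not_ok[of m "f s"] unfolding gs_vars_def by blast
   have "((%s. coeff (f s) m) has_real_derivative coeff f' m) (at 0)"
    using f(2) by (simp add: cder_def)
   then have "((%s. 0) has_real_derivative coeff f' m) (at 0)" by (simp add: z)
   then have "coeff f' m = 0" using DERIV_const[of 0] DERIV_unique by blast
   then show ?thesis by (simp add: z)
  qed
  have "((%s. \<Sum>m\<in>B. coeff (f s) m * coeff (mprod (\<sigma> s) m) k) has_real_derivative
    (\<Sum>m\<in>B. coeff f' m * coeff (mprod (\<sigma> 0) m) k + coeff (f 0) m * coeff (L (mon m)) k)) (at 0)"
   by (intro DERIV_sum t)
  then show "((%s. coeff (msub (\<sigma> s) (f s)) k) has_real_derivative
    coeff (msub (\<sigma> 0) f' + L (f 0)) k) (at 0)"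
   by (simp add: e K(2)[OF B, of "f 0"] sum.distrib)
 qed
 moreover have "msub (\<sigma> 0) f' + \<psi> (f 0) = D (msub (\<sigma> 0) (f 0))" if d
 proof -
  have "\<psi> (f 0) = D (msub (\<sigma> 0) (f 0))"
  proof (rule clin_eq_vars[OF c\<psi> clin_compose[OF clin_D cm] f(1)])
   fix m assume "mono_ok m" "set_mset m \<subseteq> ?W"
   then have "\<psi> (mon m) = D (mprod (\<sigma> 0) m)" using P[of m] that unfolding R_def by blast
   then show "\<psi> (mon m) = D (msub (\<sigma> 0) (mon m))" by (simp only: msub_mon[OF \<sigma>(1)])
  qed
  then show ?thesis using f(3) that by (simp add: clin_0[OF cm])
 qed
 ultimately show ?thesis unfolding R_def \<psi>_def L_def
  by (simp add: algebra_simps)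
qed

end

lemma superder_0: "superder (%_. 0) False (%_ _. 0)"
 by standard (auto simp: clin_zero)

lemma superder_vderiv:
 assumes "~ is_par v"
 shows "superder (vderiv v) (vodd v) (%_ _. 0)"
proof
 fix b n
 have "Par b n ~= v" using assms by (auto simp: is_par_def)
 then show "vderiv v (gs_var (Par b n)) = 0 *\<^sub>R gs_var (Par b n)"
  using vderiv_mon_notin[of v "{#Par b n#}"] by (simp add: mon_single)
qed (use gs_parity_vderiv in \<open>auto simp: clin_vderiv vderiv_mult\<close>)

lemma superder_wscale: "superder (wscale W) False (%b n. W (Par b n))"
 by standard (auto simp: clin_wscale gs_parity_wscale wscale_mult wscale_var)

subsection \<open>Calculus on open subsets of Euclidean space\<close>

text \<open>The second condition keeps the box inside \<open>Euclidean_space p\<close>, whose points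
  vanish from index \<open>p\<close> on.\<close>

definition pbox :: "nat => pt => real => pt set" where
 "pbox p x e = {y. (ALL i<p. \<bar>y i - x i\<bar> < e) & (ALL i>=p. y i = 0)}"

lemma topspace_Euclidean: "topspace (Euclidean_space p) = {x. ALL i>=p. x i = 0}"
 by (auto simp: Euclidean_space_def topspace_subtopology)

lemma pbox_subset:
 assumes U: "eopen p U" and x: "x \<in> U"
 obtains e where "e > 0" "pbox p x e \<subseteq> U"
proof -
 obtain T where T: "openin (powertop_real UNIV) T" "U = T \<inter> {x. ALL i>=p. x i = 0}"
  using U unfolding Euclidean_space_def openin_subtopology by blast
 have xT: "x \<in> T" using x T(2) by simp
 have "ALL x:T. EX W. finite {i \<in> UNIV. W i ~= topspace euclideanreal} &
   (ALL i:UNIV. openin euclideanreal (W i)) & x \<in> Pi\<^sub>E UNIV W & Pi\<^sub>E UNIV W \<subseteq> T"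
  using T(1) unfolding openin_product_topology_alt .
 from bspec[OF this xT] obtain W where "finite {i \<in> UNIV. W i ~= topspace euclideanreal} &
   (ALL i:UNIV. openin euclideanreal (W i)) & x \<in> Pi\<^sub>E UNIV W & Pi\<^sub>E UNIV W \<subseteq> T" ..
 note W' = conjunct1[OF conjunct2[OF this]] conjunct2[OF conjunct2[OF this]]
 note W = bspec[OF W'(1) UNIV_I] conjunct1[OF W'(2)] conjunct2[OF W'(2)]
 have "ALL i. EX e>0. ALL t. \<bar>t - x i\<bar> < e --> t \<in> W i"
 proof
  fix i
  have "open (W i)" using W(1)[of i] by (simp only: open_openin)
  moreover have "x i \<in> W i" using PiE_mem[OF W(2) UNIV_I] .
  ultimately obtain e where "e > 0" "ball (x i) e \<subseteq> W i"
   using open_contains_ball by metis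
  then show "EX e>0. ALL t. \<bar>t - x i\<bar> < e --> t \<in> W i"
   by (intro exI[of _ e]) (auto simp: subset_iff dist_real_def abs_minus_commute)
 qed
 then obtain \<epsilon> where \<epsilon>: "!!i. \<epsilon> i > 0" "!!i t. \<bar>t - x i\<bar> < \<epsilon> i ==> t \<in> W i" by metis
 \<comment> \<open>Only the first \<open>p\<close> coordinates are free, so a minimum exists; the
   entry 1 covers \<open>p = 0\<close>.\<close>
 define e where "e = Min (insert 1 (\<epsilon> ` {..<p}))"
 have "e > 0" unfolding e_def by (subst Min_gr_iff) (auto simp: \<epsilon>(1))
 moreover have "pbox p x e \<subseteq> U"
 proof
  fix y assume y: "y \<in> pbox p x e"
  have "y i \<in> W i" for i
  proof (cases "i < p")
   case True
   then have "e \<le> \<epsilon> i" unfolding e_def by (intro Min_le) auto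
   then show ?thesis using y True \<epsilon>(2)[of "y i" i] by (auto simp: pbox_def)
  next
   case False
   then have "y i = x i" using y x T(2) by (auto simp: pbox_def)
   then show ?thesis using W(2) by auto
  qed
  then have "y \<in> T" using W(3) by auto
  then show "y \<in> U" using y T(2) by (auto simp: pbox_def)
 qed
 ultimately show ?thesis using that by blast
qed

lemma openin_Euclidean_topspace: "eopen p U ==> x \<in> U ==> i \<ge> p ==> x i = 0"
 using openin_subset[of "Euclidean_space p" U] by (auto simp: topspace_Euclidean)

abbreviation pcont :: "nat => pt set => (pt => real) => bool" where
 "pcont p U h \<equiv> continuous_map (subtopology (Euclidean_space p) U) euclideanreal h"

lemma topspace_sub: "eopen p U ==> topspace (subtopology (Euclidean_space p) U) = U"
 using openin_subset[of "Euclidean_space p" U] by (auto simp: topspace_subtopology)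

lemma pcont_eps:
 assumes U: "eopen p U" and h: "pcont p U h" and x: "x \<in> U" and e: "e > 0"
 obtains \<delta> where "\<delta> > 0" "pbox p x \<delta> \<subseteq> U" "!!y. y \<in> pbox p x \<delta> ==> \<bar>h y - h x\<bar> < e"
proof -
 have "openin (subtopology (Euclidean_space p) U) {y \<in> U. h y \<in> {h x - e<..<h x + e}}"
  using openin_continuous_map_preimage[OF h, of "{h x - e<..<h x + e}"]
  unfolding topspace_sub[OF U] by simp
 then have "eopen p {y \<in> U. h y \<in> {h x - e<..<h x + e}}"
  using U openin_trans_full by blast
 then obtain \<delta> where "\<delta> > 0" "pbox p x \<delta> \<subseteq> {y \<in> U. h y \<in> {h x - e<..<h x + e}}"
  using pbox_subset[of p "{y \<in> U. h y \<in> {h x - e<..<h x + e}}" x] x e by auto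
 then show ?thesis using that[of \<delta>] by (fastforce simp: abs_less_iff)
qed

lemma eventually_upd_in:
 assumes U: "eopen p U" and x: "x \<in> U" and i: "i < p"
 shows "eventually (%t. x(i := t) \<in> U) (nhds (x i))"
proof -
 obtain e where e: "e > 0" "pbox p x e \<subseteq> U" using pbox_subset[OF U x] .
 have "x(i := t) \<in> U" if "dist t (x i) < e" for t
  using that e i openin_Euclidean_topspace[OF U x] by (auto simp: pbox_def dist_real_def)
 then show ?thesis unfolding eventually_nhds_metric using e(1) by blast
qed

lemma rpd_cong:
 assumes U: "eopen p U" and x: "x \<in> U" and i: "i < p"
  and eq: "!!y. y \<in> U ==> h y = g y"
 shows "rpd i h x = rpd i g x"
 unfolding rpd_def
 by (rule deriv_cong_ev) (use eventually_upd_in[OF U x i] eq in \<open>auto elim: eventually_mono\<close>)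

lemma foldr_rpd_cong:
 assumes U: "eopen p U" and l: "l \<in> lists {..<p}"
  and eq: "!!y. y \<in> U ==> h y = g y"
 shows "x \<in> U ==> foldr rpd l h x = foldr rpd l g x"
 using l
proof (induction l arbitrary: x)
 case (Cons i l)
 then show ?case by (auto intro!: rpd_cong[OF U])
qed (simp add: eq)

lemma differentiable_upd_cong:
 fixes h g :: "pt => real"
 assumes U: "eopen p U" and x: "x \<in> U" and i: "i < p"
  and eq: "!!y. y \<in> U ==> h y = g y"
  and d: "(%t. h (x(i := t))) differentiable (at (x i))"
 shows "(%t. g (x(i := t))) differentiable (at (x i))"
proof -
 obtain D where D: "((%t. h (x(i := t))) has_real_derivative D) (at (x i))"
  using d by (auto simp: real_differentiable_def)
 have ev: "eventually (%t. h (x(i := t)) = g (x(i := t))) (nhds (x i))"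
  using eventually_upd_in[OF U x i] eq by (auto elim: eventually_mono)
 show ?thesis using D unfolding DERIV_cong_ev[OF refl ev refl] by (auto simp: real_differentiable_def)
qed

lemma smooth_onD:
 assumes "smooth_on p U h"
 shows "pcont p U h" "i < p ==> x \<in> U ==> (%t. h (x(i := t))) differentiable (at (x i))"
 using assms[unfolded smooth_on_def, rule_format, of "[]"] by auto

lemma smooth_rpd:
 assumes "smooth_on p U h" "i < p"
 shows "smooth_on p U (rpd i h)"
 unfolding smooth_on_def
proof
 fix l assume "l \<in> lists {..<p}"
 then have "l @ [i] \<in> lists {..<p}" using assms(2) by auto
 from bspec[OF assms(1)[unfolded smooth_on_def] this] show "pcont p U (foldr rpd l (rpd i h)) &
  (ALL ia<p. ALL x:U. (%t. foldr rpd l (rpd i h) (x(ia := t))) differentiable at (x ia))"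
  unfolding foldr_append foldr.simps o_def id_def .
qed

text \<open>Every iterated partial derivative agrees on \<open>U\<close> with a member of
  \<open>S\<close>, so continuity and differentiability are checked on members only. Derivatives
  have to stay in \<open>S\<close> merely up to equality on \<open>U\<close>, since the rules for
  \<open>rpd\<close> of sums and products hold only where the constituents are
  differentiable.\<close>

lemma smooth_coinduct:
 assumes U: "eopen p U" and "h \<in> S"
  and S: "!!h. h \<in> S ==> pcont p U h"
   "!!h i x. h \<in> S ==> i < p ==> x \<in> U ==> (%t. h (x(i := t))) differentiable (at (x i))"
   "!!h i. h \<in> S ==> i < p ==> EX h':S. ALL x:U. rpd i h x = h' x"
 shows "smooth_on p U h"
 unfolding smooth_on_def
proof
 fix l assume "l \<in> lists {..<p}"
 then have "EX g:S. ALL x:U. foldr rpd l h x = g x"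
 proof (induction l)
  case Nil
  then show ?case using assms(2) by auto
 next
  case (Cons i l)
  then obtain g where g: "g \<in> S" "ALL x:U. foldr rpd l h x = g x" by auto
  obtain g' where "g' \<in> S" "ALL x:U. rpd i g x = g' x" using S(3)[OF g(1), of i] Cons by auto
  then show ?case using rpd_cong[OF U _ _ bspec[OF g(2)]] Cons by auto
 qed
 then obtain g where g: "g \<in> S" "!!x. x \<in> U ==> g x = foldr rpd l h x" by auto
 have "pcont p U (foldr rpd l h)"
  using S(1)[OF g(1)] by (rule continuous_map_eq) (simp add: topspace_sub[OF U] g(2))
 then show "pcont p U (foldr rpd l h) &
  (ALL i<p. ALL x:U. (%t. foldr rpd l h (x(i := t))) differentiable at (x i))"
  using differentiable_upd_cong[OF U _ _ g(2) S(2)[OF g(1)]] by blast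
qed

lemma smooth_cong:
 assumes U: "eopen p U" and "smooth_on p U h" "!!x. x \<in> U ==> h x = g x"
 shows "smooth_on p U g"
 unfolding smooth_on_def
proof (intro ballI conjI allI impI)
 fix l assume l: "l \<in> lists {..<p}"
 note e = foldr_rpd_cong[OF U l assms(3)] and h = bspec[OF assms(2)[unfolded smooth_on_def] l]
 show "pcont p U (foldr rpd l g)"
  by (rule continuous_map_eq[OF conjunct1[OF h]]) (simp add: topspace_sub[OF U] e)
 fix i x assume "i < p" "x \<in> U"
 then show "(%t. foldr rpd l g (x(i := t))) differentiable (at (x i))"
  by (intro differentiable_upd_cong[OF U _ _ e]) (use h in blast)+
qed

lemma rpd_DERIV:
 assumes "smooth_on p U h" "x \<in> U" "i < p"
 shows "((%t. h (x(i := t))) has_real_derivative rpd i h x) (at (x i))"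
 unfolding rpd_def using smooth_onD(2)[OF assms(1,3,2)]
 by (metis DERIV_deriv_iff_real_differentiable)

lemma rpd_DERIV':
 assumes "smooth_on p U h" "x(i := t) \<in> U" "i < p"
 shows "((%t. h (x(i := t))) has_real_derivative rpd i h (x(i := t))) (at t)"
 using rpd_DERIV[OF assms] by simp

lemma rpd_eqI: "((%t. h (x(i := t))) has_real_derivative D) (at (x i)) ==> rpd i h x = D"
 unfolding rpd_def by (rule DERIV_imp_deriv)

lemma rpd_const: "rpd i (%x. a) x = 0"
 by (rule rpd_eqI) simp

lemma rpd_coordinate: "rpd j (%x. x i) x = (if i = j then 1 else 0)"
 by (rule rpd_eqI) (auto intro!: derivative_eq_intros)

lemma smooth_const: "eopen p U ==> smooth_on p U (%x. a)"
 by (rule smooth_coinduct[of p U _ "{%x. b | b. True}"]) (auto simp: rpd_const intro!: exI[of _ "%x. 0"])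

lemma smooth_add:
 assumes U: "eopen p U" and "smooth_on p U f" "smooth_on p U g"
 shows "smooth_on p U (%x. f x + g x)"
proof (rule smooth_coinduct[OF U, of _ "{%x. f x + g x | f g. smooth_on p U f & smooth_on p U g}"], goal_cases)
 case 1 then show ?case using assms by auto
next
 case (2 h) then show ?case by (auto intro!: continuous_map_add dest: smooth_onD(1))
next
 case (3 h i x) then show ?case by (auto intro!: differentiable_add dest: smooth_onD(2))
next
 case (4 h i)
 then obtain f g where h: "h = (%x. f x + g x)" "smooth_on p U f" "smooth_on p U g" by auto
 have "rpd i h x = rpd i f x + rpd i g x" if "x \<in> U" for x
  unfolding h(1) by (intro rpd_eqI DERIV_add rpd_DERIV[OF h(2) that 4(2)] rpd_DERIV[OF h(3) that 4(2)])
 moreover have "(%x. rpd i f x + rpd i g x)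
   \<in> {%x. f x + g x | f g. smooth_on p U f & smooth_on p U g}"
  by (intro CollectI exI[of _ "rpd i f"] exI[of _ "rpd i g"] conjI refl
    smooth_rpd[OF h(2) 4(2)] smooth_rpd[OF h(3) 4(2)])
 ultimately show ?case by (intro bexI) auto
qed

lemma smooth_sum:
 assumes U: "eopen p U" and "!!i. i \<in> A ==> smooth_on p U (f i)"
 shows "smooth_on p U (%x. \<Sum>i\<in>A. f i x)"
 using assms(2) by (induction A rule: infinite_finite_induct) (auto intro: smooth_const[OF U] smooth_add[OF U])

lemma sum_lessThan_add: "(\<Sum>j<n + m. A j) = (\<Sum>j<n. A j) + (\<Sum>j<m. A (n + j))" for A :: "nat => real"
 by (induction m) (auto simp: add.assoc)

text \<open>A single product is not stable under differentiation, but finite sums of products are;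
  the Leibniz rule doubles the number of summands.\<close>

lemma smooth_mult:
 assumes U: "eopen p U" and "smooth_on p U f" "smooth_on p U g"
 shows "smooth_on p U (%x. f x * g x)"
proof -
 define S where "S = {%x. \<Sum>j<n. f j x * g j x | (n::nat) f g. (ALL j<n. smooth_on p U (f j) & smooth_on p U (g j))}"
 show ?thesis
 proof (rule smooth_coinduct[OF U, of _ S], goal_cases)
  case 1
  show ?case unfolding S_def using assms
   by (intro CollectI exI[of _ 1] exI[of _ "%_. f"] exI[of _ "%_. g"]) auto
 next
  case (2 h) then show ?case unfolding S_def
   by (auto intro!: continuous_map_sum continuous_map_real_mult dest: smooth_onD(1))
 next
  case (3 h i x) then show ?case unfolding S_def
   by (auto intro!: differentiable_sum differentiable_mult dest: smooth_onD(2))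
 next
  case (4 h i)
  then obtain n f g where h: "h = (%x. \<Sum>j<(n::nat). f j x * g j x)"
   "!!j. j < n ==> smooth_on p U (f j)" "!!j. j < n ==> smooth_on p U (g j)"
   unfolding S_def by blast
  let ?F = "%j. if j < n then rpd i (f j) else f (j - n)"
  let ?G = "%j. if j < n then g j else rpd i (g (j - n))"
  have "rpd i h x = (\<Sum>j<n + n. ?F j x * ?G j x)" if "x \<in> U" for x
  proof -
   have "rpd i h x = (\<Sum>j<n. rpd i (f j) x * g j x + f j x * rpd i (g j) x)"
    unfolding h(1)
    by (intro rpd_eqI DERIV_sum)
     (use DERIV_mult'[OF rpd_DERIV[OF h(2) that 4(2)] rpd_DERIV[OF h(3) that 4(2)]] in
      \<open>auto simp: add.commute mult.commute\<close>)
   also have "... = (\<Sum>j<n. ?F j x * ?G j x) + (\<Sum>j<n. ?F (n + j) x * ?G (n + j) x)"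
    by (simp add: sum.distrib)
   also have "... = (\<Sum>j<n + n. ?F j x * ?G j x)"
    by (rule sum_lessThan_add[symmetric])
   finally show ?thesis .
  qed
  moreover have "(%x. \<Sum>j<n + n. ?F j x * ?G j x) \<in> S"
   unfolding S_def using h(2,3) smooth_rpd[OF _ 4(2)]
   by (intro CollectI exI[of _ "n + n"] exI[of _ ?F] exI[of _ ?G]) auto
  ultimately show ?case by (intro bexI) auto
 qed
qed

lemma smooth_cmult: "eopen p U ==> smooth_on p U f ==> smooth_on p U (%x. r * f x)"
 by (intro smooth_mult smooth_const)

lemma smooth_coordinate:
 assumes U: "eopen p U"
 shows "smooth_on p U (%x. x i)"
proof (rule smooth_coinduct[OF U, of _ "{%x. x i} \<union> {%x. b | b. True}"], goal_cases)
 case (2 h)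
 have "continuous_map (subtopology (Euclidean_space p) U) euclideanreal (%y. y i)"
  unfolding Euclidean_space_def
  by (intro continuous_map_from_subtopology continuous_map_product_projection) simp
 then show ?case using 2 by auto
next
 case (3 h j x)
 then show ?case by (cases "i = j") auto
next
 case (4 h j)
 then show ?case using rpd_coordinate[of j i] rpd_const[of j] by auto
qed auto

lemma rpd_add:
 "smooth_on p U f ==> smooth_on p U g ==> x \<in> U ==> i < p ==> rpd i (%x. f x + g x) x = rpd i f x + rpd i g x"
 by (intro rpd_eqI DERIV_add rpd_DERIV)

lemma rpd_cmult:
 "smooth_on p U f ==> x \<in> U ==> i < p ==> rpd i (%x. r * f x) x = r * rpd i f x"
 by (intro rpd_eqI DERIV_cmult rpd_DERIV)

lemma rpd_sum:
 "(!!j. j \<in> A ==> smooth_on p U (f j)) ==> x \<in> U ==> i < p ==>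
  rpd i (%x. \<Sum>j\<in>A. f j x) x = (\<Sum>j\<in>A. rpd i (f j) x)"
 by (intro rpd_eqI DERIV_sum rpd_DERIV)

lemma rpd_mult:
 assumes "smooth_on p U f" "smooth_on p U g" "x \<in> U" "i < p"
 shows "rpd i (%x. f x * g x) x = rpd i f x * g x + f x * rpd i g x"
 using DERIV_mult'[OF rpd_DERIV[OF assms(1,3,4)] rpd_DERIV[OF assms(2,3,4)]]
 by (intro rpd_eqI) (simp add: add.commute)

lemma MVT_upd:
 assumes h: "smooth_on p U h" and i: "i < p"
  and U: "!!t. min a b \<le> t ==> t \<le> max a b ==> x(i := t) \<in> U"
 obtains t where "min a b \<le> t" "t \<le> max a b" "h (x(i := b)) - h (x(i := a)) = (b - a) * rpd i h (x(i := t))"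
proof (cases a b rule: linorder_cases)
 case less
 then have "EX z>a. z < b & h (x(i := b)) - h (x(i := a)) = (b - a) * rpd i h (x(i := z))"
  by (intro MVT2 rpd_DERIV'[OF h _ i] U) auto
 then show ?thesis using that less by (metis less_imp_le max.absorb2 min.absorb1)
next
 case equal
 then show ?thesis using that[of a] by auto
next
 case greater
 then have "EX z>b. z < a & h (x(i := a)) - h (x(i := b)) = (a - b) * rpd i h (x(i := z))"
  by (intro MVT2 rpd_DERIV'[OF h _ i] U) auto
 then obtain z where "z > b" "z < a" "h (x(i := a)) - h (x(i := b)) = (a - b) * rpd i h (x(i := z))" by blast
 then show ?thesis using that[of z] greater by (simp add: algebra_simps)
qed

text \<open>The increment of \<open>h\<close> is split into steps that change one coordinate at a
  time. The mean value theorem turns each step into a partial derivative at a nearby point, and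
  continuity of the partial derivatives gives the limit.\<close>

lemma chain_rule_curve:
 assumes U: "eopen p U" and h: "smooth_on p U h"
  and b: "b 0 \<in> U" "!!s i. i \<ge> p ==> b s i = 0"
   "!!i. i < p ==> ((%s. b s i) has_real_derivative b' i) (at 0)"
 shows "((%s. h (b s)) has_real_derivative (\<Sum>i<p. b' i * rpd i h (b 0))) (at 0)"
proof -
 define x where "x = b 0"
 define C where "C j s = (%i. if i < j then b s i else x i)" for j s
 have x: "x \<in> U" "!!i. i \<ge> p ==> x i = 0" using b by (auto simp: x_def)
 have Cs: "C (Suc j) s = (C j s)(j := b s j)" "C j s = (C j s)(j := x j)" for j s
  by (auto simp: C_def fun_eq_iff less_Suc_eq)
 have tel: "h (b s) = h x + (\<Sum>j<p. h (C (Suc j) s) - h (C j s))" for s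
 proof -
  have "C p s = b s" "C 0 s = x" using x(2) b(2) by (auto simp: C_def fun_eq_iff)
  then show ?thesis using sum_lessThan_telescope[of "%j. h (C j s)" p] by simp
 qed
 have part: "((%s. h (C (Suc j) s) - h (C j s)) has_real_derivative b' j * rpd j h x) (at 0)" if j: "j < p" for j
 proof -
  \<comment> \<open>The quotient of the increment by the change of the coordinate, continued by its
    expected limit where that change is 0.\<close>
  define A where "A s = (if b s j = x j then rpd j h x
   else (h (C (Suc j) s) - h (C j s)) / (b s j - x j))" for s
  have A: "A \<midarrow>0\<rightarrow> rpd j h x"
  proof (rule tendstoI)
   fix e :: real assume e: "e > 0"
   obtain \<delta> where \<delta>: "\<delta> > 0" "pbox p x \<delta> \<subseteq> U"
     "!!y. y \<in> pbox p x \<delta> ==> \<bar>rpd j h y - rpd j h x\<bar> < e"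
    using pcont_eps[OF U smooth_onD(1)[OF smooth_rpd[OF h j]] x(1) e] by metis
   have "eventually (%s. \<bar>b s i - x i\<bar> < \<delta>) (at 0)" if "i < p" for i
   proof -
    have "(%s. b s i) \<midarrow>0\<rightarrow> x i"
     using DERIV_isCont[OF b(3)[OF that]] by (simp add: isCont_def x_def)
    from tendstoD[OF this \<delta>(1)] show ?thesis by (simp add: dist_real_def)
   qed
   then have "eventually (%s. ALL i:{..<p}. \<bar>b s i - x i\<bar> < \<delta>) (at 0)"
    by (intro eventually_ball_finite) auto
   then show "eventually (%s. dist (A s) (rpd j h x) < e) (at 0)"
   proof eventually_elim
    case (elim s)
    have in_box: "(C j s)(j := t) \<in> pbox p x \<delta>" if "min (x j) (b s j) \<le> t" "t \<le> max (x j) (b s j)" for t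
    proof -
     have "\<bar>b s j - x j\<bar> < \<delta>" using elim j by blast
     then have "\<bar>t - x j\<bar> < \<delta>" using that \<delta>(1) by (auto simp: min_def max_def abs_if split: if_splits)
     then show ?thesis using elim \<delta>(1) x(2) j by (auto simp: pbox_def C_def)
    qed
    obtain t where t: "min (x j) (b s j) \<le> t" "t \<le> max (x j) (b s j)"
      "h ((C j s)(j := b s j)) - h ((C j s)(j := x j)) = (b s j - x j) * rpd j h ((C j s)(j := t))"
     using MVT_upd[OF h j, of "x j" "b s j" "C j s"] in_box \<delta>(2) by blast
    have "\<bar>rpd j h ((C j s)(j := t)) - rpd j h x\<bar> < e" using \<delta>(3) in_box t(1,2) by blast
    moreover have "h (C (Suc j) s) - h (C j s) = (b s j - x j) * rpd j h ((C j s)(j := t))"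
     using t(3) Cs[of j s] by metis
    ultimately show ?case using e by (auto simp: A_def dist_real_def)
   qed
  qed
  have q: "(%s. (b s j - x j) / s) \<midarrow>0\<rightarrow> b' j"
   using b(3)[OF j] by (simp add: DERIV_def x_def)
  have e: "h (C (Suc j) s) - h (C j s) = (b s j - x j) * A s" for s
   using Cs[of j s] by (auto simp: A_def)
  have "(%s. (b s j - x j) / s * A s) \<midarrow>0\<rightarrow> b' j * rpd j h x" by (rule tendsto_mult[OF q A])
  then show ?thesis unfolding DERIV_def e by (simp add: x_def)
 qed
 have "((%s. h x + (\<Sum>j<p. h (C (Suc j) s) - h (C j s))) has_real_derivative 0 + (\<Sum>j<p. b' j * rpd j h x)) (at 0)"
  by (intro DERIV_add DERIV_const DERIV_sum part) auto
 then have "((%s. h (b s)) has_real_derivative 0 + (\<Sum>j<p. b' j * rpd j h x)) (at 0)"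
  by (simp only: tel[symmetric])
 then show ?thesis by (simp add: x_def)
qed

text \<open>The second difference over a small square, treated by the mean value theorem in
  direction \<open>i\<close> and then \<open>j\<close>. It is symmetric in the two directions, so
  both mixed derivatives approximate it; this is how \<open>rpd_commute\<close> follows.\<close>

lemma rpd_rpd_MVT:
 assumes h: "smooth_on p U h" and ij: "i < p" "j < p" "i ~= j" and s: "0 < s" "s < \<delta>"
  and x: "pbox p x \<delta> \<subseteq> U" "!!k. k \<ge> p ==> x k = 0"
 obtains y where "y \<in> pbox p x \<delta>"
  "h (x(i := x i + s, j := x j + s)) - h (x(i := x i + s)) - h (x(j := x j + s)) + h x
   = s * s * rpd j (rpd i h) y"
proof -
 have box: "x(i := u, j := v) \<in> pbox p x \<delta>" if "x i \<le> u" "u \<le> x i + s" "x j \<le> v" "v \<le> x j + s" for u v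
  using that s ij x(2) by (auto simp: pbox_def)
 define f where "f u = h (x(i := u, j := x j + s)) - h (x(i := u, j := x j))" for u
 have "EX z>x i. z < x i + s & f (x i + s) - f (x i)
   = (x i + s - x i) * (rpd i h (x(i := z, j := x j + s)) - rpd i h (x(i := z, j := x j)))"
 proof (rule MVT2)
  fix u assume u: "x i \<le> u" "u \<le> x i + s"
  have D: "((%u. h ((x(j := v))(i := u))) has_real_derivative rpd i h ((x(j := v))(i := u))) (at u)"
   if "x j \<le> v" "v \<le> x j + s" for v
   using box[OF u that] x(1) by (intro rpd_DERIV'[OF h _ ij(1)]) (auto simp: fun_upd_twist[OF ij(3)])
  show "(f has_real_derivative rpd i h (x(i := u, j := x j + s)) - rpd i h (x(i := u, j := x j))) (at u)"
   unfolding f_def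
   by (rule DERIV_diff) (use D[of "x j + s"] D[of "x j"] s(1) in \<open>simp_all add: fun_upd_twist[OF ij(3)]\<close>)
 qed (use s in auto)
 then obtain z where z: "x i < z" "z < x i + s" "f (x i + s) - f (x i)
   = s * (rpd i h (x(i := z, j := x j + s)) - rpd i h (x(i := z, j := x j)))" by auto
 have "EX w>x j. w < x j + s & rpd i h ((x(i := z))(j := x j + s)) - rpd i h ((x(i := z))(j := x j))
   = (x j + s - x j) * rpd j (rpd i h) ((x(i := z))(j := w))"
 proof (rule MVT2)
  fix v assume "x j \<le> v" "v \<le> x j + s"
  then have "x(i := z, j := v) \<in> U" using box[of z v] z(1,2) x(1) by auto
  then show "((%v. rpd i h ((x(i := z))(j := v))) has_real_derivative
   rpd j (rpd i h) ((x(i := z))(j := v))) (at v)"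
   by (rule rpd_DERIV'[OF smooth_rpd[OF h ij(1)] _ ij(2)])
 qed (use s in auto)
 then obtain w where w: "x j < w" "w < x j + s"
  "rpd i h (x(i := z, j := x j + s)) - rpd i h (x(i := z, j := x j)) = s * rpd j (rpd i h) (x(i := z, j := w))"
  by auto
 have "x(i := z, j := w) \<in> pbox p x \<delta>" using box[of z w] z w by auto
 moreover have "h (x(i := x i + s, j := x j + s)) - h (x(i := x i + s)) - h (x(j := x j + s)) + h x
   = f (x i + s) - f (x i)"
  using ij(3) unfolding f_def by (simp add: fun_upd_idem)
 ultimately show ?thesis using that z(3) w(3) by (simp add: mult.assoc)
qed

lemma rpd_commute:
 assumes U: "eopen p U" and h: "smooth_on p U h" and x: "x \<in> U"
  and ij: "i < p" "j < p"
 shows "rpd i (rpd j h) x = rpd j (rpd i h) x"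
proof (cases "i = j")
 case False
 show ?thesis
 proof (rule ccontr)
  assume ne: "rpd i (rpd j h) x ~= rpd j (rpd i h) x"
  define e where "e = \<bar>rpd i (rpd j h) x - rpd j (rpd i h) x\<bar> / 2"
  have e: "e > 0" using ne by (simp add: e_def)
  obtain \<delta>1 where \<delta>1: "\<delta>1 > 0" "pbox p x \<delta>1 \<subseteq> U"
    "!!y. y \<in> pbox p x \<delta>1 ==> \<bar>rpd i (rpd j h) y - rpd i (rpd j h) x\<bar> < e"
   using pcont_eps[OF U smooth_onD(1)[OF smooth_rpd[OF smooth_rpd[OF h ij(2)] ij(1)]] x e] by metis
  obtain \<delta>2 where \<delta>2: "\<delta>2 > 0" "pbox p x \<delta>2 \<subseteq> U"
    "!!y. y \<in> pbox p x \<delta>2 ==> \<bar>rpd j (rpd i h) y - rpd j (rpd i h) x\<bar> < e"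
   using pcont_eps[OF U smooth_onD(1)[OF smooth_rpd[OF smooth_rpd[OF h ij(1)] ij(2)]] x e] by metis
  define \<delta> s where "\<delta> = min \<delta>1 \<delta>2" and "s = \<delta> / 2"
  have s: "0 < s" "s < \<delta>" using \<delta>1(1) \<delta>2(1) by (auto simp: s_def \<delta>_def)
  have sub: "pbox p x \<delta> \<subseteq> pbox p x \<delta>1" "pbox p x \<delta> \<subseteq> pbox p x \<delta>2" by (auto simp: pbox_def \<delta>_def)
  have x0: "!!k. k \<ge> p ==> x k = 0" using openin_Euclidean_topspace[OF U x] .
  obtain y where y: "y \<in> pbox p x \<delta>"
   "h (x(i := x i + s, j := x j + s)) - h (x(i := x i + s)) - h (x(j := x j + s)) + h x
   = s * s * rpd j (rpd i h) y"
   using rpd_rpd_MVT[where x = x, OF h ij False s _ x0] sub(1) \<delta>1(2) by blast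
  obtain z where z: "z \<in> pbox p x \<delta>"
   "h (x(j := x j + s, i := x i + s)) - h (x(j := x j + s)) - h (x(i := x i + s)) + h x
   = s * s * rpd i (rpd j h) z"
   using rpd_rpd_MVT[where x = x, OF h ij(2,1) _ s _ x0] False sub(1) \<delta>1(2) by blast
  have "s * s * rpd j (rpd i h) y = s * s * rpd i (rpd j h) z"
   using y(2) z(2) unfolding fun_upd_twist[OF False, of x "x i + s" "x j + s"] by linarith
  then have "rpd j (rpd i h) y = rpd i (rpd j h) z" using s by simp
  moreover have "\<bar>rpd i (rpd j h) z - rpd i (rpd j h) x\<bar> < e" using \<delta>1(3) sub z by blast
  moreover have "\<bar>rpd j (rpd i h) y - rpd j (rpd i h) x\<bar> < e" using \<delta>2(3) sub y by blast
  ultimately show False unfolding e_def by (simp add: abs_if field_simps split: if_splits)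
 qed
qed simp

subsection \<open>The Taylor pieces of an evaluation\<close>

text \<open>The part of the Taylor expansion of degree \<open>n\<close> in the souls. With this
  recursion the Leibniz and chain rules become inductions on \<open>n\<close>, while
  \<open>sfE_closed\<close> recovers the sum over words used in \<open>sf_eval_term\<close>.\<close>

fun sfE :: "nat => (coord => gs) => (coord => gs) => nat => (pt => gs) => gs" where
 "sfE p X P 0 g = msub (subst_var X P) (g (bodypt p X))"
| "sfE p X P (Suc n) g = (1 / real (Suc n)) *\<^sub>R (\<Sum>i<p. soul (X (Ev i)) * sfE p X P n (dcoord (Ev i) g))"

declare sfE.simps(2) [simp del]

text \<open>Even coordinates do not enter through \<open>subst_var\<close> but through body and
  soul. Their evenness, which makes the souls central, is therefore demanded separately.\<close>

definition evd :: "nat => (coord => gs) => (coord => gs) => bool" where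
 "evd p X P \<longleftrightarrow> good (subst_var X P) & (ALL i<p. gs_parity False (X (Ev i)))"

lemma gs_parity_soul: "gs_parity False f ==> gs_parity False (soul f)"
 by (simp add: soul_def gs_parity_diff)

lemma coeff_dcoord_Ev: "coeff (dcoord (Ev i) g x) m = rpd i (%y. coeff (g y) m) x"
proof (cases "mono_ok m")
 case False
 then have "(%y. coeff (g y) m) = (%y. 0)" by (simp add: coeff_not_ok)
 then show ?thesis using False by (simp add: coeff_not_ok rpd_const)
qed (simp add: dcoord_def)

lemma coeff_foldr_dcoord:
 "coeff (foldr (%i. dcoord (Ev i)) l g x) m = foldr rpd l (%y. coeff (g y) m) x"
proof (induction l arbitrary: x)
 case (Cons i l)
 then have "(%y. coeff (foldr (%i. dcoord (Ev i)) l g y) m) = foldr rpd l (%y. coeff (g y) m)" by blast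
 then show ?case by (simp add: coeff_dcoord_Ev)
qed simp

lemma sfE_closed:
 assumes "evd p X P"
 shows "sfE p X P n g = (\<Sum>l | set l \<subseteq> {..<p} & length l = n. (1 / fact n) *\<^sub>R
  (prod_list (map (%i. soul (X (Ev i))) l)
   * msub (subst_var X P) (foldr (%i. dcoord (Ev i)) l g (bodypt p X))))"
proof (induction n arbitrary: g)
 case 0
 have "{l. set l \<subseteq> {..<p} & length l = 0} = {[]}" by auto
 then show ?case by simp
next
 case (Suc n)
 let ?L = "%n. {l. set l \<subseteq> {..<p} & length l = n}"
 let ?h = "%n l g. (1 / fact n) *\<^sub>R (prod_list (map (%i. soul (X (Ev i))) l)
   * msub (subst_var X P) (foldr (%i. dcoord (Ev i)) l g (bodypt p X)))"
 have "sfE p X P (Suc n) g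
   = (1 / real (Suc n)) *\<^sub>R (\<Sum>i<p. \<Sum>l\<in>?L n. soul (X (Ev i)) * ?h n l (dcoord (Ev i) g))"
  by (simp add: sfE.simps(2) Suc.IH sum_distrib_left)
 also have "... = (\<Sum>(i, l)\<in>{..<p} \<times> ?L n. (1 / real (Suc n)) *\<^sub>R (soul (X (Ev i)) * ?h n l (dcoord (Ev i) g)))"
  by (simp add: scaleR_sum_right sum.cartesian_product case_prod_unfold)
 \<comment> \<open>The new index is the innermost derivative and hence the last letter of the word;
   centrality of the souls lets its factor stand in front.\<close>
 also have "... = (\<Sum>l\<in>?L (Suc n). ?h (Suc n) l g)"
 proof (rule sum.reindex_bij_witness[where i = "%l. (last l, butlast l)" and j = "%(i, l). l @ [i]"])
  fix a assume "a \<in> {..<p} \<times> ?L n"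
  then obtain i l where a: "a = (i, l)" "i < p" by auto
  have c: "y * soul (X (Ev i)) = soul (X (Ev i)) * y" for y
   using gs_even_central[OF gs_parity_soul, of "X (Ev i)" y] assms a(2) by (simp add: evd_def)
  then show "?h (Suc n) (case a of (i, l) => l @ [i]) g
    = (case a of (i, l) => (1 / real (Suc n)) *\<^sub>R (soul (X (Ev i)) * ?h n l (dcoord (Ev i) g)))"
   by (simp add: a mult.assoc[symmetric] c[symmetric])
 next
  fix l assume "l \<in> ?L (Suc n)"
  then have "l ~= []" "set l \<subseteq> {..<p}" by auto
  then show "(last l, butlast l) \<in> {..<p} \<times> ?L n"
   using \<open>l \<in> ?L (Suc n)\<close> in_set_butlastD by (fastforce dest: last_in_set)
 qed (auto intro!: append_butlast_last_id)
 finally show ?case .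
qed

lemma gsord_sfE: "gsord (%_. True) n (sfE p X P n g)"
proof (induction n arbitrary: g)
 case (Suc n)
 have "gsord (%_. True) (1 + n) (soul (X (Ev i)) * sfE p X P n (dcoord (Ev i) g))" for i
  by (intro gsord_mult gsord_soul Suc)
 then show ?case by (simp add: sfE.simps(2) gsord_scaleR gsord_sum)
qed simp

text \<open>The definition groups the terms by degree in the momenta, the pieces \<open>sfE\<close>
  by degree in the souls. For a fixed coefficient only the finitely many pairs in
  \<open>A \<times> B\<close> contribute, because a word longer than \<open>size k\<close> carries
  too many souls, and a finite sum can be grouped either way.\<close>

lemma sf_eval_coeff:
 assumes "evd p X P" and ok: "mono_ok k" and N: "size k \<le> N"
 shows "coeff (sf_eval p g X P) k = (\<Sum>n\<le>N. coeff (sfE p X P n g) k)"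
proof -
 define \<sigma> where "\<sigma> = subst_var X P"
 have \<sigma>: "good \<sigma>" using assms(1) by (simp add: \<sigma>_def evd_def)
 define pl where "pl l = prod_list (map (%i. soul (X (Ev i))) l)" for l
 define G where "G l = foldr (%i. dcoord (Ev i)) l g (bodypt p X)" for l
 define t where "t l m = coeff (sf_eval_term p g X P l m) k" for l m
 define A where "A = {l. set l \<subseteq> {..<p} & length l \<le> N}"
 \<comment> \<open>The monomials that can reach some submonomial of \<open>k\<close>; the souls may
   supply the remaining factors.\<close>
 define B where "B = (\<Union>a\<in>{a. a \<subseteq># k}. {m. coeff (mprod \<sigma> m) a ~= 0})"
 define dg where "dg m = size (filter_mset is_mom m)" for m
 have fA: "finite A" unfolding A_def by (rule finite_lists_length_le) simp
 have fB: "finite B" unfolding B_def using finite_sub_mset good_mprod_supp[OF \<sigma>] by auto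
 have t: "t l m = (1 / fact (length l)) * (coeff (G l) m * coeff (pl l * mprod \<sigma> m) k)" for l m
  by (simp add: t_def sf_eval_term_def G_def coeff_foldr_dcoord pl_def mprod_def \<sigma>_def)
 have supp: "length l \<le> N & m \<in> B" if "t l m ~= 0" for l m
 proof -
  have "coeff (pl l * mprod \<sigma> m) k ~= 0" using that by (auto simp: t)
  then obtain a c where ac: "a + c = k" "coeff (pl l) a ~= 0" "coeff (mprod \<sigma> m) c ~= 0"
   by (rule coeff_mult_nonzeroE)
  have "coeff (soul (X (Ev i))) {#} = 0" for i using gsord_soul[of "X (Ev i)"] by (simp only: gsord_UNIV_1)
  then have "length l \<le> size a" using prod_list_supp[of l "%i. soul (X (Ev i))" a] ac(2) by (simp add: pl_def)
  moreover have "size a \<le> size k" using ac(1) by auto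
  moreover have "c \<subseteq># k" using ac(1) by auto
  ultimately show ?thesis using N ac(3) by (auto simp: B_def)
 qed
 have ms: "coeff (pl l * msub \<sigma> (G l)) k = (\<Sum>m\<in>B. coeff (G l) m * coeff (pl l * mprod \<sigma> m) k)" for l
 proof -
  have "coeff (msub \<sigma> (G l)) c = (\<Sum>m\<in>B. coeff (G l) m * coeff (mprod \<sigma> m) c)" if "c \<subseteq># k" for c
   by (rule coeff_msub[OF fB _ \<sigma>]) (use that in \<open>auto simp: B_def\<close>)
  then have "coeff (pl l * msub \<sigma> (G l)) k
    = (\<Sum>x\<in>msplits k. \<Sum>m\<in>B. ksign (fst x) (snd x) * coeff (pl l) (fst x) * (coeff (G l) m * coeff (mprod \<sigma> m) (snd x)))"
   unfolding coeff_mult[OF ok] case_prod_unfold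
   by (intro sum.cong refl) (auto simp: msplits_def sum_distrib_left)
  also have "... = (\<Sum>m\<in>B. coeff (G l) m * coeff (pl l * mprod \<sigma> m) k)"
   unfolding coeff_mult[OF ok] case_prod_unfold
   by (subst sum.swap) (simp add: sum_distrib_left mult_ac)
  finally show ?thesis .
 qed
 have e: "coeff (sfE p X P n g) k = (\<Sum>l\<in>{l \<in> A. length l = n}. \<Sum>m\<in>B. t l m)" if "n \<le> N" for n
 proof -
  have eq: "{l \<in> A. length l = n} = {l. set l \<subseteq> {..<p} & length l = n}"
   using that by (auto simp: A_def)
  show ?thesis
   unfolding sfE_closed[OF assms(1)] eq coeff_sum
   by (rule sum.cong[OF refl])
    (simp add: pl_def[symmetric] \<sigma>_def[symmetric] G_def[symmetric] ms t sum_distrib_left)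
 qed
 have "(\<Sum>n\<le>N. coeff (sfE p X P n g) k) = (\<Sum>n\<le>N. \<Sum>l\<in>{l \<in> A. length l = n}. \<Sum>m\<in>B. t l m)"
  by (intro sum.cong refl e) auto
 also have "... = (\<Sum>l\<in>A. \<Sum>m\<in>B. t l m)"
  by (rule sum.group[OF fA]) (auto simp: A_def)
 also have "... = (\<Sum>x\<in>A \<times> B. t (fst x) (snd x))"
  by (simp add: sum.cartesian_product case_prod_unfold)
 finally have r: "(\<Sum>n\<le>N. coeff (sfE p X P n g) k) = (\<Sum>x\<in>A \<times> B. t (fst x) (snd x))" .
 have d: "coeff (sf_eval_deg p g X P n) k = (\<Sum>x\<in>{x \<in> A \<times> B. dg (snd x) = n}. t (fst x) (snd x))" for n
 proof -
  let ?S = "lists {..<p} \<times> {m. size (filter_mset is_mom m) = n}"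
  have "coeff (sf_eval_deg p g X P n) k = infsum (%x. t (fst x) (snd x)) ?S"
   using ok by (simp add: sf_eval_deg_def t_def case_prod_unfold)
  also have "... = infsum (%x. t (fst x) (snd x)) {x \<in> A \<times> B. dg (snd x) = n}"
   by (rule infsum_cong_neutral) (use supp in \<open>auto simp: A_def dg_def lists_eq_set\<close>)
  also have "... = (\<Sum>x\<in>{x \<in> A \<times> B. dg (snd x) = n}. t (fst x) (snd x))"
   by (rule infsum_finite) (use fA fB in simp)
  finally show ?thesis .
 qed
 have "coeff (sf_eval p g X P) k = (\<Sum>n. coeff (sf_eval_deg p g X P n) k)"
  using ok by (simp add: sf_eval_def)
 also have "... = (\<Sum>n\<in>dg ` B. coeff (sf_eval_deg p g X P n) k)"
 proof (rule suminf_finite)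
  fix n assume "n \<notin> dg ` B"
  then have "{x \<in> A \<times> B. dg (snd x) = n} = {}" by auto
  then show "coeff (sf_eval_deg p g X P n) k = 0" by (simp only: d sum.empty)
 qed (simp add: fB)
 also have "... = (\<Sum>x\<in>A \<times> B. t (fst x) (snd x))"
  unfolding d by (rule sum.group) (auto simp: fA fB)
 finally show ?thesis using r by simp
qed

lemma sf_eval_lim:
 assumes "evd p X P"
 shows "gsord (%_. True) (Suc M) (sf_eval p g X P - (\<Sum>n\<le>M. sfE p X P n g))"
 unfolding gsord_def
proof (intro allI impI)
 fix k :: "var multiset" assume "size (filter_mset (%_. True) k) < Suc M"
 then show "coeff (sf_eval p g X P - (\<Sum>n\<le>M. sfE p X P n g)) k = 0"
  using sf_eval_coeff[OF assms, of k M g]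
  by (cases "mono_ok k") (auto simp: coeff_not_ok)
qed

definition sfn :: "nat => pt set => (pt => gs) => bool" where
 "sfn p U g \<longleftrightarrow> (ALL m. smooth_on p U (%x. coeff (g x) m))"

lemma sfn_dcoord_Ev: "sfn p U g ==> i < p ==> sfn p U (dcoord (Ev i) g)"
 by (auto simp: sfn_def coeff_dcoord_Ev smooth_rpd)

lemma dcoord_Ev_cong:
 assumes "eopen p U" "x \<in> U" "i < p" "!!y. y \<in> U ==> g y = h y"
 shows "dcoord (Ev i) g x = dcoord (Ev i) h x"
 by (rule gs_eqI) (auto simp: coeff_dcoord_Ev intro!: rpd_cong[OF assms(1-3)] simp: assms(4))

lemma coeff_dcoord_Ev_nonzero:
 assumes "eopen p U" "x \<in> U" "i < p" "coeff (dcoord (Ev i) g x) m ~= 0"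
 obtains y where "y \<in> U" "coeff (g y) m ~= 0"
proof (cases "EX y:U. coeff (g y) m ~= 0")
 case False
 then have "rpd i (%y. coeff (g y) m) x = rpd i (%y. 0) x" by (intro rpd_cong[OF assms(1-3)]) blast
 then show ?thesis using assms(4) by (simp add: coeff_dcoord_Ev rpd_const)
qed (use that in blast)

lemma gs_vars_dcoord_Ev:
 assumes "eopen p U" "x \<in> U" "i < p" "!!y. y \<in> U ==> gs_vars V (g y)"
 shows "gs_vars V (dcoord (Ev i) g x)"
 unfolding gs_vars_def by (metis coeff_dcoord_Ev_nonzero[OF assms(1-3)] assms(4) gs_vars_def)

lemma gs_parity_dcoord_Ev:
 assumes "eopen p U" "x \<in> U" "i < p" "!!y. y \<in> U ==> gs_parity b (g y)"
 shows "gs_parity b (dcoord (Ev i) g x)"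
 unfolding gs_parity_altdef by (metis coeff_dcoord_Ev_nonzero[OF assms(1-3)] assms(4) gs_parity_altdef)

lemma sfE_cong:
 assumes U: "eopen p U" "bodypt p X \<in> U" and "!!y. y \<in> U ==> g y = h y"
 shows "sfE p X P n g = sfE p X P n h"
 using assms(3)
proof (induction n arbitrary: g h)
 case (Suc n)
 have "sfE p X P n (dcoord (Ev i) g) = sfE p X P n (dcoord (Ev i) h)" if "i < p" for i
  by (rule Suc.IH) (rule dcoord_Ev_cong[OF U(1) _ that Suc.prems])
 then show ?case by (simp add: sfE.simps(2))
qed (use U in simp)

lemma dcoord_Ev_add:
 assumes "sfn p U g" "sfn p U h" "x \<in> U" "i < p"
 shows "dcoord (Ev i) (%x. g x + h x) x = dcoord (Ev i) g x + dcoord (Ev i) h x"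
 by (rule gs_eqI) (use assms in \<open>auto simp: coeff_dcoord_Ev sfn_def intro!: rpd_add\<close>)

lemma dcoord_Ev_linear:
 assumes "!!f m. mono_ok m ==> coeff (L f) m = c m * coeff f (\<pi> m)" "sfn p U g" "x \<in> U" "i < p"
 shows "dcoord (Ev i) (%x. L (g x)) x = L (dcoord (Ev i) g x)"
 by (rule gs_eqI) (use assms in \<open>auto simp: coeff_dcoord_Ev sfn_def intro!: rpd_cmult\<close>)

lemma sfn_linear:
 assumes U: "eopen p U"
  and "!!f m. mono_ok m ==> coeff (L f) m = c m * coeff f (\<pi> m)" "sfn p U g"
 shows "sfn p U (%x. L (g x))"
 unfolding sfn_def
proof
 fix m show "smooth_on p U (%x. coeff (L (g x)) m)"
  using assms(2,3) smooth_cmult[OF U] smooth_const[OF U]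
  by (cases "mono_ok m") (auto simp: sfn_def coeff_not_ok)
qed

lemma sfn_add: "eopen p U ==> sfn p U g ==> sfn p U h ==> sfn p U (%x. g x + h x)"
 by (auto simp: sfn_def intro: smooth_add)

lemma sfn_sum:
 "eopen p U ==> (!!i. i \<in> A ==> sfn p U (g i)) ==> sfn p U (%x. \<Sum>i\<in>A. g i x)"
 by (auto simp: sfn_def intro: smooth_sum)

lemma sfn_const: "eopen p U ==> sfn p U (%x. a)"
 by (simp add: sfn_def smooth_const)

lemma sfn_mult:
 assumes U: "eopen p U" and "sfn p U g" "sfn p U h"
 shows "sfn p U (%x. g x * h x)"
 unfolding sfn_def
proof
 fix m show "smooth_on p U (%x. coeff (g x * h x) m)"
  using assms by (cases "mono_ok m")
   (auto simp: coeff_mult coeff_not_ok case_prod_unfold sfn_def mult.assoc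
    intro!: smooth_sum[OF U] smooth_cmult[OF U] smooth_mult[OF U] smooth_const[OF U])
qed

lemma dcoord_Ev_mult:
 assumes U: "eopen p U" and gh: "sfn p U g" "sfn p U h" and x: "x \<in> U" "i < p"
 shows "dcoord (Ev i) (%x. g x * h x) x = dcoord (Ev i) g x * h x + g x * dcoord (Ev i) h x"
proof (rule gs_eqI)
 fix m assume ok: "mono_ok m"
 have s: "smooth_on p U (%y. ksign a b * (coeff (g y) a * coeff (h y) b))" for a b
  using gh by (auto simp: sfn_def intro!: smooth_cmult[OF U] smooth_mult[OF U])
 have t: "rpd i (%y. ksign a b * (coeff (g y) a * coeff (h y) b)) x
   = ksign a b * (rpd i (%y. coeff (g y) a) x * coeff (h x) b + coeff (g x) a * rpd i (%y. coeff (h y) b) x)" for a b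
  using gh x by (subst rpd_cmult[of p U]) (auto simp: sfn_def rpd_mult[of p U] intro!: smooth_mult[OF U])
 show "coeff (dcoord (Ev i) (%x. g x * h x) x) m = coeff (dcoord (Ev i) g x * h x + g x * dcoord (Ev i) h x) m"
  unfolding coeff_dcoord_Ev coeff_arith coeff_mult[OF ok] case_prod_unfold mult.assoc
  by (subst rpd_sum[of _ p U])
   (simp_all add: s x t sum.distrib distrib_left case_prod_unfold coeff_dcoord_Ev)
qed

lemma dcoord_Ev_commute:
 assumes "eopen p U" "sfn p U g" "x \<in> U" "i < p" "j < p"
 shows "dcoord (Ev i) (dcoord (Ev j) g) x = dcoord (Ev j) (dcoord (Ev i) g) x"
proof (rule gs_eqI)
 fix m
 have "(%y. coeff (dcoord (Ev j) g y) m) = rpd j (%y. coeff (g y) m)" for j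
  by (simp add: coeff_dcoord_Ev fun_eq_iff)
 then show "coeff (dcoord (Ev i) (dcoord (Ev j) g) x) m = coeff (dcoord (Ev j) (dcoord (Ev i) g) x) m"
  unfolding coeff_dcoord_Ev[of i] coeff_dcoord_Ev[of j "dcoord (Ev i) g"]
  using rpd_commute[OF assms(1) _ assms(3-5)] assms(2) by (simp add: sfn_def)
qed

lemma sfE_add:
 assumes U: "eopen p U" "bodypt p X \<in> U" and e: "evd p X P"
  and "sfn p U g" "sfn p U h"
 shows "sfE p X P n (%x. g x + h x) = sfE p X P n g + sfE p X P n h"
 using assms(4,5)
proof (induction n arbitrary: g h)
 case 0
 then show ?case using e by (simp add: clin_add clin_msub evd_def)
next
 case (Suc n)
 have "sfE p X P n (dcoord (Ev i) (%x. g x + h x))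
   = sfE p X P n (dcoord (Ev i) g) + sfE p X P n (dcoord (Ev i) h)" if "i < p" for i
  using sfE_cong[OF U dcoord_Ev_add[OF Suc.prems _ that], where P = P and n = n]
   Suc.IH[OF sfn_dcoord_Ev[OF Suc.prems(1) that] sfn_dcoord_Ev[OF Suc.prems(2) that]] by simp
 then show ?case by (simp add: sfE.simps(2) distrib_left sum.distrib scaleR_add_right)
qed

lemma sfE_Suc: "(\<Sum>i<p. soul (X (Ev i)) * sfE p X P n (dcoord (Ev i) g)) = real (Suc n) *\<^sub>R sfE p X P (Suc n) g"
 by (simp add: sfE.simps(2))

lemma soul_central:
 assumes "evd p X P" "i < p"
 shows "f * (soul (X (Ev i)) * h) = soul (X (Ev i)) * (f * h)"
proof -
 have "f * soul (X (Ev i)) = soul (X (Ev i)) * f"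
  using gs_even_central[OF gs_parity_soul, of "X (Ev i)" f] assms by (simp add: evd_def)
 then show ?thesis by (simp flip: mult.assoc)
qed

text \<open>A Cauchy product, by induction after multiplication with \<open>Suc n\<close>:
  derivatives of the left factor yield each summand with coefficient \<open>a\<close>, those of the
  right factor with \<open>Suc n - a\<close>, and the two add up to \<open>Suc n\<close>.\<close>

lemma sfE_mult:
 assumes U: "eopen p U" "bodypt p X \<in> U" and e: "evd p X P"
  and "sfn p U g" "sfn p U h"
 shows "sfE p X P n (%x. g x * h x) = (\<Sum>a\<le>n. sfE p X P a g * sfE p X P (n - a) h)"
 using assms(4,5)
proof (induction n arbitrary: g h)
 case 0
 then show ?case using e by (simp add: msub_mult evd_def)
next
 case (Suc n)
 let ?E = "sfE p X P"
 let ?s = "%i. soul (X (Ev i))"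
 let ?d = "%i. dcoord (Ev i)"
 have step: "?s i * ?E n (?d i (%x. g x * h x))
   = (\<Sum>a\<le>n. ?s i * ?E a (?d i g) * ?E (n - a) h) + (\<Sum>a\<le>n. ?E a g * (?s i * ?E (n - a) (?d i h)))"
  if i: "i < p" for i
 proof -
  note di = sfn_dcoord_Ev[OF Suc.prems(1) i] sfn_dcoord_Ev[OF Suc.prems(2) i]
  have "?E n (?d i (%x. g x * h x)) = ?E n (%x. ?d i g x * h x + g x * ?d i h x)"
   by (rule sfE_cong[OF U dcoord_Ev_mult[OF U(1) Suc.prems _ i]])
  also have "... = ?E n (%x. ?d i g x * h x) + ?E n (%x. g x * ?d i h x)"
   by (intro sfE_add[OF U e] sfn_mult[OF U(1)] di Suc.prems)
  finally show ?thesis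
   by (simp add: Suc.IH di Suc.prems distrib_left sum_distrib_left mult.assoc soul_central[OF e i])
 qed
 have "real (Suc n) *\<^sub>R ?E (Suc n) (%x. g x * h x) = (\<Sum>i<p. ?s i * ?E n (?d i (%x. g x * h x)))"
  by (rule sfE_Suc[symmetric])
 also have "... = (\<Sum>i<p. \<Sum>a\<le>n. ?s i * ?E a (?d i g) * ?E (n - a) h) + (\<Sum>i<p. \<Sum>a\<le>n. ?E a g * (?s i * ?E (n - a) (?d i h)))"
  unfolding sum.distrib[of _ _ "{..<p}", symmetric] by (intro sum.cong refl step) simp
 also have "(\<Sum>i<p. \<Sum>a\<le>n. ?s i * ?E a (?d i g) * ?E (n - a) h)
   = (\<Sum>a\<le>n. real (Suc a) *\<^sub>R (?E (Suc a) g * ?E (n - a) h))"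
  by (subst sum.swap) (simp add: sum_distrib_right[symmetric] sfE_Suc del: of_nat_Suc)
 also have "... = (\<Sum>a\<le>Suc n. real a *\<^sub>R (?E a g * ?E (Suc n - a) h))"
  by (subst sum.atMost_Suc_shift) (simp del: of_nat_Suc)
 also have "(\<Sum>i<p. \<Sum>a\<le>n. ?E a g * (?s i * ?E (n - a) (?d i h)))
   = (\<Sum>a\<le>n. real (Suc n - a) *\<^sub>R (?E a g * ?E (Suc n - a) h))"
  by (subst sum.swap, intro sum.cong refl)
   (simp add: sum_distrib_left[symmetric] sfE_Suc Suc_diff_le del: of_nat_Suc)
 also have "... = (\<Sum>a\<le>Suc n. real (Suc n - a) *\<^sub>R (?E a g * ?E (Suc n - a) h))"
  by simp
 also have "(\<Sum>a\<le>Suc n. real a *\<^sub>R (?E a g * ?E (Suc n - a) h)) + ...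
   = (\<Sum>a\<le>Suc n. real (Suc n) *\<^sub>R (?E a g * ?E (Suc n - a) h))"
  unfolding sum.distrib[symmetric] scaleR_add_left[symmetric]
  by (intro sum.cong refl) (auto simp flip: of_nat_add)
 also have "... = real (Suc n) *\<^sub>R (\<Sum>a\<le>Suc n. ?E a g * ?E (Suc n - a) h)"
  by (simp only: scaleR_sum_right)
 finally show ?case by (metis of_nat_eq_0_iff old.nat.distinct(2) scaleR_cancel_left)
qed

lemma sf_eval_mult:
 assumes U: "eopen p U" "bodypt p X \<in> U" and e: "evd p X P"
  and gh: "sfn p U g" "sfn p U h"
 shows "sf_eval p (%x. g x * h x) X P = sf_eval p g X P * sf_eval p h X P"
proof (rule gs_eqI)
 fix k assume ok: "mono_ok k"
 define N where "N = size k"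
 let ?E = "sfE p X P"
 let ?f = "%x. ksign (fst x) (snd x)"
 have l: "coeff (sf_eval p g X P) a = coeff (\<Sum>n\<le>N. ?E n g) a" if "a \<subseteq># k" for a g
 proof (cases "mono_ok a")
  case True
  then show ?thesis using sf_eval_coeff[OF e True, of N] size_mset_mono[OF that] by (simp add: N_def)
 qed (simp add: coeff_not_ok)
 have "coeff (sf_eval p g X P * sf_eval p h X P) k = coeff ((\<Sum>n\<le>N. ?E n g) * (\<Sum>n\<le>N. ?E n h)) k"
  unfolding coeff_mult[OF ok] by (intro sum.cong refl) (auto simp: msplits_def l)
 also have "... = (\<Sum>(i, j)\<in>{..N} \<times> {..N}. coeff (?E i g * ?E j h) k)"
  by (simp add: sum_product sum.cartesian_product case_prod_unfold)
 \<comment> \<open>A product of pieces of degrees \<open>i\<close> and \<open>j\<close> vanishes to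
   order \<open>i + j\<close>, which beyond \<open>N\<close> exceeds the size of
   \<open>k\<close>.\<close>
 also have "... = (\<Sum>(i, j)\<in>{(i, j). i + j \<le> N}. coeff (?E i g * ?E j h) k)"
 proof (rule sum.mono_neutral_right)
  show "ALL x:{..N} \<times> {..N} - {(i, j). i + j \<le> N}. (case x of (i, j) => coeff (?E i g * ?E j h) k) = 0"
  proof
   fix x assume "x \<in> {..N} \<times> {..N} - {(i, j). i + j \<le> N}"
   then obtain i j where x: "x = (i, j)" "~ i + j \<le> N" by auto
   have "gsord (%_. True) (i + j) (?E i g * ?E j h)" by (intro gsord_mult gsord_sfE)
   then show "(case x of (i, j) => coeff (?E i g * ?E j h) k) = 0" using x by (auto simp: gsord_def N_def)
  qed
 qed auto
 also have "... = (\<Sum>n\<le>N. \<Sum>i\<le>n. coeff (?E i g * ?E (n - i) h) k)"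
  by (rule sum.triangle_reindex_eq)
 also have "... = coeff (sf_eval p (%x. g x * h x) X P) k"
  unfolding sf_eval_coeff[OF e ok order_refl] sfE_mult[OF U e gh] coeff_sum N_def ..
 finally show "coeff (sf_eval p (%x. g x * h x) X P) k = coeff (sf_eval p g X P * sf_eval p h X P) k" ..
qed

lemma vderiv_dcoord_Ev:
 "sfn p U g ==> x \<in> U ==> i < p ==> dcoord (Ev i) (%x. vderiv v (g x)) x = vderiv v (dcoord (Ev i) g x)"
 by (rule dcoord_Ev_linear[where c = "%m. lsign v m * real (count m v + 1)" and \<pi> = "add_mset v"])
  (simp_all add: coeff_vderiv)

lemma wscale_dcoord_Ev:
 "sfn p U g ==> x \<in> U ==> i < p ==> dcoord (Ev i) (%x. wscale W (g x)) x = wscale W (dcoord (Ev i) g x)"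
 by (rule dcoord_Ev_linear[where c = "%m. \<Sum>v\<in>#m. W v" and \<pi> = "%m. m"]) simp_all

lemma sfn_vderiv: "eopen p U ==> sfn p U g ==> sfn p U (%x. vderiv v (g x))"
 by (rule sfn_linear[where c = "%m. lsign v m * real (count m v + 1)" and \<pi> = "add_mset v"])
  (simp_all add: coeff_vderiv)

lemma sfn_wscale: "eopen p U ==> sfn p U g ==> sfn p U (%x. wscale W (g x))"
 by (rule sfn_linear[where c = "%m. \<Sum>v\<in>#m. W v" and \<pi> = "%m. m"]) simp_all

subsection \<open>The chain rule for evaluations\<close>

context superder
begin

text \<open>Each coefficient of \<open>f\<close>, \<open>f'\<close> and \<open>D (f 0)\<close> is
  already that of one approximation. Its index has to exceed the size of \<open>k\<close> and of all
  monomials on which the coefficient of \<open>D\<close> at \<open>k\<close> depends.\<close>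

lemma R_lim:
 assumes "!!M. R (T M) (T' M)" "!!M s. gsord (%_. True) M (f s - T M s)" "!!M. gsord (%_. True) M (f' - T' M)"
 shows "R f f'"
proof -
 have key: "EX M. (ALL s. coeff (f s) k = coeff (T M s) k) & coeff f' k = coeff (T' M) k &
   coeff (D (f 0)) k = coeff (D (T M 0)) k" for k
 proof -
  obtain K where K: "finite K" "!!f. (ALL m:K. coeff f m = 0) ==> coeff (D f) k = 0"
   using clin_cont[OF clin_D, of k] by auto
  define M where "M = Suc (Max (size ` insert k K))"
  have less: "size m < M" if "m \<in> insert k K" for m
   unfolding M_def less_Suc_eq_le using that K(1) by (intro Max_ge) auto
  have a: "coeff (f s - T M s) m = 0" "coeff (f' - T' M) m = 0" if "m \<in> insert k K" for m s
   using assms(2)[of M s] assms(3)[of M] less[OF that] unfolding gsord_def by simp_all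
  have "coeff (D (f 0 - T M 0)) k = 0" using K(2) a by blast
  then have "coeff (D (f 0)) k = coeff (D (T M 0)) k" by (simp add: clin_diff[OF clin_D])
  then show ?thesis using a[of k] by auto
 qed
 show ?thesis
  unfolding R_def cder_def
 proof (intro conjI allI impI)
  fix k
  obtain M where M: "!!s. coeff (f s) k = coeff (T M s) k" "coeff f' k = coeff (T' M) k"
    "coeff (D (f 0)) k = coeff (D (T M 0)) k" using key[of k] by auto
  show "((%s. coeff (f s) k) has_real_derivative coeff (f' - D (f 0)) k) (at 0)"
   using assms(1)[of M] by (simp add: M R_def cder_def)
 next
  assume d: d
  show "f' = D (f 0)"
  proof (rule gs_eqI)
   fix k
   obtain M where M: "coeff f' k = coeff (T' M) k"
     "coeff (D (f 0)) k = coeff (D (T M 0)) k" using key[of k] by auto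
   have "T' M = D (T M 0)" using assms(1)[of M] d unfolding R_def by blast
   then show "coeff f' k = coeff (D (f 0)) k" by (simp add: M)
  qed
 qed
qed

text \<open>The derivative of an even coordinate splits into \<open>\<beta>\<close>, of its body,
  and \<open>\<zeta>\<close>, of its soul. Moving the body keeps the degree \<open>n\<close>,
  whereas differentiating a soul uses up one of the \<open>n\<close> factors and leaves degree
  \<open>n - 1\<close>. Summed over \<open>n\<close>, the two parts recombine.\<close>

lemma R_sfE:
 assumes U: "eopen p U"
  and V: "finite V" "!!v. v \<in> V ==> ~ is_par v"
  and e: "!!s. evd p (X s) (P s)" "!!s. bodypt p (X s) \<in> U"
  and off: "!!s v. v \<notin> V ==> subst_var (X s) (P s) v = subst_var (X 0) (P 0) v"
  and RX: "!!i. i < p ==> R (%s. soul (X s (Ev i))) (\<zeta> i)"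
   "!!i. i < p ==> ((%s. body (X s (Ev i))) has_real_derivative \<beta> i) (at 0)"
   "!!i. d ==> i < p ==> \<beta> i = 0"
  and R\<sigma>: "!!v. v \<in> V ==> R (%s. subst_var (X s) (P s) v) (\<sigma>' v)"
  and g: "sfn p U g" "!!x. x \<in> U ==> gs_vars (V \<union> Collect is_par) (g x)"
 shows "R (%s. sfE p (X s) (P s) n g)
  ((\<Sum>i<p. \<beta> i *\<^sub>R sfE p (X 0) (P 0) n (dcoord (Ev i) g))
   + (\<Sum>i<p. \<zeta> i * (if n = 0 then 0 else sfE p (X 0) (P 0) (n - 1) (dcoord (Ev i) g)))
   + (\<Sum>v\<in>V. \<sigma>' v * sfE p (X 0) (P 0) n (%x. vderiv v (g x)))
   + sfE p (X 0) (P 0) n (%x. wscale (parw c) (g x)))"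
 using g
proof (induction n arbitrary: g)
 case 0
 let ?\<sigma> = "%s. subst_var (X s) (P s)"
 let ?b = "%s. bodypt p (X s)"
 have gd: "good (?\<sigma> s)" for s using e(1) by (simp add: evd_def)
 have cd: "cder (%s. g (?b s)) (\<Sum>i<p. \<beta> i *\<^sub>R dcoord (Ev i) g (?b 0))"
  unfolding cder_def
 proof
  fix k
  have "((%s. coeff (g (?b s)) k) has_real_derivative
    (\<Sum>i<p. \<beta> i * rpd i (%x. coeff (g x) k) (?b 0))) (at 0)"
   by (rule chain_rule_curve[OF U, of "%x. coeff (g x) k" ?b \<beta>])
    (use 0(1) e(2) RX(2) in \<open>auto simp: sfn_def bodypt_def\<close>)
  then show "((%s. coeff (g (?b s)) k) has_real_derivative
    coeff (\<Sum>i<p. \<beta> i *\<^sub>R dcoord (Ev i) g (?b 0)) k) (at 0)"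
   by (simp add: coeff_dcoord_Ev)
 qed
 have "R (%s. msub (?\<sigma> s) (g (?b s))) (msub (?\<sigma> 0) (\<Sum>i<p. \<beta> i *\<^sub>R dcoord (Ev i) g (?b 0))
  + ((\<Sum>v\<in>V. \<sigma>' v * msub (?\<sigma> 0) (vderiv v (g (?b 0)))) + msub (?\<sigma> 0) (wscale (parw c) (g (?b 0)))))"
  by (rule R_msub[OF V gd off _ R\<sigma> _ cd])
   (use e(2) 0(2) RX(3) in \<open>auto simp: subst_var_def\<close>)
 then show ?case
  by (simp add: clin_sum[OF clin_msub[OF gd]] clin_scaleR[OF clin_msub[OF gd]] add.assoc)
next
 case (Suc n)
 let ?E = "sfE p (X 0) (P 0)"
 let ?d = "%i. dcoord (Ev i)"
 let ?s = "%i. soul (X 0 (Ev i))"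
 \<comment> \<open>Summation against the souls turns this into \<open>n\<close> times the piece of
   degree \<open>n\<close>; together with the term from differentiating the outer soul that makes
   the factor \<open>Suc n\<close>.\<close>
 define mm where "mm h = (if n = 0 then 0 else ?E (n - 1) h)" for h
 define F where "F g = (\<Sum>i<p. \<beta> i *\<^sub>R ?E n (?d i g)) + (\<Sum>i<p. \<zeta> i * mm (?d i g))
  + (\<Sum>v\<in>V. \<sigma>' v * ?E n (%x. vderiv v (g x))) + ?E n (%x. wscale (parw c) (g x))" for g
 have vars: "gs_vars (V \<union> Collect is_par) (?d i g x)" if "i < p" "x \<in> U" for i x
  by (rule gs_vars_dcoord_Ev[OF U that(2,1) Suc.prems(2)])
 have RF: "R (%s. (1 / real (Suc n)) *\<^sub>R (\<Sum>i<p. soul (X s (Ev i)) * sfE p (X s) (P s) n (?d i g)))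
   ((1 / real (Suc n)) *\<^sub>R (\<Sum>i<p. \<zeta> i * ?E n (?d i g) + sgn_if (d & False) *\<^sub>R (?s i * F (?d i g))))"
 proof (intro R_scaleR R_sum R_mult)
  fix i assume "i \<in> {..<p}"
  then have i: "i < p" by simp
  show "R (%s. sfE p (X s) (P s) n (?d i g)) (F (?d i g))"
   unfolding F_def mm_def using Suc.IH[OF sfn_dcoord_Ev[OF Suc.prems(1) i] vars[OF i]] .
  show "R (%s. soul (X s (Ev i))) (\<zeta> i)" by (rule RX(1)[OF i])
  show "gs_parity False (?s i)" using e(1)[of 0] i by (simp add: evd_def gs_parity_soul)
 qed
 have E_cong: "?E n' (?d k (?d i g)) = ?E n' (?d i (?d k g))" if "i < p" "k < p" for i k n'
  by (rule sfE_cong[OF U e(2)]) (rule dcoord_Ev_commute[OF U Suc.prems(1) _ that(2,1)])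
 have E_v: "?E n (%x. vderiv v (?d i g x)) = ?E n (?d i (%x. vderiv v (g x)))" if "i < p" for i v
  by (rule sfE_cong[OF U e(2)]) (simp add: vderiv_dcoord_Ev[OF Suc.prems(1) _ that])
 have E_w: "?E n (%x. wscale (parw c) (?d i g x)) = ?E n (?d i (%x. wscale (parw c) (g x)))" if "i < p" for i
  by (rule sfE_cong[OF U e(2)]) (simp add: wscale_dcoord_Ev[OF Suc.prems(1) _ that])
 have sc: "f * (?s i * h) = ?s i * (f * h)" if "i < p" for i f h
  by (rule soul_central[OF e(1) that])
 have m: "(\<Sum>i<p. ?s i * mm (?d i h)) = real n *\<^sub>R ?E n h" for h
  by (cases n) (simp_all add: mm_def sfE_Suc)
 have mm_cong: "mm (?d k (?d i g)) = mm (?d i (?d k g))" if "i < p" "k < p" for i k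
  using that by (simp add: mm_def E_cong)
 have "(\<Sum>i<p. ?s i * F (?d i g)) = (\<Sum>i<p. (\<Sum>k<p. \<beta> k *\<^sub>R (?s i * ?E n (?d i (?d k g))))
   + (\<Sum>k<p. \<zeta> k * (?s i * mm (?d i (?d k g))))
   + (\<Sum>v\<in>V. \<sigma>' v * (?s i * ?E n (?d i (%x. vderiv v (g x)))))
   + ?s i * ?E n (?d i (%x. wscale (parw c) (g x))))"
  unfolding F_def
  by (intro sum.cong refl) (simp add: distrib_left sum_distrib_left E_cong mm_cong E_v E_w sc)
 also have "... = (\<Sum>k<p. \<beta> k *\<^sub>R (real (Suc n) *\<^sub>R ?E (Suc n) (?d k g)))
   + (\<Sum>k<p. \<zeta> k * (real n *\<^sub>R ?E n (?d k g)))
   + (\<Sum>v\<in>V. \<sigma>' v * (real (Suc n) *\<^sub>R ?E (Suc n) (%x. vderiv v (g x))))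
   + real (Suc n) *\<^sub>R ?E (Suc n) (%x. wscale (parw c) (g x))"
 proof -
  have 1: "(\<Sum>i<p. \<Sum>k<p. \<beta> k *\<^sub>R (?s i * ?E n (?d i (?d k g))))
    = (\<Sum>k<p. \<beta> k *\<^sub>R (real (Suc n) *\<^sub>R ?E (Suc n) (?d k g)))"
   by (subst sum.swap) (simp only: scaleR_sum_right[symmetric] sfE_Suc)
  have 2: "(\<Sum>i<p. \<Sum>k<p. \<zeta> k * (?s i * mm (?d i (?d k g))))
    = (\<Sum>k<p. \<zeta> k * (real n *\<^sub>R ?E n (?d k g)))"
   by (subst sum.swap) (simp only: sum_distrib_left[symmetric] m)
  have 3: "(\<Sum>i<p. \<Sum>v\<in>V. \<sigma>' v * (?s i * ?E n (?d i (%x. vderiv v (g x)))))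
    = (\<Sum>v\<in>V. \<sigma>' v * (real (Suc n) *\<^sub>R ?E (Suc n) (%x. vderiv v (g x))))"
   by (subst sum.swap) (simp only: sum_distrib_left[symmetric] sfE_Suc)
  show ?thesis by (simp only: sum.distrib 1 2 3 sfE_Suc)
 qed
 finally have s: "(\<Sum>i<p. ?s i * F (?d i g)) = ..." .
 have "(1 / real (Suc n)) *\<^sub>R (\<Sum>i<p. \<zeta> i * ?E n (?d i g) + sgn_if (d & False) *\<^sub>R (?s i * F (?d i g)))
  = (\<Sum>i<p. \<beta> i *\<^sub>R ?E (Suc n) (?d i g)) + (\<Sum>i<p. \<zeta> i * ?E n (?d i g))
   + (\<Sum>v\<in>V. \<sigma>' v * ?E (Suc n) (%x. vderiv v (g x))) + ?E (Suc n) (%x. wscale (parw c) (g x))"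
 proof -
  have z: "(\<Sum>k<p. \<zeta> k * (real n *\<^sub>R ?E n (?d k g))) + (\<Sum>i<p. \<zeta> i * ?E n (?d i g))
    = real (Suc n) *\<^sub>R (\<Sum>i<p. \<zeta> i * ?E n (?d i g))"
   by (simp add: scaleR_sum_right algebra_simps sum.distrib scaleR_add_left)
  have "(\<Sum>i<p. \<zeta> i * ?E n (?d i g)) + (\<Sum>i<p. ?s i * F (?d i g))
    = real (Suc n) *\<^sub>R ((\<Sum>i<p. \<beta> i *\<^sub>R ?E (Suc n) (?d i g)) + (\<Sum>i<p. \<zeta> i * ?E n (?d i g))
   + (\<Sum>v\<in>V. \<sigma>' v * ?E (Suc n) (%x. vderiv v (g x))) + ?E (Suc n) (%x. wscale (parw c) (g x)))"
   unfolding s scaleR_add_right z[symmetric]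
   by (simp add: scaleR_sum_right mult.commute)
  then show ?thesis by (simp add: sum.distrib)
 qed
 then show ?case using RF by (simp add: sfE.simps(2))
qed

end

subsection \<open>Evaluation at admissible arguments\<close>

definition cs :: "nat => nat => coord set" where
 "cs p q = Ev ` {..<p} \<union> Od ` {..<q}"

definition svars :: "nat => coord set => var set" where
 "svars q B = Xi ` {..<q} \<union> Mom ` B \<union> Collect is_par"

definition SF :: "nat => nat => coord set => pt set => (pt => gs) => bool" where
 "SF p q B U g \<longleftrightarrow> superfun p U (svars q B) g"

definition evok :: "nat => nat => coord set => pt set => (coord => gs) => (coord => gs) => bool" where
 "evok p q B U X P \<longleftrightarrow> (ALL a:cs p q. gs_parity (codd a) (X a)) &
   (ALL a:B. gs_parity (codd a) (P a) & coeff (P a) {#} = 0) & bodypt p X \<in> U"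

text \<open>The values of the arguments at irrelevant coordinates are arbitrary; with 0 in their place the
  substitution is well-defined.\<close>

definition rst :: "coord set => (coord => gs) => coord => gs" where
 "rst A X a = (if a \<in> A then X a else 0)"

lemma finite_cs [simp]: "finite (cs p q)"
 by (simp add: cs_def)

lemma mem_cs [simp]: "Ev i \<in> cs p q \<longleftrightarrow> i < p" "Od j \<in> cs p q \<longleftrightarrow> j < q"
 by (auto simp: cs_def)

lemma codd_simps [simp]: "codd (Ev i) = False" "codd (Od j) = True"
 by (simp_all add: codd_def)

lemma subst_var_simps [simp]: "subst_var X P (Xi j) = X (Od j)" "subst_var X P (Mom a) = P a"
 "subst_var X P (Par b n) = gs_var (Par b n)"
 by (simp_all add: subst_var_def)

lemma vodd_simps [simp]: "vodd (Xi j)" "vodd (Mom a) = codd a" "vodd (Par b n) = b"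
 by (simp_all add: vodd_def)

lemma is_par_simps [simp]: "~ is_par (Xi j)" "~ is_par (Mom a)" "is_par (Par b n)"
 by (simp_all add: is_par_def)

lemma SF_altdef: "SF p q B U g \<longleftrightarrow> (ALL x:U. gs_vars (svars q B) (g x)) & sfn p U g"
 by (simp add: SF_def superfun_def sfn_def)

lemma SF_D: "SF p q B U g ==> x \<in> U ==> gs_vars (svars q B) (g x)" "SF p q B U g ==> sfn p U g"
 by (simp_all add: SF_altdef)

lemma odd_body: "gs_parity True f ==> coeff f {#} = 0"
 by (auto simp: gs_parity_altdef)

lemma bodypt_rst [simp]: "bodypt p (rst (cs p q) X) = bodypt p X"
 by (auto simp: bodypt_def rst_def)

lemma bodypt_eq: "(!!i. i < p ==> body (X (Ev i)) = body (Y (Ev i))) ==> bodypt p X = bodypt p Y"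
 by (auto simp: bodypt_def)

lemma evokD:
 assumes "evok p q B U X P"
 shows "i < p ==> gs_parity False (X (Ev i))" "j < q ==> gs_parity True (X (Od j))"
  "a \<in> cs p q ==> gs_parity (codd a) (X a)"
  "a \<in> B ==> gs_parity (codd a) (P a)" "a \<in> B ==> coeff (P a) {#} = 0" "bodypt p X \<in> U"
 using assms unfolding evok_def by (force simp: cs_def)+

lemma evd_rst:
 assumes "finite B" "evok p q B U X P"
 shows "evd p (rst (cs p q) X) (rst B P)"
proof -
 let ?\<sigma> = "subst_var (rst (cs p q) X) (rst B P)"
 have "good ?\<sigma>"
  unfolding good_def
 proof (intro conjI allI)
  fix v
  show "gs_parity (vodd v) (?\<sigma> v)"
   using evokD[OF assms(2)] gs_parity_var[of v] by (cases v) (auto simp: rst_def)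
  have "coeff (X (Od j)) {#} = 0" if "j < q" for j
   using evokD(2)[OF assms(2) that] by (rule odd_body)
  then show "coeff (?\<sigma> v) {#} = 0"
   using evokD(5)[OF assms(2)] by (cases v) (auto simp: rst_def coeff_gs_var)
 next
  fix k :: "var multiset"
  have *: "v \<in> Xi ` {..<q} \<union> Mom ` B \<union> set_mset k" if "coeff (?\<sigma> v) k ~= 0" for v
   using that by (cases v) (auto simp: rst_def coeff_gs_var split: if_splits)
  show "finite {v. coeff (?\<sigma> v) k ~= 0}"
   by (rule finite_subset, rule subsetI, rule *) (use assms(1) in simp_all)
 qed
 then show ?thesis using evokD(1)[OF assms(2)] by (simp add: evd_def rst_def)
qed

lemma foldr_rpd_0: "foldr rpd l (%x. 0) = (%x. 0)"
 by (induction l) (auto simp: rpd_const)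

lemma sf_eval_cong:
 assumes U: "eopen p U" "bodypt p X \<in> U" and g: "!!x. x \<in> U ==> g x = g' x"
  "!!x. x \<in> U ==> gs_vars W (g x)"
  and X: "!!i. i < p ==> X (Ev i) = X' (Ev i)" "!!v. v \<in> W ==> subst_var X P v = subst_var X' P' v"
 shows "sf_eval p g X P = sf_eval p g' X' P'"
proof -
 have b: "bodypt p X' = bodypt p X" by (rule bodypt_eq) (simp add: X(1))
 have t: "sf_eval_term p g X P l m = sf_eval_term p g' X' P' l m" if l: "l \<in> lists {..<p}" for l m
 proof -
  have 1: "foldr rpd l (%y. coeff (g' y) m) (bodypt p X') = foldr rpd l (%y. coeff (g y) m) (bodypt p X)"
   unfolding b by (rule foldr_rpd_cong[OF U(1) l _ U(2)]) (simp add: g(1))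
  have 2: "map (%i. soul (X' (Ev i))) l = map (%i. soul (X (Ev i))) l" using l X(1) by auto
  show ?thesis
  proof (cases "set_mset m \<subseteq> W")
   case True
   then have 3: "map (subst_var X' P') (sorted_list_of_multiset m) = map (subst_var X P) (sorted_list_of_multiset m)"
    using X(2) by auto
   show ?thesis by (simp only: sf_eval_term_def 1 2 3)
  next
   case False
   have "foldr rpd l (%y. coeff (g y) m) (bodypt p X) = foldr rpd l (%y. 0) (bodypt p X)"
    by (rule foldr_rpd_cong[OF U(1) l _ U(2)]) (use False g(2) in \<open>auto simp: gs_vars_def\<close>)
   then show ?thesis by (simp add: sf_eval_term_def 1 foldr_rpd_0)
  qed
 qed
 have "infsum (%x. coeff (sf_eval_term p g X P (fst x) (snd x)) k) (lists {..<p} \<times> S)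
  = infsum (%x. coeff (sf_eval_term p g' X' P' (fst x) (snd x)) k) (lists {..<p} \<times> S)" for k S
  by (rule infsum_cong) (simp only: mem_Times_iff t)
 then show ?thesis by (simp add: sf_eval_def sf_eval_deg_def case_prod_unfold)
qed

lemma sf_eval_norm:
 assumes "eopen p U" "bodypt p X \<in> U" "SF p q B U g"
 shows "sf_eval p g X P = sf_eval p g (rst (cs p q) X) (rst B P)"
 by (rule sf_eval_cong[OF assms(1,2) refl, where W = "svars q B"])
  (use SF_D(1)[OF assms(3)] in \<open>auto simp: rst_def svars_def is_par_def\<close>)

lemma gs_vars_mono: "gs_vars V f ==> V \<subseteq> W ==> gs_vars W f"
 unfolding gs_vars_def by (meson order_trans)

lemma gs_vars_0 [simp]: "gs_vars V 0"
 by (simp add: gs_vars_def)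

lemma gs_vars_1 [simp]: "gs_vars V 1"
 by (simp add: gs_vars_def)

lemma gs_vars_add: "gs_vars V f ==> gs_vars V g ==> gs_vars V (f + g)"
 unfolding gs_vars_def by (metis add.right_neutral coeff_arith(3))

lemma gs_vars_scaleR: "gs_vars V f ==> gs_vars V (r *\<^sub>R f)"
 by (simp add: gs_vars_def)

lemma gs_vars_diff: "gs_vars V f ==> gs_vars V g ==> gs_vars V (f - g)"
 using gs_vars_add[of V f "(-1) *\<^sub>R g"] gs_vars_scaleR[of V g "-1"] by simp

lemma gs_vars_sum: "(!!i. i \<in> A ==> gs_vars V (f i)) ==> gs_vars V (sum f A)"
 by (induction A rule: infinite_finite_induct) (auto intro: gs_vars_add)

lemma gs_vars_of_real [simp]: "gs_vars V (of_real r)"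
 by (simp add: of_real_def gs_vars_scaleR)

lemma gs_vars_var: "v \<in> V ==> gs_vars V (gs_var v)"
 by (simp add: gs_vars_def coeff_gs_var)

lemma gs_vars_soul: "gs_vars V f ==> gs_vars V (soul f)"
 by (simp add: soul_def gs_vars_diff)

lemma gs_vars_vderiv: "gs_vars V f ==> gs_vars V (vderiv v f)"
 unfolding gs_vars_def
proof (intro allI impI)
 fix m assume *: "ALL m. coeff f m ~= 0 --> set_mset m \<subseteq> V" "coeff (vderiv v f) m ~= 0"
 then have "mono_ok m" using coeff_not_ok by blast
 with * have "coeff f (add_mset v m) ~= 0" by (auto simp: coeff_vderiv)
 with * have "set_mset (add_mset v m) \<subseteq> V" by blast
 then show "set_mset m \<subseteq> V" by simp
qed

lemma gs_vars_wscale: "gs_vars V f ==> gs_vars V (wscale W f)"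
 by (simp add: gs_vars_def)

lemma dcoord_Od: "dcoord (Od j) g = (%x. vderiv (Xi j) (g x))"
 by (simp add: dcoord_def fun_eq_iff)

lemma dmom_eq: "dmom a g = (%x. vderiv (Mom a) (g x))"
 by (simp add: dmom_def fun_eq_iff)

lemma gs_parity_dcoord:
 assumes "eopen p U" "x \<in> U" "a \<in> cs p q" "!!y. y \<in> U ==> gs_parity b (g y)"
 shows "gs_parity (b ~= codd a) (dcoord a g x)"
proof (cases a)
 case (Ev i)
 then show ?thesis using gs_parity_dcoord_Ev[OF assms(1,2) _ assms(4)] assms(3) by simp
next
 case (Od j)
 then show ?thesis using gs_parity_vderiv[OF assms(4)[OF assms(2)], of "Xi j"] by (simp add: dcoord_Od)
qed

lemma gs_parity_dmom: "gs_parity b (g x) ==> gs_parity (b ~= codd a) (dmom a g x)"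
 using gs_parity_vderiv[of b "g x" "Mom a"] by (simp add: dmom_eq)

lemma SF_dcoord:
 assumes U: "eopen p U" and "SF p q B U g" "a \<in> cs p q'"
 shows "SF p q B U (dcoord a g)"
proof (cases a)
 case (Ev i)
 then show ?thesis using assms gs_vars_dcoord_Ev[OF U _ _ SF_D(1)[OF assms(2)]]
  by (auto simp: SF_altdef sfn_dcoord_Ev)
next
 case (Od j)
 then show ?thesis using assms by (auto simp: SF_altdef dcoord_Od gs_vars_vderiv sfn_vderiv)
qed

lemma SF_dmom: "eopen p U ==> SF p q B U g ==> SF p q B U (dmom a g)"
 by (auto simp: SF_altdef dmom_eq gs_vars_vderiv sfn_vderiv)

lemma SF_wscale: "eopen p U ==> SF p q B U g ==> SF p q B U (%x. wscale W (g x))"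
 by (auto simp: SF_altdef gs_vars_wscale sfn_wscale)

lemma SF_add: "eopen p U ==> SF p q B U g ==> SF p q B U h ==> SF p q B U (%x. g x + h x)"
 by (auto simp: SF_altdef gs_vars_add sfn_add)

lemma SF_mult: "eopen p U ==> SF p q B U g ==> SF p q B U h ==> SF p q B U (%x. g x * h x)"
 by (auto simp: SF_altdef gs_vars_mult sfn_mult)

lemma SF_sum:
 "eopen p U ==> (!!i. i \<in> A ==> SF p q B U (g i)) ==> SF p q B U (%x. \<Sum>i\<in>A. g i x)"
 by (auto simp: SF_altdef gs_vars_sum sfn_sum)

lemma SF_const: "eopen p U ==> gs_vars (svars q B) a ==> SF p q B U (%x. a)"
 by (auto simp: SF_altdef sfn_const)

lemma SF_scaleR: "eopen p U ==> SF p q B U g ==> SF p q B U (%x. r *\<^sub>R g x)"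
 by (auto simp: SF_altdef gs_vars_scaleR sfn_def smooth_cmult)

lemma SF_diff: "eopen p U ==> SF p q B U g ==> SF p q B U h ==> SF p q B U (%x. g x - h x)"
 using SF_add[of p U q B g "%x. (-1) *\<^sub>R h x"] SF_scaleR[of p U q B h "-1"] by simp

lemma SF_cong: "eopen p U ==> SF p q B U g ==> (!!x. x \<in> U ==> g x = h x) ==> SF p q B U h"
 unfolding SF_altdef sfn_def by (auto intro: smooth_cong)

lemma svars_mono: "q \<le> q' ==> B \<subseteq> B' ==> svars q B \<subseteq> svars q' B'"
 by (auto simp: svars_def)

lemma SF_mono: "SF p q B U g ==> B \<subseteq> B' ==> SF p q B' U g"
 unfolding SF_altdef using svars_mono[of q q B B'] by (auto intro: gs_vars_mono)

lemma sf_eval_0: "sf_eval p (%x. 0) X P = 0"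
 by (rule gs_eqI) (simp add: sf_eval_def sf_eval_deg_def sf_eval_term_def foldr_rpd_0 case_prod_unfold)

lemma sf_eval_add:
 assumes U: "eopen p U" and B: "finite B" and e: "evok p q B U X P"
  and "SF p q B U g" "SF p q B U h"
 shows "sf_eval p (%x. g x + h x) X P = sf_eval p g X P + sf_eval p h X P"
proof -
 note b = evokD(6)[OF e]
 note n = sf_eval_norm[OF U b]
 have "sf_eval p (%x. g x + h x) (rst (cs p q) X) (rst B P)
   = sf_eval p g (rst (cs p q) X) (rst B P) + sf_eval p h (rst (cs p q) X) (rst B P)"
  by (rule gs_eqI)
   (simp add: sf_eval_coeff[OF evd_rst[OF B e] _ order_refl]
    sfE_add[OF U _ evd_rst[OF B e] SF_D(2)[OF assms(4)] SF_D(2)[OF assms(5)]] b sum.distrib)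
 then show ?thesis by (simp add: n[OF assms(4)] n[OF assms(5)] n[OF SF_add[OF U assms(4,5)]])
qed

lemma sf_eval_mult':
 assumes U: "eopen p U" and B: "finite B" and e: "evok p q B U X P"
  and "SF p q B U g" "SF p q B U h"
 shows "sf_eval p (%x. g x * h x) X P = sf_eval p g X P * sf_eval p h X P"
proof -
 note b = evokD(6)[OF e]
 note n = sf_eval_norm[OF U b]
 have "sf_eval p (%x. g x * h x) (rst (cs p q) X) (rst B P)
   = sf_eval p g (rst (cs p q) X) (rst B P) * sf_eval p h (rst (cs p q) X) (rst B P)"
  by (rule sf_eval_mult[OF U _ evd_rst[OF B e] SF_D(2)[OF assms(4)] SF_D(2)[OF assms(5)]]) (simp add: b)
 then show ?thesis by (simp add: n[OF assms(4)] n[OF assms(5)] n[OF SF_mult[OF U assms(4,5)]])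
qed

lemma sf_eval_sum:
 assumes U: "eopen p U" and B: "finite B" and e: "evok p q B U X P"
  and "!!i. i \<in> A ==> SF p q B U (g i)"
 shows "sf_eval p (%x. \<Sum>i\<in>A. g i x) X P = (\<Sum>i\<in>A. sf_eval p (g i) X P)"
 using assms(4)
proof (induction A rule: infinite_finite_induct)
 case (insert i A)
 then show ?case using sf_eval_add[OF U B e, of "g i" "%x. \<Sum>i\<in>A. g i x"] SF_sum[OF U, of A q B g] by simp
qed (simp_all add: sf_eval_0)

lemma sfE_soul_0:
 assumes "!!i. i < p ==> soul (X (Ev i)) = 0"
 shows "sfE p X P n g = (if n = 0 then msub (subst_var X P) (g (bodypt p X)) else 0)"
 by (cases n) (simp_all add: sfE.simps(2) assms)

lemma sf_eval_soul_0:
 assumes "evd p X P" "!!i. i < p ==> soul (X (Ev i)) = 0"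
 shows "sf_eval p g X P = msub (subst_var X P) (g (bodypt p X))"
 by (rule gs_eqI) (simp add: sf_eval_coeff[OF assms(1) _ order_refl] sfE_soul_0[of p X, OF assms(2)] if_distrib[of "%f. coeff f _"]
  if_distribR sum.delta cong: if_cong)

lemma coeff_sf_eval_empty:
 assumes U: "eopen p U" and B: "finite B" and e: "evok p q B U X P" and g: "SF p q B U g"
 shows "coeff (sf_eval p g X P) {#} = coeff (g (bodypt p X)) {#}"
proof -
 note b = evokD(6)[OF e]
 have gd: "good (subst_var (rst (cs p q) X) (rst B P))" using evd_rst[OF B e] by (simp add: evd_def)
 show ?thesis
  unfolding sf_eval_norm[OF U b g] sf_eval_coeff[OF evd_rst[OF B e] mono_ok_empty order_refl]
  by (simp add: coeff_msub_empty[OF gd])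
qed

lemma gs_parity_sfE:
 assumes "eopen p U" "bodypt p X \<in> U" "evd p X P" "!!x. x \<in> U ==> gs_parity b (g x)"
 shows "gs_parity b (sfE p X P n g)"
 using assms(4)
proof (induction n arbitrary: g)
 case 0
 then show ?case using assms by (simp add: gs_parity_msub evd_def)
next
 case (Suc n)
 have "gs_parity (False ~= b) (soul (X (Ev i)) * sfE p X P n (dcoord (Ev i) g))" if "i < p" for i
  using assms(3) that gs_parity_dcoord_Ev[OF assms(1) _ that Suc.prems]
  by (intro gs_parity_mult gs_parity_soul Suc.IH) (auto simp: evd_def)
 then show ?case by (auto simp: sfE.simps(2) intro!: gs_parity_scaleR gs_parity_sum)
qed

lemma gs_parity_sf_eval:
 assumes U: "eopen p U" and B: "finite B" and e: "evok p q B U X P" and g: "SF p q B U g"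
  and par: "!!x. x \<in> U ==> gs_parity b (g x)"
 shows "gs_parity b (sf_eval p g X P)"
proof -
 note b = evokD(6)[OF e]
 have "gs_parity b (\<Sum>n\<le>N. sfE p (rst (cs p q) X) (rst B P) n g)" for N
  using gs_parity_sfE[OF U _ evd_rst[OF B e] par] b by (intro gs_parity_sum) simp
 then show ?thesis
  unfolding sf_eval_norm[OF U b g] gs_parity_altdef
 proof (intro allI impI, goal_cases)
  case (1 m)
  then have "mono_ok m" using coeff_not_ok by blast
  then show ?case using 1 sf_eval_coeff[OF evd_rst[OF B e] _ order_refl, of m g] coeff_sum by metis
 qed
qed

lemma gs_vars_sfE:
 assumes "eopen p U" "bodypt p X \<in> U" "evd p X P" "!!x. x \<in> U ==> gs_vars V (g x)"
  "!!i. i < p ==> gs_vars W (X (Ev i))" "!!v. v \<in> V ==> gs_vars W (subst_var X P v)"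
 shows "gs_vars W (sfE p X P n g)"
 using assms(4)
proof (induction n arbitrary: g)
 case 0
 then show ?case using assms gs_vars_msub[of "subst_var X P" V "g (bodypt p X)" W] by (simp add: evd_def)
next
 case (Suc n)
 have "gs_vars W (soul (X (Ev i)) * sfE p X P n (dcoord (Ev i) g))" if "i < p" for i
  using that gs_vars_dcoord_Ev[OF assms(1) _ that Suc.prems]
  by (intro gs_vars_mult gs_vars_soul Suc.IH assms(5)) auto
 then show ?case by (auto simp: sfE.simps(2) intro!: gs_vars_scaleR gs_vars_sum)
qed

lemma gs_vars_sf_eval:
 assumes U: "eopen p U" and B: "finite B" and e: "evok p q B U X P" and g: "SF p q B U g"
  and W: "!!a. a \<in> cs p q ==> gs_vars W (X a)" "!!a. a \<in> B ==> gs_vars W (P a)" "Collect is_par \<subseteq> W"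
 shows "gs_vars W (sf_eval p g X P)"
proof -
 note b = evokD(6)[OF e]
 have v: "gs_vars W (subst_var (rst (cs p q) X) (rst B P) v)" if "v \<in> svars q B" for v
  using that W(3) by (cases v) (auto simp: svars_def rst_def intro!: W(1,2) gs_vars_var)
 have x: "gs_vars W (rst (cs p q) X (Ev i))" for i using W(1) by (simp add: rst_def)
 have "gs_vars W (\<Sum>n\<le>N. sfE p (rst (cs p q) X) (rst B P) n g)" for N
  using gs_vars_sfE[OF U _ evd_rst[OF B e] SF_D(1)[OF g] x v] b by (intro gs_vars_sum) simp
 then show ?thesis
  unfolding sf_eval_norm[OF U b g] gs_vars_def
 proof (intro allI impI, goal_cases)
  case (1 m)
  then have "mono_ok m" using coeff_not_ok by blast
  then show ?case using 1 sf_eval_coeff[OF evd_rst[OF B e] _ order_refl, of m g] coeff_sum by metis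
 qed
qed

abbreviation chain ::
 "nat => nat => coord set => (pt => gs) => (coord => gs) => (coord => gs) => (coord => gs) => (coord => gs) => gs" where
 "chain p q B g X P A C \<equiv> (\<Sum>a\<in>cs p q. A a * sf_eval p (dcoord a g) X P) + (\<Sum>a\<in>B. C a * sf_eval p (dmom a g) X P)"

context superder
begin

lemma R_cong:
 assumes "R f f'" "eventually (%s. f s = g s) (at 0)" "f 0 = g 0"
 shows "R g f'"
 using assms cder_cong[OF _ assms(2,3), of "f' - D (f 0)"] unfolding R_def by simp

lemma R_const_eq: "R (%s. a) f' ==> f' = D a"
 unfolding R_def using cder_unique[OF _ cder_const, of a "f' - D a"] by simp

lemma R_sf_eval_all:
 assumes U: "eopen p U" and B: "finite B" and g: "SF p q B U g"
  and e: "!!s. evok p q B U (X s) (P s)"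
  and RX: "!!a. a \<in> cs p q ==> R (%s. X s a) (X' a)"
  and RP: "!!a. a \<in> B ==> R (%s. P s a) (P' a)"
 shows "R (%s. sf_eval p g (X s) (P s))
  (chain p q B g (X 0) (P 0) X' P' + sf_eval p (%x. wscale (parw c) (g x)) (X 0) (P 0))"
proof -
 define Xn where "Xn s = rst (cs p q) (X s)" for s
 define Pn where "Pn s = rst B (P s)" for s
 define V where "V = Xi ` {..<q} \<union> Mom ` B"
 \<comment> \<open>As \<open>R\<close> records \<open>d/ds + D\<close>, the derivative of the body
   is the constant term of what is left after subtracting \<open>D\<close>.\<close>
 define \<beta> where "\<beta> i = coeff (X' (Ev i) - D (X 0 (Ev i))) {#}" for i
 define \<zeta> where "\<zeta> i = X' (Ev i) - of_real (\<beta> i)" for i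
 define \<sigma>' where "\<sigma>' v = (case v of Xi j => X' (Od j) | Mom a => P' a | Par b n => 0)" for v
 have b: "bodypt p (X s) \<in> U" for s using e[of s] by (simp add: evok_def)
 have ed: "evd p (Xn s) (Pn s)" for s unfolding Xn_def Pn_def by (rule evd_rst[OF B e])
 have nm: "sf_eval p h (X s) (P s) = sf_eval p h (Xn s) (Pn s)" if "SF p q B U h" for h s
  unfolding Xn_def Pn_def by (rule sf_eval_norm[OF U b that])
 have \<beta>: "((%s. body (X s (Ev i))) has_real_derivative \<beta> i) (at 0)" if "i < p" for i
  using RX[of "Ev i"] that by (simp add: R_def cder_def body_def \<beta>_def)
 have \<beta>0: "\<beta> i = 0" if "i < p" d for i
  using RX[of "Ev i"] that unfolding R_def by (simp add: \<beta>_def)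
 have \<zeta>: "R (%s. soul (X s (Ev i))) (\<zeta> i)" if "i < p" for i
 proof -
  have 1: "R (%s. (- body (X s (Ev i))) *\<^sub>R 1) ((- \<beta> i) *\<^sub>R 1 + (- body (X 0 (Ev i))) *\<^sub>R D 1)"
   by (rule R_smul[OF DERIV_minus[OF \<beta>[OF that]] _ R_const]) (simp add: \<beta>0 that)
  have "R (%s. X s (Ev i) + (- body (X s (Ev i))) *\<^sub>R 1)
    (X' (Ev i) + ((- \<beta> i) *\<^sub>R 1 + (- body (X 0 (Ev i))) *\<^sub>R D 1))"
   by (rule R_add[OF RX 1]) (use that in simp)
  then show ?thesis by (simp add: soul_def \<zeta>_def D_1 of_real_def)
 qed
 let ?D = "%i. dcoord (Ev i) g" and ?V = "%v x. vderiv v (g x)" and ?W = "%x. wscale (parw c) (g x)"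
 let ?e = "sfE p (Xn 0) (Pn 0)"
 define T' where "T' n = (\<Sum>i<p. \<beta> i *\<^sub>R ?e n (?D i))
   + (\<Sum>i<p. \<zeta> i * (if n = 0 then 0 else ?e (n - 1) (?D i)))
   + (\<Sum>v\<in>V. \<sigma>' v * ?e n (?V v))
   + ?e n ?W" for n
 have RT: "R (%s. sfE p (Xn s) (Pn s) n g) (T' n)" for n
  unfolding T'_def
 proof (rule R_sfE[OF U _ _ ed])
  show "finite V" using B by (simp add: V_def)
  show "~ is_par v" if "v \<in> V" for v using that by (auto simp: V_def)
  show "bodypt p (Xn s) \<in> U" for s using b by (simp add: Xn_def)
  show "subst_var (Xn s) (Pn s) v = subst_var (Xn 0) (Pn 0) v" if "v \<notin> V" for s v
   using that by (cases v) (auto simp: V_def Xn_def Pn_def rst_def)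
  show "R (%s. soul (Xn s (Ev i))) (\<zeta> i)"
   "((%s. body (Xn s (Ev i))) has_real_derivative \<beta> i) (at 0)" if "i < p" for i
   using \<zeta>[OF that] \<beta>[OF that] that by (simp_all add: Xn_def rst_def)
  show "\<beta> i = 0" if d "i < p" for i by (rule \<beta>0[OF that(2,1)])
  show "R (%s. subst_var (Xn s) (Pn s) v) (\<sigma>' v)" if "v \<in> V" for v
   using that RX RP by (auto simp: V_def Xn_def Pn_def rst_def \<sigma>'_def)
  show "sfn p U g" by (rule SF_D(2)[OF g])
  show "gs_vars (V \<union> Collect is_par) (g x)" if "x \<in> U" for x
   using SF_D(1)[OF g that] by (simp add: V_def svars_def)
 qed
 let ?S = "%h. sf_eval p h (Xn 0) (Pn 0)"
 let ?R = "(\<Sum>i<p. X' (Ev i) * ?S (?D i)) + (\<Sum>v\<in>V. \<sigma>' v * ?S (?V v)) + ?S ?W"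
 let ?P = "%M h. (\<Sum>n\<le>M. ?e n h)"
 have lim: "gsord (%_. True) M (?S h - ?P M h)" for M h
  by (rule gsord_mono[OF sf_eval_lim[OF ed]]) simp
 \<comment> \<open>The shift of the index loses one order, so the common estimate is
   \<open>M\<close> and not \<open>Suc M\<close>.\<close>
 have lim': "gsord (%_. True) M (?S h - (\<Sum>n\<le>M. if n = 0 then 0 else ?e (n - 1) h))" for M h
 proof (cases M)
  case (Suc M')
  have "(\<Sum>n\<le>M. if n = 0 then 0 else ?e (n - 1) h) = ?P M' h"
   unfolding Suc by (subst sum.atMost_Suc_shift) simp
  then show ?thesis using sf_eval_lim[OF ed, of M'] by (simp add: Suc)
 qed simp
 have fin: "gsord (%_. True) M (?R - (\<Sum>n\<le>M. T' n))" for M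
 proof -
  let ?Q = "%h. (\<Sum>n\<le>M. if n = 0 then 0 else ?e (n - 1) h)"
  have T: "(\<Sum>n\<le>M. T' n) = (\<Sum>i<p. \<beta> i *\<^sub>R ?P M (?D i)) + (\<Sum>i<p. \<zeta> i * ?Q (?D i))
    + (\<Sum>v\<in>V. \<sigma>' v * ?P M (?V v)) + ?P M ?W"
   unfolding T'_def sum.distrib scaleR_sum_right sum_distrib_left
   by (simp only: sum.swap[of _ "{..M}"])
  have X: "X' (Ev i) * h = \<beta> i *\<^sub>R h + \<zeta> i * h" for i h
   by (simp add: \<zeta>_def left_diff_distrib of_real_def)
  have "?R - (\<Sum>n\<le>M. T' n) = (\<Sum>i<p. \<beta> i *\<^sub>R (?S (?D i) - ?P M (?D i)))
   + (\<Sum>i<p. \<zeta> i * (?S (?D i) - ?Q (?D i)))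
   + (\<Sum>v\<in>V. \<sigma>' v * (?S (?V v) - ?P M (?V v)))
   + (?S ?W - ?P M ?W)"
   unfolding T X right_diff_distrib scaleR_diff_right sum_subtractf sum.distrib by simp
  also have "gsord (%_. True) M ..."
  proof -
   have m: "gsord (%_. True) M (f * h)" if "gsord (%_. True) M h" for f h
    using gsord_mult[of "%_. True" 0 f M h] that by simp
   show ?thesis by (intro gsord_add gsord_sum gsord_scaleR m lim lim')
  qed
  finally show ?thesis .
 qed
 have "R (%s. sf_eval p g (Xn s) (Pn s)) ?R"
 proof (rule R_lim[where T = "%M s. \<Sum>n\<le>M. sfE p (Xn s) (Pn s) n g"])
  show "R (%s. \<Sum>n\<le>M. sfE p (Xn s) (Pn s) n g) (\<Sum>n\<le>M. T' n)" for M
   by (intro R_sum RT)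
  show "gsord (%_. True) M (sf_eval p g (Xn s) (Pn s) - (\<Sum>n\<le>M. sfE p (Xn s) (Pn s) n g))" for M s
   by (rule gsord_mono[OF sf_eval_lim[OF ed]]) simp
 qed (rule fin)
 moreover have "(\<Sum>v\<in>V. \<sigma>' v * ?S (?V v))
   = (\<Sum>j<q. X' (Od j) * ?S (dcoord (Od j) g)) + (\<Sum>a\<in>B. P' a * ?S (dmom a g))"
 proof -
  have "inj_on Xi {..<q}" "inj_on Mom B" by (auto simp: inj_on_def)
  then show ?thesis
   unfolding V_def using B
   by (subst sum.union_disjoint) (auto simp: sum.reindex \<sigma>'_def dcoord_Od dmom_eq)
 qed
 moreover have "(\<Sum>a\<in>cs p q. X' a * ?S (dcoord a g))
   = (\<Sum>i<p. X' (Ev i) * ?S (?D i)) + (\<Sum>j<q. X' (Od j) * ?S (dcoord (Od j) g))"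
 proof -
  have "inj_on Ev {..<p}" "inj_on Od {..<q}" by (auto simp: inj_on_def)
  then show ?thesis
   unfolding cs_def by (subst sum.union_disjoint) (auto simp: sum.reindex)
 qed
 ultimately have "R (%s. sf_eval p g (Xn s) (Pn s)) ((\<Sum>a\<in>cs p q. X' a * ?S (dcoord a g))
   + (\<Sum>a\<in>B. P' a * ?S (dmom a g)) + ?S ?W)"
  by (simp add: algebra_simps)
 moreover have "sf_eval p (dcoord a g) (X 0) (P 0) = ?S (dcoord a g)" if "a \<in> cs p q" for a
  by (rule nm[OF SF_dcoord[OF U g that]])
 ultimately show ?thesis
  by (simp add: nm[OF g] nm[OF SF_dmom[OF U g]] nm[OF SF_wscale[OF U g]])
qed

text \<open>Where the arguments are not admissible the curves are replaced by their value at 0.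
  Everything in question is local at 0, so \<open>R_sf_eval_all\<close> applies to the modified
  curves.\<close>

lemma R_sf_eval:
 assumes U: "eopen p U" and B: "finite B" and g: "SF p q B U g"
  and e: "evok p q B U (X 0) (P 0)" "eventually (%s. evok p q B U (X s) (P s)) (at 0)"
  and RX: "!!a. a \<in> cs p q ==> R (%s. X s a) (X' a)"
  and RP: "!!a. a \<in> B ==> R (%s. P s a) (P' a)"
 shows "R (%s. sf_eval p g (X s) (P s))
  (chain p q B g (X 0) (P 0) X' P' + sf_eval p (%x. wscale (parw c) (g x)) (X 0) (P 0))"
proof -
 define Z where "Z F s = (if evok p q B U (X s) (P s) then F s else F 0)" for F :: "real => coord => gs" and s
 have ev: "eventually (%s. F s = Z F s) (at 0)" for F
  using e(2) by eventually_elim (simp add: Z_def)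
 have Z0: "Z F 0 = F 0" for F by (simp add: Z_def)
 have "R (%s. sf_eval p g (Z X s) (Z P s))
  (chain p q B g (Z X 0) (Z P 0) X' P' + sf_eval p (%x. wscale (parw c) (g x)) (Z X 0) (Z P 0))"
 proof (rule R_sf_eval_all[OF U B g])
  show "evok p q B U (Z X s) (Z P s)" for s using e(1) by (simp add: Z_def)
  show "R (%s. Z X s a) (X' a)" if "a \<in> cs p q" for a
   by (rule R_cong[OF RX[OF that]]) (use ev[of X] in \<open>auto simp: Z0 elim: eventually_mono\<close>)
  show "R (%s. Z P s a) (P' a)" if "a \<in> B" for a
   by (rule R_cong[OF RP[OF that]]) (use ev[of P] in \<open>auto simp: Z0 elim: eventually_mono\<close>)
 qed
 then have "R (%s. sf_eval p g (Z X s) (Z P s))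
  (chain p q B g (X 0) (P 0) X' P' + sf_eval p (%x. wscale (parw c) (g x)) (X 0) (P 0))" by (simp only: Z0)
 then show ?thesis
 proof (rule R_cong)
  show "eventually (%s. sf_eval p g (Z X s) (Z P s) = sf_eval p g (X s) (P s)) (at 0)"
   using ev[of X] ev[of P] by eventually_elim simp
 qed (simp add: Z0)
qed

lemma D_sf_eval:
 assumes U: "eopen p U" and B: "finite B" and g: "SF p q B U g" and e: "evok p q B U X P"
 shows "D (sf_eval p g X P) = chain p q B g X P (%a. D (X a)) (%a. D (P a))
  + sf_eval p (%x. wscale (parw c) (g x)) X P"
 by (rule R_const_eq[symmetric], rule R_sf_eval_all[OF U B g, of "%_. X" "%_. P"]) (auto intro: e R_const)

end

lemma parw_zero: "parw (%_ _. 0) = (%_. 0)"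
 by (auto simp: parw_def fun_eq_iff split: var.splits)

lemma wscale_zero: "wscale (%_. 0) f = 0"
 by (rule gs_eqI) simp

lemma cder_sf_eval:
 assumes U: "eopen p U" and B: "finite B" and g: "SF p q B U g"
  and e: "evok p q B U (X 0) (P 0)" "eventually (%s. evok p q B U (X s) (P s)) (at 0)"
  and RX: "!!a. a \<in> cs p q ==> cder (%s. X s a) (X' a)"
  and RP: "!!a. a \<in> B ==> cder (%s. P s a) (P' a)"
 shows "cder (%s. sf_eval p g (X s) (P s))
  (chain p q B g (X 0) (P 0) X' P')"
proof -
 interpret superder "%_. 0" False "%_ _. 0" by (rule superder_0)
 have "R f f' \<longleftrightarrow> cder f f'" for f f' by (simp add: R_def)
 then show ?thesis
  using R_sf_eval[OF U B g e, of X' P'] RX RP by (simp add: parw_zero wscale_zero sf_eval_0)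
qed

lemma vderiv_sf_eval:
 assumes U: "eopen p U" and B: "finite B" and g: "SF p q B U g" and e: "evok p q B U X P"
  and v: "~ is_par v"
 shows "vderiv v (sf_eval p g X P) = chain p q B g X P (%a. vderiv v (X a)) (%a. vderiv v (P a))"
proof -
 interpret superder "vderiv v" "vodd v" "%_ _. 0" by (rule superder_vderiv[OF v])
 show ?thesis using D_sf_eval[OF U B g e] by (simp add: parw_zero wscale_zero sf_eval_0)
qed

subsection \<open>Evaluations of families\<close>

lemma sf_eval_eqI:
 assumes U: "eopen p U" and g: "SF p q B U g" and b: "bodypt p X \<in> U"
  and X: "!!a. a \<in> cs p q ==> X a = X' a" and P: "!!a. a \<in> B ==> P a = P' a"
 shows "sf_eval p g X P = sf_eval p g X' P'"
proof (rule sf_eval_cong[OF U b refl SF_D(1)[OF g]])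
 show "X (Ev i) = X' (Ev i)" if "i < p" for i using X that by simp
 show "subst_var X P v = subst_var X' P' v" if "v \<in> svars q B" for v
  using that X P by (cases v) (auto simp: svars_def)
qed auto

lemma eventually_shift_in:
 assumes U: "eopen p U" and x: "x \<in> U" and i: "i < p"
 shows "eventually (%s. x(i := x i + s) \<in> U) (at 0)"
proof -
 obtain e where e: "e > 0" "!!t. dist t (x i) < e ==> x(i := t) \<in> U"
  using eventually_upd_in[OF assms] unfolding eventually_nhds_metric by auto
 then show ?thesis unfolding eventually_at by (intro exI[of _ e]) (auto simp: dist_real_def)
qed

lemma cder_shift:
 assumes "sfn p U f" "x \<in> U" "i < p"
 shows "cder (%s. f (x(i := x i + s))) (dcoord (Ev i) f x)"
 unfolding cder_def
proof
 fix k
 have "((%t. coeff (f (x(i := t))) k) has_real_derivative rpd i (%y. coeff (f y) k) x) (at (0 + x i))"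
  using rpd_DERIV[OF assms(1)[unfolded sfn_def, rule_format] assms(2,3)] by simp
 then have "((%s. coeff (f (x(i := s + x i))) k) has_real_derivative rpd i (%y. coeff (f y) k) x) (at 0)"
  by (subst (asm) DERIV_shift) simp
 then show "((%s. coeff (f (x(i := x i + s))) k) has_real_derivative coeff (dcoord (Ev i) f x) k) (at 0)"
  by (simp add: coeff_dcoord_Ev add.commute)
qed

lemma cder_shift_imp:
 assumes "cder (%s. f (x(i := x i + s))) e"
 shows "dcoord (Ev i) f x = e" "(%t. coeff (f (x(i := t))) k) differentiable (at (x i))"
proof -
 have d: "((%t. coeff (f (x(i := t))) k) has_real_derivative coeff e k) (at (x i))" for k
 proof -
  have "((%s. coeff (f (x(i := s + x i))) k) has_real_derivative coeff e k) (at 0)"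
   using assms by (simp add: cder_def add.commute)
  then have "((%t. coeff (f (x(i := t))) k) has_real_derivative coeff e k) (at (0 + x i))"
   by (subst DERIV_shift) simp
  then show ?thesis by simp
 qed
 show "dcoord (Ev i) f x = e"
  by (rule gs_eqI) (simp add: coeff_dcoord_Ev rpd_eqI[OF d])
 show "(%t. coeff (f (x(i := t))) k) differentiable (at (x i))"
  using d by (auto simp: real_differentiable_def)
qed

definition gcont :: "nat => pt set => (pt => gs) => bool" where
 "gcont p U T \<longleftrightarrow> (ALL k. pcont p U (%x. coeff (T x) k))"

lemma gcont_sfn: "sfn p U T ==> gcont p U T"
 by (auto simp: gcont_def sfn_def dest: smooth_onD(1))

lemma gcont_const: "gcont p U (%x. a)"
 by (simp add: gcont_def)

lemma gcont_sum: "(!!i. i \<in> A ==> gcont p U (T i)) ==> gcont p U (%x. \<Sum>i\<in>A. T i x)"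
 by (cases "finite A") (auto simp: gcont_def intro!: continuous_map_sum)

lemma gcont_scaleR: "gcont p U T ==> gcont p U (%x. r *\<^sub>R T x)"
 by (auto simp: gcont_def intro!: continuous_map_real_mult)

lemma gcont_diff: "gcont p U S ==> gcont p U T ==> gcont p U (%x. S x - T x)"
 by (auto simp: gcont_def intro!: continuous_map_diff)

lemma gcont_mult: "gcont p U S ==> gcont p U T ==> gcont p U (%x. S x * T x)"
 unfolding gcont_def
proof
 fix k assume *: "ALL k. pcont p U (%x. coeff (S x) k)" "ALL k. pcont p U (%x. coeff (T x) k)"
 show "pcont p U (%x. coeff (S x * T x) k)"
  using * by (cases "mono_ok k")
   (auto simp: coeff_mult coeff_not_ok case_prod_unfold intro!: continuous_map_sum continuous_map_real_mult)
qed

lemma gcont_mprod: "(!!v. v \<in># m ==> gcont p U (%x. \<sigma> x v)) ==> gcont p U (%x. mprod (\<sigma> x) m)"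
proof -
 have "(!!v. v \<in> set vs ==> gcont p U (%x. \<sigma> x v)) ==> gcont p U (%x. prod_list (map (\<sigma> x) vs))" for vs
  by (induction vs) (auto intro!: gcont_const gcont_mult)
 from this[of "sorted_list_of_multiset m"]
 show "(!!v. v \<in># m ==> gcont p U (%x. \<sigma> x v)) ==> gcont p U (%x. mprod (\<sigma> x) m)"
  by (simp add: mprod_def)
qed

lemma gcont_soul: "gcont p U T ==> gcont p U (%x. soul (T x))"
 unfolding soul_def
 by (intro gcont_diff) (auto simp: gcont_def of_real_def body_def intro!: continuous_map_real_mult)

text \<open>A morphism of superdomains with components \<open>Y\<close>, together with a family
  \<open>Z\<close> of series for the momenta. The condition \<open>ev\<close> says that the body of
  \<open>Y\<close> maps \<open>U1\<close> into \<open>U2\<close> and that the arguments are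
  admissible.\<close>

locale sfam =
 fixes p1 q1 :: nat and B1 :: "coord set" and U1 :: "pt set"
  and p2 q2 :: nat and B2 :: "coord set" and U2 :: "pt set"
  and Y Z :: "pt => coord => gs"
 assumes U1: "eopen p1 U1" and U2: "eopen p2 U2"
  and B1: "finite B1" and B2: "finite B2"
  and SFY: "!!a. a \<in> cs p2 q2 ==> SF p1 q1 B1 U1 (%x. Y x a)"
  and SFZ: "!!a. a \<in> B2 ==> SF p1 q1 B1 U1 (%x. Z x a)"
  and ev: "!!x. x \<in> U1 ==> evok p2 q2 B2 U2 (Y x) (Z x)"
begin

abbreviation comp :: "(pt => gs) => pt => gs" where
 "comp g \<equiv> %x. sf_eval p2 g (Y x) (Z x)"

lemma cder_comp:
 assumes g: "SF p2 q2 B2 U2 g" and x: "x \<in> U1" and i: "i < p1"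
 shows "cder (%s. comp g (x(i := x i + s)))
  (chain p2 q2 B2 g (Y x) (Z x) (%a. dcoord (Ev i) (%x. Y x a) x) (%a. dcoord (Ev i) (%x. Z x a) x))"
proof -
 have ev': "eventually (%s. evok p2 q2 B2 U2 (Y (x(i := x i + s))) (Z (x(i := x i + s)))) (at 0)"
  using eventually_shift_in[OF U1 x i] by eventually_elim (rule ev)
 show ?thesis
  using cder_sf_eval[OF U2 B2 g, of "%s. Y (x(i := x i + s))" "%s. Z (x(i := x i + s))"
    "%a. dcoord (Ev i) (%x. Y x a) x" "%a. dcoord (Ev i) (%x. Z x a) x", OF _ ev']
   ev[OF x] cder_shift[OF SF_D(2)[OF SFY] x i] cder_shift[OF SF_D(2)[OF SFZ] x i]
  by simp
qed

lemma dcoord_comp: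
 assumes g: "SF p2 q2 B2 U2 g" and x: "x \<in> U1" and a: "a \<in> cs p1 q1"
 shows "dcoord a (comp g) x =
  chain p2 q2 B2 g (Y x) (Z x) (%b. dcoord a (%x. Y x b) x) (%b. dcoord a (%x. Z x b) x)"
proof (cases a)
 case (Ev i)
 then show ?thesis using cder_shift_imp(1)[OF cder_comp[OF g x]] a by simp
next
 case (Od j)
 then show ?thesis using vderiv_sf_eval[OF U2 B2 g ev[OF x], of "Xi j"] by (simp add: dcoord_Od)
qed

lemma dmom_comp:
 assumes g: "SF p2 q2 B2 U2 g" and x: "x \<in> U1"
 shows "dmom a (comp g) x =
  chain p2 q2 B2 g (Y x) (Z x) (%b. dmom a (%x. Y x b) x) (%b. dmom a (%x. Z x b) x)"
 using vderiv_sf_eval[OF U2 B2 g ev[OF x], of "Mom a"] by (simp add: dmom_eq)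

abbreviation Yn :: "pt => coord => gs" where "Yn x \<equiv> rst (cs p2 q2) (Y x)"
abbreviation Zn :: "pt => coord => gs" where "Zn x \<equiv> rst B2 (Z x)"

lemma gcont_subst:
 assumes "v \<in> svars q2 B2"
 shows "gcont p1 U1 (%x. subst_var (Yn x) (Zn x) v)"
proof (cases v)
 case (Xi j)
 then have "j < q2" using assms by (auto simp: svars_def)
 then show ?thesis using Xi gcont_sfn[OF SF_D(2)[OF SFY]] by (simp add: rst_def)
next
 case (Mom a)
 then have "a \<in> B2" using assms by (auto simp: svars_def)
 then show ?thesis using Mom gcont_sfn[OF SF_D(2)[OF SFZ]] by (simp add: rst_def)
qed (simp add: gcont_const)

lemma continuous_bodypt:
 "continuous_map (subtopology (Euclidean_space p1) U1) (subtopology (Euclidean_space p2) U2)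
  (%x. bodypt p2 (Y x))"
proof -
 have "pcont p1 U1 (%x. bodypt p2 (Y x) i)" for i
 proof (cases "i < p2")
  case True
  then show ?thesis using gcont_sfn[OF SF_D(2)[OF SFY]]
   by (simp add: bodypt_def body_def gcont_def)
 qed (simp add: bodypt_def)
 then have "continuous_map (subtopology (Euclidean_space p1) U1) (powertop_real UNIV) (%x. bodypt p2 (Y x))"
  by (simp add: continuous_map_componentwise_UNIV)
 moreover have "bodypt p2 (Y x) \<in> U2" if "x \<in> topspace (subtopology (Euclidean_space p1) U1)" for x
  using that evokD(6)[OF ev] topspace_sub[OF U1] by simp
 ultimately show ?thesis
  unfolding Euclidean_space_def[of p2] continuous_map_in_subtopology
  by (auto simp: bodypt_def)
qed

text \<open>Only finitely many monomials matter for a given coefficient, uniformly in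
  \<open>x\<close>. Continuity thus reduces to that of the coefficients of \<open>g\<close> at the
  body of \<open>Y\<close> and of finitely many substituted monomials.\<close>

lemma gcont_sfE:
 assumes "SF p2 q2 B2 U2 g"
 shows "gcont p1 U1 (%x. sfE p2 (Yn x) (Zn x) n g)"
 using assms
proof (induction n arbitrary: g)
 case 0
 \<comment> \<open>Outside \<open>U1\<close> the identity substitution stands in, so that the
   finiteness of supports is uniform over all \<open>x\<close>.\<close>
 define \<sigma> where "\<sigma> x = (if x \<in> U1 then subst_var (Yn x) (Zn x) else gs_var)" for x
 have \<sigma>: "good (\<sigma> x)" for x
  using evd_rst[OF B2 ev] by (simp add: \<sigma>_def evd_def good_var)
 show ?case unfolding gcont_def
 proof
  fix k
  define M where "M = {m. EX x. coeff (mprod (\<sigma> x) m) k ~= 0}"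
  have fM: "finite M" unfolding M_def
  proof (rule finite_mprod_supp)
   show "coeff (\<sigma> x v) {#} = 0" for x v by (rule goodD(2)[OF \<sigma>])
   have *: "v \<in> Xi ` {..<q2} \<union> Mom ` B2 \<union> set_mset k" if "coeff (\<sigma> x v) k ~= 0" for x v k
    using that by (cases v) (auto simp: \<sigma>_def rst_def coeff_gs_var split: if_splits)
   show "finite {v. EX x. coeff (\<sigma> x v) k ~= 0}" for k
    by (rule finite_subset, rule subsetI, erule CollectE, erule exE, erule *) (use B2 in simp)
  qed
  define M' where "M' = {m \<in> M. set_mset m \<subseteq> svars q2 B2}"
  have e: "coeff (msub (\<sigma> x) (g (bodypt p2 (Y x)))) k
    = (\<Sum>m\<in>M'. coeff (g (bodypt p2 (Y x))) m * coeff (mprod (\<sigma> x) m) k)" if "x \<in> U1" for x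
  proof (rule coeff_msub[OF _ _ \<sigma>])
   show "finite M'" using fM by (simp add: M'_def)
   fix m assume "coeff (mprod (\<sigma> x) m) k ~= 0" "coeff (g (bodypt p2 (Y x))) m ~= 0"
   then show "m \<in> M'" using SF_D(1)[OF 0 evokD(6)[OF ev[OF that]]]
    by (auto simp: M'_def M_def gs_vars_def)
  qed
  have c1: "pcont p1 U1 (%x. coeff (g (bodypt p2 (Y x))) m)" for m
   using continuous_map_compose[OF continuous_bodypt smooth_onD(1)] SF_D(2)[OF 0]
   by (auto simp: sfn_def o_def)
  have c2: "pcont p1 U1 (%x. coeff (mprod (subst_var (Yn x) (Zn x)) m) k)" if "m \<in> M'" for m
  proof -
   have "gcont p1 U1 (%x. mprod (subst_var (Yn x) (Zn x)) m)"
    by (rule gcont_mprod, rule gcont_subst) (use that in \<open>auto simp: M'_def\<close>)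
   then show ?thesis by (simp add: gcont_def)
  qed
  have "pcont p1 U1 (%x. \<Sum>m\<in>M'. coeff (g (bodypt p2 (Y x))) m * coeff (mprod (subst_var (Yn x) (Zn x)) m) k)"
   using c1 c2 fM by (auto simp: M'_def intro!: continuous_map_sum continuous_map_real_mult)
  then show "pcont p1 U1 (%x. coeff (sfE p2 (Yn x) (Zn x) 0 g) k)"
   by (rule continuous_map_eq) (use e in \<open>simp add: topspace_sub[OF U1] \<sigma>_def\<close>)
 qed
next
 case (Suc n)
 have s: "gcont p1 U1 (%x. soul (Yn x (Ev i)))" if "i < p2" for i
  using gcont_soul[OF gcont_sfn[OF SF_D(2)[OF SFY]]] that by (simp add: rst_def)
 show ?case unfolding sfE.simps(2)
  by (intro gcont_scaleR gcont_sum gcont_mult s Suc.IH SF_dcoord[OF U2 Suc.prems, of _ q2]) auto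
qed

lemma gcont_comp:
 assumes g: "SF p2 q2 B2 U2 g"
 shows "gcont p1 U1 (comp g)"
 unfolding gcont_def
proof
 fix k
 show "pcont p1 U1 (%x. coeff (comp g x) k)"
 proof (cases "mono_ok k")
  case True
  have "pcont p1 U1 (%x. \<Sum>n\<le>size k. coeff (sfE p2 (Yn x) (Zn x) n g) k)"
   using gcont_sfE[OF g] by (auto simp: gcont_def intro!: continuous_map_sum)
  then show ?thesis
  proof (rule continuous_map_eq)
   fix x assume "x \<in> topspace (subtopology (Euclidean_space p1) U1)"
   then have x: "x \<in> U1" by (simp add: topspace_sub[OF U1])
   show "(\<Sum>n\<le>size k. coeff (sfE p2 (Yn x) (Zn x) n g) k) = coeff (comp g x) k"
    unfolding sf_eval_norm[OF U2 evokD(6)[OF ev[OF x]] g]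
    using sf_eval_coeff[OF evd_rst[OF B2 ev[OF x]] True order_refl] by simp
  qed
 qed (simp add: coeff_not_ok)
qed

text \<open>Closed under the partial derivatives, which gives smoothness by coinduction.\<close>

inductive_set jetcomb :: "(pt => gs) set" where
 base: "sfn p1 U1 A ==> SF p2 q2 B2 U2 g ==> (%x. A x * comp g x) \<in> jetcomb"
| zero: "(%x. 0) \<in> jetcomb"
| add: "S \<in> jetcomb ==> T \<in> jetcomb ==> (%x. S x + T x) \<in> jetcomb"

lemma jetcomb_sum: "(!!i. i \<in> A ==> T i \<in> jetcomb) ==> (%x. \<Sum>i\<in>A. T i x) \<in> jetcomb"
 by (induction A rule: infinite_finite_induct) (auto intro: zero add)

lemma jetcomb_props:
 assumes "T \<in> jetcomb"
 shows "gcont p1 U1 T & (ALL i<p1. EX T':jetcomb. ALL x:U1. cder (%s. T (x(i := x i + s))) (T' x))"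
 using assms
proof induction
 case (base A g)
 have "EX T':jetcomb. ALL x:U1. cder (%s. A (x(i := x i + s)) * comp g (x(i := x i + s))) (T' x)" if i: "i < p1" for i
 proof -
  let ?T' = "%x. dcoord (Ev i) A x * comp g x
   + ((\<Sum>a\<in>cs p2 q2. A x * dcoord (Ev i) (%x. Y x a) x * comp (dcoord a g) x)
     + (\<Sum>a\<in>B2. A x * dcoord (Ev i) (%x. Z x a) x * comp (dmom a g) x))"
  have "?T' \<in> jetcomb"
   by (intro jetcomb.add jetcomb_sum jetcomb.base sfn_mult[OF U1] sfn_dcoord_Ev base SF_dcoord[OF U2 base(2)]
     SF_dmom[OF U2 base(2)] SF_D(2)[OF SFY] SF_D(2)[OF SFZ] i)
  moreover have "cder (%s. A (x(i := x i + s)) * comp g (x(i := x i + s))) (?T' x)" if "x \<in> U1" for x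
   using cder_mult[OF cder_shift[OF base(1) that i] cder_comp[OF base(2) that i]]
   by (simp add: distrib_left sum_distrib_left mult.assoc)
  ultimately show ?thesis by (intro bexI[of _ ?T']) auto
 qed
 then show ?case using gcont_mult[OF gcont_sfn[OF base(1)] gcont_comp[OF base(2)]] by blast
next
 case zero
 have "EX T':jetcomb. ALL x:U1. cder (%s. 0) (T' x)"
  by (rule bexI[OF _ jetcomb.zero]) (simp add: cder_const)
 then show ?case by (simp add: gcont_const)
next
 case (add S T)
 have "EX T':jetcomb. ALL x:U1. cder (%s. S (x(i := x i + s)) + T (x(i := x i + s))) (T' x)" if i: "i < p1" for i
 proof -
  obtain S' T' where "S' \<in> jetcomb" "ALL x:U1. cder (%s. S (x(i := x i + s))) (S' x)"
   "T' \<in> jetcomb" "ALL x:U1. cder (%s. T (x(i := x i + s))) (T' x)" using add.IH i by blast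
  then show ?thesis
   by (intro bexI[OF _ jetcomb.add[of S' T']]) (auto intro: cder_add)
 qed
 moreover have "gcont p1 U1 (%x. S x + T x)"
  using add.IH by (auto simp: gcont_def intro: continuous_map_add)
 ultimately show ?case by blast
qed

lemma sfn_comp:
 assumes "SF p2 q2 B2 U2 g"
 shows "sfn p1 U1 (comp g)"
 unfolding sfn_def
proof
 fix k
 have "(%x. 1 * comp g x) \<in> jetcomb" by (intro jetcomb.base assms sfn_const[OF U1])
 then have in_jets: "comp g \<in> jetcomb" by simp
 show "smooth_on p1 U1 (%x. coeff (comp g x) k)"
 proof (rule smooth_coinduct[OF U1, of _ "(%T x. coeff (T x) k) ` jetcomb"])
  show "(%x. coeff (comp g x) k) \<in> (%T x. coeff (T x) k) ` jetcomb"
   using in_jets by (rule image_eqI[rotated]) simp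
 next
  fix h assume "h \<in> (%T x. coeff (T x) k) ` jetcomb"
  then obtain T where T: "h = (%x. coeff (T x) k)" "T \<in> jetcomb" by auto
  show "pcont p1 U1 h" using jetcomb_props[OF T(2)] by (simp add: T(1) gcont_def)
  fix i assume i: "i < p1"
  then obtain T' where T': "T' \<in> jetcomb" "!!x. x \<in> U1 ==> cder (%s. T (x(i := x i + s))) (T' x)"
   using jetcomb_props[OF T(2)] by auto
  show "(%t. h (x(i := t))) differentiable (at (x i))" if "x \<in> U1" for x
   unfolding T(1) by (rule cder_shift_imp(2)[OF T'(2)[OF that]])
  have "rpd i h x = coeff (T' x) k" if "x \<in> U1" for x
   unfolding T(1) coeff_dcoord_Ev[symmetric] cder_shift_imp(1)[OF T'(2)[OF that]] ..
  then show "EX h':(%T x. coeff (T x) k) ` jetcomb. ALL x:U1. rpd i h x = h' x"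
   using T'(1) by (intro bexI[of _ "%x. coeff (T' x) k"]) auto
 qed
qed

lemma SF_comp:
 assumes g: "SF p2 q2 B2 U2 g"
 shows "SF p1 q1 B1 U1 (comp g)"
 unfolding SF_altdef
proof (intro conjI ballI sfn_comp g)
 fix x assume x: "x \<in> U1"
 show "gs_vars (svars q1 B1) (comp g x)"
  by (rule gs_vars_sf_eval[OF U2 B2 ev[OF x] g])
   (use SF_D(1)[OF SFY x] SF_D(1)[OF SFZ x] in \<open>auto simp: svars_def\<close>)
qed

end

lemma gsord_msub:
 assumes "good \<sigma>" "gsord (%_. True) n f"
 shows "gsord (%_. True) n (msub \<sigma> f)"
 unfolding gsord_def
proof (intro allI impI)
 fix k :: "var multiset" assume k: "size (filter_mset (%_. True) k) < n"
 show "coeff (msub \<sigma> f) k = 0"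
 proof (subst coeff_msub[OF finite.emptyI _ assms(1)])
  fix m assume "coeff (mprod \<sigma> m) k ~= 0" "coeff f m ~= 0"
  then show "m \<in> {}" using mprod_supp(1)[OF goodD(2)[OF assms(1)]] assms(2) k
   by (fastforce simp: gsord_def)
 qed simp
qed

lemma body_msub: "good \<sigma> ==> body (msub \<sigma> f) = body f"
 by (simp add: body_def coeff_msub_empty)

lemma soul_msub: "good \<sigma> ==> soul (msub \<sigma> f) = msub \<sigma> (soul f)"
 by (simp add: soul_def body_msub clin_diff[OF clin_msub] msub_of_real)

lemma msub_sfE:
 assumes \<tau>: "good \<tau>" "!!b n. \<tau> (Par b n) = gs_var (Par b n)" and e: "evd p X P"
 shows "msub \<tau> (sfE p X P n g) = sfE p (msub \<tau> \<circ> X) (msub \<tau> \<circ> P) n g"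
proof (induction n arbitrary: g)
 case 0
 have "(msub \<tau> \<circ> subst_var X P) v = subst_var (msub \<tau> \<circ> X) (msub \<tau> \<circ> P) v" for v
  by (cases v) (simp_all add: msub_var[OF \<tau>(1)] \<tau>(2))
 then have "msub \<tau> \<circ> subst_var X P = subst_var (msub \<tau> \<circ> X) (msub \<tau> \<circ> P)" by (rule ext)
 moreover have "bodypt p (msub \<tau> \<circ> X) = bodypt p X" by (rule bodypt_eq) (simp add: body_msub[OF \<tau>(1)])
 moreover have "msub \<tau> (sfE p X P 0 g) = msub (msub \<tau> \<circ> subst_var X P) (g (bodypt p X))"
  using msub_msub[OF \<tau>(1)] e by (simp add: evd_def)
 ultimately show ?case by (simp only: sfE.simps(1))
next
 case (Suc n)
 then show ?case
  by (simp add: sfE.simps(2) clin_scaleR[OF clin_msub[OF \<tau>(1)]] clin_sum[OF clin_msub[OF \<tau>(1)]]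
    msub_mult[OF \<tau>(1)] soul_msub[OF \<tau>(1)])
qed

lemma evok_msub:
 assumes "good \<tau>" "evok p q B U X P"
 shows "evok p q B U (msub \<tau> \<circ> X) (msub \<tau> \<circ> P)"
 using assms bodypt_eq[of p "msub \<tau> \<circ> X" X]
 by (auto simp: evok_def gs_parity_msub coeff_msub_empty body_msub)

text \<open>A good substitution keeps bodies and maps souls to souls, so it passes through every
  Taylor piece. It has to fix the parameters because the evaluation treats those in \<open>g\<close>
  as constants.\<close>

lemma msub_sf_eval:
 assumes \<tau>: "good \<tau>" "!!b n. \<tau> (Par b n) = gs_var (Par b n)"
  and U: "eopen p U" and B: "finite B" and g: "SF p q B U g" and e: "evok p q B U X P"
  and XP: "!!a. a \<in> cs p q ==> msub \<tau> (X a) = X' a" "!!a. a \<in> B ==> msub \<tau> (P a) = P' a"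
 shows "msub \<tau> (sf_eval p g X P) = sf_eval p g X' P'"
proof -
 let ?X = "rst (cs p q) X" and ?P = "rst B P"
 note cm = clin_msub[OF \<tau>(1)]
 have r: "msub \<tau> \<circ> rst A F = rst A (msub \<tau> \<circ> F)" for A F
  by (auto simp: rst_def fun_eq_iff clin_0[OF cm])
 note ed = evd_rst[OF B e]
 have ed': "evd p (msub \<tau> \<circ> ?X) (msub \<tau> \<circ> ?P)"
  unfolding r by (rule evd_rst[OF B evok_msub[OF \<tau>(1) e]])
 have "gsord (%_. True) (Suc M) (msub \<tau> (sf_eval p g ?X ?P) - sf_eval p g (msub \<tau> \<circ> ?X) (msub \<tau> \<circ> ?P))" for M
 proof -
  let ?A = "\<Sum>n\<le>M. sfE p ?X ?P n g" and ?A' = "\<Sum>n\<le>M. sfE p (msub \<tau> \<circ> ?X) (msub \<tau> \<circ> ?P) n g"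
  have "?A' = msub \<tau> ?A" by (simp add: clin_sum[OF cm] msub_sfE[OF \<tau> ed])
  then have eq: "msub \<tau> (sf_eval p g ?X ?P) - sf_eval p g (msub \<tau> \<circ> ?X) (msub \<tau> \<circ> ?P)
   = msub \<tau> (sf_eval p g ?X ?P - ?A) - (sf_eval p g (msub \<tau> \<circ> ?X) (msub \<tau> \<circ> ?P) - ?A')"
   by (simp add: clin_diff[OF cm])
  show ?thesis unfolding eq
   by (rule gsord_diff[OF gsord_msub[OF \<tau>(1) sf_eval_lim[OF ed]] sf_eval_lim[OF ed']])
 qed
 then have "msub \<tau> (sf_eval p g ?X ?P) = sf_eval p g (msub \<tau> \<circ> ?X) (msub \<tau> \<circ> ?P)"
  by (intro gsord_eqI[of "%_. True"]) (meson gsord_mono le_SucI order_refl)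
 then have "msub \<tau> (sf_eval p g X P) = sf_eval p g (msub \<tau> \<circ> X) (msub \<tau> \<circ> P)"
  using sf_eval_norm[OF U evokD(6)[OF e] g] sf_eval_norm[OF U evokD(6)[OF evok_msub[OF \<tau>(1) e]] g]
  by (simp add: r)
 also have "... = sf_eval p g X' P'"
  by (rule sf_eval_eqI[OF U g evokD(6)[OF evok_msub[OF \<tau>(1) e]]]) (simp_all add: XP)
 finally show ?thesis .
qed

lemma soul_of_real [simp]: "soul (of_real r) = 0" "body (of_real r) = r"
 by (simp_all add: soul_def body_def of_real_def)

lemma body_add: "body (f + g) = body f + body g" "body (r *\<^sub>R f) = r * body f"
 by (simp_all add: body_def)

lemma body_soul [simp]: "body (soul f) = 0"
 by (simp add: soul_def body_def of_real_def)

lemma const_coeff: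
 assumes "!!t. cder (%s. f (t + s)) (e t)" "!!t. coeff (e t) k = 0"
 shows "coeff (f t) k = coeff (f 0) k"
proof -
 have "((%t. coeff (f t) k) has_real_derivative 0) (at t)" for t
 proof -
  have "((%s. coeff (f (t + s)) k) has_real_derivative coeff (e t) k) (at 0)"
   using assms(1)[of t] by (simp add: cder_def)
  then have "((%s. coeff (f (s + t)) k) has_real_derivative 0) (at 0)"
   by (simp add: assms(2) add.commute)
  then have "((%t. coeff (f t) k) has_real_derivative 0) (at (0 + t))" by (subst DERIV_shift) simp
  then show ?thesis by simp
 qed
 then show ?thesis by (intro DERIV_isconst_all) auto
qed

context sfam
begin

text \<open>Both sides are compared at all times \<open>t\<close> of the path and for all
  \<open>g\<close> at once. Their derivatives in \<open>t\<close> obey the same formula in the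
  derivatives of \<open>g\<close>, with coefficients of order 1 coming from the souls; a congruence
  of order \<open>N\<close> for those derivatives thus improves to order \<open>Suc N\<close> for
  \<open>g\<close>. At \<open>t = 0\<close> the even coordinates have no soul and evaluation is a
  substitution.\<close>

lemma compose:
 assumes g: "SF p2 q2 B2 U2 g" and e: "evok p1 q1 B1 U1 X P"
  and Y': "!!a. a \<in> cs p2 q2 ==> sf_eval p1 (%x. Y x a) X P = Y' a"
  and Z': "!!a. a \<in> B2 ==> sf_eval p1 (%x. Z x a) X P = Z' a"
 shows "sf_eval p1 (comp g) X P = sf_eval p2 g Y' Z'"
proof -
 define b where "b = bodypt p1 X"
 have b: "b \<in> U1" using evokD(6)[OF e] by (simp add: b_def)
 \<comment> \<open>Only the even coordinates move. The odd ones are without body and are dealt with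
   by the substitution at \<open>t = 0\<close>.\<close>
 define Xt where "Xt t a = (case a of Ev i => of_real (b i) + t *\<^sub>R soul (X (Ev i)) | Od j => X (Od j))" for t a
 have bXt: "bodypt p1 (Xt t) = b" for t
  by (auto simp: bodypt_def Xt_def b_def body_add)
 have et: "evok p1 q1 B1 U1 (Xt t) P" for t
  unfolding evok_def bXt
 proof (intro conjI ballI b)
  fix a assume a: "a \<in> cs p1 q1"
  show "gs_parity (codd a) (Xt t a)"
   using evokD(1,2)[OF e] a
   by (cases a) (auto simp: Xt_def intro!: gs_parity_add gs_parity_scaleR gs_parity_soul)
 qed (use evokD(4,5)[OF e] in auto)
 let ?E = "%f t. sf_eval p1 f (Xt t) P"
 have X1: "sf_eval p1 h X P = ?E h 1" if "SF p1 q1 B1 U1 h" for h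
  by (rule sf_eval_eqI[OF U1 that evokD(6)[OF e]])
   (auto simp: Xt_def b_def bodypt_def soul_def split: coord.split)
 let ?DY = "%i a. dcoord (Ev i) (%x. Y x a)" and ?DZ = "%i a. dcoord (Ev i) (%x. Z x a)"
 define YY where "YY t a = ?E (%x. Y x a) t" for t a
 define ZZ where "ZZ t a = ?E (%x. Z x a) t" for t a
 have bYY: "coeff (YY t a) {#} = coeff (Y b a) {#}" if "a \<in> cs p2 q2" for t a
  unfolding YY_def coeff_sf_eval_empty[OF U1 B1 et SFY[OF that]] bXt ..
 have bZZ: "coeff (ZZ t a) {#} = coeff (Z b a) {#}" if "a \<in> B2" for t a
  unfolding ZZ_def coeff_sf_eval_empty[OF U1 B1 et SFZ[OF that]] bXt ..
 have eYZ: "evok p2 q2 B2 U2 (YY t) (ZZ t)" for t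
  unfolding evok_def
 proof (intro conjI ballI)
  show "gs_parity (codd a) (YY t a)" if "a \<in> cs p2 q2" for a
   unfolding YY_def by (rule gs_parity_sf_eval[OF U1 B1 et SFY[OF that]]) (rule evokD(3)[OF ev that])
  show "gs_parity (codd a) (ZZ t a)" if "a \<in> B2" for a
   unfolding ZZ_def by (rule gs_parity_sf_eval[OF U1 B1 et SFZ[OF that]]) (rule evokD(4)[OF ev that])
  show "coeff (ZZ t a) {#} = 0" if "a \<in> B2" for a
   using bZZ[OF that] evokD(5)[OF ev[OF b] that] by simp
  have "bodypt p2 (YY t) = bodypt p2 (Y b)" by (rule bodypt_eq) (simp add: body_def bYY)
  then show "bodypt p2 (YY t) \<in> U2" using evokD(6)[OF ev[OF b]] by simp
 qed
 define L where "L g t = ?E (comp g) t" for g t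
 define K where "K g t = sf_eval p2 g (YY t) (ZZ t)" for g t
 let ?s = "%i. soul (X (Ev i))"
 have dX: "cder (%s. Xt (t + s) a) (case a of Ev i => ?s i | Od j => 0)" for t a
 proof (cases a)
  case (Ev i)
  have "cder (%s. of_real (b i) + (t + s) *\<^sub>R ?s i) (0 + (1 *\<^sub>R ?s i + (t + 0) *\<^sub>R 0))"
   by (intro cder_add cder_const cder_smul) (auto intro!: derivative_eq_intros)
  then show ?thesis by (simp add: Xt_def Ev)
 qed (simp add: Xt_def cder_const)
 have dcurve: "cder (%s. sf_eval p1 h (Xt (t + s)) P) (\<Sum>i<p1. ?s i * sf_eval p1 (dcoord (Ev i) h) (Xt t) P)"
  if h: "SF p1 q1 B1 U1 h" for h t
 proof -
  have "cder (%s. sf_eval p1 h (Xt (t + s)) P)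
   ((\<Sum>a\<in>cs p1 q1. (case a of Ev i => ?s i | Od j => 0) * sf_eval p1 (dcoord a h) (Xt (t + 0)) P)
    + (\<Sum>a\<in>B1. 0 * sf_eval p1 (dmom a h) (Xt (t + 0)) P))"
   by (rule cder_sf_eval[OF U1 B1 h, of "%s. Xt (t + s)" "%_. P"]) (auto simp: et dX cder_const)
  moreover have "(\<Sum>a\<in>cs p1 q1. (case a of Ev i => ?s i | Od j => 0) * ?E (dcoord a h) t)
   = (\<Sum>i<p1. ?s i * sf_eval p1 (dcoord (Ev i) h) (Xt t) P)"
   unfolding cs_def by (subst sum.union_disjoint) (auto simp: sum.reindex inj_on_def)
  ultimately show ?thesis by simp
 qed
 have main: "gsord (%_. True) N (L g t - K g t)" if "SF p2 q2 B2 U2 g" for N g t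
  using that
 proof (induction N arbitrary: g t)
  case (Suc N)
  define eL where "eL t = (\<Sum>i<p1. ?s i * ?E (dcoord (Ev i) (comp g)) t)" for t
  define eY where "eY t a = (\<Sum>i<p1. ?s i * ?E (?DY i a) t)" for t a
  define eZ where "eZ t a = (\<Sum>i<p1. ?s i * ?E (?DZ i a) t)" for t a
  define eK where "eK t = (\<Sum>a\<in>cs p2 q2. eY t a * K (dcoord a g) t) + (\<Sum>a\<in>B2. eZ t a * K (dmom a g) t)" for t
  have dL: "cder (%s. L g (t + s)) (eL t)" for t
   unfolding L_def eL_def by (rule dcurve[OF SF_comp[OF Suc.prems]])
  have dK: "cder (%s. K g (t + s)) (eK t)" for t
  proof -
   have "cder (%s. sf_eval p2 g (YY (t + s)) (ZZ (t + s)))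
    (chain p2 q2 B2 g (YY (t + 0)) (ZZ (t + 0)) (eY t) (eZ t))"
   proof (rule cder_sf_eval[OF U2 B2 Suc.prems, of "%s. YY (t + s)" "%s. ZZ (t + s)"])
    show "cder (%s. YY (t + s) a) (eY t a)" if "a \<in> cs p2 q2" for a
     unfolding YY_def eY_def by (rule dcurve[OF SFY[OF that]])
    show "cder (%s. ZZ (t + s) a) (eZ t a)" if "a \<in> B2" for a
     unfolding ZZ_def eZ_def by (rule dcurve[OF SFZ[OF that]])
   qed (auto simp: eYZ)
   then show ?thesis by (simp add: K_def eK_def)
  qed
  have SFd: "SF p1 q1 B1 U1 (?DY i a)" if "i < p1" "a \<in> cs p2 q2" for i a
   by (rule SF_dcoord[OF U1 SFY[OF that(2)], of _ q1]) (use that in simp)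
  have SFd': "SF p1 q1 B1 U1 (?DZ i a)" if "i < p1" "a \<in> B2" for i a
   by (rule SF_dcoord[OF U1 SFZ[OF that(2)], of _ q1]) (use that in simp)
  note SFg = SF_dcoord[OF U2 Suc.prems] SF_dmom[OF U2 Suc.prems]
  have eL': "eL t = (\<Sum>a\<in>cs p2 q2. eY t a * L (dcoord a g) t) + (\<Sum>a\<in>B2. eZ t a * L (dmom a g) t)" for t
  proof -
   have "?E (dcoord (Ev i) (comp g)) t =
     (\<Sum>a\<in>cs p2 q2. ?E (?DY i a) t * L (dcoord a g) t)
     + (\<Sum>a\<in>B2. ?E (?DZ i a) t * L (dmom a g) t)" if i: "i < p1" for i
   proof -
    let ?F = "%x. \<Sum>a\<in>cs p2 q2. ?DY i a x * comp (dcoord a g) x"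
    let ?G = "%x. \<Sum>a\<in>B2. ?DZ i a x * comp (dmom a g) x"
    have SF1: "SF p1 q1 B1 U1 (%x. ?DY i a x * comp (dcoord a g) x)" if "a \<in> cs p2 q2" for a
     by (intro SF_mult[OF U1] SFd SF_comp SFg(1)[OF that] i that)
    have SF2: "SF p1 q1 B1 U1 (%x. ?DZ i a x * comp (dmom a g) x)" if "a \<in> B2" for a
     by (intro SF_mult[OF U1] SFd' SF_comp SFg(2) i that)
    have "?E (dcoord (Ev i) (comp g)) t = ?E (%x. ?F x + ?G x) t"
     by (rule sf_eval_cong[OF U1 _ dcoord_comp[OF Suc.prems] SF_D(1)[OF SF_dcoord[OF U1 SF_comp[OF Suc.prems], of _ q1]]])
      (use i in \<open>auto simp: bXt b\<close>)
    also have "... = ?E ?F t + ?E ?G t"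
     by (intro sf_eval_add[OF U1 B1 et] SF_sum[OF U1] SF1 SF2)
    also have "... = (\<Sum>a\<in>cs p2 q2. ?E (%x. ?DY i a x * comp (dcoord a g) x) t)
     + (\<Sum>a\<in>B2. ?E (%x. ?DZ i a x * comp (dmom a g) x) t)"
     by (simp only: sf_eval_sum[OF U1 B1 et SF1] sf_eval_sum[OF U1 B1 et SF2])
    finally show ?thesis
     by (simp add: L_def sf_eval_mult'[OF U1 B1 et SFd[OF i] SF_comp[OF SFg(1)]]
       sf_eval_mult'[OF U1 B1 et SFd'[OF i] SF_comp[OF SFg(2)]])
   qed
   then have "eL t = (\<Sum>i<p1. (\<Sum>a\<in>cs p2 q2. ?s i * ?E (?DY i a) t * L (dcoord a g) t)
     + (\<Sum>a\<in>B2. ?s i * ?E (?DZ i a) t * L (dmom a g) t))"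
    by (simp add: eL_def distrib_left sum_distrib_left mult.assoc)
   also have "... = (\<Sum>a\<in>cs p2 q2. eY t a * L (dcoord a g) t) + (\<Sum>a\<in>B2. eZ t a * L (dmom a g) t)"
    unfolding sum.distrib eY_def eZ_def sum_distrib_right
    by (simp only: sum.swap[of _ _ "{..<p1}"])
   finally show ?thesis .
  qed
  have diff: "gsord (%_. True) (Suc N) (eL t - eK t)" for t
  proof -
   have s1: "gsord (%_. True) 1 (eY t a)" "gsord (%_. True) 1 (eZ t a)" for a
    using gsord_mult[of "%_. True" 1 "?s _" 0] gsord_soul
    by (auto simp: eY_def eZ_def intro!: gsord_sum)
   have "eL t - eK t = (\<Sum>a\<in>cs p2 q2. eY t a * (L (dcoord a g) t - K (dcoord a g) t))
     + (\<Sum>a\<in>B2. eZ t a * (L (dmom a g) t - K (dmom a g) t))"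
    by (simp add: eL' eK_def right_diff_distrib sum_subtractf)
   also have "gsord (%_. True) (1 + N) ..."
    by (intro gsord_add gsord_sum gsord_mult s1 Suc.IH SFg)
   finally show ?thesis by simp
  qed
  have base: "L g 0 = K g 0"
  proof -
   let ?X = "rst (cs p1 q1) (Xt 0)" and ?P = "rst B1 P"
   have ed: "evd p1 ?X ?P" by (rule evd_rst[OF B1 et])
   have s0: "soul (?X (Ev i)) = 0" if "i < p1" for i
    using that by (simp add: rst_def Xt_def)
   define \<sigma> where "\<sigma> = subst_var ?X ?P"
   have \<sigma>: "good \<sigma>" "!!b n. \<sigma> (Par b n) = gs_var (Par b n)" using ed by (simp_all add: evd_def \<sigma>_def)
   have z: "sf_eval p1 h (Xt 0) P = msub \<sigma> (h b)" if "SF p1 q1 B1 U1 h" for h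
   proof -
    have "sf_eval p1 h ?X ?P = msub (subst_var ?X ?P) (h (bodypt p1 ?X))"
     by (rule sf_eval_soul_0[OF ed]) (rule s0)
    then show ?thesis
     unfolding sf_eval_norm[OF U1 evokD(6)[OF et] that] \<sigma>_def by (simp add: bXt)
   qed
   have "L g 0 = msub \<sigma> (sf_eval p2 g (Y b) (Z b))"
    unfolding L_def by (rule z[OF SF_comp[OF Suc.prems]])
    also have "... = K g 0" unfolding K_def
    by (rule msub_sf_eval[OF \<sigma> U2 B2 Suc.prems ev[OF b]]) (simp_all add: YY_def ZZ_def z[OF SFY] z[OF SFZ])
   finally show ?thesis .
  qed
  show ?case
   unfolding gsord_def
  proof (intro allI impI)
   fix k :: "var multiset" assume k: "size (filter_mset (%_. True) k) < Suc N"
   have "coeff (L g t - K g t) k = coeff (L g 0 - K g 0) k"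
    by (rule const_coeff[where f = "%t. L g t - K g t" and e = "%t. eL t - eK t"])
     (use cder_diff[OF dL dK] diff k in \<open>auto simp: gsord_def\<close>)
   then show "coeff (L g t - K g t) k = 0" by (simp add: base)
  qed
 qed simp
 have "L g 1 = K g 1" using main[OF g] by (intro gsord_eqI[of "%_. True"])
 then have "sf_eval p1 (comp g) X P = sf_eval p2 g (YY 1) (ZZ 1)"
  using X1[OF SF_comp[OF g]] by (simp add: L_def K_def)
 also have "... = sf_eval p2 g Y' Z'"
 proof (rule sf_eval_eqI[OF U2 g evokD(6)[OF eYZ]])
  show "YY 1 a = Y' a" if "a \<in> cs p2 q2" for a using X1[OF SFY[OF that]] Y'[OF that] by (simp add: YY_def)
  show "ZZ 1 a = Z' a" if "a \<in> B2" for a using X1[OF SFZ[OF that]] Z'[OF that] by (simp add: ZZ_def)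
 qed
 finally show ?thesis .
qed

end

subsection \<open>Evaluation of generators\<close>

lemma psign_mult: "psign a * psign a = 1" "psign a * f = (if codd a then - f else f)" "f * psign a = psign a * f"
 by (auto simp: psign_def)

lemma gs_parity_coord_pt: "gs_parity (codd a) (coord_pt x a)"
 using gs_parity_var[of "Xi j" for j] by (cases a) (auto simp: coord_pt_def)

lemma coord_pt_simps [simp]: "coord_pt x (Ev i) = of_real (x i)" "coord_pt x (Od j) = gs_var (Xi j)"
 by (simp_all add: coord_pt_def)

lemma bodypt_coord_pt:
 assumes "eopen p U" "x \<in> U"
 shows "bodypt p (coord_pt x) = x"
 using openin_Euclidean_topspace[OF assms] by (auto simp: bodypt_def not_less)

lemma bodypt_coord_pt_in: "eopen p U ==> x \<in> U ==> bodypt p (coord_pt x) \<in> U"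
 by (simp add: bodypt_coord_pt)

lemma evok_coord_pt:
 assumes "eopen p U" "x \<in> U" "!!a. a \<in> B ==> gs_parity (codd a) (P a)" "!!a. a \<in> B ==> coeff (P a) {#} = 0"
 shows "evok p q B U (coord_pt x) P"
 using assms(3,4) by (auto simp: evok_def bodypt_coord_pt[OF assms(1,2)] assms(2) gs_parity_coord_pt)

lemma mom_var_props: "gs_parity (codd a) (mom_var a)" "coeff (mom_var a) {#} = 0"
 using gs_parity_var[of "Mom a"] by (simp_all add: mom_var_def coeff_gs_var)

text \<open>Sending the momenta outside \<open>B\<close> to 0 keeps the substitution good whatever
  \<open>P\<close> does there.\<close>

definition psub :: "coord set => (coord => gs) => var => gs" where
 "psub B P = subst_var (coord_pt (%_. 0)) (rst B P)"

lemma psub_simps [simp]: "psub B P (Xi j) = gs_var (Xi j)" "psub B P (Mom a) = (if a \<in> B then P a else 0)"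
 "psub B P (Par b n) = gs_var (Par b n)"
 by (simp_all add: psub_def rst_def)

lemma good_psub:
 assumes "finite B" "!!a. a \<in> B ==> gs_parity (codd a) (P a)" "!!a. a \<in> B ==> coeff (P a) {#} = 0"
 shows "good (psub B P)"
 unfolding good_def
proof (intro conjI allI)
 fix v
 show "gs_parity (vodd v) (psub B P v)" using assms(2) gs_parity_var[of v] by (cases v) auto
 show "coeff (psub B P v) {#} = 0" using assms(3) by (cases v) (auto simp: coeff_gs_var)
next
 fix k :: "var multiset"
 have *: "v \<in> Mom ` B \<union> set_mset k" if "coeff (psub B P v) k ~= 0" for v
  using that by (cases v) (auto simp: coeff_gs_var split: if_splits)
 show "finite {v. coeff (psub B P v) k ~= 0}"
  by (rule finite_subset, rule subsetI, rule *) (use assms(1) in simp_all)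
qed

text \<open>At a point whose even coordinates have no soul only the Taylor piece of degree 0
  survives, so evaluation is a mere substitution for the momenta.\<close>

lemma sf_eval_coord_pt:
 assumes U: "eopen p U" and B: "finite B" and g: "SF p q B U g" and x: "x \<in> U"
  and P: "!!a. a \<in> B ==> gs_parity (codd a) (P a)" "!!a. a \<in> B ==> coeff (P a) {#} = 0"
 shows "sf_eval p g (coord_pt x) P = msub (psub B P) (g x)"
proof -
 let ?X = "rst (cs p q) (coord_pt x)" and ?P = "rst B P"
 have e: "evok p q B U (coord_pt x) P" by (rule evok_coord_pt[OF U x P])
 have ed: "evd p ?X ?P" by (rule evd_rst[OF B e])
 have "sf_eval p g ?X ?P = msub (subst_var ?X ?P) (g (bodypt p ?X))"
  by (rule sf_eval_soul_0[OF ed]) (simp add: rst_def)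
 also have "... = msub (subst_var ?X ?P) (g x)" by (simp add: bodypt_coord_pt[OF U x])
 also have "... = msub (psub B P) (g x)"
 proof (rule msub_cong[OF _ good_psub[OF B P] SF_D(1)[OF g x]])
  show "good (subst_var ?X ?P)" using ed by (simp add: evd_def)
  show "subst_var ?X ?P v = psub B P v" if "v \<in> svars q B" for v
   using that by (cases v) (auto simp: svars_def rst_def)
 qed
 finally show ?thesis by (simp add: sf_eval_norm[OF U evokD(6)[OF e] g])
qed

lemma sf_eval_identity:
 assumes U: "eopen p U" and B: "finite B" and g: "SF p q B U g" and x: "x \<in> U"
 shows "sf_eval p g (coord_pt x) mom_var = g x"
proof -
 have "sf_eval p g (coord_pt x) mom_var = msub (psub B mom_var) (g x)"
  by (rule sf_eval_coord_pt[OF U B g x]) (simp_all add: mom_var_props)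
 also have "... = msub gs_var (g x)"
 proof (rule msub_cong[OF good_psub[OF B] good_var SF_D(1)[OF g x]])
  show "psub B mom_var v = gs_var v" if "v \<in> svars q B" for v
   using that by (cases v) (auto simp: svars_def mom_var_def)
 qed (simp_all add: mom_var_props)
 finally show ?thesis by (simp add: msub_gs_var)
qed

lemma dcoord_coord_pt: "dcoord b (%x. coord_pt x a) x = (if a = b then 1 else 0)"
proof (cases b)
 case (Ev i)
 show ?thesis
 proof (rule gs_eqI)
  fix m
  show "coeff (dcoord b (%x. coord_pt x a) x) m = coeff (if a = b then 1 else 0) m"
   unfolding Ev coeff_dcoord_Ev
   by (cases a; cases "m = {#}") (auto simp: of_real_def rpd_const rpd_coordinate)
 qed
next
 case (Od j)
 show ?thesis
 proof (cases a)
  case (Ev i)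
  then show ?thesis
   using vderiv_mon_notin[of "Xi j" "{#}"] by (simp add: \<open>b = Od j\<close> dcoord_Od mon_empty of_real_def clin_scaleR[OF clin_vderiv])
 next
  case (Od j')
  then show ?thesis
   using vderiv_mon_notin[of "Xi j" "{#Xi j'#}"] vderiv_mon_add[of "Xi j" "{#}"]
   by (auto simp: \<open>b = Od j\<close> dcoord_Od mon_empty mon_single mono_ok_add_mset)
 qed
qed

lemma SF_coord_pt:
 assumes "eopen p U" "a \<in> cs p q"
 shows "SF p q B U (%x. coord_pt x a)"
proof (cases a)
 case (Ev i)
 have "smooth_on p U (%x. coeff (of_real (x i)) m)" for m
  using smooth_coordinate[OF assms(1), of i] smooth_const[OF assms(1)]
  by (cases "m = {#}") (simp_all add: of_real_def)
 then show ?thesis by (simp add: Ev SF_altdef sfn_def)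
next
 case (Od j)
 then show ?thesis using assms by (auto simp: SF_altdef sfn_const svars_def intro!: gs_vars_var)
qed

lemma sfE_const:
 assumes gd: "good (subst_var X P)"
 shows "sfE p X P n (%x. a) = (if n = 0 then msub (subst_var X P) a else 0)"
proof -
 have d: "dcoord (Ev i) (%x. a) = (%x. 0)" for i a
  by (rule ext, rule gs_eqI) (simp add: coeff_dcoord_Ev rpd_const)
 have z: "sfE p X P n (%x. 0) = 0" for n
  by (induction n) (simp_all add: clin_0[OF clin_msub[OF gd]] sfE.simps(2) d)
 show ?thesis by (cases n) (simp_all add: sfE.simps(2) d z)
qed

text \<open>For an even coordinate the pieces of degree 0 and 1 are its body and its soul, and all
  others vanish; for an odd one the piece of degree 0 is everything.\<close>

lemma sf_eval_coordinate:
 assumes U: "eopen p U" and B: "finite B" and e: "evok p q B U X P" and a: "a \<in> cs p q"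
 shows "sf_eval p (%x. coord_pt x a) X P = X a"
proof -
 let ?X = "rst (cs p q) X" and ?P = "rst B P"
 let ?f = "%x. coord_pt x a"
 have ed: "evd p ?X ?P" by (rule evd_rst[OF B e])
 have gd: "good (subst_var ?X ?P)" using ed by (simp add: evd_def)
 have const: "sfE p ?X ?P n (%x. of_real r) = (if n = 0 then of_real r else 0)" for n r
  by (simp add: sfE_const[OF gd] msub_of_real[OF gd])
 have d: "dcoord (Ev i) ?f = (%x. of_real (if a = Ev i then 1 else 0))" for i
  by (simp add: fun_eq_iff dcoord_coord_pt)
 have E: "sfE p ?X ?P (Suc n) ?f = (if n = 0 then (\<Sum>i<p. soul (?X (Ev i)) * of_real (if a = Ev i then 1 else 0)) else 0)" for n
  by (simp only: sfE.simps(2) d const) simp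
 have "sf_eval p ?f ?X ?P = sfE p ?X ?P 0 ?f + sfE p ?X ?P (Suc 0) ?f"
 proof (rule gs_eqI)
  fix k assume "mono_ok k"
  then have "coeff (sf_eval p ?f ?X ?P) k = (\<Sum>n\<le>Suc (size k). coeff (sfE p ?X ?P n ?f) k)"
   by (intro sf_eval_coeff[OF ed]) auto
  also have "... = coeff (sfE p ?X ?P 0 ?f) k + (\<Sum>n\<le>size k. coeff (sfE p ?X ?P (Suc n) ?f) k)"
   by (rule sum.atMost_Suc_shift)
  also have "(\<Sum>n\<le>size k. coeff (sfE p ?X ?P (Suc n) ?f) k)
    = (\<Sum>n\<le>size k. if n = 0 then coeff (sfE p ?X ?P (Suc 0) ?f) k else 0)"
   by (intro sum.cong refl) (simp add: E)
  also have "... = coeff (sfE p ?X ?P (Suc 0) ?f) k" by (simp add: sum.delta)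
  finally show "coeff (sf_eval p ?f ?X ?P) k = coeff (sfE p ?X ?P 0 ?f + sfE p ?X ?P (Suc 0) ?f) k" by simp
 qed
 also have "... = X a"
 proof (cases a)
  case (Ev i)
  then have i: "i < p" using a by simp
  have "(\<Sum>j<p. soul (?X (Ev j)) * of_real (if a = Ev j then 1 else 0)) = (\<Sum>j<p. if j = i then soul (X (Ev j)) else 0)"
   by (intro sum.cong refl) (auto simp: Ev rst_def)
  then show ?thesis using i unfolding E by (simp add: Ev msub_of_real[OF gd] sum.delta bodypt_def rst_def soul_def)
 next
  case (Od j)
  then show ?thesis using a unfolding E by (simp add: msub_var[OF gd] rst_def)
 qed
 finally show ?thesis using sf_eval_norm[OF U evokD(6)[OF e] SF_coord_pt[OF U a, of B]] by simp
qed

lemma sf_eval_const: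
 assumes U: "eopen p U" and B: "finite B" and e: "evok p q B U X P" and a: "gs_vars (svars q B) a"
 shows "sf_eval p (%x. a) X P = msub (subst_var (rst (cs p q) X) (rst B P)) a"
proof -
 let ?X = "rst (cs p q) X" and ?P = "rst B P"
 have ed: "evd p ?X ?P" by (rule evd_rst[OF B e])
 have gd: "good (subst_var ?X ?P)" using ed by (simp add: evd_def)
 have "sfE p ?X ?P n (%x. a) = (if n = 0 then msub (subst_var ?X ?P) a else 0)" for n by (rule sfE_const[OF gd])
 then have "sf_eval p (%x. a) ?X ?P = msub (subst_var ?X ?P) a"
  by (intro gs_eqI) (simp add: sf_eval_coeff[OF ed _ order_refl] if_distrib[of "%f. coeff f _"] if_distribR sum.delta cong: if_cong)
 then show ?thesis using sf_eval_norm[OF U evokD(6)[OF e] SF_const[OF U a]] by simp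
qed

lemma sf_eval_mom_var:
 assumes U: "eopen p U" and B: "finite B" and e: "evok p q B U X P" and a: "a \<in> B"
 shows "sf_eval p (%x. mom_var a) X P = P a"
proof -
 have gd: "good (subst_var (rst (cs p q) X) (rst B P))" using evd_rst[OF B e] by (simp add: evd_def)
 have v: "gs_vars (svars q B) (mom_var a)" using a by (auto simp: mom_var_def svars_def intro!: gs_vars_var)
 show ?thesis unfolding sf_eval_const[OF U B e v]
  using a by (simp add: mom_var_def msub_var[OF gd] rst_def)
qed

lemma sf_eval_scaleR:
 assumes U: "eopen p U" and B: "finite B" and e: "evok p q B U X P" and g: "SF p q B U g"
 shows "sf_eval p (%x. r *\<^sub>R g x) X P = r *\<^sub>R sf_eval p g X P"
proof -
 have gd: "good (subst_var (rst (cs p q) X) (rst B P))" using evd_rst[OF B e] by (simp add: evd_def)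
 have "sf_eval p (%x. of_real r * g x) X P = sf_eval p (%x. of_real r) X P * sf_eval p g X P"
  by (rule sf_eval_mult'[OF U B e SF_const[OF U] g]) simp
 also have "sf_eval p (%x. of_real r) X P = of_real r"
  using sf_eval_const[OF U B e, of "of_real r"] by (simp add: msub_of_real[OF gd])
 finally show ?thesis by (simp add: of_real_def)
qed

subsection \<open>Congruences modulo powers of an ideal of variables\<close>

lemma gsord_cong_mult:
 assumes "gsord W n (f - f')" "gsord W n (g - g')"
 shows "gsord W n (f * g - f' * g')"
proof -
 have "f * g - f' * g' = (f - f') * g + f' * (g - g')" by (simp add: algebra_simps)
 then show ?thesis using gsord_mult[OF assms(1), of 0 g] gsord_mult[OF _ assms(2), of 0 f'] by (simp add: gsord_add)
qed

lemma gsord_cong_prod_list: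
 "(!!v. v \<in> set vs ==> gsord W n (\<sigma> v - \<tau> v)) ==> gsord W n (prod_list (map \<sigma> vs) - prod_list (map \<tau> vs))"
 by (induction vs) (auto intro: gsord_cong_mult)

lemma gsord_prod_list_mem:
 assumes "u \<in> set vs" "gsord W 1 (\<sigma> u)"
 shows "gsord W 1 (prod_list (map \<sigma> vs))"
 using assms(1)
proof (induction vs)
 case (Cons w ws)
 then show ?case
  using gsord_mult[OF assms(2), of 0 "prod_list (map \<sigma> ws)"] gsord_mult[of W 0 "\<sigma> w" 1] by auto
qed simp

text \<open>A factor of order 1 common to both products accompanies every difference of the other
  factors and raises its order by one. This is the source of the contraction.\<close>

lemma gsord_cong_prod_list_Suc:
 assumes "!!v. v \<in> set vs ==> gsord W n (\<sigma> v - \<tau> v)" "u \<in> set vs" "gsord W 1 (\<sigma> u)" "\<tau> u = \<sigma> u"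
 shows "gsord W (Suc n) (prod_list (map \<sigma> vs) - prod_list (map \<tau> vs))"
 using assms(1,2)
proof (induction vs)
 case (Cons v vs)
 show ?case
 proof (cases "u = v")
  case True
  have "prod_list (map \<sigma> (v # vs)) - prod_list (map \<tau> (v # vs))
    = \<sigma> u * (prod_list (map \<sigma> vs) - prod_list (map \<tau> vs))"
   using True assms(4) by (simp add: algebra_simps)
  then show ?thesis
   using gsord_mult[OF assms(3) gsord_cong_prod_list[of vs W n \<sigma> \<tau>]] Cons.prems(1) by simp
 next
  case False
  then have u: "u \<in> set vs" using Cons.prems(2) by simp
  have one: "gsord W 1 (prod_list (map \<sigma> vs))" by (rule gsord_prod_list_mem[where \<sigma> = \<sigma>, OF u assms(3)])
  have "prod_list (map \<sigma> (v # vs)) - prod_list (map \<tau> (v # vs))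
    = (\<sigma> v - \<tau> v) * prod_list (map \<sigma> vs) + \<tau> v * (prod_list (map \<sigma> vs) - prod_list (map \<tau> vs))"
   by (simp add: algebra_simps)
  moreover have "gsord W (Suc n) ((\<sigma> v - \<tau> v) * prod_list (map \<sigma> vs))"
   using gsord_mult[OF Cons.prems(1)[of v] one] by simp
  moreover have "gsord W (Suc n) (\<tau> v * (prod_list (map \<sigma> vs) - prod_list (map \<tau> vs)))"
   using gsord_mult[of W 0 "\<tau> v" "Suc n"] Cons.IH u Cons.prems(1) by simp
  ultimately show ?thesis using gsord_add by simp
 qed
qed simp

lemma sf_eval_termwise:
 assumes "!!l m. l \<in> lists {..<p} ==> coeff (sf_eval_term p g X P l m) k = coeff (sf_eval_term p g' X' P' l m) k"
 shows "coeff (sf_eval p g X P) k = coeff (sf_eval p g' X' P') k"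
proof -
 have "infsum (%x. coeff (sf_eval_term p g X P (fst x) (snd x)) k) (lists {..<p} \<times> S)
  = infsum (%x. coeff (sf_eval_term p g' X' P' (fst x) (snd x)) k) (lists {..<p} \<times> S)" for S
  by (rule infsum_cong) (simp only: mem_Times_iff assms)
 then show ?thesis by (cases "mono_ok k") (simp_all add: sf_eval_def sf_eval_deg_def case_prod_unfold coeff_not_ok)
qed

text \<open>At equal bodies the coefficients and derivatives of \<open>g\<close> are the same on
  both sides, so the evaluations differ only in the products of the arguments.\<close>

lemma sf_eval_gsord_termwise:
 assumes b: "bodypt p X = bodypt p X'" and U: "eopen p U" "bodypt p X \<in> U"
  and t: "!!l m y. l \<in> lists {..<p} ==> y \<in> U ==> coeff (g y) m ~= 0 ==>
   gsord W n (prod_list (map (%i. soul (X (Ev i))) l) * prod_list (map (subst_var X P) (sorted_list_of_multiset m))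
    - prod_list (map (%i. soul (X' (Ev i))) l) * prod_list (map (subst_var X' P') (sorted_list_of_multiset m)))"
 shows "gsord W n (sf_eval p g X P - sf_eval p g X' P')"
 unfolding gsord_def
proof (intro allI impI)
 fix k assume k: "size (filter_mset W k) < n"
 have "coeff (sf_eval p g X P) k = coeff (sf_eval p g X' P') k"
 proof (rule sf_eval_termwise)
  fix l m assume l: "l \<in> lists {..<p}"
  show "coeff (sf_eval_term p g X P l m) k = coeff (sf_eval_term p g X' P' l m) k"
  proof (cases "EX y:U. coeff (g y) m ~= 0")
   case True
   then show ?thesis using t[OF l, of _ m] k by (auto simp: sf_eval_term_def b gsord_def)
  next
   case False
   have "foldr rpd l (%y. coeff (g y) m) (bodypt p X) = foldr rpd l (%y. 0) (bodypt p X)"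
    by (rule foldr_rpd_cong[OF U(1) l _ U(2)]) (use False in blast)
   then show ?thesis by (simp add: sf_eval_term_def b foldr_rpd_0)
  qed
 qed
 then show "coeff (sf_eval p g X P - sf_eval p g X' P') k = 0" by simp
qed

lemma gsord_cong_souls:
 assumes b: "bodypt p X = bodypt p X'" and X: "!!i. i < p ==> gsord W n (X (Ev i) - X' (Ev i))" and l: "l \<in> lists {..<p}"
 shows "gsord W n (prod_list (map (%i. soul (X (Ev i))) l) - prod_list (map (%i. soul (X' (Ev i))) l))"
proof (rule gsord_cong_prod_list)
 fix i assume "i \<in> set l"
 then have "i < p" using l by auto
 then show "gsord W n (soul (X (Ev i)) - soul (X' (Ev i)))"
  using X fun_cong[OF b, of i] by (simp add: soul_def bodypt_def)
qed

lemma sf_eval_gsord_cong: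
 assumes b: "bodypt p X = bodypt p X'" and X: "!!i. i < p ==> gsord W n (X (Ev i) - X' (Ev i))"
  and v: "!!v. v \<in> V ==> gsord W n (subst_var X P v - subst_var X' P' v)"
  and g: "!!y. y \<in> U ==> gs_vars V (g y)" and U: "eopen p U" "bodypt p X \<in> U"
 shows "gsord W n (sf_eval p g X P - sf_eval p g X' P')"
proof (rule sf_eval_gsord_termwise[OF b U], rule gsord_cong_mult[OF gsord_cong_souls[OF b X]])
 fix m y assume "y \<in> U" "coeff (g y) m ~= 0"
 then have "set_mset m \<subseteq> V" using g unfolding gs_vars_def by blast
 then show "gsord W n (prod_list (map (subst_var X P) (sorted_list_of_multiset m))
   - prod_list (map (subst_var X' P') (sorted_list_of_multiset m)))"
  by (intro gsord_cong_prod_list v) auto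
qed

lemma foldr_rpd_par_0:
 assumes "!!y. gsord W 1 (g y)" "filter_mset W m = {#}"
 shows "foldr rpd l (%y. coeff (g y) m) x = 0"
proof -
 have "(%y. coeff (g y) m) = (%y. 0)" using assms by (simp add: gsord_def fun_eq_iff)
 then show ?thesis by (simp add: foldr_rpd_0)
qed

lemma gsord_own_var: "W v ==> gsord W 1 (gs_var v)"
 by (auto simp: gsord_def coeff_gs_var)

lemmas gsord_par_var = gsord_own_var[of is_par]

lemma W_split:
 assumes "filter_mset W m ~= {#}"
 obtains v where "v \<in> set (sorted_list_of_multiset m)" "W v"
proof -
 have "set_mset (filter_mset W m) ~= {}" using assms by simp
 then show ?thesis using that by auto
qed

lemma subst_var_par: "is_par v ==> subst_var X P v = gs_var v"
 by (cases v) auto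

text \<open>No convergence or parity is needed here: the congruences hold term by term.\<close>

lemma sf_eval_par_1:
 assumes "!!y. gsord W 1 (g y)" and W: "!!v. W v ==> subst_var X P v = gs_var v"
 shows "gsord W 1 (sf_eval p g X P)"
 unfolding gsord_def
proof (intro allI impI)
 fix k assume k: "size (filter_mset W k) < 1"
 have "coeff (sf_eval p g X P) k = coeff (sf_eval p (%x. 0) X P) k"
 proof (rule sf_eval_termwise)
  fix l m assume l: "l \<in> lists {..<p}"
  show "coeff (sf_eval_term p g X P l m) k = coeff (sf_eval_term p (%x. 0) X P l m) k"
  proof (cases "filter_mset W m = {#}")
   case True
   then show ?thesis by (simp add: sf_eval_term_def foldr_rpd_par_0[OF assms(1)] foldr_rpd_0)
  next
   case False
   then obtain b where bn: "b \<in> set (sorted_list_of_multiset m)" "W b" by (rule W_split)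
   have "gsord W 1 (prod_list (map (subst_var X P) (sorted_list_of_multiset m)))"
    by (rule gsord_prod_list_mem[OF bn(1)]) (simp add: W[OF bn(2)] gsord_own_var[of W, OF bn(2), unfolded One_nat_def])
   then have "gsord W (0 + 1) (prod_list (map (%i. soul (X (Ev i))) l)
     * prod_list (map (subst_var X P) (sorted_list_of_multiset m)))"
    by (intro gsord_mult) simp_all
   then show ?thesis using k by (simp add: sf_eval_term_def gsord_def foldr_rpd_0)
  qed
 qed
 then show "coeff (sf_eval p g X P) k = 0" by (simp add: sf_eval_0)
qed

text \<open>Every monomial of \<open>g\<close> contains a variable of \<open>W\<close>, which both
  evaluations leave as it is. That factor raises the order of the difference from \<open>n\<close>
  to \<open>Suc n\<close>.\<close>

lemma sf_eval_par_contract: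
 assumes b: "bodypt p X = bodypt p X'" and X: "!!i. i < p ==> gsord W n (X (Ev i) - X' (Ev i))"
  and v: "!!v. v \<in> V ==> gsord W n (subst_var X P v - subst_var X' P' v)"
  and g: "!!y. y \<in> U ==> gs_vars V (g y)" and U: "eopen p U" "bodypt p X \<in> U"
  and g1: "!!y. gsord W 1 (g y)"
  and W: "!!v. W v ==> subst_var X P v = gs_var v" and W': "!!v. W v ==> subst_var X' P' v = gs_var v"
 shows "gsord W (Suc n) (sf_eval p g X P - sf_eval p g X' P')"
proof (rule sf_eval_gsord_termwise[OF b U])
 fix l m y assume l: "l \<in> lists {..<p}" and y: "y \<in> U" "coeff (g y) m ~= 0"
 have V: "set_mset m \<subseteq> V" using g y unfolding gs_vars_def by blast
 have "filter_mset W m ~= {#}" using g1[of y] y(2) by (auto simp: gsord_def)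
 then obtain c where c: "c \<in> set (sorted_list_of_multiset m)" "W c" by (rule W_split)
 note c1 = gsord_own_var[of W, OF c(2), unfolded One_nat_def]
 let ?f = "prod_list (map (%i. soul (X (Ev i))) l)" and ?f' = "prod_list (map (%i. soul (X' (Ev i))) l)"
 let ?h = "prod_list (map (subst_var X P) (sorted_list_of_multiset m))"
 let ?h' = "prod_list (map (subst_var X' P') (sorted_list_of_multiset m))"
 have h1: "gsord W 1 ?h" by (rule gsord_prod_list_mem[OF c(1)]) (simp add: W[OF c(2)] c1)
 have 1: "gsord W (Suc n) ((?f - ?f') * ?h)"
  using gsord_mult[OF gsord_cong_souls[OF b X l] h1] by simp
 have "gsord W (Suc n) (?h - ?h')"
  by (rule gsord_cong_prod_list_Suc[OF _ c(1)]) (use V v in \<open>auto simp: W[OF c(2)] W'[OF c(2)] c1\<close>)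
 then have 2: "gsord W (0 + Suc n) (?f' * (?h - ?h'))" by (intro gsord_mult) simp_all
 show "gsord W (Suc n) (?f * ?h - ?f' * ?h')"
  using gsord_add[OF 1 2[unfolded add_0]] by (simp add: algebra_simps)
qed

text \<open>Completeness of the filtration: the coefficient at \<open>k\<close> is read off from a
  member of the sequence whose index exceeds the number of variables of \<open>W\<close> in
  \<open>k\<close>.\<close>

lemma gsord_lim_exists:
 assumes "!!n. gsord W n (T (Suc n) - T n)"
 obtains f where "!!n. gsord W n (f - T n)"
proof -
 have c: "gsord W n (T (n + m) - T n)" for n m
 proof (induction m)
  case (Suc m)
  have "gsord W n (T (Suc (n + m)) - T (n + m))" by (rule gsord_mono[OF assms]) simp
  from gsord_add[OF this Suc] show ?case by simp
 qed simp
 define f where "f = gs_of (%k. coeff (T (Suc (size (filter_mset W k)))) k)"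
 have "gsord W n (f - T n)" for n
  unfolding gsord_def
 proof (intro allI impI)
  fix k assume k: "size (filter_mset W k) < n"
  define d where "d = Suc (size (filter_mset W k))"
  have "gsord W d (T (d + (n - d)) - T d)" by (rule c)
  moreover have "d + (n - d) = n" using k by (simp add: d_def)
  ultimately have "coeff (T n - T d) k = 0" unfolding gsord_def d_def by simp
  then show "coeff (f - T n) k = 0"
   by (cases "mono_ok k") (simp_all add: f_def d_def coeff_not_ok)
 qed
 then show ?thesis using that by blast
qed

text \<open>Banach iteration for the filtration by \<open>gsord W\<close>, started at 0. The
  distance to the iterates is part of the conclusion, so that properties of the iterates can be
  passed to the limit.\<close>

lemma contraction_fixpoint:
 fixes \<Psi> :: "('i => gs) => 'i => gs"
 assumes "!!n Q Q'. (!!i. gsord W n (Q i - Q' i)) ==> (!!i. gsord W (Suc n) (\<Psi> Q i - \<Psi> Q' i))"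
 obtains Q where "\<Psi> Q = Q" "!!n i. gsord W n (Q i - (\<Psi> ^^ n) (%_. 0) i)"
  "!!Q'. \<Psi> Q' = Q' ==> Q' = Q"
proof -
 let ?T = "%n. (\<Psi> ^^ n) (%_. 0)"
 have "gsord W n (?T (Suc n) i - ?T n i)" for n i
 proof (induction n arbitrary: i)
  case (Suc n)
  then show ?case using assms[of n "?T (Suc n)" "?T n" i] by simp
 qed simp
 then have "EX f. ALL n. gsord W n (f - ?T n i)" for i
  using gsord_lim_exists[of W "%n. ?T n i"] by metis
 then obtain Q where Q: "!!i n. gsord W n (Q i - ?T n i)" by metis
 have fix_Q: "\<Psi> Q i = Q i" for i
 proof (rule gsord_eqI)
  fix n
  have "gsord W (Suc n) (\<Psi> Q i - ?T (Suc n) i)" using assms[of n Q "?T n" i] Q by simp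
  from gsord_diff[OF this Q[of "Suc n" i]] have "gsord W (Suc n) (\<Psi> Q i - Q i)" by simp
  then show "gsord W n (\<Psi> Q i - Q i)" by (rule gsord_mono) simp
 qed
 have uniq: "Q' = Q" if "\<Psi> Q' = Q'" for Q'
 proof
  fix i
  have "gsord W n (Q' i - Q i)" for n
  proof (induction n arbitrary: i)
   case (Suc n)
   then show ?case using assms[of n Q' Q i] that fix_Q by simp
  qed simp
  then show "Q' i = Q i" by (rule gsord_eqI)
 qed
 show ?thesis using that[of Q] fix_Q Q uniq by blast
qed

lemma gsord_lim_parity: "(!!n. gsord W n (f - T n)) ==> (!!n. gs_parity b (T n)) ==> gs_parity b f"
 unfolding gs_parity_def
proof (intro allI impI)
 fix m assume *: "!!n. gsord W n (f - T n)" "!!n. ALL m. coeff (T n) m ~= 0 --> odd (size (filter_mset vodd m)) = b" "coeff f m ~= 0"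
 have "coeff (f - T (Suc (size (filter_mset W m)))) m = 0" using *(1) unfolding gsord_def by blast
 then show "odd (size (filter_mset vodd m)) = b" using *(2,3) by auto
qed

lemma gsord_lim_coeff: "(!!n. gsord W n (f - T n)) ==> coeff f m = coeff (T (Suc (size (filter_mset W m)))) m"
proof -
 assume *: "!!n. gsord W n (f - T n)"
 have "coeff (f - T (Suc (size (filter_mset W m)))) m = 0" using * unfolding gsord_def by blast
 then show ?thesis by simp
qed

subsection \<open>Shifts in a nilpotent direction\<close>

lemma gsord_odd_2: "vodd v ==> gsord (%u. u = v) 2 f ==> f = 0"
proof (rule gs_eqI)
 fix m assume *: "vodd v" "gsord (%u. u = v) 2 f" "mono_ok m"
 then have "count m v \<le> 1" by (simp add: mono_ok_def)
 moreover have "size (filter_mset (%u. u = v) m) = count m v"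
  by (simp add: filter_eq_replicate_mset)
 ultimately show "coeff f m = coeff 0 m" using *(2) by (simp add: gsord_def)
qed

lemma gsord_1_empty: "gsord W 1 f ==> coeff f {#} = 0"
 by (simp add: gsord_def)

text \<open>Taylor expansion stops at first order because every increment is divisible by the odd
  variable \<open>v\<close>, whose square is 0. Along the straight path the derivatives of
  \<open>g\<close> change only by multiples of \<open>v\<close>, so the velocity is
  constant.\<close>

lemma sf_eval_shift:
 assumes U: "eopen p U" and B: "finite B" and g: "SF p q B U g" and e: "evok p q B U X P"
  and v: "vodd v" and A: "!!a. a \<in> cs p q ==> gsord (%u. u = v) 1 (A a)" "!!a. a \<in> cs p q ==> gs_parity (codd a) (A a)"
  and C: "!!a. a \<in> B ==> gsord (%u. u = v) 1 (C a)" "!!a. a \<in> B ==> gs_parity (codd a) (C a)"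
 shows "sf_eval p g (%a. X a + A a) (%a. P a + C a) = sf_eval p g X P + chain p q B g X P A C"
proof -
 define Xt where "Xt t a = X a + t *\<^sub>R A a" for t a
 define Pt where "Pt t a = P a + t *\<^sub>R C a" for t a
 have bt: "bodypt p (Xt t) = bodypt p X" for t
  by (rule bodypt_eq) (use gsord_1_empty[OF A(1)] in \<open>simp add: Xt_def body_def\<close>)
 have et: "evok p q B U (Xt t) (Pt t)" for t
  unfolding evok_def bt using evokD[OF e] A(2) C(2) gsord_1_empty[OF C(1)]
  by (auto simp: Xt_def Pt_def intro!: gs_parity_add gs_parity_scaleR)
 let ?w = "chain p q B g X P A C"
 have cong: "gsord (%u. u = v) 1 (sf_eval p h (Xt t) (Pt t) - sf_eval p h X P)" if h: "SF p q B U h" for h t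
 proof (rule sf_eval_gsord_cong[OF bt, where V = "svars q B" and U = U])
  show "gsord (%u. u = v) 1 (Xt t (Ev i) - X (Ev i))" if "i < p" for i
   using A(1)[of "Ev i"] that by (simp add: Xt_def gsord_scaleR)
  show "gsord (%u. u = v) 1 (subst_var (Xt t) (Pt t) w - subst_var X P w)" if "w \<in> svars q B" for w
   using that A(1) C(1) by (cases w) (auto simp: svars_def Xt_def Pt_def gsord_scaleR)
  show "gs_vars (svars q B) (h y)" if "y \<in> U" for y by (rule SF_D(1)[OF h that])
 qed (use U evokD(6)[OF et] in auto)
 \<comment> \<open>Next to a factor divisible by \<open>v\<close>, the other factor matters only
   modulo \<open>v\<close>.\<close>
 have kill: "a * f = a * f'" if "gsord (%u. u = v) 1 a" "gsord (%u. u = v) 1 (f - f')" for a f f'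
  using gsord_odd_2[OF v, of "a * (f - f')"] gsord_mult[OF that] by (simp add: numeral_2_eq_2 algebra_simps)
 have d: "cder (%s. sf_eval p g (Xt (t + s)) (Pt (t + s))) ?w" for t
 proof -
  have "cder (%s. sf_eval p g (Xt (t + s)) (Pt (t + s)))
   (chain p q B g (Xt (t + 0)) (Pt (t + 0)) A C)"
  proof (rule cder_sf_eval[OF U B g, of "%s. Xt (t + s)" "%s. Pt (t + s)"])
   have c: "cder (%s. f + (t + s) *\<^sub>R h) h" for f h
    using cder_add[OF cder_const cder_smul[OF _ cder_const, of "%s. t + s" 1 h], of f]
    by (simp add: derivative_intros DERIV_add[OF DERIV_const DERIV_ident, simplified])
   show "cder (%s. Xt (t + s) a) (A a)" for a unfolding Xt_def by (rule c)
   show "cder (%s. Pt (t + s) a) (C a)" for a unfolding Pt_def by (rule c)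
  qed (auto simp: et)
  moreover have "A a * sf_eval p (dcoord a g) (Xt t) (Pt t) = A a * sf_eval p (dcoord a g) X P" if "a \<in> cs p q" for a
   by (rule kill[OF A(1)[OF that] cong[OF SF_dcoord[OF U g that]]])
  moreover have "C a * sf_eval p (dmom a g) (Xt t) (Pt t) = C a * sf_eval p (dmom a g) X P" if "a \<in> B" for a
   by (rule kill[OF C(1)[OF that] cong[OF SF_dmom[OF U g]]])
  ultimately show ?thesis by simp
 qed
 have d': "cder (%s. sf_eval p g (Xt (t + s)) (Pt (t + s)) - (t + s) *\<^sub>R ?w) 0" for t
 proof -
  have "cder (%s. (t + s) *\<^sub>R ?w) (1 *\<^sub>R ?w + (t + 0) *\<^sub>R 0)"
   by (rule cder_smul[OF _ cder_const]) (auto intro!: derivative_eq_intros)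
  from cder_diff[OF d this] show ?thesis by simp
 qed
 have "sf_eval p g (Xt 1) (Pt 1) - 1 *\<^sub>R ?w = sf_eval p g (Xt 0) (Pt 0) - 0 *\<^sub>R ?w"
  by (rule gs_eqI, rule const_coeff[where f = "%t. sf_eval p g (Xt t) (Pt t) - t *\<^sub>R ?w" and e = "%_. 0"])
   (auto intro: d' simp del: coeff_arith(3-6))
 then have "sf_eval p g (Xt 1) (Pt 1) = sf_eval p g (Xt 0) (Pt 0) + ?w"
  by (simp only: diff_eq_eq scaleR_one scaleR_zero_left diff_0_right)
 moreover have "Xt 1 = (%a. X a + A a)" "Pt 1 = (%a. P a + C a)" "Xt 0 = X" "Pt 0 = P"
  by (simp_all add: fun_eq_iff Xt_def Pt_def)
 ultimately show ?thesis by simp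
qed

subsection \<open>Weights\<close>

lemma dcoord_mult:
 assumes U: "eopen p U" and g: "SF p q B U g" and h: "SF p q B U h" and x: "x \<in> U" and a: "a \<in> cs p q'"
  and par: "gs_parity b (g x)"
 shows "dcoord a (%x. g x * h x) x = dcoord a g x * h x + sgn_if (codd a & b) *\<^sub>R (g x * dcoord a h x)"
proof (cases a)
 case (Ev i)
 then show ?thesis using dcoord_Ev_mult[OF U SF_D(2)[OF g] SF_D(2)[OF h] x] a by simp
next
 case (Od j)
 then show ?thesis using vderiv_mult[OF par, of "Xi j" "h x"] by (simp add: dcoord_Od)
qed

definition euler :: "nat => (coord => int) => (var => int) => (pt => gs) => pt => gs" where
 "euler p w W g x = (\<Sum>i<p. (of_int (w (Ev i)) * x i) *\<^sub>R dcoord (Ev i) g x) + wscale (%v. of_int (W v)) (g x)"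

lemma has_weight_euler: "has_weight p U w W s g \<longleftrightarrow> (ALL x:U. euler p w W g x = of_int s *\<^sub>R g x)"
proof -
 have c: "coeff (euler p w W g x) m = (\<Sum>i<p. of_int (w (Ev i)) * x i * rpd i (%y. coeff (g y) m) x)
   + of_int (\<Sum>v\<in>#m. W v) * coeff (g x) m" for x m
 proof -
  have "(\<Sum>v\<in>#m. real_of_int (W v)) = real_of_int (\<Sum>v\<in>#m. W v)" by (induction m) auto
  then show ?thesis by (simp add: euler_def coeff_dcoord_Ev)
 qed
 show ?thesis
  unfolding has_weight_def c[symmetric]
  by (metis coeff_arith(6) gs_eqI)
qed

lemma wscale_cong: "gs_vars V f ==> (!!v. v \<in> V ==> W v = W' v) ==> wscale W f = wscale W' f"
proof (rule gs_eqI)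
 fix m assume *: "gs_vars V f" "!!v. v \<in> V ==> W v = W' v"
 show "coeff (wscale W f) m = coeff (wscale W' f) m"
 proof (cases "coeff f m = 0")
  case False
  then have "set_mset m \<subseteq> V" using *(1) by (simp add: gs_vars_def)
  then have "image_mset W m = image_mset W' m" using *(2) by (intro image_mset_cong) auto
  then show ?thesis by simp
 qed simp
qed

lemma has_weight_cong_vars:
 assumes "has_weight p U w W s g" "!!x. x \<in> U ==> gs_vars V (g x)" "!!v. v \<in> V ==> W v = W' v"
 shows "has_weight p U w W' s g"
 using assms(1) unfolding has_weight_euler euler_def
 using wscale_cong[OF assms(2), of _ "%v. of_int (W v)" "%v. of_int (W' v)"] assms(3) by simp

lemma has_weight_add:
 assumes "sfn p U g" "sfn p U h" "has_weight p U w W s g" "has_weight p U w W s h"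
 shows "has_weight p U w W s (%x. g x + h x)"
 unfolding has_weight_euler
proof
 fix x assume x: "x \<in> U"
 have "euler p w W (%x. g x + h x) x = euler p w W g x + euler p w W h x"
  unfolding euler_def
  by (simp add: dcoord_Ev_add[OF assms(1,2) x] clin_add[OF clin_wscale] scaleR_add_right sum.distrib)
 then show "euler p w W (%x. g x + h x) x = of_int s *\<^sub>R (g x + h x)"
  using assms(3,4) x by (simp add: has_weight_euler scaleR_add_right)
qed

lemma dcoord_Ev_scaleR:
 assumes "sfn p U g" "x \<in> U" "i < p"
 shows "dcoord (Ev i) (%x. r *\<^sub>R g x) x = r *\<^sub>R dcoord (Ev i) g x"
 by (rule dcoord_Ev_linear[where L = "%f. r *\<^sub>R f" and c = "%_. r" and \<pi> = "%m. m", OF _ assms]) simp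

lemma has_weight_scaleR:
 assumes "sfn p U g" "has_weight p U w W s g"
 shows "has_weight p U w W s (%x. r *\<^sub>R g x)"
 unfolding has_weight_euler
proof
 fix x assume x: "x \<in> U"
 have "euler p w W (%x. r *\<^sub>R g x) x = r *\<^sub>R euler p w W g x"
  unfolding euler_def
  by (simp add: dcoord_Ev_scaleR[OF assms(1) x] clin_scaleR[OF clin_wscale] scaleR_add_right scaleR_sum_right mult.commute)
 then show "euler p w W (%x. r *\<^sub>R g x) x = of_int s *\<^sub>R r *\<^sub>R g x"
  using assms(2) x by (simp add: has_weight_euler mult.commute)
qed

lemma has_weight_mult:
 assumes U: "eopen p U" and "sfn p U g" "sfn p U h"
  and "has_weight p U w W s g" "has_weight p U w W t h"
 shows "has_weight p U w W (s + t) (%x. g x * h x)"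
 unfolding has_weight_euler
proof
 fix x assume x: "x \<in> U"
 have "euler p w W (%x. g x * h x) x = euler p w W g x * h x + g x * euler p w W h x"
  unfolding euler_def
  by (simp add: dcoord_Ev_mult[OF U assms(2,3) x] wscale_mult distrib_left distrib_right
    scaleR_add_right sum.distrib sum_distrib_left sum_distrib_right)
 also have "... = of_int (s + t) *\<^sub>R (g x * h x)"
  using assms(4,5) x by (simp add: has_weight_euler scaleR_add_left)
 finally show "euler p w W (%x. g x * h x) x = of_int (s + t) *\<^sub>R (g x * h x)" .
qed

lemma has_weight_0: "has_weight p U w W s (%x. 0)"
 by (simp add: has_weight_def rpd_const)

lemma has_weight_sum:
 assumes U: "eopen p U" and "!!i. i \<in> A ==> sfn p U (g i)" "!!i. i \<in> A ==> has_weight p U w W s (g i)"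
 shows "has_weight p U w W s (%x. \<Sum>i\<in>A. g i x)"
 using assms(2,3)
 by (induction A rule: infinite_finite_induct) (auto simp: has_weight_0 intro!: has_weight_add sfn_sum[OF U])

lemma has_weight_cong:
 assumes U: "eopen p U" and "has_weight p U w W s g" "!!x. x \<in> U ==> g x = h x"
 shows "has_weight p U w W s h"
 using assms(2) dcoord_Ev_cong[OF U, of _ _ h g] assms(3) unfolding has_weight_euler euler_def by simp

lemma coeff_vderiv_wscale: "vderiv v (wscale W f) = wscale W (vderiv v f) + W v *\<^sub>R vderiv v f"
 by (rule gs_eqI) (simp add: coeff_vderiv algebra_simps)

lemma has_weight_vderiv:
 assumes "sfn p U g" "has_weight p U w W s g"
 shows "has_weight p U w W (s - W v) (%x. vderiv v (g x))"
 unfolding has_weight_euler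
proof
 fix x assume x: "x \<in> U"
 have "euler p w W g x = of_int s *\<^sub>R g x" using assms(2) x by (simp add: has_weight_euler)
 then have "vderiv v (euler p w W g x) = vderiv v (of_int s *\<^sub>R g x)" by simp
 then show "euler p w W (%x. vderiv v (g x)) x = of_int (s - W v) *\<^sub>R vderiv v (g x)"
  unfolding euler_def
  by (simp add: clin_add[OF clin_vderiv] clin_sum[OF clin_vderiv] clin_scaleR[OF clin_vderiv] coeff_vderiv_wscale
    vderiv_dcoord_Ev[OF assms(1) x] algebra_simps scaleR_diff_left)
qed

text \<open>The commutator of this derivative with the Euler field is \<open>w (Ev k)\<close> times
  the derivative; it comes from differentiating the coefficient \<open>x k\<close>.\<close>

lemma has_weight_dcoord_Ev:
 assumes U: "eopen p U" and g: "sfn p U g" "has_weight p U w W s g" and k: "k < p"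
 shows "has_weight p U w W (s - w (Ev k)) (dcoord (Ev k) g)"
 unfolding has_weight_euler
proof
 fix x assume x: "x \<in> U"
 let ?d = "%i. dcoord (Ev i)"
 have sx: "sfn p U (%y. of_real (r * y i))" for r i
  unfolding sfn_def
 proof
  fix m show "smooth_on p U (%x. coeff (of_real (r * x i)) m)"
   using smooth_cmult[OF U smooth_coordinate[OF U]] smooth_const[OF U] by (cases "m = {#}") (simp_all add: of_real_def)
 qed
 have dx: "?d k (%y. of_real (r * y i)) x = of_real (if i = k then r else 0)" for r i
 proof (rule gs_eqI)
  fix m
  show "coeff (?d k (%y. of_real (r * y i)) x) m = coeff (of_real (if i = k then r else 0)) m"
   using rpd_cmult[OF smooth_coordinate[OF U] x k]
   by (cases "m = {#}") (simp_all add: coeff_dcoord_Ev of_real_def rpd_const rpd_coordinate)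
 qed
 have t: "?d k (%y. (r * y i) *\<^sub>R ?d i g y) x = (if i = k then r *\<^sub>R ?d i g x else 0) + (r * x i) *\<^sub>R ?d i (?d k g) x" if i: "i < p" for r i
 proof -
  have "?d k (%y. of_real (r * y i) * ?d i g y) x
    = ?d k (%y. of_real (r * y i)) x * ?d i g x + of_real (r * x i) * ?d k (?d i g) x"
   by (rule dcoord_Ev_mult[OF U sx sfn_dcoord_Ev[OF g(1) i] x k])
  then show ?thesis unfolding dx using dcoord_Ev_commute[OF U g(1) x k i] by (simp add: of_real_def)
 qed
 have st: "sfn p U (%y. (r * y i) *\<^sub>R ?d i g y)" if "i < p" for r i
  using sfn_mult[OF U sx sfn_dcoord_Ev[OF g(1) that], of r i] by (simp add: of_real_def)
 have dsum: "?d k (%y. \<Sum>i\<in>A. (of_int (w (Ev i)) * y i) *\<^sub>R ?d i g y) x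
   = (\<Sum>i\<in>A. ?d k (%y. (of_int (w (Ev i)) * y i) *\<^sub>R ?d i g y) x)" if "A \<subseteq> {..<p}" for A
  using that
 proof (induction A rule: infinite_finite_induct)
  case (insert i A)
  then show ?case using dcoord_Ev_add[OF st sfn_sum[OF U, of A "%i y. (of_int (w (Ev i)) * y i) *\<^sub>R ?d i g y"] x k, of i "of_int (w (Ev i))"] st
   by (auto simp: subset_iff)
 qed (rule gs_eqI, simp add: coeff_dcoord_Ev rpd_const)+
 have "?d k (euler p w W g) x = ?d k (%y. of_int s *\<^sub>R g y) x"
  by (rule dcoord_Ev_cong[OF U x k]) (use g(2) in \<open>simp add: has_weight_euler\<close>)
 also have "... = of_int s *\<^sub>R ?d k g x" by (rule dcoord_Ev_scaleR[OF g(1) x k])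
 also have "?d k (euler p w W g) x = ?d k (%y. \<Sum>i<p. (of_int (w (Ev i)) * y i) *\<^sub>R ?d i g y) x
   + ?d k (%y. wscale (%v. of_int (W v)) (g y)) x"
 proof -
  have "?d k (euler p w W g) x = ?d k (%y. (\<Sum>i<p. (of_int (w (Ev i)) * y i) *\<^sub>R ?d i g y)
    + wscale (%v. of_int (W v)) (g y)) x"
   unfolding euler_def[abs_def] ..
  moreover have "sfn p U (%y. \<Sum>i<p. (of_int (w (Ev i)) * y i) *\<^sub>R ?d i g y)"
   by (rule sfn_sum[OF U st]) simp
  ultimately show ?thesis
   using dcoord_Ev_add[OF _ sfn_wscale[OF U g(1)] x k] by simp
 qed
 also have "... = of_int (w (Ev k)) *\<^sub>R ?d k g x + euler p w W (?d k g) x"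
  unfolding dsum[OF order_refl] wscale_dcoord_Ev[OF g(1) x k] euler_def
  using k by (simp add: t sum.distrib sum.delta)
 finally show "euler p w W (?d k g) x = of_int (s - w (Ev k)) *\<^sub>R ?d k g x"
  by (simp add: scaleR_diff_left algebra_simps)
qed

lemma has_weight_dcoord:
 assumes "eopen p U" "sfn p U g" "has_weight p U w (vweight w \<mu> \<omega>) s g" "a \<in> cs p q"
 shows "has_weight p U w (vweight w \<mu> \<omega>) (s - w a) (dcoord a g)"
proof (cases a)
 case (Ev i)
 then show ?thesis using has_weight_dcoord_Ev[OF assms(1-3)] assms(4) by simp
next
 case (Od j)
 then show ?thesis using has_weight_vderiv[OF assms(2,3), of "Xi j"] by (simp add: dcoord_Od vweight_def)
qed

lemma has_weight_dmom:
 assumes "sfn p U g" "has_weight p U w (vweight w \<mu> \<omega>) s g"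
 shows "has_weight p U w (vweight w \<mu> \<omega>) (s - \<mu> a) (dmom a g)"
 using has_weight_vderiv[OF assms, of "Mom a"] by (simp add: dmom_eq vweight_def)

lemma has_weight_coord_pt:
 assumes "a \<in> cs p q"
 shows "has_weight p U w (vweight w \<mu> \<omega>) (w a) (%x. coord_pt x a)"
 unfolding has_weight_euler
proof
 fix x assume "x \<in> U"
 show "euler p w (vweight w \<mu> \<omega>) (%x. coord_pt x a) x = of_int (w a) *\<^sub>R coord_pt x a"
 proof (cases a)
  case (Ev i)
  have "wscale W (of_real r) = 0" for W r by (rule gs_eqI) (simp add: of_real_def)
  then show ?thesis using assms unfolding euler_def dcoord_coord_pt
   by (simp add: Ev if_distrib[of "%f. _ *\<^sub>R f"] sum.delta of_real_def cong: if_cong)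
 next
  case (Od j)
  then show ?thesis unfolding euler_def dcoord_coord_pt by (simp add: wscale_var vweight_def)
 qed
qed

text \<open>This is the chain rule for the derivation \<open>wscale\<close> at the identical
  evaluation, which returns \<open>g\<close>. It expresses the Euler field through the generators,
  the form that can be evaluated at other arguments.\<close>

lemma euler_generators:
 assumes U: "eopen p U" and B: "finite B" and g: "SF p q B U g" and x: "x \<in> U"
 shows "euler p w (vweight w \<mu> \<omega>) g x =
  (\<Sum>a\<in>cs p q. of_int (w a) *\<^sub>R (coord_pt x a * dcoord a g x)) + (\<Sum>a\<in>B. of_int (\<mu> a) *\<^sub>R (mom_var a * dmom a g x))
  + wscale (parw (%b n. of_int (\<omega> b n))) (g x)"
proof -
 let ?W = "%v. real_of_int (vweight w \<mu> \<omega> v)"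
 interpret superder "wscale ?W" False "%b n. ?W (Par b n)" by (rule superder_wscale)
 have e: "evok p q B U (coord_pt x) mom_var" by (rule evok_coord_pt[OF U x]) (simp_all add: mom_var_props)
 have pw: "(%b n. ?W (Par b n)) = (%b n. of_int (\<omega> b n))" by (simp add: vweight_def fun_eq_iff)
 note id = sf_eval_identity[OF U B _ x]
 have "wscale ?W (g x) = (\<Sum>a\<in>cs p q. wscale ?W (coord_pt x a) * dcoord a g x)
   + (\<Sum>a\<in>B. wscale ?W (mom_var a) * dmom a g x) + wscale (parw (%b n. of_int (\<omega> b n))) (g x)"
  using D_sf_eval[OF U B g e]
  by (simp add: id[OF g] id[OF SF_dmom[OF U g]] id[OF SF_wscale[OF U g]] id[OF SF_dcoord[OF U g, of _ q]] pw)
 moreover have "(\<Sum>a\<in>B. wscale ?W (mom_var a) * dmom a g x) = (\<Sum>a\<in>B. of_int (\<mu> a) *\<^sub>R (mom_var a * dmom a g x))"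
  by (simp add: mom_var_def wscale_var vweight_def)
 moreover have "(\<Sum>a\<in>cs p q. wscale ?W (coord_pt x a) * dcoord a g x)
   + (\<Sum>i<p. (of_int (w (Ev i)) * x i) *\<^sub>R dcoord (Ev i) g x)
   = (\<Sum>a\<in>cs p q. of_int (w a) *\<^sub>R (coord_pt x a * dcoord a g x))"
 proof -
  have z: "wscale W (of_real r) = 0" for W r by (rule gs_eqI) (simp add: of_real_def)
  show ?thesis unfolding cs_def
   by (subst (1 2) sum.union_disjoint)
    (auto simp: sum.reindex inj_on_def z wscale_var vweight_def scaleR_conv_of_real mult.assoc)
 qed
 ultimately show ?thesis unfolding euler_def by (simp add: algebra_simps)
qed

context sfam
begin

lemma euler_comp:
 assumes g: "SF p2 q2 B2 U2 g" and x: "x \<in> U1"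
 shows "euler p1 w (vweight w \<mu> \<omega>) (comp g) x =
  (\<Sum>b\<in>cs p2 q2. euler p1 w (vweight w \<mu> \<omega>) (%x. Y x b) x * comp (dcoord b g) x)
   + (\<Sum>b\<in>B2. euler p1 w (vweight w \<mu> \<omega>) (%x. Z x b) x * comp (dmom b g) x)
   + comp (%y. wscale (parw (%b n. of_int (\<omega> b n))) (g y)) x"
proof -
 let ?W = "%v. real_of_int (vweight w \<mu> \<omega> v)"
 interpret superder "wscale ?W" False "%b n. ?W (Par b n)" by (rule superder_wscale)
 have pw: "(%b n. ?W (Par b n)) = (%b n. of_int (\<omega> b n))" by (simp add: vweight_def fun_eq_iff)
 have 1: "(\<Sum>i<p1. (of_int (w (Ev i)) * x i) *\<^sub>R dcoord (Ev i) (comp g) x)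
  = (\<Sum>b\<in>cs p2 q2. (\<Sum>i<p1. (of_int (w (Ev i)) * x i) *\<^sub>R dcoord (Ev i) (%x. Y x b) x) * comp (dcoord b g) x)
   + (\<Sum>b\<in>B2. (\<Sum>i<p1. (of_int (w (Ev i)) * x i) *\<^sub>R dcoord (Ev i) (%x. Z x b) x) * comp (dmom b g) x)"
 proof -
  have "(\<Sum>i<p1. (of_int (w (Ev i)) * x i) *\<^sub>R dcoord (Ev i) (comp g) x)
   = (\<Sum>i<p1. (\<Sum>b\<in>cs p2 q2. (of_int (w (Ev i)) * x i) *\<^sub>R dcoord (Ev i) (%x. Y x b) x * comp (dcoord b g) x)
    + (\<Sum>b\<in>B2. (of_int (w (Ev i)) * x i) *\<^sub>R dcoord (Ev i) (%x. Z x b) x * comp (dmom b g) x))"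
   by (intro sum.cong refl) (simp add: dcoord_comp[OF g x] scaleR_add_right scaleR_sum_right)
  then show ?thesis
   unfolding sum_distrib_right sum.distrib
   by (simp only: sum.swap[of _ "cs p2 q2" "{..<p1}"] sum.swap[of _ B2 "{..<p1}"])
 qed
 show ?thesis
  unfolding euler_def 1 using D_sf_eval[OF U2 B2 g ev[OF x]]
  by (simp add: pw distrib_right sum.distrib)
qed

text \<open>Homogeneity of \<open>Y\<close> and \<open>Z\<close> turns the Euler field of the
  composite into the evaluation of the Euler field of \<open>g\<close>, written as in
  \<open>euler_generators\<close>.\<close>

lemma has_weight_comp:
 assumes g: "SF p2 q2 B2 U2 g" "has_weight p2 U2 w2 (vweight w2 \<mu>2 \<omega>) s g"
  and Y: "!!b. b \<in> cs p2 q2 ==> has_weight p1 U1 w (vweight w \<mu> \<omega>) (w2 b) (%x. Y x b)"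
  and Z: "!!b. b \<in> B2 ==> has_weight p1 U1 w (vweight w \<mu> \<omega>) (\<mu>2 b) (%x. Z x b)"
 shows "has_weight p1 U1 w (vweight w \<mu> \<omega>) s (comp g)"
 unfolding has_weight_euler
proof
 fix x assume x: "x \<in> U1"
 note e = ev[OF x]
 let ?pw = "parw (%b n. real_of_int (\<omega> b n))"
 have mv: "SF p2 q2 B2 U2 (%y. mom_var b)" if "b \<in> B2" for b
  using that by (intro SF_const[OF U2]) (auto simp: mom_var_def svars_def intro!: gs_vars_var)
 have S1: "SF p2 q2 B2 U2 (%y. coord_pt y b * dcoord b g y)" if "b \<in> cs p2 q2" for b
  by (intro SF_mult[OF U2] SF_coord_pt[OF U2] SF_dcoord[OF U2 g(1) that] that)
 have S2: "SF p2 q2 B2 U2 (%y. mom_var b * dmom b g y)" if "b \<in> B2" for b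
  by (intro SF_mult[OF U2] SF_dmom[OF U2 g(1)] mv that)
 note S3 = SF_wscale[OF U2 g(1), of ?pw]
 let ?F = "%y. \<Sum>b\<in>cs p2 q2. of_int (w2 b) *\<^sub>R (coord_pt y b * dcoord b g y)"
 let ?G = "%y. \<Sum>b\<in>B2. of_int (\<mu>2 b) *\<^sub>R (mom_var b * dmom b g y)"
 have SFF: "SF p2 q2 B2 U2 ?F" by (rule SF_sum[OF U2 SF_scaleR[OF U2 S1]])
 have SFG: "SF p2 q2 B2 U2 ?G" by (rule SF_sum[OF U2 SF_scaleR[OF U2 S2]])
 have eY: "euler p1 w (vweight w \<mu> \<omega>) (%x. Y x b) x * f = of_int (w2 b) *\<^sub>R (Y x b * f)" if "b \<in> cs p2 q2" for b f
  using Y[OF that] x by (simp add: has_weight_euler)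
 have eZ: "euler p1 w (vweight w \<mu> \<omega>) (%x. Z x b) x * f = of_int (\<mu>2 b) *\<^sub>R (Z x b * f)" if "b \<in> B2" for b f
  using Z[OF that] x by (simp add: has_weight_euler)
 have "euler p1 w (vweight w \<mu> \<omega>) (comp g) x =
   (\<Sum>b\<in>cs p2 q2. of_int (w2 b) *\<^sub>R (Y x b * comp (dcoord b g) x))
   + (\<Sum>b\<in>B2. of_int (\<mu>2 b) *\<^sub>R (Z x b * comp (dmom b g) x)) + comp (%y. wscale ?pw (g y)) x"
  unfolding euler_comp[OF g(1) x] by (simp add: eY eZ)
 also have "(\<Sum>b\<in>cs p2 q2. of_int (w2 b) *\<^sub>R (Y x b * comp (dcoord b g) x)) = comp ?F x"
  by (subst sf_eval_sum[OF U2 B2 e SF_scaleR[OF U2 S1]], assumption, intro sum.cong refl) (simp add: sf_eval_scaleR[OF U2 B2 e S1] sf_eval_mult'[OF U2 B2 e SF_coord_pt[OF U2] SF_dcoord[OF U2 g(1), of _ q2]]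
    sf_eval_coordinate[OF U2 B2 e])
 also have "(\<Sum>b\<in>B2. of_int (\<mu>2 b) *\<^sub>R (Z x b * comp (dmom b g) x)) = comp ?G x"
  by (subst sf_eval_sum[OF U2 B2 e SF_scaleR[OF U2 S2]], assumption, intro sum.cong refl) (simp add: sf_eval_scaleR[OF U2 B2 e S2] sf_eval_mult'[OF U2 B2 e mv SF_dmom[OF U2 g(1)]]
    sf_eval_mom_var[OF U2 B2 e])
 also have "comp ?F x + comp ?G x + comp (%y. wscale ?pw (g y)) x = comp (%y. ?F y + ?G y + wscale ?pw (g y)) x"
  using sf_eval_add[OF U2 B2 e SF_add[OF U2 SFF SFG] S3] sf_eval_add[OF U2 B2 e SFF SFG] by simp
 also have "... = comp (%y. of_int s *\<^sub>R g y) x"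
 proof (rule sf_eval_cong[OF U2 evokD(6)[OF e]])
  show "?F y + ?G y + wscale ?pw (g y) = of_int s *\<^sub>R g y" if "y \<in> U2" for y
   using g(2) that euler_generators[OF U2 B2 g(1) that, of w2 \<mu>2 \<omega>] by (simp add: has_weight_euler)
  show "gs_vars (svars q2 B2) (?F y + ?G y + wscale ?pw (g y))" if "y \<in> U2" for y
   by (rule SF_D(1)[OF SF_add[OF U2 SF_add[OF U2 SFF SFG] S3] that])
 qed auto
 also have "... = of_int s *\<^sub>R comp g x" by (rule sf_eval_scaleR[OF U2 B2 e g(1)])
 finally show "euler p1 w (vweight w \<mu> \<omega>) (comp g) x = of_int s *\<^sub>R comp g x" .
qed

end

subsection \<open>The local pullback\<close>

lemma dcoord_add:
 assumes "eopen p U" "SF p q B U g" "SF p q B U h" "x \<in> U" "a \<in> cs p q'"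
 shows "dcoord a (%x. g x + h x) x = dcoord a g x + dcoord a h x"
 using assms by (cases a) (auto simp: dcoord_Ev_add[OF SF_D(2) SF_D(2)] dcoord_Od clin_add[OF clin_vderiv])

lemma dcoord_0: "dcoord a (%x. 0) x = 0"
 by (cases a) (auto simp: dcoord_Od clin_0[OF clin_vderiv] coeff_dcoord_Ev rpd_const intro: gs_eqI)

lemma dcoord_const: "~ (EX j. v = Xi j) ==> dcoord a (%_. gs_var v) x = 0"
 by (cases a) (auto simp: dcoord_Od coeff_dcoord_Ev rpd_const mon_single[symmetric] intro!: gs_eqI vderiv_mon_notin)

lemma dmom_mult:
 assumes "gs_parity b (g x)"
 shows "dmom a (%x. g x * h x) x = dmom a g x * h x + sgn_if (codd a & b) *\<^sub>R (g x * dmom a h x)"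
 unfolding dmom_eq using vderiv_mult[OF assms, of "Mom a" "h x"] by simp

lemma dmom_mom_var: "dmom a (%_. mom_var b) x = (if a = b then 1 else 0)"
 unfolding dmom_eq mom_var_def mon_single[symmetric]
 using vderiv_mon_add[of "Mom b" "{#}"] by (auto simp: vderiv_mon_notin mono_ok_add_mset mon_empty)

lemma dmom_coord_pt: "dmom a (%x. coord_pt x b) x = 0"
proof (cases b)
 case (Ev i)
 have "vderiv (Mom a) (of_real (x i)) = x i *\<^sub>R vderiv (Mom a) (mon {#})"
  by (simp add: of_real_def mon_empty clin_scaleR[OF clin_vderiv])
 then show ?thesis by (simp add: Ev dmom_eq vderiv_mon_notin)
qed (simp add: dmom_eq mon_single[symmetric] vderiv_mon_notin)

lemma gsord_dcoord:
 assumes "!!y. gsord W n (g y)" "!!j. ~ W (Xi j)"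
 shows "gsord W n (dcoord a g y)"
proof (cases a)
 case (Ev i)
 show ?thesis unfolding gsord_def Ev
 proof (intro allI impI)
  fix k assume "size (filter_mset W k) < n"
  then have "(%y. coeff (g y) k) = (%y. 0)" using assms(1) by (auto simp: gsord_def)
  then show "coeff (dcoord (Ev i) g y) k = 0" by (simp add: coeff_dcoord_Ev rpd_const)
 qed
next
 case (Od j)
 show ?thesis unfolding gsord_def Od dcoord_Od
 proof (intro allI impI)
  fix k assume "size (filter_mset W k) < n"
  then show "coeff (vderiv (Xi j) (g y)) k = 0"
   using assms(1)[of y] assms(2) by (cases "mono_ok k") (auto simp: coeff_vderiv gsord_def coeff_not_ok)
 qed
qed

lemma gsord_par_dcoord: "(!!y. gsord is_par n (g y)) ==> gsord is_par n (dcoord a g y)"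
 by (rule gsord_dcoord) simp_all

lemma gsord_psign: "gsord W n f ==> gsord W n (psign i * f)"
 using gsord_mult[of W 0 "psign i" n f] by simp

lemma sfn_lim:
 assumes U: "eopen p U" and T: "!!n. sfn p U (T n)" and f: "!!x n. x \<in> U ==> gsord W n (f x - T n x)"
 shows "sfn p U f"
 unfolding sfn_def
proof
 fix m
 show "smooth_on p U (%x. coeff (f x) m)"
  by (rule smooth_cong[OF U T[unfolded sfn_def, rule_format, of "Suc (size (filter_mset W m))" m]])
   (use gsord_lim_coeff[OF f] in simp)
qed

lemma SF_lim:
 assumes U: "eopen p U" and T: "!!n. SF p q B U (T n)" and f: "!!x n. x \<in> U ==> gsord W n (f x - T n x)"
 shows "SF p q B U f"
 unfolding SF_altdef
proof (intro conjI ballI)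
 show "sfn p U f" by (rule sfn_lim[OF U SF_D(2)[OF T] f])
 fix x assume x: "x \<in> U"
 show "gs_vars (svars q B) (f x)"
  unfolding gs_vars_def
 proof (intro allI impI)
  fix m assume "coeff (f x) m ~= 0"
  then show "set_mset m \<subseteq> svars q B"
   using gsord_lim_coeff[OF f[OF x], of m] SF_D(1)[OF T x] by (auto simp: gs_vars_def)
 qed
qed

lemma has_weight_lim:
 assumes U: "eopen p U" and T: "!!n. has_weight p U w W s (T n)"
  and f: "!!x n. x \<in> U ==> gsord V n (f x - T n x)"
 shows "has_weight p U w W s f"
 unfolding has_weight_def
proof (intro ballI allI)
 fix x m assume x: "x \<in> U"
 let ?N = "Suc (size (filter_mset V m))"
 have e: "coeff (f y) m = coeff (T ?N y) m" if "y \<in> U" for y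
  by (rule gsord_lim_coeff[OF f[OF that]])
 have "rpd i (%y. coeff (f y) m) x = rpd i (%y. coeff (T ?N y) m) x" if "i < p" for i
  by (rule rpd_cong[OF U x that e])
 then show "(\<Sum>i<p. of_int (w (Ev i)) * x i * rpd i (%y. coeff (f y) m) x)
   + of_int (\<Sum>v\<in>#m. W v) * coeff (f x) m = of_int s * coeff (f x) m"
  using T[of ?N] x e[OF x] by (simp add: has_weight_def)
qed

abbreviation phib :: "nat => nat => (pt => gs) => (coord => gs) => pt" where
 "phib p1 p2 S X \<equiv> bodypt p2 (%i. psign i * sf_eval p1 (dmom i S) X (%_. 0))"

text \<open>\<open>W\<close> generates the ideal in which \<open>g\<close> is small, and
  \<open>B\<close> lists the momenta that may occur in \<open>g\<close> as spectators. The instances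
  are the parameters without spectators, all target momenta in both roles, and a single fresh
  momentum in both roles. \<open>W\<close> excludes coordinates, which the evaluation at
  \<open>y\<close> would replace.\<close>

locale pb =
 fixes p1 q1 :: nat and U1 :: "pt set" and p2 q2 :: nat and U2 :: "pt set" and S g :: "pt => gs"
  and W :: "var => bool" and B :: "coord set"
 assumes U1: "eopen p1 U1" and U2: "eopen p2 U2"
  and S: "SF p1 q1 (cs p2 q2) U1 S" and S_par: "!!x. x \<in> U1 ==> gs_parity False (S x)"
  and B: "finite B" and W: "!!v. W v ==> EX a. v = Mom a | is_par v"
  and g: "SF p2 q2 B U2 g" and g_par: "!!y. y \<in> U2 ==> gs_parity False (g y)"
  and g1: "!!y. gsord W 1 (g y)"
  and phi: "!!x. x \<in> U1 ==> phib p1 p2 S (coord_pt x) \<in> U2"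
begin

lemma subst_W: "W v ==> subst_var X mom_var v = gs_var v"
 using W[of v] by (cases v) (auto simp: mom_var_def)

lemma W_Xi: "~ W (Xi j)"
 using W[of "Xi j"] by auto

lemma g_dcoord: "gsord W 1 (dcoord i g y)"
 by (rule gsord_dcoord[OF g1 W_Xi])

abbreviation C2 :: "coord set" where "C2 \<equiv> cs p2 q2"

definition Yof :: "pt => (coord => gs) => coord => gs" where
 "Yof x Q i = psign i * sf_eval p1 (dmom i S) (coord_pt x) Q"

lemma SFd: "SF p1 q1 C2 U1 (dmom i S)"
 by (rule SF_dmom[OF U1 S])

lemma Yof_cong:
 assumes x: "x \<in> U1" and "!!i. i \<in> C2 ==> Q i = Q' i"
 shows "Yof x Q = Yof x Q'"
proof
 fix i
 have "sf_eval p1 (dmom i S) (coord_pt x) Q = sf_eval p1 (dmom i S) (coord_pt x) Q'"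
  by (rule sf_eval_eqI[OF U1 SFd bodypt_coord_pt_in[OF U1 x]]) (simp_all add: assms(2))
 then show "Yof x Q i = Yof x Q' i" by (simp add: Yof_def)
qed

lemma Yof_gsord:
 assumes x: "x \<in> U1" and "!!i. i \<in> C2 ==> gsord w n (Q i - Q' i)"
 shows "gsord w n (Yof x Q i - Yof x Q' i)"
proof -
 have "gsord w n (sf_eval p1 (dmom i S) (coord_pt x) Q - sf_eval p1 (dmom i S) (coord_pt x) Q')"
 proof (rule sf_eval_gsord_cong[OF refl, where V = "svars q1 C2" and U = U1])
  show "gsord w n (subst_var (coord_pt x) Q v - subst_var (coord_pt x) Q' v)" if "v \<in> svars q1 C2" for v
   using that assms(2) by (cases v) (auto simp: svars_def)
  show "gs_vars (svars q1 C2) (dmom i S y)" if "y \<in> U1" for y by (rule SF_D(1)[OF SFd that])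
 qed (auto simp: U1 bodypt_coord_pt_in[OF U1 x])
 then show ?thesis using gsord_psign unfolding Yof_def right_diff_distrib[symmetric] by blast
qed

text \<open>A small \<open>Q\<close> has no influence on the body of \<open>y\<close>, so the
  condition \<open>phi\<close>, which concerns \<open>Q = 0\<close>, is enough.\<close>

lemma body_Yof:
 assumes x: "x \<in> U1" and Q: "!!i. i \<in> C2 ==> gsord W 1 (Q i)"
 shows "bodypt p2 (Yof x Q) \<in> U2"
proof -
 have "gsord W 1 (Yof x Q i - Yof x (%_. 0) i)" for i
  by (rule Yof_gsord[OF x]) (simp add: Q[unfolded One_nat_def])
 then have "coeff (Yof x Q i - Yof x (%_. 0) i) {#} = 0" for i by (rule gsord_1_empty)
 then have "bodypt p2 (Yof x Q) = bodypt p2 (Yof x (%_. 0))"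
  by (intro bodypt_eq) (simp add: body_def)
 then show ?thesis using phi[OF x] by (simp add: Yof_def[abs_def])
qed

lemma evok_Q:
 assumes "x \<in> U1" "!!i. i \<in> C2 ==> gs_parity (codd i) (Q i)" "!!i. i \<in> C2 ==> gsord W 1 (Q i)"
 shows "evok p1 q1 C2 U1 (coord_pt x) Q"
 by (rule evok_coord_pt[OF U1 assms(1,2)]) (auto intro: gsord_1_empty[OF assms(3)])

lemma Yof_parity:
 assumes "x \<in> U1" "!!i. i \<in> C2 ==> gs_parity (codd i) (Q i)" "!!i. i \<in> C2 ==> gsord W 1 (Q i)"
 shows "gs_parity (codd i) (Yof x Q i)"
proof -
 have "gs_parity (codd i) (dmom i S y)" if "y \<in> U1" for y
  using gs_parity_dmom[of False S y i] S_par[OF that] by simp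
 then have "gs_parity (codd i) (sf_eval p1 (dmom i S) (coord_pt x) Q)"
  by (intro gs_parity_sf_eval[OF U1 finite_cs evok_Q[OF assms] SFd]) auto
 then show ?thesis by (cases "codd i") (auto simp: Yof_def psign_mult(2) intro: gs_parity_uminus)
qed

lemma evok_Y:
 assumes "x \<in> U1" "!!i. i \<in> C2 ==> gs_parity (codd i) (Q i)" "!!i. i \<in> C2 ==> gsord W 1 (Q i)"
 shows "evok p2 q2 B U2 (Yof x Q) mom_var"
 using Yof_parity[OF assms] body_Yof[OF assms(1,3)] by (simp add: evok_def mom_var_props)

text \<open>The value 0 is assigned outside the target coordinates and whenever \<open>Q\<close> is
  not small. In this way \<open>Psi\<close> contracts on all functions, as
  \<open>contraction_fixpoint\<close> requires, and not only on the admissible ones.\<close>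

definition Psi :: "pt => (coord => gs) => coord => gs" where
 "Psi x Q i = (if i \<in> C2 & (ALL j. gsord W 1 (Q j)) then sf_eval p2 (dcoord i g) (Yof x Q) mom_var else 0)"

lemma Psi_par: "gsord W 1 (Psi x Q i)"
 using sf_eval_par_1[OF g_dcoord subst_W] by (simp add: Psi_def)

lemma Psi_contract:
 assumes x: "x \<in> U1" and Q: "!!i. gsord W n (Q i - Q' i)"
 shows "gsord W (Suc n) (Psi x Q i - Psi x Q' i)"
proof (cases n)
 case 0
 \<comment> \<open>At the start the gain of one order is free, because all values of
   \<open>Psi\<close> have order 1.\<close>
 then show ?thesis using gsord_diff[OF Psi_par Psi_par] by simp
next
 case (Suc n')
 have d: "gsord W 1 (Q i - Q' i)" for i by (rule gsord_mono[OF Q]) (simp add: Suc)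
 \<comment> \<open>Arguments congruent to positive order are both small or both not, so they fall
   into the same branch of \<open>Psi\<close>.\<close>
 have gd: "(ALL j. gsord W 1 (Q j)) \<longleftrightarrow> (ALL j. gsord W 1 (Q' j))"
 proof -
  have "gsord W 1 (Q j)" if "gsord W 1 (Q' j)" for j using gsord_add[OF that d[of j]] by (simp only: add_diff_cancel_left' add.commute[of "Q' j"] diff_add_cancel)
  moreover have "gsord W 1 (Q' j)" if "gsord W 1 (Q j)" for j using gsord_diff[OF that d[of j]] by (simp only: diff_diff_eq2 add_diff_cancel_left')
  ultimately show ?thesis by iprover
 qed
 show ?thesis
 proof (cases "i \<in> C2 & (ALL j. gsord W 1 (Q j))")
  case True
  have YY: "gsord W n (Yof x Q j - Yof x Q' j)" for j by (rule Yof_gsord[OF x Q])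
  have "gsord W (Suc n) (sf_eval p2 (dcoord i g) (Yof x Q) mom_var - sf_eval p2 (dcoord i g) (Yof x Q') mom_var)"
  proof (rule sf_eval_par_contract[where V = "svars q2 B" and U = U2])
   have "coeff (Yof x Q j - Yof x Q' j) {#} = 0" for j
    by (rule gsord_1_empty, rule gsord_mono[OF YY]) (simp add: Suc)
   then show "bodypt p2 (Yof x Q) = bodypt p2 (Yof x Q')" by (intro bodypt_eq) (simp add: body_def)
   show "gs_vars (svars q2 B) (dcoord i g y)" if "y \<in> U2" for y
    using SF_D(1)[OF SF_dcoord[OF U2 g, of i q2] that] True by simp
   show "gsord W n (subst_var (Yof x Q) mom_var v - subst_var (Yof x Q') mom_var v)" for v
    by (cases v) (auto simp: YY)
   show "bodypt p2 (Yof x Q) \<in> U2" by (rule body_Yof[OF x]) (use True in blast)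
  qed (auto simp: YY U2 g_dcoord[unfolded One_nat_def] subst_W)
  then show ?thesis using True gd by (simp add: Psi_def)
 next
  case False
  then have "Psi x Q i = 0" "Psi x Q' i = 0" unfolding Psi_def using gd by auto
  then show ?thesis by simp
 qed
qed

definition Qs :: "pt => coord => gs" where
 "Qs x = (SOME Q. Psi x Q = Q)"

definition It :: "nat => pt => coord => gs" where
 "It n x = (Psi x ^^ n) (%_. 0)"

abbreviation Ys :: "pt => coord => gs" where "Ys x \<equiv> Yof x (Qs x)"

lemma Qs:
 assumes x: "x \<in> U1"
 shows "Psi x (Qs x) = Qs x" "gsord W n (Qs x i - It n x i)" "Psi x Q' = Q' ==> Q' = Qs x"
proof -
 obtain Q where Q: "Psi x Q = Q" "!!n i. gsord W n (Q i - (Psi x ^^ n) (%_. 0) i)"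
  "!!Q'. Psi x Q' = Q' ==> Q' = Q"
 proof (rule contraction_fixpoint[of W "Psi x", OF Psi_contract[OF x]])
  fix n Q Q' i assume "!!i. gsord W n (Q i - Q' i)"
  then show "gsord W n (Q i - Q' i)" for i .
 next
  fix Q assume a: "Psi x Q = Q" and b: "!!n i. gsord W n (Q i - (Psi x ^^ n) (%_. 0) i)"
   and c: "!!Q'. Psi x Q' = Q' ==> Q' = Q"
  show thesis by (rule that[OF a b c])
 qed
 show e: "Psi x (Qs x) = Qs x" unfolding Qs_def by (rule someI[of _ Q]) (rule Q(1))
 have "Qs x = Q" by (rule Q(3)[OF e])
 then show "gsord W n (Qs x i - It n x i)" "Psi x Q' = Q' ==> Q' = Qs x"
  using Q(2,3) by (simp_all only: It_def)
qed

lemma Qs_par: "x \<in> U1 ==> gsord W 1 (Qs x i)"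
 using Psi_par[of x "Qs x" i] by (simp only: Qs(1))

lemma Qs_eq: "x \<in> U1 ==> i \<in> C2 ==> Qs x i = sf_eval p2 (dcoord i g) (Ys x) mom_var"
 using Psi_def[of x "Qs x" i] Qs_par by (simp add: Qs(1))

lemma It_par: "gsord W 1 (It n x i)"
 using Psi_par by (cases n) (simp_all add: It_def)

lemma It_Suc: "i \<in> C2 ==> It (Suc n) x i = sf_eval p2 (dcoord i g) (Yof x (It n x)) mom_var"
proof -
 have "It (Suc n) x i = Psi x (It n x) i" by (simp add: It_def)
 moreover have "ALL j. gsord W 1 (It n x j)" using It_par by blast
 ultimately show "i \<in> C2 ==> ?thesis" by (simp add: Psi_def)
qed

definition goodQ :: "(pt => coord => gs) => bool" where
 "goodQ Q \<longleftrightarrow> (ALL i:C2. SF p1 q1 B U1 (%x. Q x i)) &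
   (ALL x:U1. ALL i:C2. gs_parity (codd i) (Q x i) & gsord W 1 (Q x i))"

lemma goodQD:
 assumes "goodQ Q"
 shows "i \<in> C2 ==> SF p1 q1 B U1 (%x. Q x i)" "x \<in> U1 ==> i \<in> C2 ==> gs_parity (codd i) (Q x i)"
  "x \<in> U1 ==> i \<in> C2 ==> gsord W 1 (Q x i)"
 using assms unfolding goodQ_def by blast+

lemma SF_mom: "b \<in> B ==> SF p1 q1 B U1 (%x. mom_var b)"
 by (rule SF_const[OF U1]) (auto simp: mom_var_def svars_def intro: gs_vars_var)

lemma sfam_S:
 assumes Q: "goodQ Q"
 shows "sfam p1 q1 B U1 p1 q1 C2 U1 coord_pt Q"
 by unfold_locales (auto simp: U1 B intro!: SF_coord_pt[OF U1] goodQD(1)[OF Q] evok_Q goodQD(2,3)[OF Q])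

lemma SF_Yof:
 assumes Q: "goodQ Q"
 shows "SF p1 q1 B U1 (%x. Yof x (Q x) i)"
proof -
 interpret sfam p1 q1 "B" U1 p1 q1 C2 U1 coord_pt Q by (rule sfam_S[OF Q])
 have "SF p1 q1 B U1 (%x. (if codd i then - 1 else 1) *\<^sub>R comp (dmom i S) x)"
  by (rule SF_scaleR[OF U1 SF_comp[OF SFd]])
 then show ?thesis by (simp add: Yof_def psign_def split: if_splits)
qed

lemma sfam_Y:
 assumes Q: "goodQ Q"
 shows "sfam p1 q1 B U1 p2 q2 B U2 (%x. Yof x (Q x)) (%_. mom_var)"
 by unfold_locales (auto simp: U1 U2 B intro!: SF_mom SF_Yof[OF Q] evok_Y goodQD(2,3)[OF Q])

lemma goodQ_It: "goodQ (It n)"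
proof (induction n)
 case 0
 then show ?case using SF_const[OF U1, of q1 "B" 0] by (simp add: goodQ_def It_def)
next
 case (Suc n)
 interpret sfam p1 q1 "B" U1 p2 q2 "B" U2 "%x. Yof x (It n x)" "%_. mom_var" by (rule sfam_Y[OF Suc])
 show ?case
  unfolding goodQ_def
 proof (intro conjI ballI)
  fix i assume i: "i \<in> C2"
  show "SF p1 q1 B U1 (%x. It (Suc n) x i)"
   unfolding It_Suc[OF i] by (rule SF_comp[OF SF_dcoord[OF U2 g i]])
  fix x assume x: "x \<in> U1"
  show "gs_parity (codd i) (It (Suc n) x i)"
   unfolding It_Suc[OF i]
  proof (rule gs_parity_sf_eval[OF U2 _ ev[OF x] SF_dcoord[OF U2 g i]])
   show "gs_parity (codd i) (dcoord i g y)" if "y \<in> U2" for y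
    using gs_parity_dcoord[OF U2 that i, of False] g_par by simp
  qed (rule B)
  show "gsord W 1 (It (Suc n) x i)" by (rule It_par)
 qed
qed

lemma goodQ_Qs: "goodQ Qs"
 unfolding goodQ_def
proof (intro conjI ballI)
 fix i assume i: "i \<in> C2"
 show "SF p1 q1 B U1 (%x. Qs x i)"
  by (rule SF_lim[OF U1, where T = "%n x. It n x i" and W = W])
   (auto intro: goodQD(1)[OF goodQ_It i] Qs(2))
 fix x assume x: "x \<in> U1"
 show "gs_parity (codd i) (Qs x i)"
  by (rule gsord_lim_parity[where T = "%n. It n x i" and W = W])
   (auto intro: Qs(2)[OF x] goodQD(2)[OF goodQ_It x i])
 show "gsord W 1 (Qs x i)" by (rule Qs_par[OF x])
qed

sublocale s: sfam p1 q1 B U1 p1 q1 C2 U1 coord_pt Qs by (rule sfam_S[OF goodQ_Qs])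
sublocale y: sfam p1 q1 B U1 p2 q2 B U2 Ys "%_. mom_var" by (rule sfam_Y[OF goodQ_Qs])

lemmas SF_Qs = goodQD(1)[OF goodQ_Qs]
lemmas Qs_parity = goodQD(2)[OF goodQ_Qs]
lemmas SF_Ys = SF_Yof[OF goodQ_Qs]

lemma Ys_parity: "x \<in> U1 ==> gs_parity (codd i) (Ys x i)"
 by (rule Yof_parity) (rule Qs_parity Qs_par | assumption)+

lemma evok_Qs: "x \<in> U1 ==> evok p1 q1 C2 U1 (coord_pt x) (Qs x)"
 by (rule evok_Q) (rule Qs_parity Qs_par | assumption)+

lemma evok_Ys: "x \<in> U1 ==> evok p2 q2 B U2 (Ys x) mom_var"
 by (rule evok_Y) (rule Qs_parity Qs_par | assumption)+

definition val :: "pt => gs" where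
 "val x = sf_eval p2 g (Ys x) mom_var + sf_eval p1 S (coord_pt x) (Qs x) - (\<Sum>i\<in>C2. Ys x i * Qs x i)"

text \<open>The second equation alone makes \<open>Q\<close> small, because \<open>g\<close> is; the
  first then gives \<open>Y\<close> an admissible body. So any solution, cut down to the target
  coordinates, is a fixed point of \<open>Psi\<close>.\<close>

lemma solution_unique:
 assumes x: "x \<in> U1"
  and Y: "!!i. i \<in> C2 ==> Y i = psign i * sf_eval p1 (dmom i S) (coord_pt x) Q"
  and Q: "!!i. i \<in> C2 ==> Q i = sf_eval p2 (dcoord i g) Y mom_var"
 shows "!!i. i \<in> C2 ==> Q i = Qs x i" "!!i. i \<in> C2 ==> Y i = Ys x i"
  "sf_eval p2 g Y mom_var + sf_eval p1 S (coord_pt x) Q - (\<Sum>i\<in>C2. Y i * Q i) = val x"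
proof -
 define Q' where "Q' = rst C2 Q"
 have Q'p: "gsord W 1 (Q' i)" for i
  using sf_eval_par_1[OF g_dcoord subst_W] Q by (simp add: Q'_def rst_def)
 have YQ: "Yof x Q = Yof x Q'" by (rule Yof_cong[OF x]) (simp add: Q'_def rst_def)
 have Y': "Y i = Yof x Q' i" if "i \<in> C2" for i using Y[OF that] by (simp add: YQ[symmetric] Yof_def)
 have b: "bodypt p2 Y \<in> U2"
 proof -
  have "bodypt p2 Y = bodypt p2 (Yof x Q')" by (rule bodypt_eq) (simp add: Y')
  then show ?thesis using body_Yof[OF x Q'p] by simp
 qed
 have ceq: "sf_eval p2 h Y mom_var = sf_eval p2 h (Yof x Q') mom_var" if "SF p2 q2 B U2 h" for h
  by (rule sf_eval_eqI[OF U2 that b]) (simp_all add: Y')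
 have "Psi x Q' i = Q' i" for i
  using ceq[OF SF_dcoord[OF U2 g, of i q2]] Q[of i] Q'p by (auto simp: Psi_def Q'_def rst_def)
 then have "Psi x Q' = Q'" by blast
 then have e: "Q' = Qs x" by (rule Qs(3)[OF x])
 show QQ: "Q i = Qs x i" if "i \<in> C2" for i using that unfolding e[symmetric] by (simp add: Q'_def rst_def)
 show YY: "Y i = Ys x i" if "i \<in> C2" for i using Y'[OF that] by (simp add: e)
 have "sf_eval p1 S (coord_pt x) Q = sf_eval p1 S (coord_pt x) (Qs x)"
  by (rule sf_eval_eqI[OF U1 S bodypt_coord_pt_in[OF U1 x]]) (simp_all add: QQ)
 moreover have "sf_eval p2 g Y mom_var = sf_eval p2 g (Ys x) mom_var" using ceq[OF g] by (simp add: e)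
 ultimately show "sf_eval p2 g Y mom_var + sf_eval p1 S (coord_pt x) Q - (\<Sum>i\<in>C2. Y i * Q i) = val x"
  by (simp add: val_def QQ YY)
qed

lemma YQ: "b \<in> C2 ==> SF p1 q1 B U1 (%x. Ys x b * Qs x b)"
 by (intro SF_mult[OF U1] SF_Ys SF_Qs)

lemma SF_val: "SF p1 q1 B U1 val"
 unfolding val_def[abs_def]
 by (intro SF_diff[OF U1] SF_add[OF U1] y.SF_comp[OF g] s.SF_comp[OF S] SF_sum[OF U1] YQ)

lemma val_parity:
 assumes x: "x \<in> U1"
 shows "gs_parity False (val x)"
proof -
 have "gs_parity False (Ys x i * Qs x i)" if "i \<in> C2" for i
  using gs_parity_mult[OF Ys_parity[OF x] Qs_parity[OF x that], of i] by simp
 moreover have "gs_parity False (sf_eval p2 g (Ys x) mom_var)"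
  by (rule gs_parity_sf_eval[OF U2 _ evok_Ys[OF x] g g_par]) (rule B)
 moreover have "gs_parity False (sf_eval p1 S (coord_pt x) (Qs x))"
  by (rule gs_parity_sf_eval[OF U1 _ evok_Qs[OF x] S S_par]) simp
 ultimately show ?thesis unfolding val_def by (intro gs_parity_diff gs_parity_add gs_parity_sum)
qed

lemma dmom_S: "sf_eval p1 (dmom b S) (coord_pt x) Q = psign b * Yof x Q b"
 by (simp add: Yof_def psign_mult(1) flip: mult.assoc)

text \<open>The envelope property: the derivatives of the implicitly determined \<open>y\<close> and \<open>q\<close> cancel.\<close>

lemma envelope:
 fixes D :: "(pt => gs) => gs"
 assumes x: "x \<in> U1"
  and add: "!!f h r. SF p1 q1 B U1 f ==> SF p1 q1 B U1 h ==> D (%x. f x + h x) = D f + D h"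
  and mult: "!!f h b. SF p1 q1 B U1 f ==> SF p1 q1 B U1 h ==> gs_parity b (f x) ==>
   D (%x. f x * h x) = D f * h x + sgn_if (t & b) *\<^sub>R (f x * D h)"
  and par: "!!f b. SF p1 q1 B U1 f ==> (!!x. x \<in> U1 ==> gs_parity b (f x)) ==> gs_parity (b ~= t) (D f)"
  and E: "D (%x. sf_eval p2 g (Ys x) mom_var) = (\<Sum>b\<in>C2. D (%x. Ys x b) * Qs x b) + E1"
   "D (%x. sf_eval p1 S (coord_pt x) (Qs x)) = E2 + (\<Sum>b\<in>C2. D (%x. Qs x b) * (psign b * Ys x b))"
 shows "D val = E1 + E2"
proof -
 have sYQ: "SF p1 q1 B U1 (%x. \<Sum>b\<in>A. Ys x b * Qs x b)" if "A \<subseteq> C2" for A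
  by (rule SF_sum[OF U1]) (use YQ that in blast)
 have D0: "D (%x. 0) = 0"
 proof -
  have z: "SF p1 q1 B U1 (%x. 0)" by (rule SF_const[OF U1]) simp
  show ?thesis using add[OF z z] by simp
 qed
 have D_YQ: "D (%x. Ys x b * Qs x b) = D (%x. Ys x b) * Qs x b + D (%x. Qs x b) * (psign b * Ys x b)" if b: "b \<in> C2" for b
 proof -
  have "gs_parity (codd b ~= t) (D (%x. Qs x b))" by (rule par[OF SF_Qs[OF b] Qs_parity[OF _ b]])
  from gs_mult_commute[OF this Ys_parity[OF x, of b]]
  have "D (%x. Qs x b) * (psign b * Ys x b) = sgn_if (t & codd b) *\<^sub>R (Ys x b * D (%x. Qs x b))"
   by (auto simp: psign_def sgn_if_def)
  then show ?thesis using mult[OF SF_Ys SF_Qs[OF b] Ys_parity[OF x]] by simp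
 qed
 have D_sum: "D (%x. \<Sum>b\<in>A. Ys x b * Qs x b) = (\<Sum>b\<in>A. D (%x. Ys x b) * Qs x b + D (%x. Qs x b) * (psign b * Ys x b))"
  if "finite A" "A \<subseteq> C2" for A
  using that
 proof (induction A)
  case (insert i A)
  have "D (%x. \<Sum>b\<in>insert i A. Ys x b * Qs x b) = D (%x. Ys x i * Qs x i + (\<Sum>b\<in>A. Ys x b * Qs x b))"
   using insert by simp
  also have "... = D (%x. Ys x i * Qs x i) + D (%x. \<Sum>b\<in>A. Ys x b * Qs x b)"
   by (rule add[OF YQ sYQ]) (use insert in auto)
  finally show ?case using insert D_YQ[of i] by simp
 qed (simp add: D0)
 \<comment> \<open>\<open>D\<close> is known to respect sums, so the sum subtracted in
   \<open>val\<close> is added back before it is differentiated.\<close>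
 have "D (%x. val x + (\<Sum>b\<in>C2. Ys x b * Qs x b)) = D val + D (%x. \<Sum>b\<in>C2. Ys x b * Qs x b)"
  by (rule add[OF SF_val sYQ]) simp
 moreover have "D (%x. val x + (\<Sum>b\<in>C2. Ys x b * Qs x b)) = D (y.comp g) + D (s.comp S)"
  using add[OF y.SF_comp[OF g] s.SF_comp[OF S]] by (simp add: val_def)
 ultimately have "D val = D (y.comp g) + D (s.comp S) - D (%x. \<Sum>b\<in>C2. Ys x b * Qs x b)" by simp
 then show ?thesis using E by (simp add: D_sum sum.distrib)
qed

lemma dcoord_val:
 assumes x: "x \<in> U1" and a: "a \<in> cs p1 q1"
 shows "dcoord a val x = sf_eval p1 (dcoord a S) (coord_pt x) (Qs x)"
proof -
 have "dcoord a val x = 0 + s.comp (dcoord a S) x"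
 proof (rule envelope[of x "%f. dcoord a f x" "codd a", OF x dcoord_add[OF U1 _ _ x a] dcoord_mult[OF U1 _ _ x a] gs_parity_dcoord[OF U1 x a]])
  have "dcoord a (%x. mom_var b) x = 0" for b unfolding mom_var_def by (rule dcoord_const) simp
  then show "dcoord a (y.comp g) x = (\<Sum>b\<in>C2. dcoord a (%x. Ys x b) x * Qs x b) + 0"
   using y.dcoord_comp[OF g x a] Qs_eq[OF x] by simp
  have "(\<Sum>b\<in>cs p1 q1. dcoord a (%x. coord_pt x b) x * s.comp (dcoord b S) x)
    = (\<Sum>b\<in>cs p1 q1. if b = a then s.comp (dcoord a S) x else 0)"
   by (intro sum.cong refl) (simp add: dcoord_coord_pt)
  then show "dcoord a (s.comp S) x = s.comp (dcoord a S) x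
   + (\<Sum>b\<in>C2. dcoord a (%x. Qs x b) x * (psign b * Ys x b))"
   using s.dcoord_comp[OF S x a] a by (simp add: dmom_S sum.delta)
 qed
 then show ?thesis by simp
qed

text \<open>The cancellation for a spectator momentum of \<open>g\<close>. Under a change of charts
  the spectators are the new momenta, and this derivative identifies the new target
  coordinates.\<close>

lemma dmom_val:
 assumes x: "x \<in> U1" and a: "a \<in> B"
 shows "dmom a val x = sf_eval p2 (dmom a g) (Ys x) mom_var"
proof -
 have "dmom a val x = y.comp (dmom a g) x + 0"
 proof (rule envelope[of x "%f. dmom a f x" "codd a", OF x _ dmom_mult gs_parity_dmom[OF _]])
  show "dmom a (%x. f x + h x) x = dmom a f x + dmom a h x" for f h
   unfolding dmom_eq by (rule clin_add[OF clin_vderiv])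
  have "(\<Sum>b\<in>B. dmom a (%x. mom_var b) x * y.comp (dmom b g) x) = (\<Sum>b\<in>B. if b = a then y.comp (dmom a g) x else 0)"
   by (intro sum.cong refl) (simp add: dmom_mom_var)
  then show "dmom a (y.comp g) x = (\<Sum>b\<in>C2. dmom a (%x. Ys x b) x * Qs x b) + y.comp (dmom a g) x"
   using y.dmom_comp[OF g x, of a] Qs_eq[OF x] a B by (simp add: sum.delta)
  show "dmom a (s.comp S) x = 0 + (\<Sum>b\<in>C2. dmom a (%x. Qs x b) x * (psign b * Ys x b))"
   using s.dmom_comp[OF S x, of a] by (simp add: dmom_S dmom_coord_pt)
 qed (use x in auto)
 then show ?thesis by simp
qed

lemma weight_Yof:
 assumes wS: "has_weight p1 U1 w1 (vweight w1 (%i. s - w2 i) \<omega>) s S" and Q: "goodQ Q"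
  and wQ: "!!i. i \<in> C2 ==> has_weight p1 U1 w1 (vweight w1 \<mu> \<omega>) (s - w2 i) (%x. Q x i)" and i: "i \<in> C2"
 shows "has_weight p1 U1 w1 (vweight w1 \<mu> \<omega>) (w2 i) (%x. Yof x (Q x) i)"
proof -
 interpret sfam p1 q1 "B" U1 p1 q1 C2 U1 coord_pt Q by (rule sfam_S[OF Q])
 have "has_weight p1 U1 w1 (vweight w1 (%i. s - w2 i) \<omega>) (w2 i) (dmom i S)"
  using has_weight_dmom[OF SF_D(2)[OF S] wS, of i] by simp
 then have "has_weight p1 U1 w1 (vweight w1 \<mu> \<omega>) (w2 i) (comp (dmom i S))"
  by (rule has_weight_comp[OF SFd]) (auto intro: has_weight_coord_pt wQ)
 from has_weight_scaleR[OF SF_D(2)[OF SF_comp[OF SFd]] this, of "if codd i then - 1 else 1"]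
 show ?thesis by (simp add: Yof_def psign_def split: if_splits)
qed

lemma weight_It:
 assumes B0: "B = {}" and wS: "has_weight p1 U1 w1 (vweight w1 (%i. s - w2 i) \<omega>) s S"
  and wg: "has_weight p2 U2 w2 (vweight w2 \<mu>2 \<omega>) s g" and i: "i \<in> C2"
 shows "has_weight p1 U1 w1 (vweight w1 \<mu> \<omega>) (s - w2 i) (%x. It n x i)"
 using i
proof (induction n arbitrary: i)
 case 0
 then show ?case by (simp add: It_def has_weight_0)
next
 case (Suc n)
 interpret sfam p1 q1 "B" U1 p2 q2 "B" U2 "%x. Yof x (It n x)" "%_. mom_var" by (rule sfam_Y[OF goodQ_It])
 show ?case
  unfolding It_Suc[OF Suc.prems]
  by (rule has_weight_comp[OF SF_dcoord[OF U2 g Suc.prems] has_weight_dcoord[OF U2 SF_D(2)[OF g] wg Suc.prems]])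
   (auto simp: B0 intro: weight_Yof[OF wS goodQ_It Suc.IH])
qed

lemma weight_val:
 assumes B0: "B = {}" and wS: "has_weight p1 U1 w1 (vweight w1 (%i. s - w2 i) \<omega>) s S"
  and wg: "has_weight p2 U2 w2 (vweight w2 \<mu>2 \<omega>) s g"
 shows "has_weight p1 U1 w1 (vweight w1 \<mu> \<omega>) s val"
proof -
 let ?h = "has_weight p1 U1 w1 (vweight w1 \<mu> \<omega>)"
 have wQ: "?h (s - w2 i) (%x. Qs x i)" if "i \<in> C2" for i
  by (rule has_weight_lim[OF U1, where T = "%n x. It n x i" and V = W])
   (auto intro: weight_It[OF B0 wS wg that] Qs(2))
 note wY = weight_Yof[OF wS goodQ_Qs wQ]
 have 1: "?h s (y.comp g)"
  by (rule y.has_weight_comp[OF g wg]) (auto simp: B0 intro: wY)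
 have 2: "?h s (s.comp S)"
  by (rule s.has_weight_comp[OF S wS]) (auto intro: has_weight_coord_pt wQ)
 have "?h s (%x. Ys x b * Qs x b)" if "b \<in> C2" for b
  using has_weight_mult[OF U1 SF_D(2)[OF SF_Ys] SF_D(2)[OF SF_Qs[OF that]] wY[OF _ that] wQ[OF that]] by simp
 then have 3: "?h s (%x. \<Sum>b\<in>C2. Ys x b * Qs x b)"
  by (intro has_weight_sum[OF U1]) (auto intro: SF_D(2)[OF YQ])
 have sYQ: "sfn p1 U1 (%x. \<Sum>b\<in>C2. Ys x b * Qs x b)" by (rule sfn_sum[OF U1]) (rule SF_D(2)[OF YQ])
 have "?h s (%x. (y.comp g x + s.comp S x) + (-1) *\<^sub>R (\<Sum>b\<in>C2. Ys x b * Qs x b))"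
 proof (rule has_weight_add)
  show "sfn p1 U1 (%x. y.comp g x + s.comp S x)" by (intro sfn_add[OF U1] y.sfn_comp[OF g] s.sfn_comp[OF S])
  show "sfn p1 U1 (%x. (-1) *\<^sub>R (\<Sum>b\<in>C2. Ys x b * Qs x b))"
   using smooth_cmult[OF U1, of _ "-1"] sYQ unfolding sfn_def by simp
  show "?h s (%x. y.comp g x + s.comp S x)"
   by (intro has_weight_add y.sfn_comp[OF g] s.sfn_comp[OF S] 1 2)
  show "?h s (%x. (-1) *\<^sub>R (\<Sum>b\<in>C2. Ys x b * Qs x b))"
   by (rule has_weight_scaleR[OF sYQ 3])
 qed
 then show ?thesis by (simp add: val_def[abs_def])
qed

end

subsection \<open>Hamilton-Jacobi fields\<close>

lemma dcoord_cong:
 assumes "eopen p U" "x \<in> U" "a \<in> cs p q" "!!y. y \<in> U ==> g y = h y"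
 shows "dcoord a g x = dcoord a h x"
proof (cases a)
 case (Ev i)
 then show ?thesis using assms(3) by (auto intro: dcoord_Ev_cong[OF assms(1,2) _ assms(4)])
qed (simp add: dcoord_Od assms(2,4))

lemma dcoord_commute:
 assumes U: "eopen p U" and g: "sfn p U g" and x: "x \<in> U" and ab: "a \<in> cs p q" "b \<in> cs p q"
 shows "dcoord a (dcoord b g) x = sgn_if (codd a & codd b) *\<^sub>R dcoord b (dcoord a g) x"
proof (cases a; cases b)
 fix i j assume "a = Od i" "b = Od j"
 then show ?thesis using vderiv_commute[of "Xi i" "Xi j"] by (simp add: dcoord_Od)
next
 fix i j assume "a = Ev i" "b = Ev j"
 then show ?thesis using ab dcoord_Ev_commute[OF U g x] by simp
qed (use ab vderiv_dcoord_Ev[OF g x] in \<open>simp_all add: dcoord_Od\<close>)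

lemma SF_par: "eopen p U ==> SF p q B U (%x. gs_var (Par b n))"
 by (rule SF_const) (auto simp: svars_def intro: gs_vars_var)

lemma SF_eps: "eopen p U ==> SF p q B U W ==> SF p q B U (%x. gs_var (Par b n) * W x)"
 by (rule SF_mult[OF _ SF_par])

lemma sf_eval_par:
 assumes "eopen p U" "finite B" "evok p q B U X P"
 shows "sf_eval p (%y. gs_var (Par b j)) X P = gs_var (Par b j)"
 using sf_eval_const[OF assms, of "gs_var (Par b j)"] msub_var[of _ "Par b j"] evd_rst[OF assms(2,3)]
 by (simp add: svars_def gs_vars_var evd_def)

lemma dcoord_eps:
 assumes U: "eopen p U" and W: "SF p q B U W" and x: "x \<in> U" and a: "a \<in> cs p q"
 shows "dcoord a (%x. gs_var (Par True j) * W x) x = gs_var (Par True j) * (sgn_if (codd a) *\<^sub>R dcoord a W x)"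
proof -
 have p: "gs_parity True (gs_var (Par True j))" using gs_parity_var[of "Par True j"] by simp
 show ?thesis using dcoord_mult[OF U SF_par[OF U] W x a p] by (simp add: dcoord_const)
qed

lemma gsord_eps: "gsord (%u. u = Par True j) 1 (gs_var (Par True j) * f)"
proof -
 have "gsord (%u. u = Par True j) 1 (gs_var (Par True j))" by (auto simp: gsord_def coeff_gs_var)
 from gsord_mult[OF this gsord_0(2)] show ?thesis by simp
qed

lemma gsord_par_eps: "gsord is_par 1 (gs_var (Par b j) * f)"
 using gsord_mult[OF gsord_par_var[of "Par b j"] gsord_0(2)[of is_par f]] by simp

lemma eps_parity: "gs_parity b f ==> gs_parity (~ b) (gs_var (Par True j) * f)"
 using gs_parity_mult[OF gs_parity_var[of "Par True j"], of b f] by simp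

section \<open>The Hamilton-Jacobi field in one chart\<close>

locale hj =
 fixes p q :: nat and U :: "pt set" and H G :: "pt => gs"
 assumes U: "eopen p U"
  and H: "SF p q (cs p q) U H" and H_par: "!!x. x \<in> U ==> gs_parity True (H x)"
  and G: "SF p q {} U G" and G_par: "!!x. x \<in> U ==> gs_parity False (G x)"
  and G1: "!!x. gsord is_par 1 (G x)"
begin

abbreviation C :: "coord set" where "C \<equiv> cs p q"

lemma dG_par: "x \<in> U ==> a \<in> C ==> gs_parity (codd a) (dcoord a G x)"
 using gs_parity_dcoord[OF U, of x a q False G] G_par by simp

lemma dG_1: "gsord is_par 1 (dcoord a G x)"
 by (rule gsord_par_dcoord[OF G1])

sublocale sfam p q "{}" U p q "cs p q" U coord_pt "%x a. dcoord a G x"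
proof
 show "evok p q (cs p q) U (coord_pt x) (%a. dcoord a G x)" if "x \<in> U" for x
  by (rule evok_coord_pt[OF U that dG_par[OF that] gsord_1_empty[OF dG_1]])
qed (auto simp: U intro: SF_coord_pt[OF U] SF_dcoord[OF U G])

lemma dH: "a \<in> C ==> SF p q C U (dcoord a H)" "SF p q C U (dmom a H)"
 by (rule SF_dcoord[OF U H], assumption, rule SF_dmom[OF U H])

lemma dH_par: "x \<in> U ==> a \<in> C ==> gs_parity (~ codd a) (dcoord a H x)" "x \<in> U ==> gs_parity (~ codd a) (dmom a H x)"
 using gs_parity_dcoord[OF U, of x a q True H] gs_parity_dmom[of True H x a] H_par by simp_all

lemma comp_parity:
 assumes "SF p q C U g" "!!x. x \<in> U ==> gs_parity b (g x)" "x \<in> U"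
 shows "gs_parity b (comp g x)"
 by (rule gs_parity_sf_eval[OF U finite_cs ev[OF assms(3)] assms(1,2)])

lemma dcoord_HJ:
 assumes x: "x \<in> U" and a: "a \<in> C"
 shows "dcoord a (comp H) x = comp (dcoord a H) x + (\<Sum>b\<in>C. dcoord a (dcoord b G) x * comp (dmom b H) x)"
proof -
 have "(\<Sum>b\<in>C. dcoord a (%x. coord_pt x b) x * comp (dcoord b H) x) = (\<Sum>b\<in>C. if b = a then comp (dcoord a H) x else 0)"
  by (intro sum.cong refl) (simp add: dcoord_coord_pt)
 then show ?thesis using dcoord_comp[OF H x a] a by (simp add: sum.delta)
qed

text \<open>The differential of the shifted point changes by multiples of the odd parameter, so
  \<open>sf_eval_shift\<close> is exact; the signs arise from moving \<open>dcoord a\<close> past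
  the parameter.\<close>

lemma HJ_shift:
 assumes x: "x \<in> U" and W: "SF p q {} U W" "!!x. x \<in> U ==> gs_parity True (W x)"
 shows "sf_eval p H (coord_pt x) (%a. dcoord a (%x. G x + gs_var (Par True j) * W x) x)
  = comp H x + gs_var (Par True j) * (\<Sum>a\<in>C. sgn_if (codd a) *\<^sub>R (dcoord a W x * comp (dmom a H) x))"
proof -
 let ?e = "gs_var (Par True j)"
 let ?C = "%a. ?e * (sgn_if (codd a) *\<^sub>R dcoord a W x)"
 have d: "dcoord a (%x. G x + ?e * W x) x = dcoord a G x + ?C a" if "a \<in> C" for a
  using dcoord_add[OF U G SF_eps[OF U W(1)] x that] dcoord_eps[OF U W(1) x that] by simp
 have "sf_eval p H (coord_pt x) (%a. dcoord a (%x. G x + ?e * W x) x)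
   = sf_eval p H (%a. coord_pt x a + 0) (%a. dcoord a G x + ?C a)"
  by (rule sf_eval_eqI[OF U H]) (use d bodypt_coord_pt[OF U x] x in auto)
 also have "... = comp H x + ((\<Sum>a\<in>C. 0 * comp (dcoord a H) x) + (\<Sum>a\<in>C. ?C a * comp (dmom a H) x))"
 proof (rule sf_eval_shift[OF U finite_cs H ev[OF x], of "Par True j"])
  show "gs_parity (codd a) (?C a)" if "a \<in> C" for a
  proof -
   have "gs_parity (True ~= codd a) (sgn_if (codd a) *\<^sub>R dcoord a W x)"
    by (rule gs_parity_scaleR[OF gs_parity_dcoord[OF U x that W(2)]])
   from eps_parity[OF this, of j] show ?thesis by simp
  qed
  show "gsord (%u. u = Par True j) 1 (?C a)" for a by (rule gsord_eps)
 qed auto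
 finally show ?thesis by (simp add: sum_distrib_left mult.assoc)
qed

text \<open>For odd \<open>H\<close> both halves of the Poisson bracket are the same product up to
  order and sign, which makes the bracket -2 times the sum considered here. The resulting identity
  is evaluated at the differential of \<open>G\<close>.\<close>

lemma master_zero:
 assumes x: "x \<in> U" and H0: "!!x. x \<in> U ==> poisson C True H H x = 0"
 shows "(\<Sum>a\<in>C. sgn_if (codd a) *\<^sub>R (comp (dcoord a H) x * comp (dmom a H) x)) = 0"
proof -
 have 0: "(\<Sum>a\<in>C. sgn_if (codd a) *\<^sub>R (dcoord a H y * dmom a H y)) = 0" if y: "y \<in> U" for y
 proof -
  have "dmom a H y * dcoord a H y - psign a * dcoord a H y * dmom a H y
    = (- 2) *\<^sub>R (sgn_if (codd a) *\<^sub>R (dcoord a H y * dmom a H y))" if "a \<in> C" for a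
   using gs_mult_commute[OF dH_par(2)[OF y, of a] dH_par(1)[OF y that]]
   by (cases "codd a") (auto simp: psign_def sgn_if_def scaleR_2)
  then have "poisson C True H H y = (\<Sum>a\<in>C. (- 2) *\<^sub>R (sgn_if (codd a) *\<^sub>R (dcoord a H y * dmom a H y)))"
   unfolding poisson_def by (intro sum.cong refl) simp
  then have "(- 2) *\<^sub>R (\<Sum>a\<in>C. sgn_if (codd a) *\<^sub>R (dcoord a H y * dmom a H y)) = 0"
   by (simp only: H0[OF y] scaleR_sum_right)
  then show ?thesis by simp
 qed
 have m: "SF p q C U (%x. dcoord a H x * dmom a H x)" if "a \<in> C" for a
  by (rule SF_mult[OF U dH(1)[OF that] dH(2)])
 have "sf_eval p (%x. 0) (coord_pt x) (%a. dcoord a G x) = comp (%x. \<Sum>a\<in>C. sgn_if (codd a) *\<^sub>R (dcoord a H x * dmom a H x)) x"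
  using ev[OF x] 0 by (intro sf_eval_cong[where U = U and W = UNIV]) (auto simp: U evok_def gs_vars_def)
 also have "... = (\<Sum>a\<in>C. comp (%x. sgn_if (codd a) *\<^sub>R (dcoord a H x * dmom a H x)) x)"
  by (rule sf_eval_sum[OF U finite_cs ev[OF x]]) (rule SF_scaleR[OF U m])
 also have "... = (\<Sum>a\<in>C. sgn_if (codd a) *\<^sub>R (comp (dcoord a H) x * comp (dmom a H) x))"
  by (intro sum.cong refl)
   (simp add: sf_eval_scaleR[OF U finite_cs ev[OF x] m] sf_eval_mult'[OF U finite_cs ev[OF x] dH])
 finally show ?thesis by (simp add: sf_eval_0)
qed

text \<open>Besides the terms of \<open>master_zero\<close> there are those with second derivatives
  of \<open>G\<close>. These are graded symmetric in the two indices, while the momentum derivatives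
  of \<open>H\<close>, of parity opposite to the coordinates, commute with complementary signs; so
  \<open>T\<close> is antisymmetric and its double sum vanishes.\<close>

lemma HJ_square_zero:
 assumes x: "x \<in> U" and H0: "!!x. x \<in> U ==> poisson C True H H x = 0"
 shows "(\<Sum>a\<in>C. sgn_if (codd a) *\<^sub>R (dcoord a (comp H) x * comp (dmom a H) x)) = 0"
proof -
 define T where "T a b = sgn_if (codd a) *\<^sub>R (dcoord a (dcoord b G) x * comp (dmom b H) x * comp (dmom a H) x)" for a b
 have anti: "T a b = - T b a" if ab: "a \<in> C" "b \<in> C" for a b
 proof -
  have "gs_parity (~ codd a) (comp (dmom a H) x)" for a by (rule comp_parity[OF dH(2) dH_par(2) x])
  note c = gs_mult_commute[OF this[of a] this[of b]]
  show ?thesis unfolding T_def mult.assoc dcoord_commute[OF U SF_D(2)[OF G] x ab] c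
   by (cases "codd a"; cases "codd b") (simp_all add: sgn_if_def)
 qed
 have "(\<Sum>a\<in>C. \<Sum>b\<in>C. T a b) = (\<Sum>a\<in>C. \<Sum>b\<in>C. - T b a)" by (intro sum.cong refl anti)
 also have "... = - (\<Sum>a\<in>C. \<Sum>b\<in>C. T a b)" by (subst sum.swap) (simp add: sum_negf)
 finally have T: "(\<Sum>a\<in>C. \<Sum>b\<in>C. T a b) = - (\<Sum>a\<in>C. \<Sum>b\<in>C. T a b)" .
 have T0: "(\<Sum>a\<in>C. \<Sum>b\<in>C. T a b) = 0"
 proof (rule gs_eqI)
  fix m show "coeff (\<Sum>a\<in>C. \<Sum>b\<in>C. T a b) m = coeff 0 m"
   using arg_cong[OF T, of "%f. coeff f m"] unfolding coeff_arith by linarith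
 qed
 have "(\<Sum>a\<in>C. sgn_if (codd a) *\<^sub>R (dcoord a (comp H) x * comp (dmom a H) x))
   = (\<Sum>a\<in>C. sgn_if (codd a) *\<^sub>R (comp (dcoord a H) x * comp (dmom a H) x) + (\<Sum>b\<in>C. T a b))"
  by (intro sum.cong refl)
   (simp add: dcoord_HJ[OF x] T_def distrib_right sum_distrib_right scaleR_add_right scaleR_sum_right)
 then show ?thesis by (simp add: sum.distrib T0 master_zero[OF assms])
qed

end

section \<open>Atlases, global functions and formal points\<close>

locale gman =
 fixes M :: "('m, 'c) atlas"
 assumes M: "graded_supermanifold M"
begin

abbreviation p :: nat where "p \<equiv> edim M"
abbreviation q :: nat where "q \<equiv> odim M"

lemma coords_eq: "coords M = cs p q"
 by (simp add: coords_def cs_def)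

lemma vars_eq: "xi_vars M \<union> Collect is_par = svars q {}"
 by (simp add: xi_vars_def svars_def)

lemma chart:
 assumes "c \<in> charts M"
 shows "openin (carrier_top M) (cdom M c)" "eopen p (image_of M c)"
  "homeomorphic_map (subtopology (carrier_top M) (cdom M c)) (subtopology (Euclidean_space p) (image_of M c)) (cmap M c)"
 using M assms unfolding graded_supermanifold_def by blast+

lemma open_image:
 assumes c: "c \<in> charts M" and V: "openin (carrier_top M) V" "V \<subseteq> cdom M c"
 shows "eopen p (cmap M c ` V)"
proof -
 have "openin (subtopology (carrier_top M) (cdom M c)) V"
  using V chart(1)[OF c] by (simp add: openin_open_subtopology)
 then have "openin (subtopology (Euclidean_space p) (image_of M c)) (cmap M c ` V)"
  using homeomorphic_map_openness_eq[OF chart(3)[OF c]] by (meson openin_subset)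
 then show ?thesis using openin_open_subtopology[OF chart(2)[OF c]] by blast
qed

lemma open_overlap: "c \<in> charts M ==> d \<in> charts M ==> eopen p (overlap M c d)"
 unfolding overlap_def by (rule open_image) (auto intro: chart(1))

lemma overlap_subset: "overlap M c d \<subseteq> image_of M c"
 by (auto simp: overlap_def image_of_def)

lemma cmap_zero: "c \<in> charts M ==> z \<in> cdom M c ==> i \<ge> p ==> cmap M c z i = 0"
 by (rule openin_Euclidean_topspace[OF chart(2)]) (auto simp: image_of_def)

lemma cmap_inj: "c \<in> charts M ==> inj_on (cmap M c) (cdom M c)"
 using homeomorphic_imp_injective_map[OF chart(3)] openin_subset[OF chart(1)] by (simp add: topspace_subtopology Int_absorb1)

text \<open>The variables of a transition function are odd coordinates only, so the weights
  \<open>\<mu>\<close> of momenta and \<open>\<omega>\<close> of parameters can be chosen to fit the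
  context.\<close>

lemma trans:
 assumes "c \<in> charts M" "d \<in> charts M" "a \<in> cs p q"
 shows "SF p q B (overlap M c d) (transition M c d a)"
  "x \<in> overlap M c d ==> gs_parity (codd a) (transition M c d a x)"
  "x \<in> overlap M c d ==> gs_vars (xi_vars M) (transition M c d a x)"
  "has_weight p (overlap M c d) (cweight M c) (vweight (cweight M c) \<mu> \<omega>) (cweight M d a) (transition M c d a)"
proof -
 have "superfun p (overlap M c d) (xi_vars M) (transition M c d a) &
    (ALL x:overlap M c d. gs_parity (codd a) (transition M c d a x)) &
    has_weight p (overlap M c d) (cweight M c)
     (vweight (cweight M c) (%_. 0) (%_ _. 0)) (cweight M d a) (transition M c d a)"
  using M assms unfolding graded_supermanifold_def coords_eq by blast
 then have s: "superfun p (overlap M c d) (xi_vars M) (transition M c d a)"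
  and pa: "ALL x:overlap M c d. gs_parity (codd a) (transition M c d a x)"
  and w: "has_weight p (overlap M c d) (cweight M c)
     (vweight (cweight M c) (%_. 0) (%_ _. 0)) (cweight M d a) (transition M c d a)" by blast+
 have v: "xi_vars M \<subseteq> svars q B" by (auto simp: xi_vars_def svars_def)
 show "SF p q B (overlap M c d) (transition M c d a)"
  using s gs_vars_mono[OF _ v] unfolding SF_def superfun_def by blast
 show "x \<in> overlap M c d ==> gs_parity (codd a) (transition M c d a x)" using pa by blast
 show vx: "x \<in> overlap M c d ==> gs_vars (xi_vars M) (transition M c d a x)" for x using s unfolding superfun_def by blast
 show "has_weight p (overlap M c d) (cweight M c) (vweight (cweight M c) \<mu> \<omega>) (cweight M d a) (transition M c d a)"
  by (rule has_weight_cong_vars[OF w vx]) (auto simp: xi_vars_def vweight_def)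
qed

lemma bodypt_change:
 assumes "c \<in> charts M" "d \<in> charts M" "z \<in> cdom M c" "z \<in> cdom M d"
 shows "bodypt p (change M c d (cmap M c z)) = cmap M d z"
proof
 fix i
 have "i < p ==> body (transition M c d (Ev i) (cmap M c z)) = cmap M d z i"
  using M assms unfolding graded_supermanifold_def by blast
 then show "bodypt p (change M c d (cmap M c z)) i = cmap M d z i"
  using cmap_zero[OF assms(2,4), of i] by (simp add: bodypt_def change_def)
qed

lemma evok_change:
 assumes "c \<in> charts M" "d \<in> charts M" "x \<in> overlap M c d"
  and "!!a. a \<in> B ==> gs_parity (codd a) (P a)" "!!a. a \<in> B ==> coeff (P a) {#} = 0"
 shows "evok p q B (overlap M d c) (change M c d x) P"
proof -
 obtain z where z: "z \<in> cdom M c" "z \<in> cdom M d" "x = cmap M c z" using assms(3) by (auto simp: overlap_def)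
 then have "bodypt p (change M c d x) \<in> overlap M d c"
  using bodypt_change[OF assms(1,2) z(1,2)] by (auto simp: overlap_def)
 then show ?thesis using assms trans(2)[OF assms(1,2)] by (simp add: evok_def change_def)
qed

lemma evok_change':
 assumes "c \<in> charts M" "d \<in> charts M" "x \<in> overlap M c d"
  and "!!a. a \<in> B ==> gs_parity (codd a) (P a)" "!!a. a \<in> B ==> coeff (P a) {#} = 0"
 shows "evok p q B (image_of M d) (change M c d x) P"
 using evok_change[OF assms] overlap_subset unfolding evok_def by blast

lemma sfam_change:
 assumes "c \<in> charts M" "d \<in> charts M"
 shows "sfam p q {} (overlap M c d) p q {} (image_of M d) (change M c d) (%_. mom_var)"
proof
 show "SF p q {} (overlap M c d) (%x. change M c d x a)" if "a \<in> cs p q" for a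
  using trans(1)[OF assms that] by (simp add: change_def)
qed (auto intro: open_overlap chart(2) evok_change' assms)

lemma globalD:
 assumes "G \<in> global_functions M \<omega> b s" "c \<in> charts M"
 shows "SF p q {} (image_of M c) (G c)" "x \<in> image_of M c ==> gs_parity b (G c x)"
  "has_weight p (image_of M c) (cweight M c) (vweight (cweight M c) \<mu> \<omega>) s (G c)"
  "d \<in> charts M ==> x \<in> overlap M c d ==> G c x = sf_eval p (G d) (change M c d x) mom_var"
proof -
 have *: "superfun p (image_of M c) (svars q {}) (G c) &
    (ALL x:image_of M c. gs_parity b (G c x)) &
    has_weight p (image_of M c) (cweight M c) (vweight (cweight M c) (%_. 0) \<omega>) s (G c)"
  using assms unfolding global_functions_def vars_eq by blast
 then show SF: "SF p q {} (image_of M c) (G c)" by (simp add: SF_def)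
 show "x \<in> image_of M c ==> gs_parity b (G c x)" using * by blast
 have w: "has_weight p (image_of M c) (cweight M c) (vweight (cweight M c) (%_. 0) \<omega>) s (G c)" using * by blast
 show "has_weight p (image_of M c) (cweight M c) (vweight (cweight M c) \<mu> \<omega>) s (G c)"
  by (rule has_weight_cong_vars[OF w SF_D(1)[OF SF]]) (auto simp: svars_def vweight_def is_par_def)
 show "d \<in> charts M ==> x \<in> overlap M c d ==> G c x = sf_eval p (G d) (change M c d x) mom_var"
  using assms unfolding global_functions_def by blast
qed

lemma global_off: "G \<in> global_functions M \<omega> b s ==> c \<notin> charts M | x \<notin> image_of M c ==> G c x = 0"
 unfolding global_functions_def by blast

lemma globalI:
 assumes "!!c x. c \<notin> charts M | x \<notin> image_of M c ==> F c x = 0"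
  "!!c. c \<in> charts M ==> SF p q {} (image_of M c) (F c)"
  "!!c x. c \<in> charts M ==> x \<in> image_of M c ==> gs_parity b (F c x)"
  "!!c. c \<in> charts M ==> has_weight p (image_of M c) (cweight M c) (vweight (cweight M c) (%_. 0) \<omega>) s (F c)"
  "!!c d x. c \<in> charts M ==> d \<in> charts M ==> x \<in> overlap M c d ==> F c x = sf_eval p (F d) (change M c d x) mom_var"
 shows "F \<in> global_functions M \<omega> b s"
 unfolding global_functions_def vars_eq using assms unfolding SF_def by blast

lemma formalD: "G \<in> formal_points M \<omega> s ==> G \<in> global_functions M \<omega> False s" "G \<in> formal_points M \<omega> s ==> gsord is_par 1 (G c x)"
proof -
 assume G: "G \<in> formal_points M \<omega> s"
 then show "G \<in> global_functions M \<omega> False s" by (simp add: formal_points_def)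
 show "gsord is_par 1 (G c x)"
  unfolding gsord_def
 proof (intro allI impI, rule ccontr)
  fix m assume m: "size (filter_mset is_par m) < 1" "coeff (G c x) m ~= 0"
  from m(2) obtain v where "v \<in># m" "is_par v" using G unfolding formal_points_def by blast
  then have "v \<in># filter_mset is_par m" by simp
  moreover from m(1) have "filter_mset is_par m = {#}" by simp
  ultimately show False by simp
 qed
qed

end

lemma msub_xi_par:
 assumes "finite B" "!!a. a \<in> B ==> gs_parity (codd a) (P a)" "!!a. a \<in> B ==> coeff (P a) {#} = 0" "gs_vars (svars q {}) f"
 shows "msub (psub B P) f = f"
proof -
 have "msub (psub B P) f = msub gs_var f"
  by (rule msub_cong[OF good_psub[OF assms(1-3)] good_var assms(4)]) (auto simp: svars_def is_par_def)
 then show ?thesis by (simp add: msub_gs_var)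
qed

lemma msub_coord_pt: "good (psub B P) ==> msub (psub B P) (coord_pt x a) = coord_pt x a"
 by (cases a) (simp_all add: msub_of_real msub_var)

section \<open>Master Hamiltonians on an atlas\<close>

locale hjm = gman M for M :: "('m, 'c) atlas" +
 fixes k :: int and H :: "'c => pt => gs"
 assumes master: "master_hamiltonian k M H"
begin

lemma H_cot: "H \<in> cotangent_functions M (1 - k) True (2 - k)"
 using master by (simp add: master_hamiltonian_def)

lemma HD:
 assumes c: "c \<in> charts M"
 shows "SF p q (cs p q) (image_of M c) (H c)" "x \<in> image_of M c ==> gs_parity True (H c x)"
  "has_weight p (image_of M c) (cweight M c) (vweight (cweight M c) (%a. 1 - k - cweight M c a) \<omega>) (2 - k) (H c)"
  "x \<in> image_of M c ==> poisson (cs p q) True (H c) (H c) x = 0"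
  "x \<in> image_of M c ==> gs_vars (xi_vars M \<union> mom_vars M) (H c x)"
  "d \<in> charts M ==> x \<in> overlap M c d ==>
   sf_eval p (H c) (coord_pt x) (change_mom M c d x) = sf_eval p (H d) (change M c d x) mom_var"
proof -
 have *: "superfun p (image_of M c) (xi_vars M \<union> mom_vars M) (H c) &
    (ALL x:image_of M c. gs_parity True (H c x)) &
    has_weight p (image_of M c) (cweight M c) (vweight (cweight M c) (%a. 1 - k - cweight M c a) (%_ _. 0)) (2 - k) (H c)"
  using H_cot c unfolding cotangent_functions_def by blast
 have v: "xi_vars M \<union> mom_vars M \<subseteq> svars q (cs p q)" by (auto simp: xi_vars_def mom_vars_def svars_def coords_eq)
 show SF: "SF p q (cs p q) (image_of M c) (H c)"
  using * gs_vars_mono[OF _ v] unfolding SF_def superfun_def by blast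
 show "x \<in> image_of M c ==> gs_parity True (H c x)" using * by blast
 show vx: "x \<in> image_of M c ==> gs_vars (xi_vars M \<union> mom_vars M) (H c x)" for x using * unfolding superfun_def by blast
 have w: "has_weight p (image_of M c) (cweight M c) (vweight (cweight M c) (%a. 1 - k - cweight M c a) (%_ _. 0)) (2 - k) (H c)"
  using * by blast
 show "has_weight p (image_of M c) (cweight M c) (vweight (cweight M c) (%a. 1 - k - cweight M c a) \<omega>) (2 - k) (H c)"
  by (rule has_weight_cong_vars[OF w vx]) (auto simp: xi_vars_def mom_vars_def vweight_def)
 show "x \<in> image_of M c ==> poisson (cs p q) True (H c) (H c) x = 0"
  using master c by (simp add: master_hamiltonian_def coords_eq)
 show "d \<in> charts M ==> x \<in> overlap M c d ==>
   sf_eval p (H c) (coord_pt x) (change_mom M c d x) = sf_eval p (H d) (change M c d x) mom_var"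
  using H_cot c unfolding cotangent_functions_def by blast
qed

lemma hj:
 assumes G: "G \<in> formal_points M \<omega> (1 - k)" and c: "c \<in> charts M"
 shows "hj p q (image_of M c) (H c) (G c)"
 by unfold_locales (use chart(2)[OF c] HD[OF c] globalD[OF formalD(1)[OF G] c] formalD(2)[OF G] in blast)+

text \<open>The transformation law of \<open>H\<close> is an identity in the momentum variables.
  Substituting for them the derivatives of \<open>G\<close> in the chart \<open>d\<close>, evaluated
  at the new coordinates, turns \<open>change_mom\<close> into the derivatives of \<open>G\<close>
  in the chart \<open>c\<close>, by the chain rule.\<close>

lemma HJ_chart:
 assumes G: "G \<in> formal_points M \<omega> (1 - k)" and c: "c \<in> charts M" and d: "d \<in> charts M" and x: "x \<in> overlap M c d"
 shows "sf_eval p (H c) (coord_pt x) (%a. dcoord a (G c) x)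
  = sf_eval p (%y. sf_eval p (H d) (coord_pt y) (%a. dcoord a (G d) y)) (change M c d x) mom_var"
proof -
 let ?X = "change M c d x"
 let ?C = "cs p q"
 interpret C: hj p q "image_of M c" "H c" "G c" by (rule hj[OF G c])
 interpret D: hj p q "image_of M d" "H d" "G d" by (rule hj[OF G d])
 interpret T: sfam p q "{}" "overlap M c d" p q "{}" "image_of M d" "change M c d" "%_. mom_var" by (rule sfam_change[OF c d])
 have xc: "x \<in> image_of M c" using x overlap_subset by blast
 note G' = formalD(1)[OF G]
 define R where "R b = sf_eval p (dcoord b (G d)) ?X mom_var" for b
 have SFR: "SF p q {} (overlap M c d) (T.comp (dcoord b (G d)))" if "b \<in> ?C" for b
  by (rule T.SF_comp[OF SF_dcoord[OF D.U D.G that]])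
 have R: "gs_parity (codd b) (R b)" "coeff (R b) {#} = 0" if "b \<in> ?C" for b
 proof -
  show "gs_parity (codd b) (R b)" unfolding R_def
   by (rule gs_parity_sf_eval[OF D.U _ T.ev[OF x] SF_dcoord[OF D.U D.G that] D.dG_par[OF _ that]]) simp
  show "coeff (R b) {#} = 0" unfolding R_def by (rule gsord_1_empty[OF sf_eval_par_1[OF D.dG_1 subst_var_par]])
 qed
 let ?t = "psub ?C R"
 have gt: "good ?t" by (rule good_psub[OF finite_cs R])
 have tp: "?t (Par b n) = gs_var (Par b n)" for b n by simp
 have id: "msub ?t f = f" if "gs_vars (svars q {}) f" for f by (rule msub_xi_par[OF finite_cs R that])
 have evm: "evok p q ?C (image_of M d) ?X mom_var" by (rule evok_change'[OF c d x]) (auto intro: mom_var_props)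
 have dG: "dcoord a (G c) x = (\<Sum>b\<in>?C. dcoord a (transition M c d b) x * R b)" if a: "a \<in> ?C" for a
 proof -
  have "dcoord a (G c) x = dcoord a (T.comp (G d)) x"
   by (rule dcoord_cong[OF open_overlap[OF c d] x a]) (rule globalD(4)[OF G' c d])
  also have "... = (\<Sum>b\<in>?C. dcoord a (transition M c d b) x * R b)"
   using T.dcoord_comp[OF D.G x a] by (simp add: R_def change_def)
  finally show ?thesis .
 qed
 have par_tr: "gs_parity (codd a) (change_mom M c d x a)" if a: "a \<in> ?C" for a
  unfolding change_mom_def coords_eq
 proof (rule gs_parity_sum)
  fix b assume b: "b \<in> ?C"
  have "gs_parity (codd b ~= codd a) (dcoord a (transition M c d b) x)"
   by (rule gs_parity_dcoord[OF open_overlap[OF c d] x a trans(2)[OF c d b]])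
  from gs_parity_mult[OF this mom_var_props(1)[of b]]
  show "gs_parity (codd a) (dcoord a (transition M c d b) x * mom_var b)" by (cases "codd b") auto
 qed
 have m1: "coeff (f * mom_var b) {#} = 0" for f b
  using gsord_mult[of "%_. True" 0 f 1 "mom_var b"] mom_var_props(2)[of b] by (simp add: gsord_UNIV_1[unfolded One_nat_def])
 have evc: "evok p q ?C (image_of M c) (coord_pt x) (change_mom M c d x)"
  by (rule evok_coord_pt[OF C.U xc par_tr]) (simp_all add: change_mom_def m1)
 have "sf_eval p (H c) (coord_pt x) (%a. dcoord a (G c) x) = msub ?t (sf_eval p (H c) (coord_pt x) (change_mom M c d x))"
 proof (rule msub_sf_eval[OF gt tp C.U finite_cs C.H evc, symmetric])
  fix a assume a: "a \<in> ?C"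
  have "msub ?t (dcoord a (transition M c d b) x) = dcoord a (transition M c d b) x" if b: "b \<in> ?C" for b
   by (rule id[OF SF_D(1)[OF SF_dcoord[OF open_overlap[OF c d] trans(1)[OF c d b] a] x]])
  then show "msub ?t (change_mom M c d x a) = dcoord a (G c) x"
   by (simp add: dG[OF a] change_mom_def coords_eq clin_sum[OF clin_msub[OF gt]] msub_mult[OF gt] mom_var_def msub_var[OF gt])
 qed (rule msub_coord_pt[OF gt])
 also have "... = msub ?t (sf_eval p (H d) ?X mom_var)" by (simp only: HD(6)[OF c d x])
 also have "... = sf_eval p (H d) ?X R"
 proof (rule msub_sf_eval[OF gt tp D.U finite_cs D.H evm])
  show "msub ?t (?X a) = ?X a" if "a \<in> ?C" for a
   using id[OF SF_D(1)[OF trans(1)[OF c d that] x]] by (simp add: change_def)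
 qed (simp add: mom_var_def msub_var[OF gt])
 also have "... = sf_eval p (D.comp (H d)) ?X mom_var"
  by (rule D.compose[OF D.H T.ev[OF x] _ R_def[symmetric], symmetric]) (rule sf_eval_coordinate[OF D.U finite.emptyI T.ev[OF x]])
 finally show ?thesis .
qed

lemma HJ_value: "c \<in> charts M ==> x \<in> image_of M c ==> HJ_field M H G c x = sf_eval p (H c) (coord_pt x) (%a. dcoord a (G c) x)"
 by (simp add: HJ_field_def)

lemma HJ_global:
 assumes G: "G \<in> formal_points M \<omega> (1 - k)"
 shows "HJ_field M H G \<in> global_functions M \<omega> True (2 - k)"
proof (rule globalI)
 note G' = formalD(1)[OF G]
 show "HJ_field M H G c x = 0" if "c \<notin> charts M | x \<notin> image_of M c" for c x
  using that by (auto simp: HJ_field_def)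
 fix c assume c: "c \<in> charts M"
 interpret hj p q "image_of M c" "H c" "G c" by (rule hj[OF G c])
 show "SF p q {} (image_of M c) (HJ_field M H G c)"
  by (rule SF_cong[OF U SF_comp[OF H]]) (simp add: HJ_value[OF c])
 show "gs_parity True (HJ_field M H G c x)" if x: "x \<in> image_of M c" for x
  unfolding HJ_value[OF c x] by (rule comp_parity[OF H H_par x])
 have "has_weight p (image_of M c) (cweight M c) (vweight (cweight M c) (%_. 0) \<omega>) (2 - k) (comp (H c))"
 proof (rule has_weight_comp[OF H HD(3)[OF c]])
  show "has_weight p (image_of M c) (cweight M c) (vweight (cweight M c) (%_. 0) \<omega>) (cweight M c b) (%x. coord_pt x b)"
   if "b \<in> cs p q" for b by (rule has_weight_coord_pt[OF that])
  show "has_weight p (image_of M c) (cweight M c) (vweight (cweight M c) (%_. 0) \<omega>) (1 - k - cweight M c b) (%x. dcoord b (G c) x)"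
   if "b \<in> cs p q" for b by (rule has_weight_dcoord[OF U SF_D(2)[OF G] globalD(3)[OF G' c] that])
 qed
 then show "has_weight p (image_of M c) (cweight M c) (vweight (cweight M c) (%_. 0) \<omega>) (2 - k) (HJ_field M H G c)"
  by (rule has_weight_cong[OF U]) (simp add: HJ_value[OF c])
 fix d x assume d: "d \<in> charts M" and x: "x \<in> overlap M c d"
 have xc: "x \<in> image_of M c" using x overlap_subset by blast
 interpret T: sfam p q "{}" "overlap M c d" p q "{}" "image_of M d" "change M c d" "%_. mom_var" by (rule sfam_change[OF c d])
 interpret D: hj p q "image_of M d" "H d" "G d" by (rule hj[OF assms d])
 show "HJ_field M H G c x = sf_eval p (HJ_field M H G d) (change M c d x) mom_var"
  unfolding HJ_value[OF c xc] HJ_chart[OF assms c d x]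
  by (rule sf_eval_cong[OF D.U evokD(6)[OF T.ev[OF x]] _ SF_D(1)[OF D.SF_comp[OF D.H]]]) (auto simp: HJ_value[OF d])
qed

lemma HJ_homological: "homological_field (1 - k) M (HJ_field M H)"
 unfolding homological_field_def
proof (intro allI ballI conjI impI)
 fix \<omega> G assume Gf: "G \<in> formal_points M \<omega> (1 - k)"
 show "HJ_field M H G \<in> global_functions M \<omega> True (1 - k + 1)" using HJ_global[OF Gf] by simp
 fix j
 show "HJ_field M H (shift j G (HJ_field M H G)) = HJ_field M H G"
 proof (intro ext)
  fix c x
  show "HJ_field M H (shift j G (HJ_field M H G)) c x = HJ_field M H G c x"
  proof (cases "c \<in> charts M & x \<in> image_of M c")
   case True
   then have c: "c \<in> charts M" and x: "x \<in> image_of M c" by auto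
   interpret hj p q "image_of M c" "H c" "G c" by (rule hj[OF Gf c])
   note V = globalD(1,2)[OF HJ_global[OF Gf] c]
   have d: "dcoord a (HJ_field M H G c) x = dcoord a (comp (H c)) x" if "a \<in> C" for a
    by (rule dcoord_cong[OF U x that]) (simp add: HJ_value[OF c])
   have "(\<Sum>a\<in>C. sgn_if (codd a) *\<^sub>R (dcoord a (HJ_field M H G c) x * comp (dmom a (H c)) x)) = 0"
    using HJ_square_zero[OF x HD(4)[OF c]] by (simp add: d)
   then show ?thesis
    using HJ_shift[OF x V, of j] by (simp add: HJ_value[OF c x] shift_def[abs_def])
  qed (simp only: HJ_field_def if_False)
 qed
qed

end

subsection \<open>Chart independence of the pullback\<close>

lemma dcoord_sum:
 assumes U: "eopen p U" and g: "!!i. i \<in> A ==> SF p q B U (g i)" and x: "x \<in> U" and a: "a \<in> cs p q'"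
 shows "dcoord a (%x. \<Sum>i\<in>A. g i x) x = (\<Sum>i\<in>A. dcoord a (g i) x)"
 using g
proof (induction A rule: infinite_finite_induct)
 case (insert i A)
 have "SF p q B U (%x. \<Sum>i\<in>A. g i x)" by (rule SF_sum[OF U]) (simp add: insert.prems)
 then show ?case using insert dcoord_add[OF U _ _ x a, of q B "g i" "%x. \<Sum>i\<in>A. g i x"] by simp
qed (simp_all add: dcoord_0)

lemma SF_subset: "SF p q B U g ==> V \<subseteq> U ==> SF p q B V g"
 unfolding SF_def superfun_def smooth_on_def by (meson subsetD continuous_map_from_subtopology_mono)

lemma gsord_mult_mom: "gsord is_mom n f ==> gsord is_mom (Suc n) (f * mom_var j)"
 using gsord_mult[of is_mom n f 1 "mom_var j"] gsord_own_var[of is_mom "Mom j"]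
 by (auto simp: mom_var_def is_mom_def)

lemma vderiv_gs_vars: "gs_vars V f ==> v \<notin> V ==> vderiv v f = 0"
 by (rule gs_eqI) (auto simp: coeff_vderiv gs_vars_def)

text \<open>No homogeneity of \<open>Y\<close> and \<open>Q\<close> is known here, so the argument works with congruences modulo powers
  of the momenta only.\<close>

lemma law_unique:
 assumes U1: "eopen p1 U1" "bodypt p1 X \<in> U1" and S: "SF p1 q1 (cs p2 q2) U1 S"
  and V: "eopen p2 V" "bodypt p2 Y' \<in> V" and t: "!!j. j \<in> cs p2 q2 ==> SF p2 q2 {} V (t j)"
  and Y: "!!i. i \<in> cs p2 q2 ==> Y i = psign i * sf_eval p1 (dmom i S) X Q"
  and Q: "!!i. i \<in> cs p2 q2 ==> Q i = (\<Sum>j\<in>cs p2 q2. sf_eval p2 (dcoord i (t j)) Y mom_var * mom_var j)"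
  and Y': "!!i. i \<in> cs p2 q2 ==> Y' i = psign i * sf_eval p1 (dmom i S) X Q'"
  and Q': "!!i. i \<in> cs p2 q2 ==> Q' i = (\<Sum>j\<in>cs p2 q2. sf_eval p2 (dcoord i (t j)) Y' mom_var * mom_var j)"
  and i: "i \<in> cs p2 q2"
 shows "Q i = Q' i" "Y i = Y' i"
proof -
 have YY: "gsord is_mom n (Y i - Y' i)" if n: "!!i. i \<in> cs p2 q2 ==> gsord is_mom n (Q i - Q' i)" and i: "i \<in> cs p2 q2" for n i
 proof -
  have "gsord is_mom n (sf_eval p1 (dmom i S) X Q - sf_eval p1 (dmom i S) X Q')"
  proof (rule sf_eval_gsord_cong[OF refl, where V = "svars q1 (cs p2 q2)" and U = U1])
   show "gsord is_mom n (subst_var X Q v - subst_var X Q' v)" if "v \<in> svars q1 (cs p2 q2)" for v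
    using that n by (cases v) (auto simp: svars_def)
   show "gs_vars (svars q1 (cs p2 q2)) (dmom i S y)" if "y \<in> U1" for y by (rule SF_D(1)[OF SF_dmom[OF U1(1) S] that])
  qed (auto simp: U1)
  from gsord_psign[OF this] show ?thesis unfolding Y[OF i] Y'[OF i] right_diff_distrib .
 qed
 \<comment> \<open>Both are linear combinations of momenta, so their difference has order 1 from the
   start; this in turn equates the bodies of \<open>Y\<close> and \<open>Y'\<close>.\<close>
 have 1: "gsord is_mom 1 (Q i - Q' i)" if "i \<in> cs p2 q2" for i
  unfolding Q[OF that] Q'[OF that] sum_subtractf[symmetric] left_diff_distrib[symmetric] One_nat_def
  by (intro gsord_sum gsord_mult_mom) simp
 have b: "bodypt p2 Y = bodypt p2 Y'"
 proof (rule bodypt_eq)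
  fix i assume "i < p2"
  then have "coeff (Y (Ev i) - Y' (Ev i)) {#} = 0" by (intro gsord_1_empty[OF YY[OF 1]]) simp_all
  then show "body (Y (Ev i)) = body (Y' (Ev i))" by (simp add: body_def)
 qed
 have n: "ALL i:cs p2 q2. gsord is_mom n (Q i - Q' i)" for n
 proof (induction n)
  case (Suc n)
  show ?case
  proof
   fix i assume i: "i \<in> cs p2 q2"
   have "gsord is_mom n (sf_eval p2 (dcoord i (t j)) Y mom_var - sf_eval p2 (dcoord i (t j)) Y' mom_var)" if j: "j \<in> cs p2 q2" for j
   proof (rule sf_eval_gsord_cong[OF b, where V = "svars q2 {}" and U = V])
    show "gsord is_mom n (Y (Ev i) - Y' (Ev i))" if "i < p2" for i by (rule YY) (use Suc that in auto)
    show "gsord is_mom n (subst_var Y mom_var v - subst_var Y' mom_var v)" if "v \<in> svars q2 {}" for v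
     using that YY Suc by (cases v) (auto simp: svars_def)
    show "gs_vars (svars q2 {}) (dcoord i (t j) y)" if "y \<in> V" for y by (rule SF_D(1)[OF SF_dcoord[OF V(1) t[OF j] i] that])
   qed (auto simp: V b)
   then show "gsord is_mom (Suc n) (Q i - Q' i)"
    unfolding Q[OF i] Q'[OF i] sum_subtractf[symmetric] left_diff_distrib[symmetric]
    by (intro gsord_sum gsord_mult_mom)
  qed
 qed simp
 show "Q i = Q' i" using n i by (intro gsord_eqI) blast
 show "Y i = Y' i" by (rule gsord_eqI, rule YY) (use n i in auto)
qed

text \<open>Primes mark the new charts; \<open>X\<close> expresses the old source coordinates by the
  new ones and \<open>t\<close> the new target coordinates by the old ones. The comparison runs
  through \<open>\<Sigma>\<close>, which is \<open>S\<close> in the new source coordinates: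
  \<open>L\<close> pulls back \<open>gL\<close>, the generating function of \<open>t\<close>, along
  it, and \<open>R\<close> pulls back \<open>g\<close> along it.\<close>

locale chg =
 fixes p1 q1 p2 q2 :: nat and U1 O' U2 V U2' :: "pt set" and S S' g g' :: "pt => gs"
  and X t :: "pt => coord => gs"
 assumes P: "pb p1 q1 U1 p2 q2 U2 S g is_par {}" and P': "pb p1 q1 O' p2 q2 U2' S' g' is_par {}"
  and X: "!!B. finite B ==> sfam p1 q1 B O' p1 q1 B U1 X (%_. mom_var)" and X0: "!!a. a \<in> cs p1 q1 ==> SF p1 q1 {} O' (%x. X x a)"
  and t: "sfam p2 q2 {} V p2 q2 {} U2' t (%_. mom_var)"
  and tp: "!!j y. j \<in> cs p2 q2 ==> y \<in> V ==> gs_parity (codd j) (t y j)"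
  and VU: "V \<subseteq> U2" and gg: "!!y. y \<in> V ==> g y = sf_eval p2 g' (t y) mom_var"
  and phiV: "!!x. x \<in> O' ==> phib p1 p2 S (X x) \<in> V"
  and law: "!!x. x \<in> O' ==> EX Y Q. (ALL i:cs p2 q2. Y i = psign i * sf_eval p1 (dmom i S) (X x) Q) &
   (ALL i:cs p2 q2. Q i = (\<Sum>j\<in>cs p2 q2. sf_eval p2 (dcoord i (%y. t y j)) Y mom_var * mom_var j)) &
   S' x = sf_eval p1 S (X x) Q - (\<Sum>i\<in>cs p2 q2. Y i * Q i) + (\<Sum>j\<in>cs p2 q2. sf_eval p2 (%y. t y j) Y mom_var * mom_var j)"
begin

sublocale P: pb p1 q1 U1 p2 q2 U2 S g is_par "{}" by (rule P)
sublocale P': pb p1 q1 O' p2 q2 U2' S' g' is_par "{}" by (rule P')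
sublocale T: sfam p2 q2 "{}" V p2 q2 "{}" U2' t "%_. mom_var" by (rule t)

abbreviation C2 :: "coord set" where "C2 \<equiv> cs p2 q2"

sublocale X: sfam p1 q1 C2 O' p1 q1 C2 U1 X "%_. mom_var" by (rule X) simp

definition \<Sigma> :: "pt => gs" where "\<Sigma> x = sf_eval p1 S (X x) mom_var"

definition gL :: "pt => gs" where "gL y = (\<Sum>j\<in>C2. t y j * mom_var j)"

lemma SF_\<Sigma>: "SF p1 q1 C2 O' \<Sigma>"
 using X.SF_comp[OF P.S] by (simp add: \<Sigma>_def[abs_def])

lemma eval_X:
 assumes g: "SF p1 q1 C2 U1 f" and x: "x \<in> O'" and Q: "!!i. i \<in> C2 ==> gs_parity (codd i) (Q i)" "!!i. i \<in> C2 ==> coeff (Q i) {#} = 0"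
 shows "sf_eval p1 (X.comp f) (coord_pt x) Q = sf_eval p1 f (X x) Q"
proof -
 have e: "evok p1 q1 C2 O' (coord_pt x) Q" by (rule evok_coord_pt[OF P'.U1 x Q])
 show ?thesis
 proof (rule X.compose[OF g e])
  show "sf_eval p1 (%x. X x a) (coord_pt x) Q = X x a" if "a \<in> cs p1 q1" for a
   using sf_eval_coord_pt[OF P'.U1 finite_cs SF_mono[OF X0[OF that]] x Q]
    msub_xi_par[OF finite_cs Q SF_D(1)[OF X0[OF that] x]] by simp
 qed (rule sf_eval_mom_var[OF P'.U1 finite_cs e])
qed

lemma dmom_\<Sigma>: "x \<in> O' ==> dmom i \<Sigma> x = (if i \<in> C2 then sf_eval p1 (dmom i S) (X x) mom_var else 0)"
proof -
 assume x: "x \<in> O'"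
 have "dmom i (%x. X x b) x = 0" if b: "b \<in> cs p1 q1" for b
  unfolding dmom_eq by (rule vderiv_gs_vars[OF SF_D(1)[OF X0[OF b] x]]) (auto simp: svars_def)
 then have "dmom i (X.comp S) x = (\<Sum>b\<in>C2. if b = i then X.comp (dmom i S) x else 0)"
  unfolding X.dmom_comp[OF P.S x] by (simp add: dmom_mom_var if_distrib[of "%u. u * _"] cong: if_cong)
 then show ?thesis by (simp add: \<Sigma>_def[abs_def] sum.delta)
qed

lemma eval_\<Sigma>:
 assumes x: "x \<in> O'" and Q: "!!i. i \<in> C2 ==> gs_parity (codd i) (Q i)" "!!i. i \<in> C2 ==> coeff (Q i) {#} = 0"
 shows "sf_eval p1 \<Sigma> (coord_pt x) Q = sf_eval p1 S (X x) Q"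
  "i \<in> C2 ==> sf_eval p1 (dmom i \<Sigma>) (coord_pt x) Q = sf_eval p1 (dmom i S) (X x) Q"
proof -
 show "sf_eval p1 \<Sigma> (coord_pt x) Q = sf_eval p1 S (X x) Q"
  using eval_X[OF P.S assms] by (simp add: \<Sigma>_def[abs_def])
 assume i: "i \<in> C2"
 have "sf_eval p1 (dmom i \<Sigma>) (coord_pt x) Q = sf_eval p1 (%x. sf_eval p1 (dmom i S) (X x) mom_var) (coord_pt x) Q"
  by (rule sf_eval_cong[OF P'.U1 _ _ SF_D(1)[OF SF_dmom[OF P'.U1 SF_\<Sigma>]]])
   (use bodypt_coord_pt[OF P'.U1 x] x i in \<open>auto simp: dmom_\<Sigma>\<close>)
 then show "sf_eval p1 (dmom i \<Sigma>) (coord_pt x) Q = sf_eval p1 (dmom i S) (X x) Q"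
  using eval_X[OF P.SFd assms] by simp
qed

lemma \<Sigma>_par: "x \<in> O' ==> gs_parity False (\<Sigma> x)"
 unfolding \<Sigma>_def by (rule gs_parity_sf_eval[OF P.U1 _ X.ev P.S P.S_par]) simp_all

lemma body_\<Sigma>: "x \<in> O' ==> phib p1 p2 \<Sigma> (coord_pt x) \<in> V"
proof -
 assume x: "x \<in> O'"
 have "phib p1 p2 \<Sigma> (coord_pt x) = phib p1 p2 S (X x)"
  by (rule bodypt_eq) (simp add: eval_\<Sigma>(2)[OF x])
 then show ?thesis using phiV[OF x] by simp
qed

lemma tj: "j \<in> C2 ==> SF p2 q2 B V (%y. t y j)"
 by (rule SF_mono[where B = "{}"], rule T.SFY) simp_all

lemma SF_mom2: "j \<in> C2 ==> SF p2 q2 C2 V (%x. mom_var j)"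
 by (rule SF_const[OF T.U1]) (auto simp: mom_var_def svars_def intro: gs_vars_var)

lemma SF_gL: "SF p2 q2 C2 V gL"
 unfolding gL_def[abs_def] by (intro SF_sum[OF T.U1] SF_mult[OF T.U1] tj SF_mom2)

sublocale L: pb p1 q1 O' p2 q2 V \<Sigma> gL is_mom C2
proof
 show "gs_parity False (gL y)" if "y \<in> V" for y
  unfolding gL_def
 proof (rule gs_parity_sum)
  fix j assume "j \<in> C2"
  from gs_parity_mult[OF tp[OF this that] mom_var_props(1)[of j]] show "gs_parity False (t y j * mom_var j)" by simp
 qed
 show "gsord is_mom 1 (gL y)" for y
  unfolding gL_def One_nat_def by (intro gsord_sum gsord_mult_mom) simp
 show "EX a. v = Mom a | is_par v" if "is_mom v" for v using that by (auto simp: is_mom_def)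
qed (auto simp: P'.U1 T.U1 SF_gL SF_\<Sigma> \<Sigma>_par body_\<Sigma>)

sublocale R: pb p1 q1 O' p2 q2 V \<Sigma> g is_par "{}"
proof
 show "SF p2 q2 {} V g" by (rule SF_subset[OF P.g VU])
qed (use VU in \<open>auto simp: P'.U1 T.U1 SF_\<Sigma> \<Sigma>_par body_\<Sigma> P.g_par P.g1[unfolded One_nat_def] is_par_def\<close>)

lemma dcoord_gL:
 assumes "i \<in> C2" "y \<in> V"
 shows "dcoord i gL y = (\<Sum>j\<in>C2. dcoord i (%y. t y j) y * mom_var j)"
proof -
 have "dcoord i gL y = (\<Sum>j\<in>C2. dcoord i (%y. t y j * mom_var j) y)"
  unfolding gL_def[abs_def] by (rule dcoord_sum[OF T.U1 _ assms(2,1)]) (rule SF_mult[OF T.U1 tj SF_mom2])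
 also have "... = (\<Sum>j\<in>C2. dcoord i (%y. t y j) y * mom_var j)"
 proof (intro sum.cong refl)
  fix j assume j: "j \<in> C2"
  have "dcoord i (%_. mom_var j) y = 0" unfolding mom_var_def by (rule dcoord_const) simp
  then show "dcoord i (%y. t y j * mom_var j) y = dcoord i (%y. t y j) y * mom_var j"
   using dcoord_mult[OF T.U1 tj[OF j] SF_mom2[OF j] assms(2,1) tp[OF j assms(2)]] by simp
 qed
 finally show ?thesis .
qed

lemma eval_dgL:
 assumes e: "evok p2 q2 C2 V Y Q"
 shows "i \<in> C2 ==> sf_eval p2 (dcoord i gL) Y Q = (\<Sum>j\<in>C2. sf_eval p2 (dcoord i (%y. t y j)) Y mom_var * Q j)"
  "sf_eval p2 gL Y Q = (\<Sum>j\<in>C2. sf_eval p2 (%y. t y j) Y mom_var * Q j)"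
proof -
 have *: "sf_eval p2 (%y. \<Sum>j\<in>C2. f j y * mom_var j) Y Q = (\<Sum>j\<in>C2. sf_eval p2 (f j) Y mom_var * Q j)"
  if f: "!!j. j \<in> C2 ==> SF p2 q2 {} V (f j)" for f
 proof -
  have f': "SF p2 q2 C2 V (f j)" if "j \<in> C2" for j by (rule SF_mono[OF f[OF that]]) simp
  have "sf_eval p2 (f j) Y Q = sf_eval p2 (f j) Y mom_var" if "j \<in> C2" for j
   by (rule sf_eval_eqI[OF T.U1 f[OF that] evokD(6)[OF e]]) simp_all
  then show ?thesis
   by (subst sf_eval_sum[OF T.U1 finite_cs e SF_mult[OF T.U1 f' SF_mom2]])
    (simp_all add: sf_eval_mult'[OF T.U1 finite_cs e f' SF_mom2] sf_eval_mom_var[OF T.U1 finite_cs e])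
 qed
 show "sf_eval p2 (dcoord i gL) Y Q = (\<Sum>j\<in>C2. sf_eval p2 (dcoord i (%y. t y j)) Y mom_var * Q j)" if i: "i \<in> C2"
 proof -
 have "sf_eval p2 (dcoord i gL) Y Q = sf_eval p2 (%y. \<Sum>j\<in>C2. dcoord i (%y. t y j) y * mom_var j) Y Q"
  by (rule sf_eval_cong[OF T.U1 evokD(6)[OF e] _ SF_D(1)[OF SF_dcoord[OF T.U1 SF_gL i]]])
   (simp_all add: dcoord_gL i)
 then show ?thesis using *[OF SF_dcoord[OF T.U1 tj i]] by simp
 qed
 show "sf_eval p2 gL Y Q = (\<Sum>j\<in>C2. sf_eval p2 (%y. t y j) Y mom_var * Q j)"
  unfolding gL_def[abs_def] by (rule *[OF tj])
qed

text \<open>The equations in \<open>law\<close> and those solved by \<open>L\<close> are the same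
  once the source coordinates are changed, so \<open>law_unique\<close> identifies their
  solutions.\<close>

lemma S'_eq:
 assumes x: "x \<in> O'"
 shows "S' x = L.val x"
proof -
 obtain Y Q where Y: "!!i. i \<in> C2 ==> Y i = psign i * sf_eval p1 (dmom i S) (X x) Q"
  and Q: "!!i. i \<in> C2 ==> Q i = (\<Sum>j\<in>C2. sf_eval p2 (dcoord i (%y. t y j)) Y mom_var * mom_var j)"
  and S': "S' x = sf_eval p1 S (X x) Q - (\<Sum>i\<in>C2. Y i * Q i) + (\<Sum>j\<in>C2. sf_eval p2 (%y. t y j) Y mom_var * mom_var j)"
  using law[OF x] by blast
 note Qp = L.Qs_parity[OF x] gsord_1_empty[OF L.Qs_par[OF x]]
 note ev = L.evok_Ys[OF x]
 have L: "L.Ys x i = psign i * sf_eval p1 (dmom i S) (X x) (L.Qs x)"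
  "L.Qs x i = (\<Sum>j\<in>C2. sf_eval p2 (dcoord i (%y. t y j)) (L.Ys x) mom_var * mom_var j)" if i: "i \<in> C2" for i
  using L.Qs_eq[OF x i] eval_dgL(1)[OF ev i] by (simp_all add: L.Yof_def eval_\<Sigma>(2)[OF x Qp i])
 note QY = law_unique[OF P.U1 evokD(6)[OF X.ev[OF x]] P.S T.U1 evokD(6)[OF ev] tj Y Q L]
 have "sf_eval p1 S (X x) Q = sf_eval p1 S (X x) (L.Qs x)"
  by (rule sf_eval_eqI[OF P.U1 P.S evokD(6)[OF X.ev[OF x]] refl QY(1)])
 moreover have "sf_eval p2 (%y. t y j) Y mom_var = sf_eval p2 (%y. t y j) (L.Ys x) mom_var" if "j \<in> C2" for j
 proof (rule sf_eval_eqI[OF T.U1 tj[OF that, of "{}"] _ QY(2)])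
  show "bodypt p2 Y \<in> V" using evokD(6)[OF ev] bodypt_eq[of p2 Y "L.Ys x"] QY by simp
 qed auto
 ultimately show ?thesis
  unfolding S' L.val_def using QY by (simp add: eval_\<Sigma>(1)[OF x Qp] eval_dgL(2)[OF ev])
qed

text \<open>Relations are composed: the solution of \<open>L\<close>, with its spectator momenta
  replaced by the momenta that solve the primed problem, solves the equations of \<open>R\<close>.
  In the values the products of primed coordinates and momenta cancel.\<close>

lemma val'_eq:
 assumes x: "x \<in> O'"
 shows "P'.val x = R.val x"
proof -
 let ?Q = "P'.Qs x" and ?Y = "P'.Ys x"
 note Qp = P'.Qs_parity[OF x] gsord_1_empty[OF P'.Qs_par[OF x]]
 let ?t = "psub C2 ?Q"
 have gt: "good ?t" by (rule good_psub[OF finite_cs Qp])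
 have tP: "?t (Par b n) = gs_var (Par b n)" for b n by simp
 define Y0 Q0 where "Y0 = msub ?t \<circ> L.Ys x" and "Q0 = msub ?t \<circ> L.Qs x"
 have mYQ: "msub ?t (L.Ys x i) = Y0 i" "msub ?t (L.Qs x i) = Q0 i" for i by (simp_all add: Y0_def Q0_def)
 have Q0p: "gs_parity (codd i) (Q0 i)" "coeff (Q0 i) {#} = 0" if "i \<in> C2" for i
  using gs_parity_msub[OF gt L.Qs_parity[OF x that]] gsord_1_empty[OF L.Qs_par[OF x, of i]]
  by (simp_all add: Q0_def coeff_msub_empty[OF gt])
 have mS: "msub ?t (sf_eval p1 f (coord_pt x) (L.Qs x)) = sf_eval p1 f (coord_pt x) Q0" if "SF p1 q1 C2 O' f" for f
  by (rule msub_sf_eval[OF gt tP P'.U1 finite_cs that L.evok_Qs[OF x]]) (simp_all add: msub_coord_pt[OF gt] Q0_def)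
 have eQ: "evok p2 q2 C2 V Y0 ?Q"
  using evok_msub[OF gt L.evok_Ys[OF x]] by (simp add: evok_def Y0_def Qp)
 have em: "evok p2 q2 {} V Y0 mom_var" using eQ by (simp add: evok_def)
 have mV: "msub ?t (sf_eval p2 f (L.Ys x) mom_var) = sf_eval p2 f Y0 ?Q" if f: "SF p2 q2 C2 V f" for f
  by (rule msub_sf_eval[OF gt tP T.U1 finite_cs f L.evok_Ys[OF x]]) (simp_all add: Y0_def mom_var_def msub_var[OF gt])
 have Y0: "Y0 i = psign i * sf_eval p1 (dmom i \<Sigma>) (coord_pt x) Q0" for i
  by (simp add: Y0_def L.Yof_def psign_mult(2) clin_uminus[OF clin_msub[OF gt]] mS[OF L.SFd])
 \<comment> \<open>The primed \<open>y\<close> is a momentum derivative of \<open>S'\<close>, that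
   is of \<open>L.val\<close>; by \<open>dmom_val\<close> only the explicit momenta of
   \<open>gL\<close> are differentiated, which leaves \<open>t\<close>.\<close>
 have tY: "?Y j = sf_eval p2 (%y. t y j) Y0 mom_var" if j: "j \<in> C2" for j
 proof -
  have "dmom j S' x = dmom j L.val x" by (simp add: dmom_eq S'_eq[OF x])
  also have "... = sf_eval p2 (dmom j gL) (L.Ys x) mom_var" by (rule L.dmom_val[OF x j])
  also have "... = sf_eval p2 (%y. (if codd j then - 1 else 1) *\<^sub>R t y j) (L.Ys x) mom_var"
  proof (rule sf_eval_cong[OF T.U1 evokD(6)[OF L.evok_Ys[OF x]] _ SF_D(1)[OF SF_dmom[OF T.U1 SF_gL]]])
   fix y assume y: "y \<in> V"
   have z: "vderiv (Mom j) (t y i) = 0" if "i \<in> C2" for i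
    by (rule vderiv_gs_vars[OF SF_D(1)[OF tj[OF that, of "{}"] y]]) (auto simp: svars_def)
   have "dmom j gL y = (\<Sum>i\<in>C2. vderiv (Mom j) (t y i * mom_var i))"
    by (simp add: dmom_eq gL_def clin_sum[OF clin_vderiv])
   also have "... = (\<Sum>i\<in>C2. if i = j then (if codd j then - 1 else 1) *\<^sub>R t y j else 0)"
   proof (intro sum.cong refl)
    fix i assume i: "i \<in> C2"
    show "vderiv (Mom j) (t y i * mom_var i) = (if i = j then (if codd j then - 1 else 1) *\<^sub>R t y j else 0)"
     using vderiv_mult[OF tp[OF i y], of "Mom j" "mom_var i"] dmom_mom_var[of j i] by (auto simp: z[OF i] dmom_eq sgn_if_def)
   qed
   finally show "dmom j gL y = (if codd j then - 1 else 1) *\<^sub>R t y j" using j by (simp add: sum.delta)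
  qed auto
  also have "... = (if codd j then - 1 else 1) *\<^sub>R sf_eval p2 (%y. t y j) (L.Ys x) mom_var"
   by (rule sf_eval_scaleR[OF T.U1 finite_cs L.evok_Ys[OF x] tj[OF j]])
  finally have "psign j * dmom j S' x = sf_eval p2 (%y. t y j) (L.Ys x) mom_var" by (simp add: psign_def)
  moreover have "?Y j = msub ?t (psign j * dmom j S' x)"
   by (simp add: P'.Yof_def sf_eval_coord_pt[OF P'.U1 finite_cs P'.SFd x Qp] psign_mult(2) clin_uminus[OF clin_msub[OF gt]])
  ultimately have "?Y j = sf_eval p2 (%y. t y j) Y0 ?Q" using mV[OF tj[OF j]] by simp
  also have "... = sf_eval p2 (%y. t y j) Y0 mom_var"
   by (rule sf_eval_eqI[OF T.U1 tj[OF j, of "{}"] evokD(6)[OF eQ]]) simp_all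
  finally show ?thesis .
 qed
 have eT: "sf_eval p2 (T.comp f) Y0 mom_var = sf_eval p2 f ?Y mom_var" if f: "SF p2 q2 {} U2' f" for f
  by (rule T.compose[OF f em]) (simp_all add: tY)
 \<comment> \<open>Since \<open>g\<close> is the composite of \<open>g'\<close> with
   \<open>t\<close>, the chain rule converts the primed momenta into the derivatives of
   \<open>g\<close>, as the second equation for \<open>R\<close> demands.\<close>
 have dg: "sf_eval p2 (dcoord i g) Y0 mom_var = (\<Sum>j\<in>C2. sf_eval p2 (dcoord i (%y. t y j)) Y0 mom_var * ?Q j)" if i: "i \<in> C2" for i
 proof -
  have SFd: "SF p2 q2 {} V (dcoord i (%y. t y j))" "SF p2 q2 {} V (T.comp (dcoord j g'))" if "j \<in> C2" for j
   by (rule SF_dcoord[OF T.U1 tj[OF that] i], rule T.SF_comp[OF SF_dcoord[OF P'.U2 P'.g that]])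
  have "dcoord i g y = (\<Sum>j\<in>C2. dcoord i (%y. t y j) y * T.comp (dcoord j g') y)" if y: "y \<in> V" for y
   using dcoord_cong[OF T.U1 y i gg] T.dcoord_comp[OF P'.g y i] by simp
  then have "sf_eval p2 (dcoord i g) Y0 mom_var
    = sf_eval p2 (%y. \<Sum>j\<in>C2. dcoord i (%y. t y j) y * T.comp (dcoord j g') y) Y0 mom_var"
   by (intro sf_eval_cong[OF T.U1 evokD(6)[OF eQ] _ SF_D(1)[OF SF_dcoord[OF T.U1 R.g i]]]) auto
  also have "... = (\<Sum>j\<in>C2. sf_eval p2 (dcoord i (%y. t y j)) Y0 mom_var * sf_eval p2 (T.comp (dcoord j g')) Y0 mom_var)"
   by (subst sf_eval_sum[OF T.U1 _ em SF_mult[OF T.U1 SFd]]) (simp_all add: sf_eval_mult'[OF T.U1 _ em SFd])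
  also have "... = (\<Sum>j\<in>C2. sf_eval p2 (dcoord i (%y. t y j)) Y0 mom_var * ?Q j)"
   by (intro sum.cong refl) (simp add: eT[OF SF_dcoord[OF P'.U2 P'.g]] P'.Qs_eq[OF x])
  finally show ?thesis .
 qed
 have Q0: "Q0 i = sf_eval p2 (dcoord i g) Y0 mom_var" if i: "i \<in> C2" for i
  using mV[OF SF_dcoord[OF T.U1 SF_gL i]] L.Qs_eq[OF x i] eval_dgL(1)[OF eQ i] dg[OF i] by (simp add: Q0_def)
 have "R.val x = sf_eval p2 g Y0 mom_var + sf_eval p1 \<Sigma> (coord_pt x) Q0 - (\<Sum>i\<in>C2. Y0 i * Q0 i)"
  by (rule R.solution_unique(3)[OF x Y0 Q0, symmetric])
 moreover have "sf_eval p2 g Y0 mom_var = sf_eval p2 g' ?Y mom_var"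
  using eT[OF P'.g] sf_eval_cong[OF T.U1 evokD(6)[OF eQ] gg SF_D(1)[OF R.g]] by simp
 moreover have "sf_eval p1 S' (coord_pt x) ?Q = msub ?t (L.val x)"
  by (simp add: sf_eval_coord_pt[OF P'.U1 finite_cs P'.S x Qp] S'_eq[OF x])
 moreover have "msub ?t (L.val x) = (\<Sum>j\<in>C2. ?Y j * ?Q j) + sf_eval p1 \<Sigma> (coord_pt x) Q0 - (\<Sum>i\<in>C2. Y0 i * Q0 i)"
  unfolding L.val_def clin_diff[OF clin_msub[OF gt]] clin_add[OF clin_msub[OF gt]] clin_sum[OF clin_msub[OF gt]] msub_mult[OF gt]
  by (simp add: mV[OF SF_gL] mS[OF SF_\<Sigma>] eval_dgL(2)[OF eQ] tY mYQ)
 ultimately show ?thesis by (simp add: P'.val_def)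
qed

text \<open>By \<open>compose\<close>, evaluating the solution for \<open>S\<close> at
  \<open>X x\<close> gives a solution of the equations for \<open>\<Sigma>\<close> at
  \<open>x\<close>; uniqueness identifies it with that of \<open>R\<close>.\<close>

lemma val_eq:
 assumes x: "x \<in> O'"
 shows "R.val x = sf_eval p1 P.val (X x) mom_var"
proof -
 interpret E: sfam p1 q1 "{}" O' p1 q1 "{}" U1 X "%_. mom_var" by (rule X) simp
 let ?ev = "%f. sf_eval p1 f (X x) mom_var"
 note e = E.ev[OF x]
 define Y1 Q1 where "Y1 i = ?ev (%x. P.Ys x i)" and "Q1 i = ?ev (%x. P.Qs x i)" for i
 have Q1p: "gs_parity (codd i) (Q1 i)" "coeff (Q1 i) {#} = 0" if i: "i \<in> C2" for i
  unfolding Q1_def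
  by (rule gs_parity_sf_eval[OF P.U1 _ e P.SF_Qs[OF i] P.Qs_parity[OF _ i]], simp, assumption)
   (simp add: coeff_sf_eval_empty[OF P.U1 _ e P.SF_Qs[OF i]] gsord_1_empty[OF P.Qs_par[OF evokD(6)[OF e]]])
 have eS: "?ev (P.s.comp f) = sf_eval p1 f (X x) Q1" if f: "SF p1 q1 C2 U1 f" for f
  by (rule P.s.compose[OF f e _ Q1_def[symmetric]]) (rule sf_eval_coordinate[OF P.U1 finite.emptyI e])
 have eY: "?ev (P.y.comp f) = sf_eval p2 f Y1 mom_var" if f: "SF p2 q2 {} U2 f" for f
  by (rule P.y.compose[OF f e Y1_def[symmetric]]) simp
 have Y1: "Y1 i = psign i * sf_eval p1 (dmom i \<Sigma>) (coord_pt x) Q1" if i: "i \<in> C2" for i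
 proof -
  have "Y1 i = ?ev (%x. (if codd i then - 1 else 1) *\<^sub>R P.s.comp (dmom i S) x)"
   by (simp add: Y1_def P.Yof_def psign_def)
  also have "... = psign i * ?ev (P.s.comp (dmom i S))"
   using sf_eval_scaleR[OF P.U1 _ e P.s.SF_comp[OF P.SFd], of "if codd i then - 1 else 1" i] by (simp add: psign_def split: if_splits)
  finally show ?thesis by (simp add: eS[OF P.SFd] eval_\<Sigma>(2)[OF x Q1p i])
 qed
 have Q1: "Q1 i = sf_eval p2 (dcoord i g) Y1 mom_var" if i: "i \<in> C2" for i
 proof -
  have "Q1 i = ?ev (P.y.comp (dcoord i g))" unfolding Q1_def
   by (rule sf_eval_cong[OF P.U1 evokD(6)[OF e] P.Qs_eq[OF _ i] SF_D(1)[OF P.SF_Qs[OF i]]]) simp_all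
  then show ?thesis by (simp add: eY[OF SF_dcoord[OF P.U2 P.g i]])
 qed
 have sYQ: "?ev (%x. \<Sum>i\<in>C2. P.Ys x i * P.Qs x i) = (\<Sum>i\<in>C2. Y1 i * Q1 i)"
  unfolding Y1_def Q1_def
  by (subst sf_eval_sum[OF P.U1 _ e P.YQ]) (simp_all add: sf_eval_mult'[OF P.U1 _ e P.SF_Ys P.SF_Qs])
 have SFs: "SF p1 q1 {} U1 (%x. \<Sum>i\<in>C2. P.Ys x i * P.Qs x i)" by (rule SF_sum[OF P.U1 P.YQ])
 have "?ev (%x. P.val x + (\<Sum>i\<in>C2. P.Ys x i * P.Qs x i)) = ?ev P.val + (\<Sum>i\<in>C2. Y1 i * Q1 i)"
  using sf_eval_add[OF P.U1 _ e P.SF_val SFs] sYQ by simp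
 moreover have "?ev (%x. P.val x + (\<Sum>i\<in>C2. P.Ys x i * P.Qs x i)) = sf_eval p2 g Y1 mom_var + sf_eval p1 \<Sigma> (coord_pt x) Q1"
  using sf_eval_add[OF P.U1 _ e P.y.SF_comp[OF P.g] P.s.SF_comp[OF P.S]]
  by (simp add: P.val_def eS[OF P.S] eY[OF P.g] eval_\<Sigma>(1)[OF x Q1p])
 ultimately have "?ev P.val = sf_eval p2 g Y1 mom_var + sf_eval p1 \<Sigma> (coord_pt x) Q1 - (\<Sum>i\<in>C2. Y1 i * Q1 i)" by simp
 then show ?thesis using R.solution_unique(3)[OF x Y1 Q1] by simp
qed

end

subsection \<open>The pullback of functions\<close>

lemma smooth_local:
 assumes "!!x. x \<in> U ==> EX V. eopen p V & x \<in> V & V \<subseteq> U & smooth_on p V h"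
 shows "smooth_on p U h"
 unfolding smooth_on_def
proof (intro ballI conjI allI impI)
 fix l assume l: "l \<in> lists {..<p}"
 let ?I = "{V. eopen p V & V \<subseteq> U & smooth_on p V h}"
 show "pcont p U (foldr rpd l h)"
 proof (rule pasting_lemma[where I = ?I and T = "%V. V" and f = "%_. foldr rpd l h"])
  show "openin (subtopology (Euclidean_space p) U) V" if "V \<in> ?I" for V
   using that unfolding openin_subtopology by blast
  show "continuous_map (subtopology (subtopology (Euclidean_space p) U) V) euclideanreal (foldr rpd l h)" if V: "V \<in> ?I" for V
  proof -
   have "subtopology (subtopology (Euclidean_space p) U) V = subtopology (Euclidean_space p) V"
    using V by (simp add: subtopology_subtopology Int_absorb1)
   then show ?thesis using V l by (simp add: smooth_on_def)
  qed
  show "EX j. j \<in> ?I & x \<in> j & foldr rpd l h x = foldr rpd l h x" if "x \<in> topspace (subtopology (Euclidean_space p) U)" for x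
   using assms[of x] that by auto
 qed simp
 fix i x assume "i < p" "x \<in> U"
 then show "(%t. foldr rpd l h (x(i := t))) differentiable at (x i)"
  using assms[of x] l unfolding smooth_on_def by blast
qed

lemma SF_local:
 assumes "!!x. x \<in> U ==> EX V. eopen p V & x \<in> V & V \<subseteq> U & SF p q B V f"
 shows "SF p q B U f"
 unfolding SF_altdef sfn_def
proof (intro conjI ballI allI)
 fix m show "smooth_on p U (%x. coeff (f x) m)"
 proof (rule smooth_local)
  fix x assume "x \<in> U"
  then obtain V where V: "eopen p V" "x \<in> V" "V \<subseteq> U" "SF p q B V f" using assms by blast
  from SF_D(2)[OF V(4)] have "smooth_on p V (%x. coeff (f x) m)" by (simp add: sfn_def)
  then show "EX V. eopen p V & x \<in> V & V \<subseteq> U & smooth_on p V (%x. coeff (f x) m)" using V by blast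
 qed
next
 fix x assume "x \<in> U"
 then obtain V where V: "x \<in> V" "SF p q B V f" using assms by blast
 show "gs_vars (svars q B) (f x)" by (rule SF_D(1)[OF V(2,1)])
qed

section \<open>Gluing the local pullbacks\<close>

locale thk = A: gman M1 + B: gman M2 for M1 :: "('m, 'c) atlas" and M2 :: "('n, 'd) atlas" +
 fixes s :: int and \<Phi> :: "('m, 'c, 'n, 'd) thick"
 assumes \<Phi>: "thick_morphism s M1 M2 \<Phi>"
begin

abbreviation p1 :: nat where "p1 \<equiv> edim M1"
abbreviation q1 :: nat where "q1 \<equiv> odim M1"
abbreviation p2 :: nat where "p2 \<equiv> edim M2"
abbreviation q2 :: nat where "q2 \<equiv> odim M2"
abbreviation K2 :: "coord set" where "K2 \<equiv> cs p2 q2"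
abbreviation td :: "'c => 'd => 'm set" where "td c d \<equiv> tdom M1 M2 (tmap \<Phi>) c d"
abbreviation D :: "'c => 'd => pt set" where "D c d \<equiv> cmap M1 c ` td c d"

lemma open_td: "c \<in> charts M1 ==> d \<in> charts M2 ==> openin (carrier_top M1) (td c d)"
proof -
 assume c: "c \<in> charts M1" and d: "d \<in> charts M2"
 have "continuous_map (carrier_top M1) (carrier_top M2) (tmap \<Phi>)" using \<Phi> by (simp add: thick_morphism_def)
 then have "openin (carrier_top M1) (cdom M1 c \<inter> {z \<in> topspace (carrier_top M1). tmap \<Phi> z \<in> cdom M2 d})"
  by (intro openin_Int A.chart(1)[OF c] openin_continuous_map_preimage[OF _ B.chart(1)[OF d]])
 moreover have "cdom M1 c \<inter> {z \<in> topspace (carrier_top M1). tmap \<Phi> z \<in> cdom M2 d} = td c d"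
  using openin_subset[OF A.chart(1)[OF c]] by (auto simp: tdom_def)
 ultimately show ?thesis by simp
qed

lemma tdD: "z \<in> td c d ==> z \<in> cdom M1 c" "z \<in> td c d ==> tmap \<Phi> z \<in> cdom M2 d"
 by (auto simp: tdom_def)

lemma D_subset: "D c d \<subseteq> image_of M1 c"
 by (auto simp: tdom_def image_of_def)

lemma open_cmap: "c \<in> charts M1 ==> openin (carrier_top M1) V ==> V \<subseteq> td c d ==> eopen p1 (cmap M1 c ` V)"
 by (rule A.open_image) (auto simp: tdom_def)

lemma open_D: "c \<in> charts M1 ==> d \<in> charts M2 ==> eopen p1 (D c d)"
 by (rule open_cmap) (auto intro: open_td)

lemma D_cover:
 assumes "c \<in> charts M1" "x \<in> image_of M1 c"
 shows "EX d:charts M2. x \<in> D c d"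
proof -
 obtain z where z: "z \<in> cdom M1 c" "x = cmap M1 c z" using assms(2) by (auto simp: image_of_def)
 have "z \<in> topspace (carrier_top M1)" using z openin_subset[OF A.chart(1)[OF assms(1)]] by blast
 moreover have "continuous_map (carrier_top M1) (carrier_top M2) (tmap \<Phi>)" using \<Phi> by (simp add: thick_morphism_def)
 ultimately have "tmap \<Phi> z \<in> topspace (carrier_top M2)" by (meson continuous_map_image_subset_topspace image_subset_iff)
 moreover have "topspace (carrier_top M2) = (\<Union>c\<in>charts M2. cdom M2 c)" using B.M by (simp add: graded_supermanifold_def)
 ultimately show ?thesis using z by (auto simp: tdom_def)
qed

lemma genD:
 assumes c: "c \<in> charts M1" and d: "d \<in> charts M2"
 shows "SF p1 q1 K2 (D c d) (gen \<Phi> c d)" "x \<in> D c d ==> gs_parity False (gen \<Phi> c d x)"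
  "has_weight p1 (D c d) (cweight M1 c) (vweight (cweight M1 c) (%i. s - cweight M2 d i) \<omega>) s (gen \<Phi> c d)"
  "x \<in> D c d ==> gs_vars (xi_vars M1 \<union> mom_vars M2) (gen \<Phi> c d x)"
  "z \<in> td c d ==> phib p1 p2 (gen \<Phi> c d) (coord_pt (cmap M1 c z)) = cmap M2 d (tmap \<Phi> z)"
proof -
 let ?S = "gen \<Phi> c d"
 have *: "superfun p1 (D c d) (xi_vars M1 \<union> mom_vars M2) ?S &
     (ALL x:D c d. gs_parity False (?S x)) &
     has_weight p1 (D c d) (cweight M1 c) (vweight (cweight M1 c) (%i. s - cweight M2 d i) (%_ _. 0)) s ?S &
     (ALL z:td c d. ALL i<p2. body (thick_phi M1 \<Phi> c d (cmap M1 c z) (Ev i)) = cmap M2 d (tmap \<Phi> z) i)"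
  using \<Phi> c d unfolding thick_morphism_def Let_def by blast
 have v: "xi_vars M1 \<union> mom_vars M2 \<subseteq> svars q1 K2" by (auto simp: xi_vars_def mom_vars_def svars_def B.coords_eq)
 show "SF p1 q1 K2 (D c d) ?S"
  using * gs_vars_mono[OF _ v] unfolding SF_def superfun_def by blast
 show "x \<in> D c d ==> gs_parity False (?S x)" using * by blast
 show vx: "x \<in> D c d ==> gs_vars (xi_vars M1 \<union> mom_vars M2) (?S x)" for x using * unfolding superfun_def by blast
 have w: "has_weight p1 (D c d) (cweight M1 c) (vweight (cweight M1 c) (%i. s - cweight M2 d i) (%_ _. 0)) s ?S" using * by blast
 show "has_weight p1 (D c d) (cweight M1 c) (vweight (cweight M1 c) (%i. s - cweight M2 d i) \<omega>) s ?S"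
  by (rule has_weight_cong_vars[OF w vx]) (auto simp: xi_vars_def mom_vars_def vweight_def)
 assume z: "z \<in> td c d"
 then have b: "body (thick_phi M1 \<Phi> c d (cmap M1 c z) (Ev i)) = cmap M2 d (tmap \<Phi> z) i" if "i < p2" for i using * that by blast
 show "phib p1 p2 ?S (coord_pt (cmap M1 c z)) = cmap M2 d (tmap \<Phi> z)"
 proof
  fix i
  show "phib p1 p2 ?S (coord_pt (cmap M1 c z)) i = cmap M2 d (tmap \<Phi> z) i"
   using b[of i] B.cmap_zero[OF d, of "tmap \<Phi> z" i] tdD(2)[OF z] by (simp add: bodypt_def thick_phi_def thick_y_def)
 qed
qed

lemma pbI:
 assumes G: "G \<in> formal_points M2 \<omega> s" and c: "c \<in> charts M1" and d: "d \<in> charts M2"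
  and V: "openin (carrier_top M1) V" "V \<subseteq> td c d"
 shows "pb p1 q1 (cmap M1 c ` V) p2 q2 (image_of M2 d) (gen \<Phi> c d) (G d) is_par {}"
proof
 have sub: "cmap M1 c ` V \<subseteq> D c d" using V by blast
 show "eopen p1 (cmap M1 c ` V)" by (rule open_cmap[OF c V])
 show "SF p1 q1 K2 (cmap M1 c ` V) (gen \<Phi> c d)" by (rule SF_subset[OF genD(1)[OF c d] sub])
 show "gs_parity False (gen \<Phi> c d x)" if "x \<in> cmap M1 c ` V" for x using genD(2)[OF c d] that sub by blast
 show "SF p2 q2 {} (image_of M2 d) (G d)" by (rule B.globalD(1)[OF B.formalD(1)[OF G] d])
 show "gs_parity False (G d y)" if "y \<in> image_of M2 d" for y by (rule B.globalD(2)[OF B.formalD(1)[OF G] d that])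
 show "gsord is_par 1 (G d y)" for y by (rule B.formalD(2)[OF G])
 show "phib p1 p2 (gen \<Phi> c d) (coord_pt x) \<in> image_of M2 d" if x: "x \<in> cmap M1 c ` V" for x
 proof -
  obtain z where z: "z \<in> td c d" "x = cmap M1 c z" using x V by blast
  show ?thesis unfolding z(2) genD(5)[OF c d z(1)] using tdD(2)[OF z(1)] by (simp add: image_of_def)
 qed
qed (auto simp: B.chart(2)[OF d] is_par_def)

definition Val :: "('d => pt => gs) => 'c => 'd => pt => gs" where
 "Val G c d = pb.val p1 p2 q2 (gen \<Phi> c d) (G d) is_par"

lemma pullback_value_iff:
 assumes G: "G \<in> formal_points M2 \<omega> s" and c: "c \<in> charts M1" and d: "d \<in> charts M2" and x: "x \<in> D c d"
 shows "pullback_value M1 M2 (gen \<Phi> c d) (G d) x f \<longleftrightarrow> f = Val G c d x"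
proof -
 interpret pb p1 q1 "D c d" p2 q2 "image_of M2 d" "gen \<Phi> c d" "G d" is_par "{}"
  by (rule pbI[OF G c d open_td[OF c d] subset_refl])
 show ?thesis
 proof
  assume "pullback_value M1 M2 (gen \<Phi> c d) (G d) x f"
  then obtain Y Q where Y: "!!i. i \<in> cs p2 q2 ==> Y i = psign i * sf_eval p1 (dmom i (gen \<Phi> c d)) (coord_pt x) Q"
   and Q: "!!i. i \<in> cs p2 q2 ==> Q i = sf_eval p2 (dcoord i (G d)) Y mom_var"
   and f: "f = sf_eval p2 (G d) Y mom_var + sf_eval p1 (gen \<Phi> c d) (coord_pt x) Q - (\<Sum>i\<in>cs p2 q2. Y i * Q i)"
   unfolding pullback_value_def B.coords_eq thick_y_def by blast
  show "f = Val G c d x" unfolding f Val_def by (rule solution_unique(3)[OF x Y Q])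
 next
  assume f: "f = Val G c d x"
  show "pullback_value M1 M2 (gen \<Phi> c d) (G d) x f"
   unfolding pullback_value_def B.coords_eq thick_y_def f Val_def
   by (rule exI[of _ "Ys x"], rule exI[of _ "Qs x"]) (use Qs_eq[OF x] in \<open>simp add: Yof_def val_def\<close>)
 qed
qed

lemma sfam_X:
 assumes c: "c \<in> charts M1" "c' \<in> charts M1" and d: "d \<in> charts M2" and V: "openin (carrier_top M1) V" "V \<subseteq> td c d" "V \<subseteq> cdom M1 c'" and B: "finite B"
 shows "sfam p1 q1 B (cmap M1 c' ` V) p1 q1 B (D c d) (change M1 c' c) (%_. mom_var)"
proof
 have sub: "cmap M1 c' ` V \<subseteq> overlap M1 c' c" using V by (auto simp: overlap_def tdom_def)
 show o: "eopen p1 (cmap M1 c' ` V)" by (rule A.open_image[OF c(2) V(1,3)])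
 show "SF p1 q1 B (cmap M1 c' ` V) (%x. change M1 c' c x a)" if "a \<in> cs p1 q1" for a
  unfolding change_def by (rule SF_subset[OF A.trans(1)[OF c(2,1) that] sub])
 show "SF p1 q1 B (cmap M1 c' ` V) (%x. mom_var a)" if "a \<in> B" for a
  by (rule SF_const[OF o]) (use that in \<open>auto simp: mom_var_def svars_def intro: gs_vars_var\<close>)
 show "evok p1 q1 B (D c d) (change M1 c' c x) mom_var" if x: "x \<in> cmap M1 c' ` V" for x
 proof -
  obtain z where z: "z \<in> V" "x = cmap M1 c' z" using x by blast
  have zz: "z \<in> cdom M1 c'" "z \<in> cdom M1 c" "z \<in> td c d" using z V by (auto simp: tdom_def)
  have "bodypt p1 (change M1 c' c x) \<in> D c d" using A.bodypt_change[OF c(2,1) zz(1,2)] zz(3) z by simp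
  moreover have "evok p1 q1 B (overlap M1 c c') (change M1 c' c x) mom_var"
   by (rule A.evok_change[OF c(2,1)]) (use x sub in \<open>auto simp: mom_var_props\<close>)
  ultimately show ?thesis by (simp add: evok_def)
 qed
qed (use B open_D[OF c(1) d] in auto)

lemma chart_val:
 assumes G: "G \<in> formal_points M2 \<omega> s" and c: "c \<in> charts M1" "c' \<in> charts M1" and d: "d \<in> charts M2" "d' \<in> charts M2"
  and z: "z \<in> td c d" "z \<in> td c' d'"
 shows "Val G c' d' (cmap M1 c' z) = sf_eval p1 (Val G c d) (change M1 c' c (cmap M1 c' z)) mom_var"
proof -
 let ?V = "td c d \<inter> td c' d'"
 let ?O = "cmap M1 c' ` ?V" and ?S = "gen \<Phi> c d"
 note o = open_D[OF c(1) d(1)]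
 have oV: "openin (carrier_top M1) ?V" by (intro openin_Int open_td c d)
 have Vs: "?V \<subseteq> td c d" "?V \<subseteq> td c' d'" "?V \<subseteq> cdom M1 c'" by (auto simp: tdom_def)
 have sub: "?O \<subseteq> overlap M1 c' c" by (auto simp: overlap_def tdom_def)
 interpret chg p1 q1 p2 q2 "D c d" ?O "image_of M2 d" "overlap M2 d d'" "image_of M2 d'" "gen \<Phi> c d" "gen \<Phi> c' d'" "G d" "G d'"
  "change M1 c' c" "change M2 d d'"
 proof (rule chg.intro)
  show "pb p1 q1 (D c d) p2 q2 (image_of M2 d) ?S (G d) is_par {}"
   by (rule pbI[OF G c(1) d(1) open_td[OF c(1) d(1)] subset_refl])
  show "pb p1 q1 ?O p2 q2 (image_of M2 d') (gen \<Phi> c' d') (G d') is_par {}"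
   by (rule pbI[OF G c(2) d(2) oV Vs(2)])
  show "sfam p1 q1 B ?O p1 q1 B (D c d) (change M1 c' c) (%_. mom_var)" if "finite B" for B
   by (rule sfam_X[OF c d(1) oV Vs(1,3) that])
  show "SF p1 q1 {} ?O (%x. change M1 c' c x a)" if "a \<in> cs p1 q1" for a
   unfolding change_def by (rule SF_subset[OF A.trans(1)[OF c(2,1) that] sub])
  show "sfam p2 q2 {} (overlap M2 d d') p2 q2 {} (image_of M2 d') (change M2 d d') (%_. mom_var)"
   by (rule B.sfam_change[OF d])
  show "gs_parity (codd j) (change M2 d d' y j)" if "j \<in> K2" "y \<in> overlap M2 d d'" for j y
   unfolding change_def by (rule B.trans(2)[OF d that])
  show "overlap M2 d d' \<subseteq> image_of M2 d" by (rule B.overlap_subset)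
  show "G d y = sf_eval p2 (G d') (change M2 d d' y) mom_var" if "y \<in> overlap M2 d d'" for y
   by (rule B.globalD(4)[OF B.formalD(1)[OF G] d that])
  fix x assume "x \<in> ?O"
  then obtain z where z: "z \<in> ?V" "x = cmap M1 c' z" by blast
  have zz: "z \<in> cdom M1 c'" "z \<in> cdom M1 c" "z \<in> td c d" using z by (auto simp: tdom_def)
  interpret X: sfam p1 q1 "{}" ?O p1 q1 "{}" "D c d" "change M1 c' c" "%_. mom_var" by (rule sfam_X[OF c d(1) oV Vs(1,3)]) simp
  let ?X = "change M1 c' c x"
  have e: "evok p1 q1 {} (D c d) ?X mom_var" using X.ev \<open>x \<in> ?O\<close> by blast
  have e2: "evok p1 q1 K2 (D c d) ?X (%_. 0)" using e by (simp add: evok_def)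
  have b: "bodypt p1 ?X = cmap M1 c z" using A.bodypt_change[OF c(2,1) zz(1,2)] z by simp
  have e3: "evok p1 q1 K2 (D c d) (coord_pt (cmap M1 c z)) (%_. 0)"
   by (rule evok_coord_pt[OF o]) (use zz in auto)
  note SFd = SF_dmom[OF o genD(1)[OF c(1) d(1)]]
  \<comment> \<open>Bodies of values depend only on the bodies of the arguments, so \<open>X\<close>
    may be replaced by the old coordinates of the point \<open>z\<close>.\<close>
  have "body (sf_eval p1 (dmom i ?S) ?X (%_. 0)) = body (sf_eval p1 (dmom i ?S) (coord_pt (cmap M1 c z)) (%_. 0))" for i
   unfolding body_def coeff_sf_eval_empty[OF o finite_cs e2 SFd] coeff_sf_eval_empty[OF o finite_cs e3 SFd] b
   using bodypt_coord_pt[OF o] zz by simp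
  then have "phib p1 p2 ?S ?X
   = phib p1 p2 ?S (coord_pt (cmap M1 c z))"
   by (intro bodypt_eq) (simp add: psign_def)
  then show "phib p1 p2 ?S ?X \<in> overlap M2 d d'"
   using genD(5)[OF c(1) d(1) zz(3)] z by (auto simp: overlap_def tdom_def)
  have "z \<in> ?V" using z by blast
  with \<Phi> c d have "EX Y Q. (ALL i:coords M2. Y i = thick_y M1 ?S (change M1 c' c (cmap M1 c' z)) Q i) &
      (ALL i:coords M2. Q i =
        (\<Sum>j\<in>coords M2. sf_eval (edim M2) (dcoord i (transition M2 d d' j)) Y mom_var * mom_var j)) &
      gen \<Phi> c' d' (cmap M1 c' z) = sf_eval (edim M1) ?S (change M1 c' c (cmap M1 c' z)) Q - (\<Sum>i\<in>coords M2. Y i * Q i)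
       + (\<Sum>j\<in>coords M2. sf_eval (edim M2) (transition M2 d d' j) Y mom_var * mom_var j)"
   unfolding thick_morphism_def Let_def by blast
  then show "EX Y Q. (ALL i:K2. Y i = psign i * sf_eval p1 (dmom i ?S) ?X Q) &
   (ALL i:K2. Q i = (\<Sum>j\<in>K2. sf_eval p2 (dcoord i (%y. change M2 d d' y j)) Y mom_var * mom_var j)) &
   gen \<Phi> c' d' x = sf_eval p1 ?S ?X Q - (\<Sum>i\<in>K2. Y i * Q i) + (\<Sum>j\<in>K2. sf_eval p2 (%y. change M2 d d' y j) Y mom_var * mom_var j)"
   unfolding z(2) thick_y_def B.coords_eq change_def .
 qed
 have x: "cmap M1 c' z \<in> ?O" using z by blast
 show ?thesis using val'_eq[OF x] val_eq[OF x] by (simp only: Val_def)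
qed

text \<open>The target chart is an arbitrary one that contains the image of the point;
  \<open>Val_indep\<close> makes the choice immaterial.\<close>

definition PB :: "('d => pt => gs) => 'c => pt => gs" where
 "PB G c x = (if c \<in> charts M1 & x \<in> image_of M1 c then Val G c (SOME d. d \<in> charts M2 & x \<in> D c d) x else 0)"

lemma PB_off: "c \<notin> charts M1 | x \<notin> image_of M1 c ==> PB G c x = 0"
 unfolding PB_def by (rule if_not_P) blast

lemma SF_Val:
 assumes G: "G \<in> formal_points M2 \<omega> s" and c: "c \<in> charts M1" and d: "d \<in> charts M2"
 shows "SF p1 q1 {} (D c d) (Val G c d)" "x \<in> D c d ==> gs_parity False (Val G c d x)"
  "has_weight p1 (D c d) (cweight M1 c) (vweight (cweight M1 c) \<mu> \<omega>) s (Val G c d)"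
proof -
 interpret pb p1 q1 "D c d" p2 q2 "image_of M2 d" "gen \<Phi> c d" "G d" is_par "{}"
  by (rule pbI[OF G c d open_td[OF c d] subset_refl])
 show "SF p1 q1 {} (D c d) (Val G c d)" "x \<in> D c d ==> gs_parity False (Val G c d x)"
  unfolding Val_def by (rule SF_val, rule val_parity)
 show "has_weight p1 (D c d) (cweight M1 c) (vweight (cweight M1 c) \<mu> \<omega>) s (Val G c d)"
  unfolding Val_def by (rule weight_val[OF refl genD(3)[OF c d] B.globalD(3)[OF B.formalD(1)[OF G] d]])
qed

text \<open>A special case of \<open>chart_val\<close>: the source chart stays the same, and its
  change of coordinates is the identity.\<close>

lemma Val_indep:
 assumes G: "G \<in> formal_points M2 \<omega> s" and c: "c \<in> charts M1" and d: "d \<in> charts M2" "d' \<in> charts M2" and x: "x \<in> D c d" "x \<in> D c d'"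
 shows "Val G c d' x = Val G c d x"
proof -
 obtain z where z: "z \<in> td c d" "x = cmap M1 c z" using x by blast
 obtain z' where z': "z' \<in> td c d'" "x = cmap M1 c z'" using x by blast
 have "z' = z" using inj_onD[OF A.cmap_inj[OF c]] z z' tdD(1) by metis
 then have zz: "z \<in> td c d'" using z' by simp
 have "Val G c d' x = sf_eval p1 (Val G c d) (change M1 c c x) mom_var"
  using chart_val[OF G c c d z(1) zz] z by simp
 also have "... = sf_eval p1 (Val G c d) (coord_pt x) mom_var"
 proof (rule sf_eval_eqI[OF open_D[OF c d(1)] SF_Val(1)[OF G c d(1)]])
  show e: "change M1 c c x a = coord_pt x a" if "a \<in> cs p1 q1" for a
  proof -
   have "ALL c:charts M1. ALL a:coords M1. ALL x:image_of M1 c. transition M1 c c a x = coord_pt x a"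
    using A.M unfolding graded_supermanifold_def by blast
   then show ?thesis using c that x(1) D_subset unfolding A.coords_eq change_def by blast
  qed
  have "bodypt p1 (change M1 c c x) = bodypt p1 (coord_pt x)"
   by (rule bodypt_eq) (simp del: coord_pt_simps add: e)
  then show "bodypt p1 (change M1 c c x) \<in> D c d" using bodypt_coord_pt[OF open_D[OF c d(1)] x(1)] x by simp
 qed simp
 also have "... = Val G c d x"
  by (rule sf_eval_identity[OF open_D[OF c d(1)] _ SF_Val(1)[OF G c d(1)] x(1)]) simp
 finally show ?thesis .
qed

lemma PB_eq:
 assumes G: "G \<in> formal_points M2 \<omega> s" and c: "c \<in> charts M1" and d: "d \<in> charts M2" and x: "x \<in> D c d"
 shows "PB G c x = Val G c d x"
proof -
 let ?d = "SOME d. d \<in> charts M2 & x \<in> D c d"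
 have "?d \<in> charts M2 & x \<in> D c ?d" by (rule someI[of _ d]) (use d x in blast)
 then have "Val G c ?d x = Val G c d x" using Val_indep[OF G c d _ x] by blast
 then show ?thesis using c x D_subset by (auto simp: PB_def)
qed

lemma is_pullback_iff:
 assumes G: "G \<in> formal_points M2 \<omega> s"
 shows "is_pullback M1 M2 \<Phi> G F \<longleftrightarrow> F = PB G"
proof
 assume F: "is_pullback M1 M2 \<Phi> G F"
 show "F = PB G"
 proof (intro ext)
  fix c x
  show "F c x = PB G c x"
  proof (cases "c \<in> charts M1 & x \<in> image_of M1 c")
   case True
   then obtain d where d: "d \<in> charts M2" "x \<in> D c d" using D_cover by blast
   have "pullback_value M1 M2 (gen \<Phi> c d) (G d) x (F c x)" using F d True unfolding is_pullback_def by blast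
   then show ?thesis using pullback_value_iff[OF G _ d] PB_eq[OF G _ d] True by simp
  next
   case False
   then have "F c x = 0" using F unfolding is_pullback_def by blast
   then show ?thesis unfolding PB_def if_not_P[OF False] .
  qed
 qed
next
 assume F: "F = PB G"
 show "is_pullback M1 M2 \<Phi> G F"
  unfolding is_pullback_def F
 proof (intro conjI allI impI ballI)
  show "PB G c x = 0" if "c \<notin> charts M1 | x \<notin> image_of M1 c" for c x using that by (rule PB_off)
  fix c d x assume "c \<in> charts M1" "d \<in> charts M2" "x \<in> D c d"
  then show "pullback_value M1 M2 (gen \<Phi> c d) (G d) x (PB G c x)"
   by (simp only: pullback_value_iff[OF G] PB_eq[OF G])
 qed
qed

lemma pullback_eq: "G \<in> formal_points M2 \<omega> s ==> pullback M1 M2 \<Phi> G = PB G"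
 unfolding pullback_def by (rule the_equality) (simp_all only: is_pullback_iff)

lemma PB_global:
 assumes G: "G \<in> formal_points M2 \<omega> s"
 shows "PB G \<in> global_functions M1 \<omega> False s"
proof (rule A.globalI)
 show "PB G c x = 0" if "c \<notin> charts M1 | x \<notin> image_of M1 c" for c x using that by (rule PB_off)
 fix c assume c: "c \<in> charts M1"
 show "SF p1 q1 {} (image_of M1 c) (PB G c)"
 proof (rule SF_local)
  fix x assume "x \<in> image_of M1 c"
  then obtain d where d: "d \<in> charts M2" "x \<in> D c d" using D_cover[OF c] by blast
  have "SF p1 q1 {} (D c d) (PB G c)"
   by (rule SF_cong[OF open_D[OF c d(1)] SF_Val(1)[OF G c d(1)]]) (simp add: PB_eq[OF G c d(1)])
  then show "EX V. eopen p1 V & x \<in> V & V \<subseteq> image_of M1 c & SF p1 q1 {} V (PB G c)"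
   using open_D[OF c d(1)] d(2) D_subset by blast
 qed
 show "gs_parity False (PB G c x)" if "x \<in> image_of M1 c" for x
  using D_cover[OF c that] SF_Val(2)[OF G c] PB_eq[OF G c] by metis
 show "has_weight p1 (image_of M1 c) (cweight M1 c) (vweight (cweight M1 c) (%_. 0) \<omega>) s (PB G c)"
  unfolding has_weight_def
 proof
  fix x assume "x \<in> image_of M1 c"
  then obtain d where d: "d \<in> charts M2" "x \<in> D c d" using D_cover[OF c] by blast
  have "has_weight p1 (D c d) (cweight M1 c) (vweight (cweight M1 c) (%_. 0) \<omega>) s (PB G c)"
   by (rule has_weight_cong[OF open_D[OF c d(1)] SF_Val(3)[OF G c d(1)]]) (simp add: PB_eq[OF G c d(1)])
  then show "ALL m. (\<Sum>i<p1. of_int (cweight M1 c (Ev i)) * x i * rpd i (%y. coeff (PB G c y) m) x)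
   + of_int (\<Sum>v\<in>#m. vweight (cweight M1 c) (%_. 0) \<omega> v) * coeff (PB G c x) m = of_int s * coeff (PB G c x) m"
   using d(2) unfolding has_weight_def by blast
 qed
 fix c' x assume c': "c' \<in> charts M1" and x: "x \<in> overlap M1 c c'"
 obtain z where z: "z \<in> cdom M1 c" "z \<in> cdom M1 c'" "x = cmap M1 c z" using x by (auto simp: overlap_def)
 obtain d where d: "d \<in> charts M2" "x \<in> D c d" using D_cover[OF c] x A.overlap_subset by blast
 obtain z' where z': "z' \<in> td c d" "x = cmap M1 c z'" using d by blast
 have "z' = z" using inj_onD[OF A.cmap_inj[OF c]] z z' tdD(1) by metis
 then have zz: "z \<in> td c d" "z \<in> td c' d" using z z' by (auto simp: tdom_def)
 have "PB G c x = sf_eval p1 (Val G c' d) (change M1 c c' x) mom_var"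
  using chart_val[OF G c' c d(1) d(1) zz(2,1)] PB_eq[OF G c d] z by simp
 also have "... = sf_eval p1 (PB G c') (change M1 c c' x) mom_var"
 proof (rule sf_eval_cong[OF open_D[OF c' d(1)] _ _ SF_D(1)[OF SF_Val(1)[OF G c' d(1)]]])
  show "bodypt p1 (change M1 c c' x) \<in> D c' d" using A.bodypt_change[OF c c' z(1,2)] z zz by simp
 qed (simp_all add: PB_eq[OF G c' d(1)])
 finally show "PB G c x = sf_eval p1 (PB G c') (change M1 c c' x) mom_var" .
qed

end

subsection \<open>The pullback intertwines the Hamilton-Jacobi fields\<close>

text \<open>Odd variables occur at most once in an admissible monomial, so apart from its momenta
  such a monomial has at most \<open>card V\<close> factors.\<close>

lemma finite_mom_degree:
 assumes V: "finite V" "!!v. v \<in> V ==> is_mom v | vodd v"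
 shows "finite {m. set_mset m \<subseteq> V & mono_ok m & size (filter_mset is_mom m) = n}"
proof (rule finite_subset[OF _ finite_mset_bounded[OF V(1), of "n + card V"]], rule subsetI)
 fix m assume "m \<in> {m. set_mset m \<subseteq> V & mono_ok m & size (filter_mset is_mom m) = n}"
 then have m: "set_mset m \<subseteq> V" "mono_ok m" "size (filter_mset is_mom m) = n" by auto
 let ?f = "filter_mset (%v. ~ is_mom v) m"
 have "size ?f = (\<Sum>v\<in>set_mset ?f. count ?f v)" by (simp add: size_multiset_overloaded_eq)
 also have "... \<le> (\<Sum>v\<in>set_mset ?f. 1)"
  by (rule sum_mono) (use m V in \<open>auto simp: mono_ok_def\<close>)
 also have "... \<le> card V" using card_mono[OF V(1), of "set_mset ?f"] m by auto
 finally have "size ?f \<le> card V" .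
 moreover have "size m = size (filter_mset is_mom m) + size ?f"
  by (subst multiset_partition[of m is_mom]) (rule size_union)
 ultimately show "m \<in> {m. set_mset m \<subseteq> V & size m \<le> n + card V}" using m by simp
qed

text \<open>Without souls only the empty word remains, and each degree in the momenta involves
  finitely many monomials. The formula therefore holds for every \<open>P\<close>, also for one with
  constant terms.\<close>

lemma sf_eval_deg_coord_pt:
 assumes U: "eopen p U" "x \<in> U" and V: "finite V" "!!v. v \<in> V ==> is_mom v | vodd v" and g: "gs_vars V (g x)"
 shows "sf_eval_deg p g (coord_pt x) P n
  = (\<Sum>m | set_mset m \<subseteq> V & mono_ok m & size (filter_mset is_mom m) = n. coeff (g x) m *\<^sub>R mprod (subst_var (coord_pt x) P) m)"
proof (rule gs_eqI)
 fix k assume k: "mono_ok k"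
 let ?F = "{m. set_mset m \<subseteq> V & mono_ok m & size (filter_mset is_mom m) = n}"
 let ?f = "%(l, m). coeff (sf_eval_term p g (coord_pt x) P l m) k"
 have b: "bodypt p (coord_pt x) = x" by (rule bodypt_coord_pt[OF U])
 have z: "?f (l, m) = 0" if lm: "l ~= [] | m \<notin> ?F" "size (filter_mset is_mom m) = n" for l m
 proof (cases l)
  case Nil
  then have "coeff (g x) m = 0" using lm g coeff_not_ok unfolding gs_vars_def by blast
  then show ?thesis by (simp add: sf_eval_term_def Nil b)
 next
  case (Cons i l')
  then show ?thesis by (simp add: sf_eval_term_def)
 qed
 have "infsum ?f (lists {..<p} \<times> {m. size (filter_mset is_mom m) = n}) = infsum ?f ({[]} \<times> ?F)"
  by (rule infsum_cong_neutral) (use z in auto)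
 also have "... = (\<Sum>m\<in>?F. ?f ([], m))"
  using finite_mom_degree[OF V] by (simp add: sum.cartesian_product[symmetric])
 also have "... = coeff (\<Sum>m\<in>?F. coeff (g x) m *\<^sub>R mprod (subst_var (coord_pt x) P) m) k"
  by (simp add: sf_eval_term_def b mprod_def)
 finally show "coeff (sf_eval_deg p g (coord_pt x) P n) k
   = coeff (\<Sum>m\<in>?F. coeff (g x) m *\<^sub>R mprod (subst_var (coord_pt x) P) m) k"
  using k by (simp add: sf_eval_deg_def)
qed

lemma sums_clin:
 assumes L: "clin L" and f: "!!k. (%n. coeff (f n) k) sums coeff g k"
 shows "(%n. coeff (L (f n)) k) sums coeff (L g) k"
proof -
 obtain K where K: "finite K" "!!f. coeff (L f) k = (\<Sum>m\<in>K. coeff f m * coeff (L (mon m)) k)"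
  using clin_coeff[OF L, of k] by blast
 show ?thesis unfolding K(2)[of g] K(2)[of "f _"] by (intro sums_sum sums_mult2 f)
qed

text \<open>Convergence concerns one coefficient at a time, and a substitution mixes only finitely
  many of them. Hence it preserves convergence, even though \<open>P\<close> need not be
  small.\<close>

lemma sf_eval_sums_msub:
 assumes U: "eopen p U" "x \<in> U" and V: "finite V" "!!v. v \<in> V ==> is_mom v | vodd v" "!!v. v \<in> V ==> ~ is_par v" and g: "gs_vars V (g x)"
  and t: "good (psub B Q)" and P: "!!a. Mom a \<in> V ==> P' a = msub (psub B Q) (P a)" and f: "sf_eval_sums p g (coord_pt x) P f"
 shows "sf_eval_sums p g (coord_pt x) P' (msub (psub B Q) f)"
 unfolding sf_eval_sums_def
proof
 fix k
 have e: "sf_eval_deg p g (coord_pt x) P' n = msub (psub B Q) (sf_eval_deg p g (coord_pt x) P n)" for n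
 proof -
  have "mprod (subst_var (coord_pt x) P') m = msub (psub B Q) (mprod (subst_var (coord_pt x) P) m)" if "set_mset m \<subseteq> V" for m
   unfolding msub_mprod[OF t]
  proof (rule mprod_cong)
   fix v assume "v \<in># m"
   then have "v \<in> V" using that by blast
   then show "subst_var (coord_pt x) P' v = (msub (psub B Q) \<circ> subst_var (coord_pt x) P) v"
    using P V(3)[of v] by (cases v) (simp_all add: msub_var[OF t])
  qed
  note m = this
  have d: "sf_eval_deg p g (coord_pt x) P n
   = (\<Sum>m | set_mset m \<subseteq> V & mono_ok m & size (filter_mset is_mom m) = n. coeff (g x) m *\<^sub>R mprod (subst_var (coord_pt x) P) m)" for P
   by (rule sf_eval_deg_coord_pt[where g = g, OF U V(1,2) g])
  show ?thesis
   unfolding d clin_sum[OF clin_msub[OF t]] clin_scaleR[OF clin_msub[OF t]]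
   by (intro sum.cong refl) (simp add: m)
 qed
 show "(%n. coeff (sf_eval_deg p g (coord_pt x) P' n) k) sums coeff (msub (psub B Q) f) k"
  unfolding e by (rule sums_clin[OF clin_msub[OF t]]) (use f in \<open>simp add: sf_eval_sums_def\<close>)
qed

lemma sf_eval_sumsD: "sf_eval_sums p g X P f ==> sf_eval p g X P = f"
 by (rule gs_eqI) (simp add: sf_eval_def sf_eval_sums_def sums_unique[symmetric])

section \<open>The derivative of the pullback in an odd direction\<close>

locale pbs =
 fixes p1 q1 :: nat and U1 :: "pt set" and p2 q2 :: nat and U2 :: "pt set" and S g v :: "pt => gs" and j :: nat
 assumes P: "pb p1 q1 U1 p2 q2 U2 S g is_par {}"
  and v: "SF p2 q2 {} U2 v" and v_par: "!!y. y \<in> U2 ==> gs_parity True (v y)"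
begin

abbreviation e :: gs where "e \<equiv> gs_var (Par True j)"
abbreviation E :: "nat => gs => bool" where "E \<equiv> gsord (%u. u = Par True j)"

definition gt :: "pt => gs" where "gt y = g y + e * v y"

sublocale P: pb p1 q1 U1 p2 q2 U2 S g is_par "{}" by (rule P)

sublocale Pt: pb p1 q1 U1 p2 q2 U2 S gt is_par "{}"
proof
 show "SF p2 q2 {} U2 gt" unfolding gt_def[abs_def] by (rule SF_add[OF P.U2 P.g SF_eps[OF P.U2 v]])
 show "gs_parity False (gt y)" if "y \<in> U2" for y
  unfolding gt_def using eps_parity[OF v_par[OF that], of j] by (intro gs_parity_add P.g_par that) simp
 show "gsord is_par 1 (gt y)" for y unfolding gt_def by (intro gsord_add P.g1 gsord_par_eps)
qed (auto simp: P.U1 P.U2 P.S P.S_par P.phi P.W)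

lemma eval_eps:
 assumes e: "evok p2 q2 {} U2 Y mom_var" and f: "SF p2 q2 {} U2 f"
 shows "sf_eval p2 (%y. e * f y) Y mom_var = e * sf_eval p2 f Y mom_var"
 by (simp add: sf_eval_mult'[OF P.U2 _ e SF_par[OF P.U2] f] sf_eval_par[OF P.U2 _ e])

lemma eval_gt:
 assumes ev: "evok p2 q2 {} U2 Y mom_var"
 shows "sf_eval p2 gt Y mom_var = sf_eval p2 g Y mom_var + e * sf_eval p2 v Y mom_var"
 unfolding gt_def[abs_def] by (simp only: sf_eval_add[OF P.U2 finite.emptyI ev P.g SF_eps[OF P.U2 v]] eval_eps[OF ev v])

lemma E_cong:
 assumes f: "SF p2 q2 {} U2 f" and b: "bodypt p2 Y \<in> U2" and Y: "!!i. E 1 (Y i - Y' i)"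
 shows "E 1 (sf_eval p2 f Y mom_var - sf_eval p2 f Y' mom_var)"
proof (rule sf_eval_gsord_cong[where V = "svars q2 {}" and U = U2])
 have "coeff (Y i - Y' i) {#} = 0" for i by (rule gsord_1_empty[OF Y])
 then show "bodypt p2 Y = bodypt p2 Y'" by (intro bodypt_eq) (simp add: body_def)
 show "E 1 (subst_var Y mom_var u - subst_var Y' mom_var u)" for u
  using Y[unfolded One_nat_def] by (cases u) auto
 show "gs_vars (svars q2 {}) (f y)" if "y \<in> U2" for y by (rule SF_D(1)[OF f that])
qed (auto simp: P.U2 b Y[unfolded One_nat_def])

lemma dcoord_gt: "y \<in> U2 ==> i \<in> P.C2 ==> dcoord i gt y = dcoord i g y + e * (sgn_if (codd i) *\<^sub>R dcoord i v y)"
 unfolding gt_def[abs_def] using dcoord_add[OF P.U2 P.g SF_eps[OF P.U2 v]] dcoord_eps[OF P.U2 v] by simp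

lemma eval_dgt:
 assumes ev: "evok p2 q2 {} U2 Y mom_var" and i: "i \<in> P.C2"
 shows "E 1 (sf_eval p2 (dcoord i gt) Y mom_var - sf_eval p2 (dcoord i g) Y mom_var)"
proof -
 have d: "SF p2 q2 {} U2 (%y. sgn_if (codd i) *\<^sub>R dcoord i v y)" by (rule SF_scaleR[OF P.U2 SF_dcoord[OF P.U2 v i]])
 have "sf_eval p2 (dcoord i gt) Y mom_var = sf_eval p2 (%y. dcoord i g y + e * (sgn_if (codd i) *\<^sub>R dcoord i v y)) Y mom_var"
  by (rule sf_eval_cong[OF P.U2 evokD(6)[OF ev] dcoord_gt[OF _ i] SF_D(1)[OF SF_dcoord[OF P.U2 Pt.g i]]]) simp_all
 also have "... = sf_eval p2 (dcoord i g) Y mom_var + e * sf_eval p2 (%y. sgn_if (codd i) *\<^sub>R dcoord i v y) Y mom_var"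
  by (simp only: sf_eval_add[OF P.U2 finite.emptyI ev SF_dcoord[OF P.U2 P.g i] SF_eps[OF P.U2 d]] eval_eps[OF ev d])
 finally show ?thesis using gsord_eps[of j "sf_eval p2 (%y. sgn_if (codd i) *\<^sub>R dcoord i v y) Y mom_var"] by simp
qed

lemma E_It:
 assumes x: "x \<in> U1" and i: "i \<in> P.C2"
 shows "E 1 (Pt.It n x i - P.It n x i)"
 using i
proof (induction n arbitrary: i)
 case 0
 then show ?case by (simp add: Pt.It_def P.It_def)
next
 case (Suc n)
 let ?Y = "P.Yof x (Pt.It n x)" and ?Y' = "P.Yof x (P.It n x)"
 have ev: "evok p2 q2 {} U2 ?Y mom_var"
  by (rule P.evok_Y[OF x]) (use Pt.goodQD(2,3)[OF Pt.goodQ_It x] in auto)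
 have 1: "E 1 (sf_eval p2 (dcoord i gt) ?Y mom_var - sf_eval p2 (dcoord i g) ?Y mom_var)"
  by (rule eval_dgt[OF ev Suc.prems])
 have 2: "E 1 (sf_eval p2 (dcoord i g) ?Y mom_var - sf_eval p2 (dcoord i g) ?Y' mom_var)"
  by (rule E_cong[OF SF_dcoord[OF P.U2 P.g Suc.prems] evokD(6)[OF ev] P.Yof_gsord[OF x Suc.IH]])
 show ?case using gsord_add[OF 1 2] unfolding Pt.It_Suc[OF Suc.prems] P.It_Suc[OF Suc.prems] by simp
qed

text \<open>A given coefficient of either solution is that of an iterate with the same index, so the
  congruence modulo the odd parameter is inherited from \<open>E_It\<close>.\<close>

lemma E_Qs:
 assumes x: "x \<in> U1" and i: "i \<in> P.C2"
 shows "E 1 (Pt.Qs x i - P.Qs x i)"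
 unfolding gsord_def
proof (intro allI impI)
 fix k assume k: "size (filter_mset (%u. u = Par True j) k) < 1"
 let ?n = "Suc (size (filter_mset is_par k))"
 have "coeff (Pt.Qs x i) k = coeff (Pt.It ?n x i) k" "coeff (P.Qs x i) k = coeff (P.It ?n x i) k"
  by (rule gsord_lim_coeff[OF Pt.Qs(2)[OF x]], rule gsord_lim_coeff[OF P.Qs(2)[OF x]])
 moreover have "coeff (Pt.It ?n x i - P.It ?n x i) k = 0" using E_It[OF x i, of ?n] k unfolding gsord_def by blast
 ultimately show "coeff (Pt.Qs x i - P.Qs x i) k = 0" by simp
qed

lemma E_Ys: "x \<in> U1 ==> E 1 (Pt.Ys x i - P.Ys x i)"
 by (rule P.Yof_gsord[OF _ E_Qs])

lemma E_prod: "E 1 a ==> E 1 b ==> a * b = 0"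
 using gsord_odd_2[of "Par True j" "a * b"] gsord_mult[of _ 1 a 1 b] by (simp add: numeral_2_eq_2)

text \<open>The increments \<open>A\<close> and \<open>C\<close> of the solution are divisible by
  the odd parameter, so terms of second order drop out. The terms of first order cancel as in
  \<open>envelope\<close>, and only the explicit change of the argument remains.\<close>

lemma val_shift:
 assumes x: "x \<in> U1"
 shows "Pt.val x = P.val x + e * sf_eval p2 v (P.Ys x) mom_var"
proof -
 define A C where "A i = Pt.Ys x i - P.Ys x i" and "C i = Pt.Qs x i - P.Qs x i" for i
 have Y: "Pt.Ys x = (%i. P.Ys x i + A i)" and Q: "Pt.Qs x = (%i. P.Qs x i + C i)" by (simp_all add: A_def C_def fun_eq_iff)
 have EA: "E 1 (A i)" for i unfolding A_def by (rule E_Ys[OF x])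
 have EC: "E 1 (C i)" if "i \<in> P.C2" for i unfolding C_def by (rule E_Qs[OF x that])
 have PA: "gs_parity (codd i) (A i)" for i unfolding A_def by (rule gs_parity_diff[OF Pt.Ys_parity[OF x] P.Ys_parity[OF x]])
 have PC: "gs_parity (codd i) (C i)" if "i \<in> P.C2" for i unfolding C_def
  by (rule gs_parity_diff[OF Pt.Qs_parity[OF x that] P.Qs_parity[OF x that]])
 have "sf_eval p2 g (%i. P.Ys x i + A i) (%i. mom_var i + 0) = sf_eval p2 g (P.Ys x) mom_var + chain p2 q2 {} g (P.Ys x) mom_var A (%_. 0)"
  by (rule sf_eval_shift[OF P.U2 finite.emptyI P.g P.evok_Ys[OF x], where v = "Par True j"]) (use EA PA in auto)
 then have g: "sf_eval p2 g (Pt.Ys x) mom_var = sf_eval p2 g (P.Ys x) mom_var + (\<Sum>i\<in>P.C2. A i * P.Qs x i)"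
  by (simp add: Y P.Qs_eq[OF x])
 \<comment> \<open>The old and the new solution agree modulo \<open>e\<close>, and the factor
   \<open>e\<close> kills the difference.\<close>
 have vv: "e * sf_eval p2 v (Pt.Ys x) mom_var = e * sf_eval p2 v (P.Ys x) mom_var"
 proof -
  have "E 1 (e * 1)" by (rule gsord_eps)
  then have "E 1 e" by simp
  from E_prod[OF this E_cong[OF v evokD(6)[OF Pt.evok_Ys[OF x]] E_Ys[OF x]]]
  have "e * (sf_eval p2 v (Pt.Ys x) mom_var - sf_eval p2 v (P.Ys x) mom_var) = 0" .
  then show ?thesis by (simp add: right_diff_distrib)
 qed
 note gt = eval_gt[OF Pt.evok_Ys[OF x]]
 have "sf_eval p1 S (%a. coord_pt x a + 0) (%i. P.Qs x i + C i) = sf_eval p1 S (coord_pt x) (P.Qs x)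
   + chain p1 q1 P.C2 S (coord_pt x) (P.Qs x) (%_. 0) C"
  by (rule sf_eval_shift[OF P.U1 finite_cs P.S P.evok_Qs[OF x], where v = "Par True j"]) (use EC PC in auto)
 then have S: "sf_eval p1 S (coord_pt x) (Pt.Qs x) = sf_eval p1 S (coord_pt x) (P.Qs x) + (\<Sum>i\<in>P.C2. C i * (psign i * P.Ys x i))"
  by (simp add: Q P.dmom_S)
 have YQ: "Pt.Ys x i * Pt.Qs x i = P.Ys x i * P.Qs x i + A i * P.Qs x i + C i * (psign i * P.Ys x i)" if i: "i \<in> P.C2" for i
 proof -
  have "C i * (psign i * P.Ys x i) = P.Ys x i * C i"
   using gs_mult_commute[OF PC[OF i] P.Ys_parity[OF x, of i]] by (auto simp: psign_mult(2))
  moreover have "A i * C i = 0" by (rule E_prod[OF EA EC[OF i]])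
  moreover have "Pt.Ys x i = P.Ys x i + A i" "Pt.Qs x i = P.Qs x i + C i" by (simp_all add: A_def C_def)
  ultimately show ?thesis by (simp add: distrib_left distrib_right)
 qed
 show ?thesis
  unfolding Pt.val_def P.val_def gt g S vv by (simp add: YQ sum.distrib)
qed

end

section \<open>The Hamilton-Jacobi equation along the solution\<close>

locale sthk = thk M1 M2 "1 - k" \<Phi> + X1: hjm M1 k H1 + X2: hjm M2 k H2
 for M1 :: "('m, 'c) atlas" and M2 :: "('n, 'd) atlas" and k :: int and \<Phi> :: "('m, 'c, 'n, 'd) thick" and H1 H2 +
 assumes HJ: "S_infinity_thick_morphism k M1 H1 M2 H2 \<Phi>"
begin

text \<open>One statement gives both the convergence and the value of the Hamilton-Jacobi field on
  the pullback: the substitution of \<open>Qs\<close> for the momenta is applied to the convergent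
  series itself and not only to its sum.\<close>

lemma HJ_sums:
 assumes G: "G \<in> formal_points M2 \<omega> (1 - k)" and c: "c \<in> charts M1" and d: "d \<in> charts M2" and x: "x \<in> D c d"
 shows "sf_eval_sums p1 (H1 c) (coord_pt x) (%a. dcoord a (PB G c) x)
  (sf_eval p2 (HJ_field M2 H2 G d) (pb.Yof p1 (gen \<Phi> c d) x (pb.Qs p1 p2 q2 (gen \<Phi> c d) (G d) is_par x)) mom_var)"
proof -
 interpret P: pb p1 q1 "D c d" p2 q2 "image_of M2 d" "gen \<Phi> c d" "G d" is_par "{}"
  by (rule pbI[OF G c d open_td[OF c d] subset_refl])
 interpret h: hj p2 q2 "image_of M2 d" "H2 d" "G d" by (rule X2.hj[OF G d])
 note Qp = P.Qs_parity[OF x] gsord_1_empty[OF P.Qs_par[OF x]]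
 let ?t = "psub K2 (P.Qs x)"
 let ?S = "gen \<Phi> c d"
 have gt: "good ?t" by (rule good_psub[OF finite_cs Qp])
 have tP: "?t (Par b n) = gs_var (Par b n)" for b n by simp
 have sums: "sf_eval_sums p1 (H1 c) (coord_pt x) (%a. dcoord a ?S x) (sf_eval p2 (H2 d) (%i. psign i * dmom i ?S x) mom_var)"
  using HJ c d x unfolding S_infinity_thick_morphism_def Let_def by blast
 have dPB: "dcoord a (PB G c) x = msub ?t (dcoord a ?S x)" if a: "a \<in> cs p1 q1" for a
 proof -
  have "dcoord a (PB G c) x = dcoord a P.val x"
   by (rule dcoord_cong[OF P.U1 x a]) (simp add: PB_eq[OF G c d] Val_def)
  also have "... = msub ?t (dcoord a ?S x)"
   unfolding P.dcoord_val[OF x a] by (rule sf_eval_coord_pt[OF P.U1 finite_cs SF_dcoord[OF P.U1 P.S a] x Qp])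
  finally show ?thesis .
 qed
 have s: "sf_eval_sums p1 (H1 c) (coord_pt x) (%a. dcoord a (PB G c) x) (msub ?t (sf_eval p2 (H2 d) (%i. psign i * dmom i ?S x) mom_var))"
 proof (rule sf_eval_sums_msub[OF P.U1 x _ _ _ _ gt _ sums, where V = "xi_vars M1 \<union> mom_vars M1"])
  show "gs_vars (xi_vars M1 \<union> mom_vars M1) (H1 c x)" using X1.HD(5)[OF c] x D_subset by blast
  show "dcoord a (PB G c) x = msub ?t (dcoord a ?S x)" if "Mom a \<in> xi_vars M1 \<union> mom_vars M1" for a
   using that by (intro dPB) (auto simp: xi_vars_def mom_vars_def A.coords_eq)
 qed (auto simp: xi_vars_def mom_vars_def A.coords_eq is_mom_def)
 have Yi: "msub ?t (psign i * dmom i ?S x) = P.Ys x i" for i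
  by (simp add: P.Yof_def sf_eval_coord_pt[OF P.U1 finite_cs P.SFd x Qp] psign_mult(2) clin_uminus[OF clin_msub[OF gt]])
 have par: "gs_parity (codd i) (psign i * dmom i ?S x)" for i
  using gs_parity_dmom[of False ?S x i] P.S_par[OF x] gs_parity_uminus by (auto simp: psign_mult(2))
 have "body (psign i * dmom i ?S x) = body (P.Ys x i)" for i
  unfolding Yi[symmetric] by (rule body_msub[OF gt, symmetric])
 then have "bodypt p2 (%i. psign i * dmom i ?S x) = bodypt p2 (P.Ys x)" by (intro bodypt_eq)
 then have evm: "evok p2 q2 K2 (image_of M2 d) (%i. psign i * dmom i ?S x) mom_var"
  using evokD(6)[OF P.evok_Ys[OF x]] par by (simp add: evok_def mom_var_props)
 have "msub ?t (sf_eval p2 (H2 d) (%i. psign i * dmom i ?S x) mom_var) = sf_eval p2 (H2 d) (P.Ys x) (P.Qs x)"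
  by (rule msub_sf_eval[OF gt tP P.U2 finite_cs X2.HD(1)[OF d] evm Yi]) (simp add: mom_var_def msub_var[OF gt])
 also have "... = sf_eval p2 (h.comp (H2 d)) (P.Ys x) mom_var"
  by (rule h.compose[OF h.H P.evok_Ys[OF x] _ P.Qs_eq[OF x, symmetric], symmetric])
   (rule sf_eval_coordinate[OF P.U2 finite.emptyI P.evok_Ys[OF x]])
 also have "... = sf_eval p2 (HJ_field M2 H2 G d) (P.Ys x) mom_var"
  by (rule sf_eval_cong[OF P.U2 evokD(6)[OF P.evok_Ys[OF x]] _ SF_D(1)[OF h.SF_comp[OF h.H]]]) (simp_all add: X2.HJ_value[OF d])
 finally show ?thesis using s by simp
qed

lemma converges:
 assumes G: "G \<in> formal_points M2 \<omega> (1 - k)"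
 shows "HJ_converges M1 H1 (PB G)"
 unfolding HJ_converges_def
proof (intro ballI)
 fix c x assume c: "c \<in> charts M1" and x: "x \<in> image_of M1 c"
 obtain d where d: "d \<in> charts M2" "x \<in> D c d" using D_cover[OF c x] by blast
 show "sf_eval_sums p1 (H1 c) (coord_pt x) (%a. dcoord a (PB G c) x) (HJ_field M1 H1 (PB G) c x)"
  using HJ_sums[OF G c d] sf_eval_sumsD[OF HJ_sums[OF G c d]] by (simp add: X1.HJ_value[OF c x])
qed

text \<open>The odd parameter of weight -1 lowers the weight \<open>2 - k\<close> of the field to
  that of a point, makes it even, and supplies the parameter that a formal point must
  contain.\<close>

lemma shift_formal:
 assumes G: "G \<in> formal_points M2 \<omega> (1 - k)" and j: "\<omega> True j = - 1"
 shows "shift j G (HJ_field M2 H2 G) \<in> formal_points M2 \<omega> (1 - k)"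
proof -
 let ?V = "HJ_field M2 H2 G"
 let ?e = "gs_var (Par True j)" and ?h = "%c. has_weight p2 (image_of M2 c) (cweight M2 c) (vweight (cweight M2 c) (%_. 0) \<omega>)"
 note Gg = B.formalD(1)[OF G] and Vg = X2.HJ_global[OF G]
 have "shift j G ?V \<in> global_functions M2 \<omega> False (1 - k)"
 proof (rule B.globalI)
  show "shift j G ?V c x = 0" if "c \<notin> charts M2 | x \<notin> image_of M2 c" for c x
   using B.global_off[OF Gg that] B.global_off[OF Vg that] by (simp add: shift_def)
  fix c assume c: "c \<in> charts M2"
  note U = B.chart(2)[OF c] and g = B.globalD[OF Gg c] and v = B.globalD[OF Vg c]
  have E: "SF p2 q2 {} (image_of M2 c) (%x. ?e * ?V c x)" by (rule SF_eps[OF U v(1)])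
  have sh: "shift j G ?V c = (%x. G c x + ?e * ?V c x)" by (simp add: shift_def)
  show "SF p2 q2 {} (image_of M2 c) (shift j G ?V c)" unfolding sh by (rule SF_add[OF U g(1) E])
  show "gs_parity False (shift j G ?V c x)" if "x \<in> image_of M2 c" for x
   unfolding sh using eps_parity[OF v(2)[OF that], of j] by (intro gs_parity_add g(2)[OF that]) simp
  have "?h c (- 1) (%x. ?e)"
   unfolding has_weight_euler euler_def using dcoord_const[of "Par True j"] by (simp add: wscale_var vweight_def j)
  from has_weight_mult[OF U SF_D(2)[OF SF_par[OF U]] SF_D(2)[OF v(1)] this v(3)]
  have "?h c (1 - k) (%x. ?e * ?V c x)" by simp
  then show "?h c (1 - k) (shift j G ?V c)"
   unfolding sh by (rule has_weight_add[OF SF_D(2)[OF g(1)] SF_D(2)[OF E] g(3)])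
  fix d x assume d: "d \<in> charts M2" and x: "x \<in> overlap M2 c d"
  have ev: "evok p2 q2 {} (image_of M2 d) (change M2 c d x) mom_var" by (rule B.evok_change'[OF c d x]) auto
  note gd = B.globalD(1)[OF Gg d] and vd = B.globalD(1)[OF Vg d] and Ud = B.chart(2)[OF d]
  show "shift j G ?V c x = sf_eval p2 (shift j G ?V d) (change M2 c d x) mom_var"
   by (simp add: shift_def sf_eval_add[OF Ud finite.emptyI ev gd SF_eps[OF Ud vd]] sf_eval_mult'[OF Ud finite.emptyI ev SF_par[OF Ud] vd] sf_eval_par[OF Ud finite.emptyI ev]
     g(4)[OF d x] v(4)[OF d x])
 qed
 moreover have "\<exists>v\<in>#m. is_par v" if m: "coeff (shift j G ?V c x) m ~= 0" for c x m
 proof (rule ccontr)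
  assume "~ (\<exists>v\<in>#m. is_par v)"
  then have "size (filter_mset is_par m) < 1" by (simp add: filter_mset_eq_conv)
  moreover have "gsord is_par 1 (shift j G ?V c x)"
   unfolding shift_def by (intro gsord_add B.formalD(2)[OF G] gsord_par_eps)
  ultimately show False using m unfolding gsord_def by blast
 qed
 ultimately show ?thesis unfolding formal_points_def by blast
qed

lemma intertwining:
 assumes G: "G \<in> formal_points M2 \<omega> (1 - k)" and j: "\<omega> True j = - 1"
 shows "PB (shift j G (HJ_field M2 H2 G)) = shift j (PB G) (HJ_field M1 H1 (PB G))"
proof (intro ext)
 let ?V = "HJ_field M2 H2 G"
 fix c x
 show "PB (shift j G ?V) c x = shift j (PB G) (HJ_field M1 H1 (PB G)) c x"
 proof (cases "c \<in> charts M1 & x \<in> image_of M1 c")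
  case True
  then have c: "c \<in> charts M1" and x: "x \<in> image_of M1 c" by auto
  obtain d where d: "d \<in> charts M2" "x \<in> D c d" using D_cover[OF c x] by blast
  interpret pbs p1 q1 "D c d" p2 q2 "image_of M2 d" "gen \<Phi> c d" "G d" "?V d" j
  proof (rule pbs.intro)
   show "pb p1 q1 (D c d) p2 q2 (image_of M2 d) (gen \<Phi> c d) (G d) is_par {}"
    by (rule pbI[OF G c d(1) open_td[OF c d(1)] subset_refl])
  qed (use B.globalD(1,2)[OF X2.HJ_global[OF G] d(1)] in auto)
  have g: "shift j G ?V d = gt" by (simp add: shift_def gt_def fun_eq_iff)
  have "PB (shift j G ?V) c x = Pt.val x"
   unfolding PB_eq[OF shift_formal[OF G j] c d] Val_def g by (rule refl)
  also have "... = PB G c x + e * sf_eval p2 (?V d) (P.Ys x) mom_var"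
   unfolding val_shift[OF d(2)] PB_eq[OF G c d] Val_def by (rule refl)
  also have "sf_eval p2 (?V d) (P.Ys x) mom_var = HJ_field M1 H1 (PB G) c x"
   using sf_eval_sumsD[OF HJ_sums[OF G c d]] by (simp add: X1.HJ_value[OF c x])
  finally show ?thesis by (simp add: shift_def)
 next
  case False
  then show ?thesis using PB_off by (simp only: shift_def HJ_field_def if_False) simp
 qed
qed

end

subsection \<open>Expansion in the jets of the argument\<close>

lemma gsord_prod_list: "(!!v. P v ==> gsord W 1 (\<sigma> v)) ==> gsord W (length (filter P vs)) (prod_list (map \<sigma> vs))"
proof (induction vs)
 case (Cons v vs)
 show ?case
 proof (cases "P v")
  case True
  then show ?thesis using gsord_mult[OF Cons.prems[OF True] Cons.IH[OF Cons.prems]] by simp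
 next
  case False
  then show ?thesis using gsord_mult[of W 0 "\<sigma> v", OF gsord_0(2) Cons.IH[OF Cons.prems]] by simp
 qed
qed simp

text \<open>Maclaurin's formula for each coefficient along the segment in the direction
  \<open>\<eta>\<close>. The remainder contains \<open>Suc N\<close> increments, each of order 1,
  whatever the intermediate point \<open>\<xi>\<close> is.\<close>

lemma taylor:
 assumes U: "eopen p U" and g: "SF p q {} U g" and e: "evok p q {} U X mom_var"
  and h: "!!a. a \<in> cs p q ==> gs_parity (codd a) (\<eta> a)" "!!a. a \<in> cs p q ==> gsord W 1 (\<eta> a)"
 shows "gsord W (Suc N) (sf_eval p g (%a. X a + \<eta> a) mom_var
  - (\<Sum>r\<le>N. \<Sum>l | set l \<subseteq> cs p q & length l = r. (1 / fact r) *\<^sub>R (prod_list (map \<eta> (rev l)) * sf_eval p (foldr dcoord l g) X mom_var)))"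
 unfolding gsord_def
proof (intro allI impI)
 fix k assume k: "size (filter_mset W k) < Suc N"
 let ?L = "%r. {l. set l \<subseteq> cs p q & length l = r}"
 let ?X = "%s a. X a + s *\<^sub>R \<eta> a"
 define u where "u r s = (\<Sum>l\<in>?L r. prod_list (map \<eta> (rev l)) * sf_eval p (foldr dcoord l g) (?X s) mom_var)" for r and s :: real
 have finL: "finite (?L r)" for r using finite_lists_length_eq[OF finite_cs] by simp
 have SFl: "SF p q {} U (foldr dcoord l g)" if "set l \<subseteq> cs p q" for l
  using that by (induction l) (auto intro: g SF_dcoord[OF U])
 have ev: "evok p q {} U (?X s) mom_var" for s
 proof -
  have "body (?X s (Ev i)) = body (X (Ev i))" if "i < p" for i
   using gsord_1_empty[OF h(2)[of "Ev i"]] that by (simp add: body_def)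
  then have "bodypt p (?X s) = bodypt p X" by (rule bodypt_eq)
  then show ?thesis using e h(1) by (simp add: evok_def gs_parity_add gs_parity_scaleR)
 qed
 have cd: "cder (%d. u r (s + d)) (u (Suc r) s)" for r s
 proof -
  have 1: "cder (%d. sf_eval p (foldr dcoord l g) (?X (s + d)) mom_var)
    (\<Sum>a\<in>cs p q. \<eta> a * sf_eval p (dcoord a (foldr dcoord l g)) (?X s) mom_var)" if l: "set l \<subseteq> cs p q" for l
  proof -
   have "cder (%d. ?X (s + d) a) (\<eta> a)" for a
   proof -
    have "cder (%d. (X a + s *\<^sub>R \<eta> a) + d *\<^sub>R \<eta> a) (0 + (1 *\<^sub>R \<eta> a + 0 *\<^sub>R 0))"
     using cder_add[OF cder_const cder_smul[OF DERIV_ident cder_const]] by simp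
    then show ?thesis by (simp add: scaleR_add_left add.assoc)
   qed
   from cder_sf_eval[OF U finite.emptyI SFl[OF l], of "%d. ?X (s + d)" "%_. mom_var", OF _ _ this] ev
   show ?thesis by simp
  qed
  have "cder (%d. u r (s + d)) (\<Sum>l\<in>?L r. 0 * sf_eval p (foldr dcoord l g) (?X (s + 0)) mom_var
    + prod_list (map \<eta> (rev l)) * (\<Sum>a\<in>cs p q. \<eta> a * sf_eval p (dcoord a (foldr dcoord l g)) (?X s) mom_var))"
   unfolding u_def by (intro cder_sum cder_mult cder_const 1) auto
  moreover have "(\<Sum>l\<in>?L r. prod_list (map \<eta> (rev l)) * (\<Sum>a\<in>cs p q. \<eta> a * sf_eval p (dcoord a (foldr dcoord l g)) (?X s) mom_var))
    = u (Suc r) s"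
  proof -
   \<comment> \<open>A further derivative is put in front of the word while its increment comes last
     in the product; this is why the product runs over \<open>rev l\<close>.\<close>
   have im: "?L (Suc r) = (%(l, a). a # l) ` (?L r \<times> cs p q)"
    by (auto simp: length_Suc_conv image_iff)
   have "u (Suc r) s = (\<Sum>z\<in>?L r \<times> cs p q. prod_list (map \<eta> (rev (snd z # fst z))) * sf_eval p (foldr dcoord (snd z # fst z) g) (?X s) mom_var)"
    unfolding u_def im by (subst sum.reindex) (auto simp: inj_on_def case_prod_unfold)
   then show ?thesis
    by (simp add: sum.cartesian_product' sum_distrib_left mult.assoc)
  qed
  ultimately show ?thesis by simp
 qed
 have D: "((%s. coeff (u r s) k) has_real_derivative coeff (u (Suc r) s) k) (at s)" for r s
  using cd[of r s, unfolded cder_def, rule_format, of k] DERIV_shift[of "%s. coeff (u r s) k" "coeff (u (Suc r) s) k" 0 s]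
  by (simp add: add.commute)
 obtain \<xi> where \<xi>: "coeff (u 0 1) k = (\<Sum>m<Suc N. coeff (u m 0) k / fact m * 1 ^ m) + coeff (u (Suc N) \<xi>) k / fact (Suc N) * 1 ^ Suc N"
  using Maclaurin_all_le[of "%m s. coeff (u m s) k" "%s. coeff (u 0 s) k" 1 "Suc N"] D by auto
 have "gsord W (Suc N) (u (Suc N) \<xi>)"
  unfolding u_def
 proof (rule gsord_sum)
  fix l assume l: "l \<in> ?L (Suc N)"
  have "gsord W (length (filter (%a. a \<in> cs p q) (rev l))) (prod_list (map \<eta> (rev l)))"
   by (rule gsord_prod_list[OF h(2)])
  moreover have "filter (%a. a \<in> cs p q) (rev l) = rev l" using l by (intro filter_True) auto
  ultimately have "gsord W (Suc N) (prod_list (map \<eta> (rev l)))" using l by simp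
  from gsord_mult[OF this gsord_0(2)] show "gsord W (Suc N) (prod_list (map \<eta> (rev l)) * sf_eval p (foldr dcoord l g) (?X \<xi>) mom_var)" by simp
 qed
 then have "coeff (u (Suc N) \<xi>) k = 0" using k by (simp add: gsord_def)
 then have "coeff (u 0 1) k = (\<Sum>m\<le>N. coeff (u m 0) k / fact m)" using \<xi> by (simp add: lessThan_Suc_atMost)
 moreover have "u 0 1 = sf_eval p g (%a. X a + \<eta> a) mom_var"
 proof -
  have "?L 0 = {[]}" by auto
  then show ?thesis by (simp add: u_def)
 qed
 ultimately show "coeff (sf_eval p g (%a. X a + \<eta> a) mom_var
  - (\<Sum>r\<le>N. \<Sum>l\<in>?L r. (1 / fact r) *\<^sub>R (prod_list (map \<eta> (rev l)) * sf_eval p (foldr dcoord l g) X mom_var))) k = 0"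
  by (simp add: u_def sum_divide_distrib)
qed

lemma coeff_mon_mult:
 assumes k: "mono_ok k" and r: "mono_ok r"
 shows "coeff (mon r * a) k = (if r \<subseteq># k then ksign r (k - r) * coeff a (k - r) else 0)"
proof -
 have "coeff (mon r * a) k = (\<Sum>z\<in>msplits k. if z = (r, k - r) then ksign r (k - r) * coeff a (k - r) else 0)"
  unfolding coeff_mult[OF k] by (intro sum.cong refl) (auto simp: msplits_def coeff_mon r split: if_splits)
 also have "... = (if (r, k - r) \<in> msplits k then ksign r (k - r) * coeff a (k - r) else 0)"
  by (simp add: sum.delta)
 also have "(r, k - r) \<in> msplits k \<longleftrightarrow> r \<subseteq># k"
  by (auto simp: msplits_def subset_mset.add_diff_inverse) (metis mset_subset_eq_add_left)
 finally show ?thesis .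
qed

lemma var_power_mon:
 assumes "~ vodd t"
 shows "gs_var t ^ n = mon (replicate_mset n t)" "ksign (replicate_mset n t) b = 1" "mono_ok (replicate_mset n t)"
proof -
 have ks: "ksign (replicate_mset n t) b = 1" for n b by (induction n) (simp_all add: ksign_add_mset assms)
 show "ksign (replicate_mset n t) b = 1" by (rule ks)
 show "gs_var t ^ n = mon (replicate_mset n t)"
 proof (induction n)
  case (Suc n)
  then show ?case using mon_mult[of "{#t#}" "replicate_mset n t"] ks[of 1] by (simp add: mon_single)
 qed (simp add: mon_empty)
 show "mono_ok (replicate_mset n t)" using assms by (auto simp: mono_ok_def)
qed

text \<open>Powers of an even variable are independent over series free of it: the coefficient at
  \<open>k + replicate_mset m t\<close> sees only the term with index \<open>m\<close>.\<close>

lemma t_extract: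
 assumes t: "~ vodd t" and a: "!!m. gs_vars (- {t}) (a m)" and s: "gsord (%v. v = t) (Suc n) (\<Sum>m\<le>n. gs_var t ^ m * a m)" and m: "m \<le> n"
 shows "a m = 0"
proof (rule gs_eqI)
 fix k assume k: "mono_ok k"
 show "coeff (a m) k = coeff 0 k"
 proof (cases "t \<in># k")
  case True
  then show ?thesis using a[of m] unfolding gs_vars_def by auto
 next
  case False
  let ?k = "k + replicate_mset m t"
  have ok: "mono_ok ?k" using k t by (auto simp: mono_ok_def)
  have "size (filter_mset (%v. v = t) ?k) = m" using False by (simp add: filter_eq_replicate_mset not_in_iff)
  then have "coeff (\<Sum>m\<le>n. gs_var t ^ m * a m) ?k = 0" using s m unfolding gsord_def by (metis le_imp_less_Suc)
  moreover have "coeff (gs_var t ^ i * a i) ?k = (if i = m then coeff (a m) k else 0)" for i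
  proof -
   have c: "coeff (gs_var t ^ i * a i) ?k = (if replicate_mset i t \<subseteq># ?k then coeff (a i) (?k - replicate_mset i t) else 0)"
    by (simp add: var_power_mon[OF t] coeff_mon_mult[OF ok])
   consider "i = m" | "i < m" | "i > m" by linarith
   then show ?thesis
   proof cases
    case 2
    then have "t \<in># ?k - replicate_mset i t" using False by (simp add: in_diff_count not_in_iff)
    then have "coeff (a i) (?k - replicate_mset i t) = 0" using a[of i] unfolding gs_vars_def by auto
    then show ?thesis using c 2 by simp
   next
    case 3
    then have "~ replicate_mset i t \<subseteq># ?k"
     using False mset_subset_eq_count[of "replicate_mset i t" ?k t] by (auto simp: not_in_iff)
    then show ?thesis using c 3 by simp
   qed (use c in simp)
  qed
  ultimately show ?thesis using m by (simp add: sum.delta)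
 qed
qed

section \<open>Homogeneous polynomials in the jets of the argument\<close>

locale jets =
 fixes p1 q1 :: nat and U1 :: "pt set" and p2 q2 :: nat and U2 :: "pt set" and S :: "pt => gs"
 assumes U1: "eopen p1 U1" and U2: "eopen p2 U2"
  and S: "SF p1 q1 (cs p2 q2) U1 S" and S_par: "!!x. x \<in> U1 ==> gs_parity False (S x)"
  and S_vars: "!!x. x \<in> U1 ==> gs_vars (Xi ` {..<q1} \<union> Mom ` cs p2 q2) (S x)"
  and phi_body: "!!x. x \<in> U1 ==> phib p1 p2 S (coord_pt x) \<in> U2"
begin

abbreviation C2 :: "coord set" where "C2 \<equiv> cs p2 q2"

definition GG :: "(pt => gs) => bool" where
 "GG g \<longleftrightarrow> SF p2 q2 {} U2 g & (ALL y:U2. gs_parity False (g y)) & (ALL y. gsord is_par 1 (g y))"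

definition \<phi> :: "pt => coord => gs" where
 "\<phi> x i = psign i * sf_eval p1 (dmom i S) (coord_pt x) (%_. 0)"

definition XF :: "(pt => gs) => bool" where
 "XF a \<longleftrightarrow> superfun p1 U1 (Xi ` {..<q1}) a"

definition jet :: "(pt => gs) => pt => coord list => gs" where
 "jet g x l = sf_eval p2 (foldr dcoord l g) (\<phi> x) mom_var"

text \<open>The data required by \<open>formal_map\<close> in degree \<open>n\<close>:
  \<open>r\<close> carries the index set and the coefficients, which do not depend on
  \<open>g\<close>.\<close>

definition JR :: "nat => ((pt => gs) => pt => gs) => coord list list set \<times> (coord list list => pt => gs) => bool" where
 "JR n F r \<longleftrightarrow> finite (fst r) & (ALL I:fst r. length I = n & set I \<subseteq> lists C2 & XF (snd r I)) &
   (ALL g x. GG g --> x \<in> U1 --> F g x = (\<Sum>I\<in>fst r. snd r I x * prod_list (map (jet g x) I)))"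

definition JP :: "nat => ((pt => gs) => pt => gs) => bool" where
 "JP n F \<longleftrightarrow> (EX r. JR n F r)"

text \<open>The momentum of a coordinate that does not exist serves as a fresh even variable \<open>t\<close>. Solving for
  \<open>t g\<close> separates the degrees in \<open>g\<close>; all constructions are done for \<open>t g\<close> and for \<open>g\<close> in parallel.\<close>

abbreviation tv :: var where "tv \<equiv> Mom (Ev p2)"

definition W :: "bool => var => bool" where "W w v = (if w then v = tv else is_par v)"
definition \<tau> :: "bool => gs" where "\<tau> w = (if w then gs_var tv else 1)"
definition Bw :: "bool => coord set" where "Bw w = (if w then {Ev p2} else {})"

definition psum :: "(nat => (pt => gs) => pt => gs) => nat => bool => (pt => gs) => pt => gs" where
 "psum F N w g x = (\<Sum>n\<le>N. \<tau> w ^ n * F n g x)"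

text \<open>One family \<open>F\<close> serves for both values of \<open>w\<close>. The case
  \<open>True\<close>, where \<open>t\<close> marks the degree, determines the values of its
  members; the case \<open>False\<close> is the one that is finally used.\<close>

definition KK :: "(bool => (pt => gs) => pt => gs) => bool" where
 "KK f \<longleftrightarrow> (EX F. (ALL n. JP n (F n)) & (ALL w g x N. GG g --> x \<in> U1 -->
   gsord (W w) (Suc N) (f w g x - psum F N w g x)))"

lemma XF_altdef: "XF a \<longleftrightarrow> (ALL x:U1. gs_vars (Xi ` {..<q1}) (a x)) & sfn p1 U1 a"
 by (simp add: XF_def superfun_def sfn_def)

lemma XF_SF: "XF a ==> SF p1 q1 B U1 a"
 unfolding XF_altdef SF_altdef using gs_vars_mono[of "Xi ` {..<q1}" _ "svars q1 B"] by (auto simp: svars_def)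

lemma XF_const: "gs_vars (Xi ` {..<q1}) a ==> XF (%x. a)"
 by (simp add: XF_altdef sfn_const[OF U1])

lemma XF_add: "XF a ==> XF b ==> XF (%x. a x + b x)"
 by (auto simp: XF_altdef intro: sfn_add[OF U1] gs_vars_add)

lemma XF_mult: "XF a ==> XF b ==> XF (%x. a x * b x)"
 by (auto simp: XF_altdef intro: sfn_mult[OF U1] gs_vars_mult)

lemma XF_smooth: "smooth_on p1 U1 h ==> XF (%x. of_real (h x))"
 unfolding XF_altdef sfn_def
proof (intro conjI ballI allI)
 fix m assume h: "smooth_on p1 U1 h"
 have "coeff (of_real (h x)) m = (if m = {#} then 1 else 0) * h x" for x by (simp add: of_real_def)
 then show "smooth_on p1 U1 (%x. coeff (of_real (h x)) m)" using smooth_cmult[OF U1 h, of "if m = {#} then 1 else 0"] by simp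
qed simp

text \<open>The effect on \<open>f\<close> of moving an element of parity \<open>b\<close> past it;
  with it the coefficients in a product of jet polynomials are collected in front.\<close>

definition tw :: "bool => gs => gs" where
 "tw b f = gs_part False f + sgn_if b *\<^sub>R gs_part True f"

lemma tw:
 assumes d: "gs_parity b d"
 shows "d * f = tw b f * d"
proof -
 have "d * f = d * gs_part False f + d * gs_part True f" by (metis distrib_left gs_part_sum)
 then show ?thesis
  using gs_mult_commute[OF d gs_parity_part[of False f]] gs_mult_commute[OF d gs_parity_part[of True f]]
  by (simp add: sgn_if_def tw_def distrib_right)
qed

lemma XF_tw: "XF a ==> XF (%x. tw b (a x))"
proof -
 assume a: "XF a"
 have c: "coeff (tw b f) m = (if odd (nodd m) then sgn_if b else 1) * coeff f m" for f m
  by (cases "mono_ok m") (auto simp: tw_def gs_part_def coeff_not_ok)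
 show "XF (%x. tw b (a x))"
  unfolding XF_altdef
 proof
  show "sfn p1 U1 (%x. tw b (a x))"
   using a smooth_cmult[OF U1] unfolding XF_altdef sfn_def c by blast
  show "ALL x:U1. gs_vars (Xi ` {..<q1}) (tw b (a x))"
   using a unfolding XF_altdef gs_vars_def c by auto
 qed
qed

lemma phi_props:
 assumes x: "x \<in> U1"
 shows "gs_parity (codd i) (\<phi> x i)" "gs_vars (Xi ` {..<q1}) (\<phi> x i)" "evok p2 q2 B U2 (\<phi> x) mom_var"
proof -
 have e: "evok p1 q1 C2 U1 (coord_pt x) (%_. 0)" by (rule evok_coord_pt[OF U1 x]) simp_all
 show p: "gs_parity (codd i) (\<phi> x i)" for i
 proof -
  have "gs_parity (codd i) (sf_eval p1 (dmom i S) (coord_pt x) (%_. 0))"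
   by (rule gs_parity_sf_eval[OF U1 finite_cs e SF_dmom[OF U1 S]]) (use gs_parity_dmom[of False S _ i] S_par in simp)
  then show ?thesis by (cases "codd i") (auto simp: \<phi>_def psign_mult(2) intro: gs_parity_uminus)
 qed
 have "gs_vars (Xi ` {..<q1}) (msub (psub C2 (%_. 0)) (dmom i S x))"
 proof (rule gs_vars_msub[OF good_psub[OF finite_cs]])
  show "gs_vars (Xi ` {..<q1} \<union> Mom ` C2) (dmom i S x)" unfolding dmom_eq by (rule gs_vars_vderiv[OF S_vars[OF x]])
  show "gs_vars (Xi ` {..<q1}) (psub C2 (%_. 0) v)" if "v \<in> Xi ` {..<q1} \<union> Mom ` C2" for v
   using that by (auto intro!: gs_vars_var)
 qed simp_all
 then have "gs_vars (Xi ` {..<q1}) (sf_eval p1 (dmom i S) (coord_pt x) (%_. 0))"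
  using sf_eval_coord_pt[OF U1 finite_cs SF_dmom[OF U1 S] x, of "%_. 0" i] by simp
 then show "gs_vars (Xi ` {..<q1}) (\<phi> x i)"
  using gs_vars_scaleR[of "Xi ` {..<q1}" _ "- 1"] by (auto simp: \<phi>_def psign_mult(2))
 show "evok p2 q2 B U2 (\<phi> x) mom_var"
  using phi_body[OF x] p by (simp add: evok_def \<phi>_def[abs_def] mom_var_props)
qed

lemma XF_phi: "XF (%x. \<phi> x i)"
 unfolding XF_altdef
proof
 interpret sfam p1 q1 "{}" U1 p1 q1 C2 U1 coord_pt "%_ _. 0"
  by unfold_locales (auto simp: U1 intro!: SF_coord_pt[OF U1] SF_const[OF U1] evok_coord_pt[OF U1])
 have "SF p1 q1 {} U1 (%x. (if codd i then - 1 else 1) *\<^sub>R comp (dmom i S) x)"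
  by (rule SF_scaleR[OF U1 SF_comp[OF SF_dmom[OF U1 S]]])
 then show "sfn p1 U1 (%x. \<phi> x i)" by (intro SF_D(2)) (simp add: \<phi>_def psign_def split: if_splits)
qed (simp add: phi_props)

lemma GG_l:
 assumes g: "GG g" and l: "set l \<subseteq> C2"
 shows "SF p2 q2 {} U2 (foldr dcoord l g)" "y \<in> U2 ==> gs_parity (odd (length (filter codd l))) (foldr dcoord l g y)"
  "gsord is_par 1 (foldr dcoord l g y)"
proof -
 let ?P = "%l. SF p2 q2 {} U2 (foldr dcoord l g) & (ALL y:U2. gs_parity (odd (length (filter codd l))) (foldr dcoord l g y))
  & (ALL y. gsord is_par 1 (foldr dcoord l g y))"
 have "?P l"
  using l
 proof (induction l)
  case Nil
  then show ?case using g by (simp add: GG_def)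
 next
  case (Cons a l)
  then have a: "a \<in> C2" and IH: "?P l" by auto
  have "gs_parity (odd (length (filter codd (a # l)))) (dcoord a (foldr dcoord l g) y)" if "y \<in> U2" for y
   using gs_parity_dcoord[OF U2 that a, of "odd (length (filter codd l))"] IH by (cases "codd a") auto
  moreover have "gsord is_par 1 (dcoord a (foldr dcoord l g) y)" for y by (rule gsord_par_dcoord) (use IH in blast)
  ultimately show ?case using SF_dcoord[OF U2 _ a] IH by simp
 qed
 then show "SF p2 q2 {} U2 (foldr dcoord l g)" "y \<in> U2 ==> gs_parity (odd (length (filter codd l))) (foldr dcoord l g y)"
  "gsord is_par 1 (foldr dcoord l g y)" by blast+
qed

lemma jet_props:
 assumes g: "GG g" and x: "x \<in> U1" and l: "set l \<subseteq> C2"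
 shows "gs_parity (odd (length (filter codd l))) (jet g x l)" "gsord is_par 1 (jet g x l)" "gs_vars (svars q1 {}) (jet g x l)"
proof -
 note G = GG_l[OF g l]
 show "gs_parity (odd (length (filter codd l))) (jet g x l)" unfolding jet_def
  by (rule gs_parity_sf_eval[OF U2 finite.emptyI phi_props(3)[OF x] G(1,2)])
 show "gsord is_par 1 (jet g x l)" unfolding jet_def by (rule sf_eval_par_1[OF G(3) subst_var_par])
 show "gs_vars (svars q1 {}) (jet g x l)" unfolding jet_def
  by (rule gs_vars_sf_eval[OF U2 finite.emptyI phi_props(3)[OF x] G(1)])
   (auto simp: svars_def intro: gs_vars_mono[OF phi_props(2)[OF x]])
qed

lemma JRD:
 assumes "JR n F (J, A)"
 shows "finite J" "!!I. I \<in> J ==> length I = n" "!!I. I \<in> J ==> set I \<subseteq> lists C2" "!!I. I \<in> J ==> XF (A I)"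
  "!!g x. GG g ==> x \<in> U1 ==> F g x = (\<Sum>I\<in>J. A I x * prod_list (map (jet g x) I))"
 using assms unfolding JR_def fst_conv snd_conv by blast+

lemma JPI:
 assumes "finite J" "!!I. I \<in> J ==> length I = n" "!!I. I \<in> J ==> set I \<subseteq> lists C2" "!!I. I \<in> J ==> XF (A I)"
  "!!g x. GG g ==> x \<in> U1 ==> F g x = (\<Sum>I\<in>J. A I x * prod_list (map (jet g x) I))"
 shows "JP n F"
proof -
 have "JR n F (J, A)" unfolding JR_def fst_conv snd_conv using assms by blast
 then show ?thesis unfolding JP_def by blast
qed

lemma JPE:
 assumes "JP n F"
 obtains J A where "JR n F (J, A)"
 using assms unfolding JP_def by (metis surj_pair)

lemma JP_cong:
 assumes "JP n F" and e: "!!g x. GG g ==> x \<in> U1 ==> F g x = G g x"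
 shows "JP n G"
proof -
 obtain J A where "JR n F (J, A)" by (rule JPE[OF assms(1)])
 note J = JRD[OF this]
 show ?thesis by (rule JPI[OF J(1-4)]) (simp_all only: e[symmetric] J(5))
qed

lemma JP_single:
 assumes "XF a" "length I = n" "set I \<subseteq> lists C2"
 shows "JP n (%g x. a x * prod_list (map (jet g x) I))"
 by (rule JPI[of "{I}" n "%_. a"]) (use assms in \<open>simp_all del: in_lists_conv_set\<close>)

lemma JP_0: "JP n (%g x. 0)"
 by (rule JPI[of "{}"]) simp_all

lemma JP_add:
 assumes "JP n F" "JP n G"
 shows "JP n (%g x. F g x + G g x)"
proof -
 obtain J A where "JR n F (J, A)" by (rule JPE[OF assms(1)])
 note J = JRD[OF this]
 obtain J' A' where "JR n G (J', A')" by (rule JPE[OF assms(2)])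
 note J' = JRD[OF this]
 let ?A = "%I x. (if I \<in> J then A I x else 0) + (if I \<in> J' then A' I x else 0)"
 have z: "XF (%x. 0)" by (rule XF_const) simp
 have "XF (?A I)" if "I \<in> J \<union> J'" for I
 proof (rule XF_add)
  show "XF (%x. if I \<in> J then A I x else 0)" using J(4)[of I] z by (cases "I \<in> J") auto
  show "XF (%x. if I \<in> J' then A' I x else 0)" using J'(4)[of I] z by (cases "I \<in> J'") auto
 qed
 moreover have "F g x + G g x = (\<Sum>I\<in>J \<union> J'. ?A I x * prod_list (map (jet g x) I))" if "GG g" "x \<in> U1" for g x
 proof -
  have "F g x = (\<Sum>I\<in>J \<union> J'. (if I \<in> J then A I x else 0) * prod_list (map (jet g x) I))"
   unfolding J(5)[OF that] by (rule sum.mono_neutral_cong_left) (use J(1) J'(1) in auto)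
  moreover have "G g x = (\<Sum>I\<in>J \<union> J'. (if I \<in> J' then A' I x else 0) * prod_list (map (jet g x) I))"
   unfolding J'(5)[OF that] by (rule sum.mono_neutral_cong_left) (use J(1) J'(1) in auto)
  ultimately show ?thesis by (simp add: distrib_right sum.distrib)
 qed
 ultimately show ?thesis
  by (intro JPI[of "J \<union> J'" n ?A]) (use J(1-3) J'(1-3) in blast)+
qed

lemma JP_sum: "(!!i. i \<in> A ==> JP n (F i)) ==> JP n (%g x. \<Sum>i\<in>A. F i g x)"
 by (induction A rule: infinite_finite_induct) (simp_all add: JP_0 JP_add)

lemma JP_mult:
 assumes F: "JP m F" and G: "JP n G"
 shows "JP (m + n) (%g x. F g x * G g x)"
proof -
 obtain J A where "JR m F (J, A)" by (rule JPE[OF F])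
 note J = JRD[OF this]
 obtain J' A' where "JR n G (J', A')" by (rule JPE[OF G])
 note J' = JRD[OF this]
 define b where "b I = odd (\<Sum>l\<leftarrow>I. length (filter codd l))" for I
 have par: "gs_parity (b I) (prod_list (map (jet g x) I))" if "GG g" "x \<in> U1" "set I \<subseteq> lists C2" for g x I
  using that(3)
 proof (induction I)
  case (Cons l I)
  have "gs_parity (odd (length (filter codd l))) (jet g x l)" by (rule jet_props(1)[OF that(1,2)]) (use Cons.prems in auto)
  from gs_parity_mult[OF this Cons.IH] show ?case using Cons.prems by (simp add: b_def)
 qed (simp add: b_def)
 have "JP (m + n) (%g x. \<Sum>I\<in>J. \<Sum>I'\<in>J'. (A I x * tw (b I) (A' I' x)) * prod_list (map (jet g x) (I @ I')))"
  by (intro JP_sum JP_single XF_mult XF_tw) (use J(2-4) J'(2-4) in \<open>auto simp del: in_lists_conv_set\<close>)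
 then show ?thesis
 proof (rule JP_cong)
  fix g x assume gx: "GG g" "x \<in> U1"
  have "A I x * prod_list (map (jet g x) I) * (A' I' x * prod_list (map (jet g x) I'))
   = (A I x * tw (b I) (A' I' x)) * prod_list (map (jet g x) (I @ I'))" if "I \<in> J" for I I'
   using tw[OF par[OF gx, of I], of "A' I' x"] J(3)[OF that] by (simp add: mult.assoc) (simp flip: mult.assoc)
  then show "(\<Sum>I\<in>J. \<Sum>I'\<in>J'. (A I x * tw (b I) (A' I' x)) * prod_list (map (jet g x) (I @ I'))) = F g x * G g x"
   by (simp add: J(5)[OF gx] J'(5)[OF gx] sum_product)
 qed
qed

lemma JP_props:
 assumes F: "JP n F" and g: "GG g" and x: "x \<in> U1"
 shows "gsord is_par n (F g x)" "gs_vars (svars q1 {}) (F g x)"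
proof -
 obtain J A where "JR n F (J, A)" by (rule JPE[OF F])
 note J = JRD[OF this]
 show "gsord is_par n (F g x)" unfolding J(5)[OF g x]
 proof (rule gsord_sum)
  fix I assume I: "I \<in> J"
  have "gsord is_par (length (filter (%l. set l \<subseteq> C2) I)) (prod_list (map (jet g x) I))"
   by (rule gsord_prod_list[OF jet_props(2)[OF g x]])
  moreover have "filter (%l. set l \<subseteq> C2) I = I" using J(3)[OF I] by (intro filter_True) auto
  ultimately have "gsord is_par n (prod_list (map (jet g x) I))" using J(2)[OF I] by simp
  from gsord_mult[OF gsord_0(2) this] show "gsord is_par n (A I x * prod_list (map (jet g x) I))" by simp
 qed
 show "gs_vars (svars q1 {}) (F g x)" unfolding J(5)[OF g x]
 proof (rule gs_vars_sum, rule gs_vars_mult)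
  fix I assume I: "I \<in> J"
  show "gs_vars (svars q1 {}) (A I x)" using SF_D(1)[OF XF_SF[OF J(4)[OF I]] x] .
  show "gs_vars (svars q1 {}) (prod_list (map (jet g x) I))"
  proof (rule gs_vars_prod_list)
   fix f assume "f \<in> set (map (jet g x) I)"
   then obtain l where l: "l \<in> set I" "f = jet g x l" by auto
   then have "set l \<subseteq> C2" using J(3)[OF I] by auto
   then show "gs_vars (svars q1 {}) f" unfolding l(2) by (rule jet_props(3)[OF g x])
  qed
 qed
qed

end

section \<open>Simultaneous expansion for \<open>t g\<close> and for \<open>g\<close>\<close>

context jets
begin

lemma tau_even: "gs_parity False (\<tau> w)" "gs_parity False (\<tau> w ^ n)"
proof -
 show 1: "gs_parity False (\<tau> w)" using gs_parity_var[of tv] by (simp add: \<tau>_def)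
 show "gs_parity False (\<tau> w ^ n)"
  using gs_parity_mult[OF 1] by (induction n) simp_all
qed

lemma tau_comm: "\<tau> w ^ n * f = f * \<tau> w ^ n" "\<tau> w * f = f * \<tau> w"
 by (rule gs_even_central[OF tau_even(2)], rule gs_even_central[OF tau_even(1)])

text \<open>For \<open>w = True\<close> the order comes from the power of \<open>t\<close>, for
  \<open>w = False\<close> from the parameters in \<open>f\<close>. Parts of degree \<open>n\<close>
  thus have order \<open>n\<close> in either case.\<close>

lemma gsord_tau: "gsord is_par n f ==> gsord (W w) n (\<tau> w ^ n * f)"
proof (cases w)
 case True
 have "gsord (%v. v = tv) n (gs_var tv ^ n)"
 proof (induction n)
  case (Suc n)
  then show ?case using gsord_mult[OF gsord_own_var[of "%v. v = tv" tv] Suc] by simp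
 qed simp
 from gsord_mult[OF this gsord_0(2)] show ?thesis using True by (simp add: W_def[abs_def] \<tau>_def)
qed (simp add: W_def[abs_def] \<tau>_def)

lemma KKI:
 assumes "!!n. JP n (F n)" "!!w g x N. GG g ==> x \<in> U1 ==> gsord (W w) (Suc N) (f w g x - psum F N w g x)"
 shows "KK f"
 unfolding KK_def using assms by blast

lemma KKE:
 assumes "KK f"
 obtains F where "!!n. JP n (F n)" "!!w g x N. GG g ==> x \<in> U1 ==> gsord (W w) (Suc N) (f w g x - psum F N w g x)"
 using assms unfolding KK_def by blast

lemma KK_cong:
 assumes "KK f" and e: "!!w g x. GG g ==> x \<in> U1 ==> f w g x = h w g x"
 shows "KK h"
proof -
 obtain F where F: "!!n. JP n (F n)" "!!w g x N. GG g ==> x \<in> U1 ==> gsord (W w) (Suc N) (f w g x - psum F N w g x)"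
  by (rule KKE[OF assms(1)]) blast
 show ?thesis by (rule KKI[OF F(1)]) (simp only: e[symmetric] F(2))
qed

lemma KK_hom:
 assumes a: "JP m a"
 shows "KK (%w g x. \<tau> w ^ m * a g x)"
proof (rule KKI[of "%n. if n = m then a else (%g x. 0)"])
 show "JP n (if n = m then a else (%g x. 0))" for n using a JP_0 by simp
 fix w g x N assume gx: "GG g" "x \<in> U1"
 have "psum (%n. if n = m then a else (%g x. 0)) N w g x = (\<Sum>n\<le>N. if n = m then \<tau> w ^ m * a g x else 0)"
  unfolding psum_def by (intro sum.cong refl) simp
 then show "gsord (W w) (Suc N) (\<tau> w ^ m * a g x - psum (%n. if n = m then a else (%g x. 0)) N w g x)"
  using gsord_mono[OF gsord_tau[OF JP_props(1)[OF a gx]], of "Suc N" w] by auto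
qed

lemma KK_const: "XF a ==> KK (%w g x. a x)"
 using KK_hom[OF JP_single[of a "[]" 0]] by simp

lemma KK_jet: "set l \<subseteq> C2 ==> KK (%w g x. \<tau> w * jet g x l)"
 using KK_hom[OF JP_single[of "%_. 1" "[l]" 1, OF XF_const]] by auto

lemma KK_add:
 assumes "KK f" "KK h"
 shows "KK (%w g x. f w g x + h w g x)"
proof -
 obtain F where F: "!!n. JP n (F n)" "!!w g x N. GG g ==> x \<in> U1 ==> gsord (W w) (Suc N) (f w g x - psum F N w g x)"
  by (rule KKE[OF assms(1)]) blast
 obtain H where H: "!!n. JP n (H n)" "!!w g x N. GG g ==> x \<in> U1 ==> gsord (W w) (Suc N) (h w g x - psum H N w g x)"
  by (rule KKE[OF assms(2)]) blast
 show ?thesis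
 proof (rule KKI[OF JP_add[OF F(1) H(1)]])
  fix w g x N assume gx: "GG g" "x \<in> U1"
  show "gsord (W w) (Suc N) (f w g x + h w g x - psum (%n g x. F n g x + H n g x) N w g x)"
   using gsord_add[OF F(2)[OF gx] H(2)[OF gx]] by (simp add: psum_def distrib_left sum.distrib algebra_simps)
 qed
qed

lemma psum_mono:
 assumes F: "!!n. JP n (F n)" and gx: "GG g" "x \<in> U1" and n: "n \<le> N"
 shows "gsord (W w) (Suc n) (psum F N w g x - psum F n w g x)"
 using n
proof (induction N rule: dec_induct)
 case (step N)
 have "gsord (W w) (Suc n) (\<tau> w ^ Suc N * F (Suc N) g x)"
  by (rule gsord_mono[OF gsord_tau[OF JP_props(1)[OF F gx]]]) (use step in simp)
 from gsord_add[OF step.IH this] show ?case by (simp add: psum_def algebra_simps)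
qed simp

text \<open>The homogeneous parts of a limit are determined by those of the approximations, because \<open>t\<close> does not
  occur in \<open>g\<close>.\<close>

lemma KK_lim:
 assumes f': "!!N. KK (f' N)" and ff': "!!w g x N. GG g ==> x \<in> U1 ==> gsord (W w) (Suc N) (f w g x - f' N w g x)"
 shows "KK f"
proof -
 have "EX F. (ALL n. JP n (F n)) & (ALL w g x. GG g --> x \<in> U1 --> gsord (W w) (Suc N) (f w g x - psum F N w g x))" for N
 proof -
  obtain F where F: "!!n. JP n (F n)" "!!w g x M. GG g ==> x \<in> U1 ==> gsord (W w) (Suc M) (f' N w g x - psum F M w g x)"
   by (rule KKE[OF f']) blast
  have "gsord (W w) (Suc N) (f w g x - psum F N w g x)" if "GG g" "x \<in> U1" for w g x
   using gsord_add[OF ff'[OF that, of w N] F(2)[OF that, of w N]] by simp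
  then show ?thesis using F(1) by blast
 qed
 then have "ALL N. EX F. (ALL n. JP n (F n)) & (ALL w g x. GG g --> x \<in> U1 --> gsord (W w) (Suc N) (f w g x - psum F N w g x))"
  by (rule allI)
 from choice[OF this] obtain F where FF: "ALL N. (ALL n. JP n (F N n)) & (ALL w g x. GG g --> x \<in> U1 --> gsord (W w) (Suc N) (f w g x - psum (F N) N w g x))"
  by (rule exE)
 note F = FF[THEN spec, THEN conjunct1, THEN spec] FF[THEN spec, THEN conjunct2, rule_format]
 have eq: "F N n g x = F n n g x" if "n \<le> N" "GG g" "x \<in> U1" for N n g x
 proof -
  note gx = that(2,3)
  let ?a = "%m. F N m g x - F n m g x"
  \<comment> \<open>Two families approximate the same \<open>f\<close> up to order
    \<open>Suc n\<close>. Their difference is a polynomial in \<open>t\<close> of degree at most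
    \<open>n\<close> vanishing to that order, so \<open>t_extract\<close> applies.\<close>
  have "gsord (W True) (Suc n) (f True g x - psum (F N) N True g x)"
   using gsord_mono[OF F(2)[OF gx]] that(1) by simp
  from gsord_add[OF this psum_mono[where F = "F N", OF F(1) gx that(1)]]
  have "gsord (W True) (Suc n) (f True g x - psum (F N) n True g x)" by simp
  from gsord_diff[OF F(2)[OF gx] this]
  have "gsord (W True) (Suc n) (psum (F N) n True g x - psum (F n) n True g x)" by simp
  then have s: "gsord (%v. v = tv) (Suc n) (\<Sum>m\<le>n. gs_var tv ^ m * ?a m)"
   by (simp add: W_def[abs_def] \<tau>_def psum_def right_diff_distrib sum_subtractf)
  have v: "gs_vars (- {tv}) (?a m)" for m
   by (rule gs_vars_mono[OF gs_vars_diff[OF JP_props(2)[OF F(1) gx] JP_props(2)[OF F(1) gx]]])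
    (auto simp: svars_def is_par_def)
  have "?a n = 0" by (rule t_extract[OF _ v s]) simp_all
  then show ?thesis by simp
 qed
 show ?thesis
 proof (rule KKI[of "%n. F n n"])
  fix w g x N assume gx: "GG g" "x \<in> U1"
  have "F n n g x = F N n g x" if "n \<in> {..N}" for n using eq[of n N g x] that gx by simp
  then have e: "psum (%n. F n n) N w g x = psum (F N) N w g x"
   unfolding psum_def by (intro sum.cong refl) (simp only:)
  show "gsord (W w) (Suc N) (f w g x - psum (%n. F n n) N w g x)" unfolding e by (rule F(2)[OF gx])
 qed (rule F(1))
qed

lemma KK_0: "KK (%w g x. 0)"
 by (rule KK_const[OF XF_const]) simp

lemma KK_sum: "(!!i. i \<in> A ==> KK (f i)) ==> KK (%w g x. \<Sum>i\<in>A. f i w g x)"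
 by (induction A rule: infinite_finite_induct) (simp_all add: KK_0 KK_add)

text \<open>The product of two truncations also contains degrees above \<open>N\<close>. It is taken
  as an approximation as it stands, and \<open>KK_lim\<close> recovers the homogeneous
  parts.\<close>

lemma KK_mult:
 assumes "KK f" "KK h"
 shows "KK (%w g x. f w g x * h w g x)"
proof -
 obtain F where F: "!!n. JP n (F n)" "!!w g x N. GG g ==> x \<in> U1 ==> gsord (W w) (Suc N) (f w g x - psum F N w g x)"
  by (rule KKE[OF assms(1)]) blast
 obtain H where H: "!!n. JP n (H n)" "!!w g x N. GG g ==> x \<in> U1 ==> gsord (W w) (Suc N) (h w g x - psum H N w g x)"
  by (rule KKE[OF assms(2)]) blast
 show ?thesis
 proof (rule KK_lim)
  show "KK (%w g x. \<Sum>n\<le>N. \<Sum>m\<le>N. \<tau> w ^ (n + m) * (F n g x * H m g x))" for N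
   by (intro KK_sum KK_hom JP_mult F(1) H(1))
  fix w g x N assume gx: "GG g" "x \<in> U1"
  have "\<tau> w ^ (n + m) * (F n g x * H m g x) = \<tau> w ^ n * F n g x * (\<tau> w ^ m * H m g x)" for n m
   by (metis mult.assoc power_add tau_comm(1))
  then have e: "(\<Sum>n\<le>N. \<Sum>m\<le>N. \<tau> w ^ (n + m) * (F n g x * H m g x)) = psum F N w g x * psum H N w g x"
   by (simp add: psum_def sum_product)
  show "gsord (W w) (Suc N) (f w g x * h w g x - (\<Sum>n\<le>N. \<Sum>m\<le>N. \<tau> w ^ (n + m) * (F n g x * H m g x)))"
   unfolding e by (rule gsord_cong_mult[OF F(2)[OF gx] H(2)[OF gx]])
 qed
qed

lemma KK_prod_list: "(!!i. i \<in> set l ==> KK (%w g x. f w g x i)) ==> KK (%w g x. prod_list (map (f w g x) l))"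
proof (induction l)
 case Nil
 show ?case using KK_const[OF XF_const, of 1] by simp
next
 case (Cons a l)
 then show ?case using KK_mult[of "%w g x. f w g x a" "%w g x. prod_list (map (f w g x) l)"] by simp
qed

lemma KK_smooth: "smooth_on p1 U1 h ==> KK f ==> KK (%w g x. h x *\<^sub>R f w g x)"
 using KK_mult[OF KK_const[OF XF_smooth]] by (simp add: scaleR_conv_of_real)

lemma KK_scaleR: "KK f ==> KK (%w g x. r *\<^sub>R f w g x)"
 by (rule KK_smooth[OF smooth_const[OF U1]])

lemma KK_diff: "KK f ==> KK h ==> KK (%w g x. f w g x - h w g x)"
 using KK_add[OF _ KK_scaleR[of h "- 1"]] by simp

text \<open>Each momentum is replaced by a series of order 1, so degree in the momenta turns into
  order with respect to \<open>V\<close>.\<close>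

lemma gsord_mom_msub:
 assumes good: "good (psub B Q)" and f: "gsord is_mom n f" and Q: "!!a. a \<in> B ==> gsord V 1 (Q a)"
 shows "gsord V n (msub (psub B Q) f)"
 unfolding gsord_def
proof (intro allI impI)
 fix k assume k: "size (filter_mset V k) < n"
 have "coeff f m * coeff (mprod (psub B Q) m) k = 0" for m
 proof (cases "size (filter_mset is_mom m) < n")
  case True
  then show ?thesis using f by (simp add: gsord_def)
 next
  case False
  have "gsord V 1 (psub B Q v)" if "is_mom v" for v
   using that Q by (cases v) (auto simp: is_mom_def simp del: One_nat_def)
  then have "gsord V (length (filter is_mom (sorted_list_of_multiset m))) (mprod (psub B Q) m)"
   unfolding mprod_def by (rule gsord_prod_list)
  moreover have "length (filter is_mom (sorted_list_of_multiset m)) = size (filter_mset is_mom m)"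
   by (metis mset_filter mset_sorted_list_of_multiset size_mset)
  ultimately have "coeff (mprod (psub B Q) m) k = 0" using False k by (simp add: gsord_def)
  then show ?thesis by simp
 qed
 note z = this
 show "coeff (msub (psub B Q) f) k = 0"
  unfolding msub_def coeff_gs_of by (simp only: z sum.neutral_const if_cancel)
qed

definition QK :: "(bool => (pt => gs) => pt => coord => gs) => bool" where
 "QK Q \<longleftrightarrow> (ALL a:C2. KK (%w g x. Q w g x a) &
   (ALL w g x. GG g --> x \<in> U1 --> gs_parity (codd a) (Q w g x a) & gsord (W w) 1 (Q w g x a)))"

lemma QKD:
 assumes "QK Q" "a \<in> C2"
 shows "KK (%w g x. Q w g x a)" "GG g ==> x \<in> U1 ==> gs_parity (codd a) (Q w g x a)" "GG g ==> x \<in> U1 ==> gsord (W w) 1 (Q w g x a)"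
 using assms unfolding QK_def by blast+

text \<open>The approximations keep the monomials of \<open>f\<close> of degree at most
  \<open>N\<close> in the momenta. These are finitely many, with smooth coefficients, and the others
  acquire order \<open>Suc N\<close> when the small \<open>Q\<close> is substituted.\<close>

lemma KK_S:
 assumes f: "SF p1 q1 C2 U1 f" and fv: "!!x. x \<in> U1 ==> gs_vars (Xi ` {..<q1} \<union> Mom ` C2) (f x)" and Q: "QK Q"
 shows "KK (%w g x. sf_eval p1 f (coord_pt x) (Q w g x))"
proof -
 let ?V = "Xi ` {..<q1} \<union> Mom ` C2"
 let ?M = "%N. {m. set_mset m \<subseteq> ?V & mono_ok m & size (filter_mset is_mom m) \<le> N}"
 let ?f = "%N w g x. \<Sum>m\<in>?M N. coeff (f x) m *\<^sub>R mprod (psub C2 (Q w g x)) m"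
 have "?M N = (\<Union>n\<le>N. {m. set_mset m \<subseteq> ?V & mono_ok m & size (filter_mset is_mom m) = n})" for N by auto
 moreover have "finite {m. set_mset m \<subseteq> ?V & mono_ok m & size (filter_mset is_mom m) = n}" for n
  by (rule finite_mom_degree) (auto simp: is_mom_def)
 ultimately have fin: "finite (?M N)" for N by simp
 have sm: "smooth_on p1 U1 (%x. coeff (f x) m)" for m using SF_D(2)[OF f] by (simp add: sfn_def)
 have pr: "KK (%w g x. mprod (psub C2 (Q w g x)) m)" if m: "m \<in> ?M N" for m N
  unfolding mprod_def
 proof (rule KK_prod_list)
  fix v assume "v \<in> set (sorted_list_of_multiset m)"
  then have "v \<in> ?V" using m by auto
  then consider j where "v = Xi j" "j < q1" | a where "v = Mom a" "a \<in> C2" by blast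
  then show "KK (%w g x. psub C2 (Q w g x) v)"
  proof cases
   case 1
   then show ?thesis using KK_const[OF XF_const, of "gs_var (Xi j)"] by (simp add: gs_vars_var)
  qed (simp add: QKD(1)[OF Q])
 qed
 have 1: "KK (?f N)" for N by (rule KK_sum, rule KK_smooth[OF sm pr])
 have 2: "gsord (W w) (Suc N) (sf_eval p1 f (coord_pt x) (Q w g x) - ?f N w g x)" if gx: "GG g" "x \<in> U1" for w g x N
 proof -
  have Qp: "gs_parity (codd a) (Q w g x a)" "coeff (Q w g x a) {#} = 0" if "a \<in> C2" for a
   by (rule QKD(2)[OF Q that gx], rule gsord_1_empty[OF QKD(3)[OF Q that gx]])
  have gt: "good (psub C2 (Q w g x))" by (rule good_psub[OF finite_cs Qp])
  have A: "msub (psub C2 (Q w g x)) (f x - (\<Sum>m\<in>?M N. coeff (f x) m *\<^sub>R mon m)) = sf_eval p1 f (coord_pt x) (Q w g x) - ?f N w g x"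
   by (simp add: sf_eval_coord_pt[OF U1 finite_cs f gx(2) Qp] clin_diff[OF clin_msub[OF gt]] clin_sum[OF clin_msub[OF gt]]
     clin_scaleR[OF clin_msub[OF gt]] msub_mon[OF gt])
  have B: "gsord is_mom (Suc N) (f x - (\<Sum>m\<in>?M N. coeff (f x) m *\<^sub>R mon m))"
   unfolding gsord_def
  proof (intro allI impI)
   fix k assume k: "size (filter_mset is_mom k) < Suc N"
   have "coeff (\<Sum>m\<in>?M N. coeff (f x) m *\<^sub>R mon m) k = (\<Sum>m\<in>?M N. if m = k then coeff (f x) k else 0)"
    unfolding coeff_sum by (intro sum.cong refl) (auto simp: coeff_mon)
   also have "... = (if k \<in> ?M N then coeff (f x) k else 0)" using fin by (simp add: sum.delta)
   also have "... = coeff (f x) k"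
   proof (cases "k \<in> ?M N")
    case False
    then have "~ set_mset k \<subseteq> ?V | ~ mono_ok k" using k by auto
    then have "coeff (f x) k = 0" using fv[OF gx(2)] coeff_not_ok unfolding gs_vars_def by blast
    then show ?thesis by simp
   qed simp
   finally show "coeff (f x - (\<Sum>m\<in>?M N. coeff (f x) m *\<^sub>R mon m)) k = 0" by simp
  qed
  show ?thesis unfolding A[symmetric] by (rule gsord_mom_msub[OF gt B QKD(3)[OF Q _ gx]])
 qed
 show ?thesis by (rule KK_lim[OF 1 2])
qed

definition Yx :: "(coord => gs) => pt => coord => gs" where
 "Yx Q x i = psign i * sf_eval p1 (dmom i S) (coord_pt x) Q"

lemma KK_Yx:
 assumes Q: "QK Q"
 shows "KK (%w g x. Yx (Q w g x) x i)"
proof -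
 have "KK (%w g x. (if codd i then - 1 else 1) *\<^sub>R sf_eval p1 (dmom i S) (coord_pt x) (Q w g x))"
  by (intro KK_scaleR KK_S[OF SF_dmom[OF U1 S] _ Q]) (simp add: dmom_eq gs_vars_vderiv S_vars)
 then show ?thesis by (simp add: Yx_def psign_def split: if_splits)
qed

lemma tau_vars: "gs_vars (svars q2 (Bw w)) (\<tau> w)"
 by (simp add: \<tau>_def Bw_def svars_def gs_vars_var)

lemma SF_tau: "SF p2 q2 {} U2 h ==> SF p2 q2 (Bw w) U2 (%y. \<tau> w * h y)"
 by (rule SF_mult[OF U2 SF_const[OF U2 tau_vars]], rule SF_mono[where B = "{}"]) simp_all

lemma pbw:
 assumes g: "GG g"
 shows "pb p1 q1 U1 p2 q2 U2 S (%y. \<tau> w * g y) (W w) (Bw w)"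
proof
 show "SF p2 q2 (Bw w) U2 (%y. \<tau> w * g y)" using g by (intro SF_tau) (simp add: GG_def)
 show "gs_parity False (\<tau> w * g y)" if "y \<in> U2" for y
  using gs_parity_mult[OF tau_even(1), of False "g y"] g that by (simp add: GG_def)
 show "gsord (W w) 1 (\<tau> w * g y)" for y
  using gsord_tau[of 1 "g y" w] g by (simp add: GG_def)
 show "finite (Bw w)" by (simp add: Bw_def)
 show "EX a. v = Mom a | is_par v" if "W w v" for v using that by (cases w) (auto simp: W_def)
qed (auto simp: U1 U2 S S_par phi_body)

lemma eval_tau:
 assumes e: "evok p2 q2 (Bw w) U2 Y mom_var" and h: "SF p2 q2 {} U2 h"
 shows "sf_eval p2 (%y. \<tau> w * h y) Y mom_var = \<tau> w * sf_eval p2 h Y mom_var"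
proof (cases w)
 case True
 have e': "evok p2 q2 {Ev p2} U2 Y mom_var" using e True by (simp add: Bw_def)
 have m: "SF p2 q2 {Ev p2} U2 (%y. mom_var (Ev p2))" by (rule SF_const[OF U2]) (auto simp: mom_var_def svars_def intro!: gs_vars_var)
 have h': "SF p2 q2 {Ev p2} U2 h" by (rule SF_mono[OF h]) simp
 show ?thesis
  using sf_eval_mult'[OF U2 _ e' m h'] sf_eval_mom_var[OF U2 _ e', of "Ev p2"] True by (simp add: \<tau>_def mom_var_def)
qed (simp add: \<tau>_def)

lemma dcoord_tau:
 assumes h: "SF p2 q2 {} U2 h" and y: "y \<in> U2" and i: "i \<in> C2"
 shows "dcoord i (%y. \<tau> w * h y) y = \<tau> w * dcoord i h y"
proof (cases w)
 case True
 have m: "SF p2 q2 (Bw w) U2 (%y. \<tau> w)" by (rule SF_const[OF U2 tau_vars])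
 have h': "SF p2 q2 (Bw w) U2 h" by (rule SF_mono[OF h]) simp
 show ?thesis using dcoord_mult[OF U2 m h' y i tau_even(1)] dcoord_const[of tv i y] True by (simp add: \<tau>_def)
qed (simp add: \<tau>_def)

text \<open>Taylor expansion at \<open>\<phi> x\<close>: the increment \<open>Yx Q - \<phi>\<close>
  is small because \<open>Q\<close> is, and every Taylor coefficient is a jet of \<open>g\<close>,
  carrying the factor \<open>\<tau> w\<close>.\<close>

lemma KK_g:
 assumes l0: "set l0 \<subseteq> C2" and Q: "QK Q"
 shows "KK (%w g x. \<tau> w * sf_eval p2 (foldr dcoord l0 g) (Yx (Q w g x) x) mom_var)"
proof -
 let ?L = "%r. {l. set l \<subseteq> C2 & length l = r}"
 let ?\<eta> = "%w g x a. Yx (Q w g x) x a - \<phi> x a"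
 let ?f = "%N w g x. \<Sum>r\<le>N. \<Sum>l\<in>?L r. (1 / fact r) *\<^sub>R (prod_list (map (?\<eta> w g x) (rev l)) * (\<tau> w * jet g x (l @ l0)))"
 have 1: "KK (?f N)" for N
  by (intro KK_sum KK_scaleR KK_mult KK_prod_list KK_diff KK_Yx Q KK_const XF_phi KK_jet) (use l0 in auto)
 have 2: "gsord (W w) (Suc N) (\<tau> w * sf_eval p2 (foldr dcoord l0 g) (Yx (Q w g x) x) mom_var - ?f N w g x)" if gx: "GG g" "x \<in> U1" for w g x N
 proof -
  interpret P: pb p1 q1 U1 p2 q2 U2 S "%y. \<tau> w * g y" "W w" "Bw w" by (rule pbw[OF gx(1)])
  have Y: "Yx (Q w g x) x = P.Yof x (Q w g x)" "\<phi> x = P.Yof x (%_. 0)" by (simp_all add: Yx_def P.Yof_def \<phi>_def fun_eq_iff)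
  have "gsord (W w) (Suc N) (sf_eval p2 (foldr dcoord l0 g) (%a. \<phi> x a + ?\<eta> w g x a) mom_var
   - (\<Sum>r\<le>N. \<Sum>l\<in>?L r. (1 / fact r) *\<^sub>R (prod_list (map (?\<eta> w g x) (rev l)) * sf_eval p2 (foldr dcoord l (foldr dcoord l0 g)) (\<phi> x) mom_var)))"
  proof (rule taylor[OF U2 GG_l(1)[OF gx(1) l0] phi_props(3)[OF gx(2)]])
   fix a assume "a \<in> C2"
   show "gs_parity (codd a) (?\<eta> w g x a)"
    unfolding Y(1) by (intro gs_parity_diff phi_props(1)[OF gx(2)] P.Yof_parity[OF gx(2)]) (rule QKD(2,3)[OF Q _ gx], assumption)+
   show "gsord (W w) 1 (?\<eta> w g x a)"
    unfolding Y by (rule P.Yof_gsord[OF gx(2)]) (use QKD(3)[OF Q _ gx] in simp)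
  qed
  then have "gsord (W w) (0 + Suc N) (\<tau> w * (sf_eval p2 (foldr dcoord l0 g) (Yx (Q w g x) x) mom_var
   - (\<Sum>r\<le>N. \<Sum>l\<in>?L r. (1 / fact r) *\<^sub>R (prod_list (map (?\<eta> w g x) (rev l)) * jet g x (l @ l0)))))"
   by (intro gsord_mult) (simp_all add: jet_def)
  moreover have "\<tau> w * (\<Sum>r\<le>N. \<Sum>l\<in>?L r. (1 / fact r) *\<^sub>R (prod_list (map (?\<eta> w g x) (rev l)) * jet g x (l @ l0))) = ?f N w g x"
   unfolding sum_distrib_left
  proof (intro sum.cong refl)
   fix r l
   let ?p = "prod_list (map (?\<eta> w g x) (rev l))"
   show "\<tau> w * ((1 / fact r) *\<^sub>R (?p * jet g x (l @ l0))) = (1 / fact r) *\<^sub>R (?p * (\<tau> w * jet g x (l @ l0)))"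
    by (simp only: mult_scaleR_right mult.assoc[symmetric] tau_comm(2)[of w ?p])
  qed
  ultimately show ?thesis by (simp only: right_diff_distrib add_0)
 qed
 show ?thesis by (rule KK_lim[OF 1 2])
qed

abbreviation Iw :: "nat => bool => (pt => gs) => pt => coord => gs" where
 "Iw n w g x \<equiv> pb.It p1 p2 q2 S (%y. \<tau> w * g y) (W w) n x"

abbreviation Qw :: "bool => (pt => gs) => pt => coord => gs" where
 "Qw w g x \<equiv> pb.Qs p1 p2 q2 S (%y. \<tau> w * g y) (W w) x"

lemma QK_It: "QK (Iw n)"
proof (induction n)
 case 0
 have e: "Iw 0 w g x a = 0" if "GG g" for w g x a
  using pb.It_def[OF pbw[OF that]] by simp
 have "KK (%w g x. Iw 0 w g x a)" for a by (rule KK_cong[OF KK_0]) (simp add: e)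
 then show ?case unfolding QK_def by (simp add: e)
next
 case (Suc n)
 show ?case
  unfolding QK_def
 proof (intro ballI conjI allI impI)
  fix i assume i: "i \<in> C2"
  have l: "set [i] \<subseteq> C2" using i by simp
  show "KK (%w g x. Iw (Suc n) w g x i)"
  proof (rule KK_cong[OF KK_g[OF l Suc]])
   fix w g x assume gx: "GG g" "x \<in> U1"
   interpret P: pb p1 q1 U1 p2 q2 U2 S "%y. \<tau> w * g y" "W w" "Bw w" by (rule pbw[OF gx(1)])
   have Y: "Yx (Iw n w g x) x = P.Yof x (P.It n x)" by (simp add: Yx_def P.Yof_def fun_eq_iff)
   have ev: "evok p2 q2 (Bw w) U2 (P.Yof x (P.It n x)) mom_var"
    by (rule P.evok_Y[OF gx(2)]) (rule QKD(2,3)[OF Suc _ gx], assumption)+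
   have g: "SF p2 q2 {} U2 g" using gx by (simp add: GG_def)
   have "P.It (Suc n) x i = sf_eval p2 (dcoord i (%y. \<tau> w * g y)) (P.Yof x (P.It n x)) mom_var"
    by (rule P.It_Suc[OF i])
   also have "... = sf_eval p2 (%y. \<tau> w * dcoord i g y) (P.Yof x (P.It n x)) mom_var"
    by (rule sf_eval_cong[OF U2 evokD(6)[OF ev] dcoord_tau[OF g _ i] SF_D(1)[OF SF_dcoord[OF U2 P.g i]]]) simp_all
   also have "... = \<tau> w * sf_eval p2 (dcoord i g) (P.Yof x (P.It n x)) mom_var"
    by (rule eval_tau[OF ev SF_dcoord[OF U2 g i]])
   finally show "\<tau> w * sf_eval p2 (foldr dcoord [i] g) (Yx (Iw n w g x) x) mom_var = Iw (Suc n) w g x i"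
    unfolding Y by simp
  qed
  fix w g x assume gx: "GG g" "x \<in> U1"
  interpret P: pb p1 q1 U1 p2 q2 U2 S "%y. \<tau> w * g y" "W w" "Bw w" by (rule pbw[OF gx(1)])
  show "gs_parity (codd i) (Iw (Suc n) w g x i)" by (rule P.goodQD(2)[OF P.goodQ_It gx(2) i])
  show "gsord (W w) 1 (Iw (Suc n) w g x i)" by (rule P.It_par)
 qed
qed

lemma QK_Qs: "QK Qw"
 unfolding QK_def
proof (intro ballI conjI allI impI)
 fix i assume i: "i \<in> C2"
 show "KK (%w g x. Qw w g x i)"
 proof (rule KK_lim[OF QKD(1)[OF QK_It i]])
  show "gsord (W w) (Suc N) (Qw w g x i - Iw (Suc N) w g x i)" if "GG g" "x \<in> U1" for w g x N
   by (rule pb.Qs(2)[OF pbw[OF that(1)] that(2)])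
 qed
 fix w g x assume gx: "GG g" "x \<in> U1"
 interpret P: pb p1 q1 U1 p2 q2 U2 S "%y. \<tau> w * g y" "W w" "Bw w" by (rule pbw[OF gx(1)])
 show "gs_parity (codd i) (Qw w g x i)" by (rule P.Qs_parity[OF gx(2) i])
 show "gsord (W w) 1 (Qw w g x i)" by (rule P.Qs_par[OF gx(2)])
qed

lemma KK_val: "KK (%w g x. pb.val p1 p2 q2 S (%y. \<tau> w * g y) (W w) x)"
proof (rule KK_cong)
 show "KK (%w g x. \<tau> w * sf_eval p2 (foldr dcoord [] g) (Yx (Qw w g x) x) mom_var + sf_eval p1 S (coord_pt x) (Qw w g x)
  - (\<Sum>i\<in>C2. Yx (Qw w g x) x i * Qw w g x i))"
  by (intro KK_diff KK_add KK_g KK_S[OF S S_vars] KK_sum KK_mult KK_Yx QK_Qs QKD(1)) auto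
 fix w g x assume gx: "GG g" "x \<in> U1"
 interpret P: pb p1 q1 U1 p2 q2 U2 S "%y. \<tau> w * g y" "W w" "Bw w" by (rule pbw[OF gx(1)])
 have Y: "Yx (Qw w g x) x = P.Ys x" by (simp add: Yx_def P.Yof_def fun_eq_iff)
 have g: "SF p2 q2 {} U2 g" using gx by (simp add: GG_def)
 show "\<tau> w * sf_eval p2 (foldr dcoord [] g) (Yx (Qw w g x) x) mom_var + sf_eval p1 S (coord_pt x) (Qw w g x)
  - (\<Sum>i\<in>C2. Yx (Qw w g x) x i * Qw w g x i) = P.val x"
  unfolding P.val_def Y eval_tau[OF P.evok_Ys[OF gx(2)] g] by simp
qed

theorem jet_expansion:
 "EX J A. (ALL n. finite (J n) & (ALL I:J n. length I = n & set I \<subseteq> lists C2 & superfun p1 U1 (Xi ` {..<q1}) (A n I))) &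
  (ALL g x k. GG g --> x \<in> U1 -->
   (%n. coeff (\<Sum>I\<in>J n. A n I x * prod_list (map (jet g x) I)) k) sums coeff (pb.val p1 p2 q2 S g is_par x) k)"
proof -
 obtain F where F: "!!n. JP n (F n)" "!!w g x N. GG g ==> x \<in> U1 ==>
   gsord (W w) (Suc N) (pb.val p1 p2 q2 S (%y. \<tau> w * g y) (W w) x - psum F N w g x)"
  by (rule KKE[OF KK_val]) blast
 from F(1) have "ALL n. EX r. JR n (F n) r" by (simp add: JP_def)
 from choice[OF this] obtain r where "ALL n. JR n (F n) (r n)" by (rule exE)
 then have r: "JR n (F n) (fst (r n), snd (r n))" for n by simp
 have "(%n. coeff (F n g x) k) sums coeff (pb.val p1 p2 q2 S g is_par x) k" if gx: "GG g" "x \<in> U1" for g x k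
 proof -
  let ?N = "size (filter_mset is_par k)"
  have "W False = is_par" by (simp add: W_def fun_eq_iff)
  with F(2)[OF gx, of False ?N] have v: "coeff (pb.val p1 p2 q2 S g is_par x) k = (\<Sum>n\<le>?N. coeff (F n g x) k)"
   by (simp add: \<tau>_def gsord_def psum_def)
  \<comment> \<open>The part of degree \<open>n\<close> has order \<open>n\<close> in the
    parameters, so only degrees up to the number of parameters in \<open>k\<close>
    contribute.\<close>
  have "coeff (F n g x) k = 0" if "n \<notin> {..?N}" for n
   using JP_props(1)[OF F(1) gx, of n] that by (simp add: gsord_def)
  then show ?thesis unfolding v by (intro sums_finite) auto
 qed
 then have "(%n. coeff (\<Sum>I\<in>fst (r n). snd (r n) I x * prod_list (map (jet g x) I)) k) sums coeff (pb.val p1 p2 q2 S g is_par x) k"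
  if "GG g" "x \<in> U1" for g x k
  unfolding JRD(5)[OF r that, symmetric] using that by blast
 moreover have "finite (fst (r n)) & (ALL I:fst (r n). length I = n & set I \<subseteq> lists C2 & superfun p1 U1 (Xi ` {..<q1}) (snd (r n) I))" for n
  using JRD[OF r[of n]] unfolding XF_def by blast
 ultimately show ?thesis
  by (intro exI[of _ "%n. fst (r n)"] exI[of _ "%n. snd (r n)"]) blast
qed

end

section \<open>The global pullback as a formal map\<close>

context thk
begin

definition expands :: "'c => 'd => (nat => coord list list set) => (nat => coord list list => pt => gs) => bool" where
 "expands c d J A \<longleftrightarrow> (ALL n. finite (J n) & (ALL I:J n. length I = n & set I \<subseteq> lists (coords M2) &
   superfun p1 (D c d) (xi_vars M1) (A n I))) &
  (ALL \<omega>. ALL G:formal_points M2 \<omega> s. ALL x:D c d. ALL k.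
   (%n. coeff (\<Sum>I\<in>J n. A n I x *
    prod_list (map (%l. sf_eval p2 (foldr dcoord l (G d)) (thick_phi M1 \<Phi> c d x) mom_var) I)) k)
   sums coeff (pullback M1 M2 \<Phi> G c x) k)"

lemma local_expansion:
 assumes c: "c \<in> charts M1" and d: "d \<in> charts M2"
 shows "EX J A. expands c d J A"
proof -
 interpret j: jets p1 q1 "D c d" p2 q2 "image_of M2 d" "gen \<Phi> c d"
 proof
  show "gs_vars (Xi ` {..<q1} \<union> Mom ` K2) (gen \<Phi> c d x)" if "x \<in> D c d" for x
   using genD(4)[OF c d that] by (simp add: xi_vars_def mom_vars_def B.coords_eq)
  show "phib p1 p2 (gen \<Phi> c d) (coord_pt x) \<in> image_of M2 d" if x: "x \<in> D c d" for x
  proof -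
   obtain z where z: "z \<in> td c d" "x = cmap M1 c z" using x by blast
   show ?thesis unfolding z(2) genD(5)[OF c d z(1)] using tdD(2)[OF z(1)] by (simp add: image_of_def)
  qed
 qed (use open_D[OF c d] B.chart(2)[OF d] genD(1,2)[OF c d] in auto)
 obtain J A where J: "ALL n. finite (J n) & (ALL I:J n. length I = n & set I \<subseteq> lists K2 & superfun p1 (D c d) (Xi ` {..<q1}) (A n I))"
  and s: "ALL g x k. j.GG g --> x \<in> D c d -->
   (%n. coeff (\<Sum>I\<in>J n. A n I x * prod_list (map (j.jet g x) I)) k) sums coeff (pb.val p1 p2 q2 (gen \<Phi> c d) g is_par x) k"
  using j.jet_expansion by (elim exE conjE)
 have "(%n. coeff (\<Sum>I\<in>J n. A n I x *
    prod_list (map (%l. sf_eval p2 (foldr dcoord l (G d)) (thick_phi M1 \<Phi> c d x) mom_var) I)) k)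
   sums coeff (pullback M1 M2 \<Phi> G c x) k" if G: "G \<in> formal_points M2 \<omega> s" and x: "x \<in> D c d" for \<omega> G x k
 proof -
  have gg: "j.GG (G d)"
   using B.globalD(1,2)[OF B.formalD(1)[OF G] d] B.formalD(2)[OF G] by (simp add: j.GG_def)
  have ph: "thick_phi M1 \<Phi> c d x = j.\<phi> x" by (simp add: thick_phi_def thick_y_def j.\<phi>_def fun_eq_iff)
  have v: "pullback M1 M2 \<Phi> G c x = pb.val p1 p2 q2 (gen \<Phi> c d) (G d) is_par x"
   by (simp add: pullback_eq[OF G] PB_eq[OF G c d x] Val_def)
  have "(%l. sf_eval p2 (foldr dcoord l (G d)) (thick_phi M1 \<Phi> c d x) mom_var) = j.jet (G d) x"
   by (simp add: ph j.jet_def fun_eq_iff)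
  then show ?thesis using s[rule_format, OF gg x, of k] by (simp only: v)
 qed
 then show ?thesis
  using J unfolding expands_def xi_vars_def B.coords_eq by (intro exI[of _ J] exI[of _ A]) blast
qed

lemma formal: "formal_map s M2 M1 (tmap \<Phi>) (thick_phi M1 \<Phi>) (pullback M1 M2 \<Phi>)"
proof -
 have "ALL c d. EX J A. c \<in> charts M1 --> d \<in> charts M2 --> expands c d J A" using local_expansion by blast
 then obtain J A where "ALL c d. c \<in> charts M1 --> d \<in> charts M2 --> expands c d (J c d) (A c d)" by metis
 then have "EX J A. ALL c:charts M1. ALL d:charts M2. expands c d (J c d) (A c d)" by blast
 then show ?thesis
  unfolding formal_map_def Let_def expands_def using PB_global pullback_eq by simp
qed

end

theorem theorem2:
  fixes k :: int
    and M1 :: "('m, 'c) atlas" and M2 :: "('n, 'd) atlas"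
    and H1 :: "'c \<Rightarrow> pt \<Rightarrow> gs" and H2 :: "'d \<Rightarrow> pt \<Rightarrow> gs"
    and br1 :: "(bool \<times> ('c \<Rightarrow> pt \<Rightarrow> gs)) list \<Rightarrow> 'c \<Rightarrow> pt \<Rightarrow> gs"
    and br2 :: "(bool \<times> ('d \<Rightarrow> pt \<Rightarrow> gs)) list \<Rightarrow> 'd \<Rightarrow> pt \<Rightarrow> gs"
    and \<Phi> :: "('m, 'c, 'n, 'd) thick"
  assumes "graded_supermanifold M1" and "graded_supermanifold M2"
    and "specifies_S_infinity k M1 H1 br1" and "specifies_S_infinity k M2 H2 br2"
    and "S_infinity_thick_morphism k M1 H1 M2 H2 \<Phi>"
  shows "(\<forall>\<omega>. \<forall>G\<in>formal_points M2 \<omega> (1 - k). \<exists>!F. is_pullback M1 M2 \<Phi> G F) \<and>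
    formal_Q_morphism (1 - k) M2 H2 M1 H1 (tmap \<Phi>) (thick_phi M1 \<Phi>) (pullback M1 M2 \<Phi>) \<and>
    L_infinity_morphism k M2 br2 M1 br1 (tmap \<Phi>) (thick_phi M1 \<Phi>) (pullback M1 M2 \<Phi>)"
proof -
 interpret sthk M1 M2 k \<Phi> H1 H2
  by unfold_locales (use assms in \<open>simp_all add: specifies_S_infinity_def S_infinity_thick_morphism_def\<close>)
 have Q: "formal_Q_morphism (1 - k) M2 H2 M1 H1 (tmap \<Phi>) (thick_phi M1 \<Phi>) (pullback M1 M2 \<Phi>)"
  unfolding formal_Q_morphism_def
 proof (intro conjI X1.HJ_homological X2.HJ_homological formal allI ballI)
  show "HJ_converges M1 H1 (pullback M1 M2 \<Phi> G)" if "G \<in> formal_points M2 \<omega> (1 - k)" for \<omega> G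
   using converges[OF that] by (simp add: pullback_eq[OF that])
  show "intertwines (1 - k) M2 (HJ_field M2 H2) (HJ_field M1 H1) (pullback M1 M2 \<Phi>)"
   unfolding intertwines_def
   by (simp add: pullback_eq pullback_eq[OF shift_formal] intertwining)
 qed
 moreover have "EX! F. is_pullback M1 M2 \<Phi> G F" if "G \<in> formal_points M2 \<omega> (1 - k)" for \<omega> G
  unfolding is_pullback_iff[OF that] by (rule ex1I[of _ "PB G"]) (rule refl)
 moreover have "L_infinity_morphism k M2 br2 M1 br1 (tmap \<Phi>) (thick_phi M1 \<Phi>) (pullback M1 M2 \<Phi>)"
  unfolding L_infinity_morphism_def using Q assms(3,4) by blast
 ultimately show ?thesis by blast
qed

end
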